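(* Let $\Bbbk$ be a field and let $A=\Bbbk Q/(R)$ be a monomial quiver algebra. There is a canonical $A_\infty$-algebra structure $(\mu_n)_{n\geqslant2}$ on $\mathrm{Ext}_A=\mathrm{Ext}_A(\underline{\Bbbk},\underline{\Bbbk})$ given as follows. If $n\geqslant2$ and $\gamma_1^\vee,\ldots,\gamma_n^\vee$ are chains in $\mathrm{Ext}_A$ of respective lengths $r_1,\ldots,r_n$, then $$\mu_n(\gamma_1^\vee\otimes\cdots\otimes\gamma_n^\vee)=(-1)^M\gamma^\vee$$ if the concatenation $\gamma=\gamma_1\cdots\gamma_n$ is a chain of length $r=r_1+\cdots+r_n+1$, where $M$ is the integer $$M=\binom{n+1}{2}-1+\sum_{i<j}r_i(r_j+1)+r_1+r.$$ Otherwise, this higher product is zero.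
   Context: $Q=(Q_0,Q_1,s,t)$ is a finite quiver and $R$ is a set of paths in $Q$ of length at least two, none of which is a divisor (subpath) of another; $A=\Bbbk Q/(R)$ is then called a monomial quiver algebra. Paths are written so that a product $ab$ is a path when $t(a)=s(b)$. $\underline{\Bbbk}=\Bbbk Q_0$ is the semisimple algebra spanned by the vertices, and $A$ is augmented over $\underline{\Bbbk}$ and weight graded by path length. A path is normal if no element of $R$ divides it; normal paths form a basis of $A$ and the other paths are $0$ in $A$. For normal paths $u,v$ of positive length with $t(u)=s(v)$, "$uv=0$ minimally" means that the path $uv$ is $0$ in $A$ but $uv'\neq0$ in $A$ for every proper prefix $v'$ of $v$. For $r\geqslant0$, an $r$-chain (chain of length $r$) is a path $u_0u_1\cdots u_r$ with $u_0$ an arrow, $u_1,\ldots,u_r$ normal paths of positive length, $t(u_j)=s(u_{j+1})$ and $u_ju_{j+1}=0$ minimally for $j=0,\ldots,r-1$; the factorization and $r$ are determined by the path. The $r$-chains form a basis of $\mathrm{Tor}_A^{r+1}(\underline{\Bbbk},\underline{\Bbbk})$, via the bar cycles $[u_0|\cdots|u_r]$. $BA$ is the bar construction of $A$ over $\underline{\Bbbk}$ in positive degrees: basis $[a_1|\cdots|a_n]$, $n\geqslant1$, with $a_i$ normal paths of positive length and $t(a_i)=s(a_{i+1})$, in degree $n$, differential $d[a_1|\cdots|a_n]=\sum_{i=1}^{n-1}(-1)^{i-1}[a_1|\cdots|a_ia_{i+1}|\cdots|a_n]$, deconcatenation coproduct. $(-)^\vee$ denotes the graded dual (with respect to homological degree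 and weight), so $BA^\vee$ is a dga algebra. $\mathrm{Ext}_A$ (in positive degrees) is identified with $\mathrm{Tor}_A(\underline{\Bbbk},\underline{\Bbbk})^\vee$; for an $r$-chain $\gamma$, $\gamma^\vee\in\mathrm{Ext}_A^{r+1}$ is the element of the basis dual to the basis of chains. Tensor products are over $\underline{\Bbbk}$. An $A_\infty$-algebra structure on $\mathrm{Ext}_A$ is called canonical if it is $A_\infty$-quasi-isomorphic to the dga algebra $BA^\vee$. Sign convention: $A_\infty$-coalgebras have maps $\Delta_n:V\to V^{\otimes n}$ of degree $n-2$ satisfying $\sum_{r+s+t=n}(-1)^{r+st}(1^{\otimes r}\otimes\Delta_s\otimes1^{\otimes t})\Delta_{r+1+t}=0$, and $A_\infty$-algebra structures satisfy the identities obtained by dualizing these with the Koszul sign rule, namely $\sum_{r+s+t=n}(-1)^{r+s+rs}\mu_{r+1+t}(1^{\otimes r}\otimes\mu_s\otimes1^{\otimes t})=0$; here $\mu_1=0$.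
   Formalization: The A∞-algebra identities are taken with signs (-1)^(r+st) instead of (-1)^(r+s+rs): with the latter the printed M fails outside characteristic 2 (loops x,y,z, R={xyzx,zxy}, inputs x,y,z,x,y). The conventions are exchanged by multiplying each μ_n by (-1)^((n-1)(n-2)/2). *)

theory Defs
  imports
    "Graph_Theory.Arc_Walk"
    "HOL-Library.Sublist"
    "HOL-Library.Function_Algebras"
begin

section \<open>Graded bimodules over a semisimple base and A-infinity-algebras\<close>

text \<open>
  A graded bimodule over the semisimple algebra with orthogonal idempotents \<open>e\<^sub>i\<close> is given by its
  homogeneous components (subspaces of a common vector space), its scalar multiplication and the
  maps \<open>x \<mapsto> e\<^sub>i x\<close> and \<open>x \<mapsto> x e\<^sub>i\<close>.  Labels \<open>i\<close> that are not vertices act as zero.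
\<close>

record ('k, 'i, 'm) graded_bimodule =
  component :: "int \<Rightarrow> 'm set"
  scl :: "'k \<Rightarrow> 'm \<Rightarrow> 'm"
  lact :: "'i \<Rightarrow> 'm \<Rightarrow> 'm"
  ract :: "'i \<Rightarrow> 'm \<Rightarrow> 'm"

definition homogeneous :: "('k, 'i, 'm) graded_bimodule \<Rightarrow> int list \<Rightarrow> 'm list \<Rightarrow> bool" where
  "homogeneous M ds xs \<longleftrightarrow> list_all2 (\<lambda>d x. x \<in> component M d) ds xs"

text \<open>
  \<open>F\<close> represents a bimodule map of degree \<open>d\<close> from the \<open>n\<close>-fold tensor power of \<open>M\<close> over the base
  to \<open>N\<close>, as a multilinear balanced map on lists of \<open>n\<close> homogeneous elements.  Since tensor powers
  are direct sums of tensor products of components, homogeneous arguments suffice.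
\<close>

definition multi_map ::
  "('k, 'i, 'm::ab_group_add) graded_bimodule \<Rightarrow> ('k, 'i, 'p::ab_group_add) graded_bimodule \<Rightarrow>
   nat \<Rightarrow> int \<Rightarrow> ('m list \<Rightarrow> 'p) \<Rightarrow> bool" where
  "multi_map M N n d F \<longleftrightarrow>
     (\<forall>ds xs. length xs = n \<and> homogeneous M ds xs \<longrightarrow> F xs \<in> component N (sum_list ds + d)) \<and>
     (\<forall>ds es a xs x y ys.
        homogeneous M ds xs \<and> x \<in> component M a \<and> y \<in> component M a \<and> homogeneous M es ys \<and>
        length xs + 1 + length ys = n \<longrightarrow>
        F (xs @ [x + y] @ ys) = F (xs @ [x] @ ys) + F (xs @ [y] @ ys)) \<and>
     (\<forall>ds es a c xs x ys.
        homogeneous M ds xs \<and> x \<in> component M a \<and> homogeneous M es ys \<and>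
        length xs + 1 + length ys = n \<longrightarrow>
        F (xs @ [scl M c x] @ ys) = scl N c (F (xs @ [x] @ ys))) \<and>
     (\<forall>ds es a b i xs x y ys.
        homogeneous M ds xs \<and> x \<in> component M a \<and> y \<in> component M b \<and> homogeneous M es ys \<and>
        length xs + 2 + length ys = n \<longrightarrow>
        F (xs @ [ract M i x, y] @ ys) = F (xs @ [x, lact M i y] @ ys)) \<and>
     (\<forall>ds a i x xs. x \<in> component M a \<and> homogeneous M ds xs \<and> 1 + length xs = n \<longrightarrow>
        F (lact M i x # xs) = lact N i (F (x # xs))) \<and>
     (\<forall>ds a i x xs. x \<in> component M a \<and> homogeneous M ds xs \<and> length xs + 1 = n \<longrightarrow>
        F (xs @ [ract M i x]) = ract N i (F (xs @ [x])))"

definition parity_sign :: "int \<Rightarrow> 'k::field" where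
  "parity_sign e = (if even e then 1 else -1)"

text \<open>
  Evaluates the sum over \<open>r + s + t = n\<close> of
  \<open>(-1)^(r + s t) g\<^bsub>r+1+t\<^esub> (1\<^sup>r \<otimes> \<mu>\<^sub>s \<otimes> 1\<^sup>t)\<close> on \<open>x\<^sub>1 \<otimes> \<dots> \<otimes> x\<^sub>n\<close>, where the \<open>x\<^sub>i\<close> have degrees
  \<open>ds\<close>; the second summand of the exponent is the Koszul sign from moving \<open>\<mu>\<^sub>s\<close>, of degree \<open>2 - s\<close>,
  past \<open>x\<^sub>1, \<dots>, x\<^sub>r\<close>.
\<close>

definition inner_sum ::
  "('k::field, 'i, 'p::ab_group_add) graded_bimodule \<Rightarrow> (nat \<Rightarrow> 'm list \<Rightarrow> 'p) \<Rightarrow>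
   (nat \<Rightarrow> 'm list \<Rightarrow> 'm) \<Rightarrow> int list \<Rightarrow> 'm list \<Rightarrow> 'p" where
  "inner_sum N g \<mu> ds xs =
     (\<Sum>(r, s, t) \<in> {(r, s, t). 1 \<le> s \<and> r + s + t = length xs}.
        scl N (parity_sign (int (r + s * t) + (2 - int s) * sum_list (take r ds)))
          (g (r + 1 + t) (take r xs @ [\<mu> s (take s (drop r xs))] @ drop (r + s) xs)))"

text \<open>
  Sign convention.  The identities are those with signs \<open>(-1)^(r + s t)\<close>.  If \<open>(\<mu>\<^sub>n)\<close> satisfies
  them then \<open>((-1)^((n-1)(n-2)/2) \<mu>\<^sub>n)\<close> satisfies the identities with signs \<open>(-1)^(r + s + r s)\<close>, and
  conversely; for \<open>n \<le> 2\<close>, hence for dga algebras, the two conventions agree.  The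
  closed formula for the higher products of a monomial algebra with sign exponent
  \<open>binom (n+1) 2 - 1 + \<dots>\<close> belongs to the convention used here: for one vertex, loops
  \<open>x, y, z\<close> and relations \<open>xyzx, zxy\<close>, it gives
  \<open>\<mu>\<^sub>2(\<mu>\<^sub>4(x,y,z,x),y) = (xyzxy)\<^sup>\<or>\<close> and \<open>\<mu>\<^sub>3(x,y,\<mu>\<^sub>3(z,x,y)) = -(xyzxy)\<^sup>\<or>\<close>, and these are the only
  two terms of the identity on \<open>(x,y,z,x,y)\<close>.  They have \<open>(r,s,t) = (0,4,1), (2,3,0)\<close>, so
  they cancel for \<open>(-1)^(r + s t)\<close>, but add up to \<open>2 (xyzxy)\<^sup>\<or>\<close> for \<open>(-1)^(r + s + r s)\<close>.
\<close>

definition a_infinity_algebra ::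
  "('k::field, 'i, 'm::ab_group_add) graded_bimodule \<Rightarrow> (nat \<Rightarrow> 'm list \<Rightarrow> 'm) \<Rightarrow> bool" where
  "a_infinity_algebra M \<mu> \<longleftrightarrow>
     (\<forall>n\<ge>1. multi_map M M n (2 - int n) (\<mu> n)) \<and>
     (\<forall>ds xs. xs \<noteq> [] \<and> homogeneous M ds xs \<longrightarrow> inner_sum M \<mu> \<mu> ds xs = 0)"

definition compositions :: "nat \<Rightarrow> nat list set" where
  "compositions n = {is. sum_list is = n \<and> 0 \<notin> set is}"

fun blocks :: "nat list \<Rightarrow> 'b list \<Rightarrow> 'b list list" where
  "blocks [] xs = []"
| "blocks (i # is) xs = take i xs # blocks is (drop i xs)"

text \<open>
  The morphism identities for the sign convention above:
  \<open>\<Sum> (-1)^(r + s t) f\<^bsub>r+1+t\<^esub> (1\<^sup>r \<otimes> \<mu>\<^sub>s \<otimes> 1\<^sup>t) = \<Sum> (-1)^w \<nu>\<^sub>q (f\<^bsub>i1\<^esub> \<otimes> \<dots> \<otimes> f\<^bsub>iq\<^esub>)\<close> with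
  \<open>w = \<Sum>\<^sub>j (q - j) (i\<^sub>j - 1)\<close>, and \<open>f\<^sub>i\<close> of degree \<open>1 - i\<close>.  The second sum in the sign below is
  the Koszul sign from moving each \<open>f\<^bsub>ik\<^esub>\<close> past the arguments of the earlier blocks.
\<close>

definition a_infinity_morphism ::
  "('k::field, 'i, 'm::ab_group_add) graded_bimodule \<Rightarrow> (nat \<Rightarrow> 'm list \<Rightarrow> 'm) \<Rightarrow>
   ('k, 'i, 'p::ab_group_add) graded_bimodule \<Rightarrow> (nat \<Rightarrow> 'p list \<Rightarrow> 'p) \<Rightarrow>
   (nat \<Rightarrow> 'm list \<Rightarrow> 'p) \<Rightarrow> bool" where
  "a_infinity_morphism M \<mu> N \<nu> f \<longleftrightarrow>
     (\<forall>n\<ge>1. multi_map M N n (1 - int n) (f n)) \<and>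
     (\<forall>ds xs. xs \<noteq> [] \<and> homogeneous M ds xs \<longrightarrow>
        inner_sum N f \<mu> ds xs =
        (\<Sum>is \<in> compositions (length xs).
           scl N (parity_sign
               ((\<Sum>j<length is. (int (length is) - 1 - int j) * (int (is ! j) - 1)) +
                (\<Sum>k<length is. (1 - int (is ! k)) * sum_list (take (sum_list (take k is)) ds))))
             (\<nu> (length is) (map2 f is (blocks is xs)))))"

text \<open>The last two conjuncts say that \<open>f\<^sub>1\<close> is injective and surjective on cohomology.\<close>

definition a_infinity_quasi_iso ::
  "('k::field, 'i, 'm::ab_group_add) graded_bimodule \<Rightarrow> (nat \<Rightarrow> 'm list \<Rightarrow> 'm) \<Rightarrow>
   ('k, 'i, 'p::ab_group_add) graded_bimodule \<Rightarrow> (nat \<Rightarrow> 'p list \<Rightarrow> 'p) \<Rightarrow>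
   (nat \<Rightarrow> 'm list \<Rightarrow> 'p) \<Rightarrow> bool" where
  "a_infinity_quasi_iso M \<mu> N \<nu> f \<longleftrightarrow>
     a_infinity_morphism M \<mu> N \<nu> f \<and>
     (\<forall>d. \<forall>x \<in> component M d. \<mu> 1 [x] = 0 \<and> (\<exists>z \<in> component N (d - 1). f 1 [x] = \<nu> 1 [z]) \<longrightarrow>
        (\<exists>u \<in> component M (d - 1). x = \<mu> 1 [u])) \<and>
     (\<forall>d. \<forall>y \<in> component N d. \<nu> 1 [y] = 0 \<longrightarrow>
        (\<exists>x \<in> component M d. \<exists>z \<in> component N (d - 1). \<mu> 1 [x] = 0 \<and> y = f 1 [x] + \<nu> 1 [z]))"


section \<open>Monomial quiver algebras and chains\<close>

text \<open>
  A finite quiver is a \<open>fin_digraph\<close>, with \<open>s = tail\<close> and \<open>t = head\<close>.  Only paths of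
  positive length occur; they are the nonempty walks, represented by their lists of arrows.
\<close>

definition quiver_path :: "('v, 'a) pre_digraph \<Rightarrow> 'a list \<Rightarrow> bool" where
  "quiver_path Q p \<longleftrightarrow> p \<noteq> [] \<and> (\<exists>u v. pre_digraph.awalk Q u p v)"

definition source :: "('v, 'a) pre_digraph \<Rightarrow> 'a list \<Rightarrow> 'v" where
  "source Q p = tail Q (hd p)"

definition target :: "('v, 'a) pre_digraph \<Rightarrow> 'a list \<Rightarrow> 'v" where
  "target Q p = head Q (last p)"

definition monomial_relations :: "('v, 'a) pre_digraph \<Rightarrow> 'a list set \<Rightarrow> bool" where
  "monomial_relations Q R \<longleftrightarrow>
     (\<forall>\<rho>\<in>R. quiver_path Q \<rho> \<and> length \<rho> \<ge> 2) \<and>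
     (\<forall>\<rho>\<in>R. \<forall>\<sigma>\<in>R. sublist \<rho> \<sigma> \<longrightarrow> \<rho> = \<sigma>)"

definition normal :: "'a list set \<Rightarrow> 'a list \<Rightarrow> bool" where
  "normal R p \<longleftrightarrow> \<not> (\<exists>\<rho>\<in>R. sublist \<rho> p)"

definition normal_path :: "('v, 'a) pre_digraph \<Rightarrow> 'a list set \<Rightarrow> 'a list \<Rightarrow> bool" where
  "normal_path Q R p \<longleftrightarrow> quiver_path Q p \<and> normal R p"

definition zero_minimally :: "'a list set \<Rightarrow> 'a list \<Rightarrow> 'a list \<Rightarrow> bool" where
  "zero_minimally R u v \<longleftrightarrow> \<not> normal R (u @ v) \<and> (\<forall>v'. strict_prefix v' v \<longrightarrow> normal R (u @ v'))"

definition chain_factorization ::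
  "('v, 'a) pre_digraph \<Rightarrow> 'a list set \<Rightarrow> 'a list list \<Rightarrow> bool" where
  "chain_factorization Q R us \<longleftrightarrow>
     us \<noteq> [] \<and> length (hd us) = 1 \<and> (\<forall>u\<in>set us. normal_path Q R u) \<and>
     successively (\<lambda>u v. target Q u = source Q v \<and> zero_minimally R u v) us"

definition chain :: "('v, 'a) pre_digraph \<Rightarrow> 'a list set \<Rightarrow> nat \<Rightarrow> 'a list \<Rightarrow> bool" where
  "chain Q R r \<gamma> \<longleftrightarrow> (\<exists>us. chain_factorization Q R us \<and> length us = r + 1 \<and> concat us = \<gamma>)"


section \<open>The bar construction, its graded dual, and Ext\<close>

text \<open>
  \<open>[a\<^sub>1|\<dots>|a\<^sub>n]\<close> is the list of the \<open>a\<^sub>i\<close>; elements of the bar construction are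
  finitely supported functions on such words.
\<close>

definition bar_word :: "('v, 'a) pre_digraph \<Rightarrow> 'a list set \<Rightarrow> 'a list list \<Rightarrow> bool" where
  "bar_word Q R w \<longleftrightarrow>
     w \<noteq> [] \<and> (\<forall>a\<in>set w. normal_path Q R a) \<and> successively (\<lambda>a b. target Q a = source Q b) w"

definition bar_space ::
  "('v, 'a) pre_digraph \<Rightarrow> 'a list set \<Rightarrow> ('a list list \<Rightarrow> 'k::field) set" where
  "bar_space Q R = {x. finite {w. x w \<noteq> 0} \<and> (\<forall>w. x w \<noteq> 0 \<longrightarrow> bar_word Q R w)}"

definition single :: "'b \<Rightarrow> 'b \<Rightarrow> 'k::field" where
  "single w = (\<lambda>v. if v = w then 1 else 0)"

definition bar_diff_word :: "'a list set \<Rightarrow> 'a list list \<Rightarrow> 'a list list \<Rightarrow> 'k::field" where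
  "bar_diff_word R w = (\<lambda>v. \<Sum>i<length w - 1.
     if normal R (w ! i @ w ! (i + 1))
     then (-1) ^ i * single (take i w @ [w ! i @ w ! (i + 1)] @ drop (i + 2) w) v
     else 0)"

definition bar_diff :: "'a list set \<Rightarrow> ('a list list \<Rightarrow> 'k) \<Rightarrow> 'a list list \<Rightarrow> 'k::field" where
  "bar_diff R x = (\<lambda>v. \<Sum>w | x w \<noteq> 0. x w * bar_diff_word R w v)"

definition bar_cycles ::
  "('v, 'a) pre_digraph \<Rightarrow> 'a list set \<Rightarrow> ('a list list \<Rightarrow> 'k::field) set" where
  "bar_cycles Q R = {x \<in> bar_space Q R. bar_diff R x = 0}"

definition bihomogeneous :: "nat \<Rightarrow> nat \<Rightarrow> ('a list list \<Rightarrow> 'k::field) \<Rightarrow> bool" where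
  "bihomogeneous n m x \<longleftrightarrow> (\<forall>w. x w \<noteq> 0 \<longrightarrow> length w = n \<and> length (concat w) = m)"

text \<open>
  Graded dual, with respect to degree and weight, of a bigraded sub-bimodule \<open>V\<close> of the bar
  construction: the component of degree \<open>n\<close> is the direct sum over the weights \<open>m\<close> of the duals of
  the bihomogeneous parts \<open>V\<^bsub>n,m\<^esub>\<close>.  Functionals are extended by \<open>0\<close> outside \<open>V\<close>.  The
  actions are \<open>(e\<^sub>i \<phi>)(x) = \<phi>(e\<^sub>i x)\<close> and \<open>(\<phi> e\<^sub>i)(x) = \<phi>(x e\<^sub>i)\<close>, so that the dual of a path from
  \<open>i\<close> to \<open>j\<close> lies in \<open>e\<^sub>i V\<^sup>\<or> e\<^sub>j\<close>, and \<open>\<gamma>\<^sub>1\<^sup>\<or> \<otimes> \<gamma>\<^sub>2\<^sup>\<or>\<close> vanishes unless \<open>\<gamma>\<^sub>1\<gamma>\<^sub>2\<close> is a path.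
\<close>

definition graded_dual ::
  "('v, 'a) pre_digraph \<Rightarrow> ('a list list \<Rightarrow> 'k::field) set \<Rightarrow>
   ('k, 'v, ('a list list \<Rightarrow> 'k) \<Rightarrow> 'k) graded_bimodule" where
  "graded_dual Q V =
     \<lparr> component = (\<lambda>n. {\<phi>.
         (\<forall>x. x \<notin> V \<longrightarrow> \<phi> x = 0) \<and>
         (\<forall>x\<in>V. \<forall>y\<in>V. \<phi> (\<lambda>w. x w + y w) = \<phi> x + \<phi> y) \<and>
         (\<forall>c. \<forall>x\<in>V. \<phi> (\<lambda>w. c * x w) = c * \<phi> x) \<and>
         (\<exists>W. finite W \<and>
            (\<forall>k m. \<forall>x\<in>V. bihomogeneous k m x \<and> \<not> (int k = n \<and> m \<in> W) \<longrightarrow> \<phi> x = 0))}),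
       scl = (\<lambda>c \<phi> x. c * \<phi> x),
       lact = (\<lambda>i \<phi> x. if x \<in> V then \<phi> (\<lambda>w. if source Q (hd w) = i then x w else 0) else 0),
       ract = (\<lambda>i \<phi> x. if x \<in> V then \<phi> (\<lambda>w. if target Q (last w) = i then x w else 0) else 0) \<rparr>"

definition bar_dual ::
  "('v, 'a) pre_digraph \<Rightarrow> 'a list set \<Rightarrow>
   ('k::field, 'v, ('a list list \<Rightarrow> 'k) \<Rightarrow> 'k) graded_bimodule" where
  "bar_dual Q R = graded_dual Q (bar_space Q R)"

text \<open>
  The dga structure dual to the differential and the deconcatenation coproduct, with the
  Koszul sign rule: \<open>d\<^sup>\<or>(\<phi>) = (-1)^\<bar>\<phi>\<bar> \<phi> \<circ> d\<close> and \<open>\<phi> \<psi> = (\<phi> \<otimes> \<psi>) \<circ> \<Delta>\<close>, where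
  \<open>(\<phi> \<otimes> \<psi>)(a \<otimes> b) = (-1)^(\<bar>\<psi>\<bar>\<bar>a\<bar>) \<phi>(a) \<psi>(b)\<close>.  For a nonzero term at a word \<open>w\<close> one has
  \<open>\<bar>\<phi>\<bar> = length w - 1\<close> in the first case, and \<open>\<bar>\<psi>\<bar> = \<bar>b\<bar>\<close> in the second.
\<close>

definition bar_dual_diff ::
  "('v, 'a) pre_digraph \<Rightarrow> 'a list set \<Rightarrow> (('a list list \<Rightarrow> 'k) \<Rightarrow> 'k) \<Rightarrow>
   ('a list list \<Rightarrow> 'k) \<Rightarrow> 'k::field" where
  "bar_dual_diff Q R \<phi> = (\<lambda>x. if x \<in> bar_space Q R
     then \<Sum>w | x w \<noteq> 0. x w * ((-1) ^ (length w - 1) * \<phi> (bar_diff_word R w)) else 0)"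

definition bar_dual_mult ::
  "('v, 'a) pre_digraph \<Rightarrow> 'a list set \<Rightarrow> (('a list list \<Rightarrow> 'k) \<Rightarrow> 'k) \<Rightarrow>
   (('a list list \<Rightarrow> 'k) \<Rightarrow> 'k) \<Rightarrow> ('a list list \<Rightarrow> 'k) \<Rightarrow> 'k::field" where
  "bar_dual_mult Q R \<phi> \<psi> = (\<lambda>x. if x \<in> bar_space Q R
     then \<Sum>w | x w \<noteq> 0. x w * (\<Sum>i\<in>{1..<length w}.
       (-1) ^ (i * (length w - i)) * (\<phi> (single (take i w)) * \<psi> (single (drop i w)))) else 0)"

definition bar_dual_ops ::
  "('v, 'a) pre_digraph \<Rightarrow> 'a list set \<Rightarrow> nat \<Rightarrow>
   (('a list list \<Rightarrow> 'k::field) \<Rightarrow> 'k) list \<Rightarrow> ('a list list \<Rightarrow> 'k) \<Rightarrow> 'k" where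
  "bar_dual_ops Q R n \<phi>s =
     (if n = 1 then bar_dual_diff Q R (\<phi>s ! 0)
      else if n = 2 then bar_dual_mult Q R (\<phi>s ! 0) (\<phi>s ! 1)
      else 0)"

text \<open>
  Ext in positive degrees is the graded dual of Tor, the homology of the bar construction:
  functionals on (cycles modulo boundaries) are functionals on cycles that vanish on boundaries.
\<close>

definition Ext ::
  "('v, 'a) pre_digraph \<Rightarrow> 'a list set \<Rightarrow>
   ('k::field, 'v, ('a list list \<Rightarrow> 'k) \<Rightarrow> 'k) graded_bimodule" where
  "Ext Q R = (graded_dual Q (bar_cycles Q R))
     \<lparr> component := (\<lambda>n. {\<phi> \<in> component (graded_dual Q (bar_cycles Q R)) n.
         \<forall>x\<in>bar_space Q R. \<phi> (bar_diff R x) = 0}) \<rparr>"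

text \<open>
  The classes of the bar cycles \<open>[u\<^sub>0|\<dots>|u\<^sub>r]\<close> of the chains form a homogeneous basis of Tor;
  \<open>\<gamma>\<^sup>\<or>\<close> is the member of the dual basis that belongs to the chain \<open>\<gamma>\<close>.
\<close>

definition chain_dual ::
  "('v, 'a) pre_digraph \<Rightarrow> 'a list set \<Rightarrow> 'a list \<Rightarrow> ('a list list \<Rightarrow> 'k) \<Rightarrow> 'k::field" where
  "chain_dual Q R \<gamma> = (THE \<phi>. (\<exists>n. \<phi> \<in> component (Ext Q R) n) \<and>
     (\<forall>us. chain_factorization Q R us \<longrightarrow> \<phi> (single us) = (if concat us = \<gamma> then 1 else 0)))"

definition canonical ::
  "('v, 'a) pre_digraph \<Rightarrow> 'a list set \<Rightarrow>
   (nat \<Rightarrow> (('a list list \<Rightarrow> 'k::field) \<Rightarrow> 'k) list \<Rightarrow> ('a list list \<Rightarrow> 'k) \<Rightarrow> 'k) \<Rightarrow> bool" where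
  "canonical Q R \<mu> \<longleftrightarrow>
     (\<exists>f. a_infinity_quasi_iso (Ext Q R) \<mu> (bar_dual Q R) (bar_dual_ops Q R) f)"

text \<open>The exponent \<open>M\<close>; \<open>rs\<close> is the list of the lengths \<open>r\<^sub>1, \<dots>, r\<^sub>n\<close>, numbered from \<open>0\<close>.\<close>

definition sign_exponent :: "nat list \<Rightarrow> nat \<Rightarrow> nat" where
  "sign_exponent rs r =
     (let n = length rs in
      ((n + 1) choose 2) - 1 + (\<Sum>j<n. \<Sum>i<j. rs ! i * (rs ! j + 1)) + rs ! 0 + r)"

end

theory Submission
  imports Defs
begin

text \<open>
  A word of chains is a list of chains whose concatenation is a path. Linear combinations of
  such words form the tensor algebra on the span of the chains. Let \<open>D\<close> (\<open>cobar_diff\<close>) be the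
  derivation that sends a chain of length \<open>r\<close> to the signed sum of all its decompositions
  \<open>\<gamma>\<^sub>1 \<dots> \<gamma>\<^sub>n\<close> into chains with \<open>r = r\<^sub>1 + \<dots> + r\<^sub>n + 1\<close>. Up to a rescaling of words by signs
  the asserted products are the transpose of \<open>D\<close>, so their identities say that \<open>D\<close> squares to
  zero: \<open>D\<close> is the differential of the cobar construction of Tor. The theorem has then two
  parts, \<open>D\<^sup>2 = 0\<close> and the comparison with the bar construction.

  Chains become accessible through positions. Fix a path \<open>p\<close>, and let \<open>nx p s\<close> be the first
  position at which the part of \<open>p\<close> starting at \<open>s\<close> is no longer normal; this is monotone in
  \<open>s\<close>. The pieces of a chain that starts at \<open>s\<close> can only end at the terms of the sequence
  \<open>s, s + 1, nx s, nx (s + 1), nx (nx s), \<dots>\<close>, and the slice from \<open>s\<close> to the term number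
  \<open>r + 1\<close> is an \<open>r\<close>-chain if and only if the sequence increases strictly up to the next term
  (\<open>chain_slice_iff\<close>). Which blocks of letters of a word can be merged to a chain is
  therefore a question about iterates of one monotone function.

  The second tool is discrete Morse theory (\<open>triangular_matching\<close>). A lower word
  \<open>(rest, \<gamma>, arrows of c d)\<close>, where \<open>\<gamma> c\<close> is the next longer chain and \<open>c d\<close> is normal, is
  matched with the upper word \<open>(rest, \<gamma> c, arrows of d)\<close>. Over a path that is not normal
  every word is lower or upper, and the matrix of \<open>D\<close> from upper to lower words is triangular
  with invertible diagonal. Hence a \<open>D\<close>-cycle over such a path that vanishes on lower words
  is zero (\<open>cycle_zero\<close>). By induction on the length of \<open>\<gamma>\<close> the element \<open>D\<^sup>2 \<gamma>\<close> is a cycle,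
  so only its coefficients at lower words are needed; there exactly two terms occur and they
  cancel (\<open>cobar_diff_square_single_lo\<close>). The same matching shows that \<open>D\<close> is exact over
  paths that are not normal (\<open>acyclic\<close>).

  Exactness allows to choose recursively, for each bar word \<open>w\<close>, an element \<open>F w\<close> (\<open>lift\<close>) of
  the tensor algebra with \<open>D (F w) = \<Sum> \<plusminus> (F(prefix) F(suffix) - F(merged word))\<close>, where
  \<open>F [u]\<close> is the word of the arrows of \<open>u\<close>. The transpose of \<open>F\<close> is an A-infinity morphism
  from Ext with the asserted products to the dual of the bar construction
  (\<open>a_infinity_morphism_mor\<close>). The coefficient \<open>kappa w\<close> of \<open>F w\<close> at the word with the single
  letter \<open>concat w\<close> vanishes on boundaries and is \<open>1\<close> on the bar cycles of the chains. A
  matching of bar words like the one above shows that these cycles span the homology of the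
  bar construction (\<open>bar_decomposition\<close>). So the morphism is an isomorphism on cohomology,
  and the functionals \<open>\<gamma>\<^sup>\<or>\<close> are obtained from \<open>kappa\<close> by restriction to words over \<open>\<gamma>\<close>.
\<close>

section \<open>Slices and factorizations of paths\<close>

definition slice :: "'b list \<Rightarrow> nat \<Rightarrow> nat \<Rightarrow> 'b list" where
  "slice p a b = drop a (take b p)"

lemma length_slice [simp]: "b \<le> length p \<Longrightarrow> length (slice p a b) = b - a"
  by (simp add: slice_def)

lemma slice_append:
  assumes "a \<le> b" "b \<le> c"
  shows "slice p a b @ slice p b c = slice p a c"
proof -
  have "take c p = take b p @ drop b (take c p)"
    using append_take_drop_id[of b "take c p"] assms by (simp add: min_def)
  then have "drop a (take c p) = drop a (take b p) @ drop (a - length (take b p)) (drop b (take c p))"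
    by (metis drop_append)
  also have "drop (a - length (take b p)) (drop b (take c p)) = drop b (take c p)"
    using assms by (cases "b \<le> length p") auto
  finally show ?thesis by (simp add: slice_def)
qed

lemma slice_whole [simp]: "slice p 0 (length p) = p"
  by (simp add: slice_def)

lemma sublist_slice: "a \<le> a' \<Longrightarrow> b' \<le> b \<Longrightarrow> sublist (slice p a' b') (slice p a b)"
proof -
  assume a: "a \<le> a'" "b' \<le> b"
  have "drop a' (take b' p) = drop (a' - a) (drop a (take b' p))"
    using a(1) by simp
  then have "sublist (drop a' (take b' p)) (drop a (take b' p))"
    by (simp only: sublist_drop)
  also have "drop a (take b' p) = take (b' - a) (drop a (take b p))"
    using a(2) by (simp add: drop_take min_def)
  then have "sublist (drop a (take b' p)) (drop a (take b p))"
    by (simp only: sublist_take)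
  finally show ?thesis by (simp add: slice_def)
qed

lemma sublist_slice_list: "sublist (slice p a b) p"
  by (metis slice_def sublist_drop sublist_order.order.trans sublist_take)

lemma normal_sublist: "normal R p \<Longrightarrow> sublist q p \<Longrightarrow> normal R q"
  unfolding normal_def using sublist_order.order.trans by blast

lemma normal_appendD: "normal R (p @ q) \<Longrightarrow> normal R p \<and> normal R q"
  using normal_sublist sublist_append_rightI sublist_append_leftI by blast

locale monomial_quiver =
  fixes Q :: "('v, 'a) pre_digraph" and R :: "'a list set"
  assumes wf: "wf_digraph Q" and relations: "monomial_relations Q R"
begin

lemma quiver_path_iff:
  "quiver_path Q p \<longleftrightarrow> p \<noteq> [] \<and> set p \<subseteq> arcs Q \<and> successively (\<lambda>a b. head Q a = tail Q b) p"
proof -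
  have cas: "pre_digraph.cas Q u p v \<longleftrightarrow> (if p = [] then u = v else tail Q (hd p) = u \<and>
      head Q (last p) = v \<and> successively (\<lambda>a b. head Q a = tail Q b) p)" for u v
    by (induction p arbitrary: u) (auto simp: pre_digraph.cas.simps successively_Cons)
  show ?thesis
  proof (cases "p = []")
    case False
    then have "tail Q (hd p) \<in> verts Q" if "set p \<subseteq> arcs Q"
      using that wf_digraph.tail_in_verts[OF wf] by (metis hd_in_set subsetD)
    then show ?thesis
      using False by (auto simp: quiver_path_def pre_digraph.awalk_def cas)
  qed (simp add: quiver_path_def)
qed

lemma quiver_path_append:
  assumes "p \<noteq> []" "q \<noteq> []"
  shows "quiver_path Q (p @ q) \<longleftrightarrow> quiver_path Q p \<and> quiver_path Q q \<and> target Q p = source Q q"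
  using assms by (auto simp: quiver_path_iff successively_append_iff target_def source_def)

lemma quiver_path_sublist: "quiver_path Q p \<Longrightarrow> sublist q p \<Longrightarrow> q \<noteq> [] \<Longrightarrow> quiver_path Q q"
  unfolding sublist_def quiver_path_iff by (auto simp: successively_append_iff)

lemma quiver_path_concat:
  assumes "ps \<noteq> []" "\<forall>p\<in>set ps. p \<noteq> []"
  shows "quiver_path Q (concat ps) \<longleftrightarrow>
    (\<forall>p\<in>set ps. quiver_path Q p) \<and> successively (\<lambda>p q. target Q p = source Q q) ps"
  using assms
proof (induction ps)
  case (Cons p ps)
  show ?case
  proof (cases ps)
    case (Cons q qs)
    then have "concat ps \<noteq> []" "source Q (concat ps) = source Q q"
      using Cons.prems by (auto simp: source_def hd_append)
    then show ?thesis
      using Cons.prems Cons.IH Cons by (auto simp: quiver_path_append)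
  qed simp
qed simp

lemma normal_short: "length p \<le> 1 \<Longrightarrow> normal R p"
  using relations sublist_length_le unfolding normal_def monomial_relations_def by fastforce

lemma factorization_nonempty: "chain_factorization Q R us \<Longrightarrow> u \<in> set us \<Longrightarrow> u \<noteq> []"
  by (auto simp: chain_factorization_def normal_path_def quiver_path_def)

lemma factorization_single: "chain_factorization Q R [u] \<longleftrightarrow> length u = 1 \<and> quiver_path Q u"
  by (auto simp: chain_factorization_def normal_path_def intro: normal_short)

lemma factorization_snoc:
  "us \<noteq> [] \<Longrightarrow> chain_factorization Q R (us @ [u]) \<longleftrightarrow>
     chain_factorization Q R us \<and> normal_path Q R u \<and> target Q (last us) = source Q u \<and>
     zero_minimally R (last us) u"
  by (auto simp: chain_factorization_def successively_append_iff)

lemma factorization_butlast: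
  "chain_factorization Q R (us @ vs) \<Longrightarrow> us \<noteq> [] \<Longrightarrow> chain_factorization Q R us"
  by (auto simp: chain_factorization_def successively_append_iff)

lemma factorization_path:
  assumes "chain_factorization Q R us"
  shows "quiver_path Q (concat us)"
proof -
  have "us \<noteq> []" "\<forall>u\<in>set us. quiver_path Q u" "successively (\<lambda>p q. target Q p = source Q q) us"
    using assms by (auto simp: chain_factorization_def normal_path_def intro: successively_mono)
  then show ?thesis
    by (subst quiver_path_concat) (auto simp: quiver_path_def)
qed

lemma zero_minimally_unique:
  assumes "zero_minimally R u v" "zero_minimally R u v'" "prefix v w" "prefix v' w"
  shows "v = v'"
proof -
  have "prefix v v' \<or> prefix v' v" using assms(3,4) by (rule prefix_same_cases)
  moreover have "\<not> strict_prefix v v'" "\<not> strict_prefix v' v"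
    using assms(1,2) unfolding zero_minimally_def by blast+
  ultimately show ?thesis unfolding strict_prefix_def by blast
qed

text \<open>
  The pieces are determined from left to right: the first is an arrow, and each further piece
  is the shortest one whose product with the previous piece vanishes.
\<close>
lemma factorization_prefix_unique:
  assumes "chain_factorization Q R us" "chain_factorization Q R vs" "length us = length vs"
    "prefix (concat us) w" "prefix (concat vs) w"
  shows "us = vs"
  using assms
proof (induction us arbitrary: vs rule: rev_induct)
  case Nil
  then show ?case by (simp add: chain_factorization_def)
next
  case (snoc u us)
  then obtain v vs' where vs: "vs = vs' @ [v]" "length us = length vs'"
    by (cases vs rule: rev_cases) auto
  show ?case
  proof (cases "us = []")
    case True
    then have "length u = 1" "length v = 1" "vs' = []"
      using snoc.prems vs by (auto simp: factorization_single)
    then show ?thesis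
      using snoc.prems True vs by (auto simp: prefix_def)
  next
    case False
    then have ne: "vs' \<noteq> []" using vs by auto
    have "prefix (concat us) w" "prefix (concat vs') w"
      using snoc.prems vs by (auto simp: prefix_def)
    then have "us = vs'"
      using snoc.IH[of vs'] snoc.prems vs False ne by (simp add: factorization_snoc)
    moreover have "u = v"
    proof (rule zero_minimally_unique)
      show "zero_minimally R (last us) u" "zero_minimally R (last us) v"
        using snoc.prems vs False ne \<open>us = vs'\<close> by (auto simp: factorization_snoc)
      show "prefix u (drop (length (concat us)) w)"
        using snoc.prems(4) by (auto simp: prefix_def)
      show "prefix v (drop (length (concat us)) w)"
        using snoc.prems(5) vs \<open>us = vs'\<close> by (auto simp: prefix_def)
    qed
    ultimately show ?thesis using vs by simp
  qed
qed

lemma factorization_unique_length: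
  assumes "chain_factorization Q R us" "chain_factorization Q R vs" "concat us = concat vs"
  shows "\<not> length us < length vs"
proof
  assume l: "length us < length vs"
  define k where "k = length us"
  have "us \<noteq> []" using assms by (simp add: chain_factorization_def)
  have vs: "vs = take k vs @ vs ! k # drop (Suc k) vs"
    using l by (simp add: k_def id_take_nth_drop)
  have t: "take k vs \<noteq> []" using l \<open>us \<noteq> []\<close> by (auto simp: k_def)
  then have "chain_factorization Q R (take k vs)"
    using assms(2) vs factorization_butlast by metis
  moreover have "prefix (concat (take k vs)) (concat vs)"
    by (metis append_take_drop_id concat_append prefix_def)
  moreover have "length us = length (take k vs)" using l by (simp add: k_def)
  moreover have "prefix (concat us) (concat vs)" using assms(3) by simp
  ultimately have eq: "us = take k vs"
    using factorization_prefix_unique[OF assms(1)] by blast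
  have "concat vs = concat (take k vs) @ vs ! k @ concat (drop (Suc k) vs)"
    by (subst vs) simp
  then have "concat us = concat us @ vs ! k @ concat (drop (Suc k) vs)"
    using assms(3) eq by simp
  then have "vs ! k = []" by simp
  then show False using factorization_nonempty[OF assms(2) nth_mem] l by (auto simp: k_def)
qed

text \<open>
  Of two factorizations of different lengths, the shorter one would be an initial part of the
  longer one, whose remaining pieces would be empty.
\<close>
lemma factorization_unique:
  assumes "chain_factorization Q R us" "chain_factorization Q R vs" "concat us = concat vs"
  shows "us = vs"
proof (rule factorization_prefix_unique[OF assms(1,2)])
  show "length us = length vs"
    using factorization_unique_length[OF assms] factorization_unique_length[OF assms(2,1)] assms(3)
    by simp
  show "prefix (concat us) (concat us)" "prefix (concat vs) (concat us)"
    using assms(3) by simp_all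
qed

section \<open>Positions of chains in a path\<close>

text \<open>
  The value \<open>length p + 1\<close>, beyond the path, means that \<open>p\<close> stays normal from \<open>s\<close> on. It
  makes \<open>nx p\<close> monotone, and lets inequalities express that a piece is normal.
\<close>
definition nx :: "'a list \<Rightarrow> nat \<Rightarrow> nat" where
  "nx p s = (if \<exists>b\<le>length p. \<not> normal R (slice p s b)
     then LEAST b. b \<le> length p \<and> \<not> normal R (slice p s b) else Suc (length p))"

lemma nx_le: "nx p s \<le> Suc (length p)"
proof (cases "\<exists>b\<le>length p. \<not> normal R (slice p s b)")
  case True
  then obtain b where "b \<le> length p \<and> \<not> normal R (slice p s b)" by blast
  then have "nx p s \<le> b" unfolding nx_def using True by (auto intro: Least_le)
  then show ?thesis using \<open>b \<le> length p \<and> _\<close> by simp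
qed (simp only: nx_def if_False order_refl)

lemma normal_slice_iff:
  assumes "b \<le> length p"
  shows "normal R (slice p s b) \<longleftrightarrow> b < nx p s"
proof (cases "\<exists>b\<le>length p. \<not> normal R (slice p s b)")
  case True
  define P where "P b \<longleftrightarrow> b \<le> length p \<and> \<not> normal R (slice p s b)" for b
  have nx: "nx p s = (LEAST b. P b)" using True by (simp add: nx_def P_def)
  have "\<exists>b. P b" using True by (auto simp: P_def)
  then have L: "P (nx p s)" unfolding nx by (metis LeastI)
  show ?thesis
  proof
    assume n: "normal R (slice p s b)"
    show "b < nx p s"
    proof (rule ccontr)
      assume "\<not> b < nx p s"
      then have "sublist (slice p s (nx p s)) (slice p s b)" by (intro sublist_slice) auto
      then show False using n L normal_sublist by (auto simp: P_def)
    qed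
  next
    assume "b < nx p s"
    then show "normal R (slice p s b)" using assms not_less_Least[of b P] by (auto simp: nx P_def)
  qed
next
  case False
  then show ?thesis using assms by (auto simp: nx_def)
qed

lemma nx_eqI:
  assumes "b \<le> length p" "\<not> normal R (slice p s b)" "\<And>b'. b' < b \<Longrightarrow> normal R (slice p s b')"
  shows "nx p s = b"
proof -
  have "nx p s \<le> b" using assms(1,2) normal_slice_iff[of b p s] by simp
  moreover have "\<not> nx p s < b"
  proof
    assume l: "nx p s < b"
    then have "normal R (slice p s (nx p s))" by (rule assms(3))
    then show False using l assms(1) normal_slice_iff[of "nx p s" p s] by simp
  qed
  ultimately show ?thesis by simp
qed

text \<open>
  The slice from \<open>s'\<close> is part of the slice from \<open>s\<close>, so it does not stop being normal any
  earlier.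
\<close>
lemma nx_mono: "s \<le> s' \<Longrightarrow> nx p s \<le> nx p s'"
proof (rule ccontr)
  assume s: "s \<le> s'" and "\<not> nx p s \<le> nx p s'"
  then have less: "nx p s' < nx p s" by simp
  then have l: "nx p s' \<le> length p" using nx_le[of p s] by simp
  then have "normal R (slice p s (nx p s'))" using less by (simp add: normal_slice_iff)
  then have "normal R (slice p s' (nx p s'))"
    using normal_sublist sublist_slice[OF s order_refl] by blast
  then show False using l by (simp add: normal_slice_iff)
qed

lemma nx_ge: "s < length p \<Longrightarrow> Suc s < nx p s"
  using normal_slice_iff[of "Suc s" p s] normal_short[of "slice p s (Suc s)"] by simp

text \<open>
  The possible ends of the pieces of a chain that starts at \<open>s\<close>. The first piece is an arrow.
  A later piece ends where the path, read from the beginning of the previous piece, stops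
  being normal; this is the reason for the step of two.
\<close>
fun pos :: "'a list \<Rightarrow> nat \<Rightarrow> nat \<Rightarrow> nat" where
  "pos p s 0 = s"
| "pos p s (Suc 0) = Suc s"
| "pos p s (Suc (Suc j)) = nx p (pos p s j)"

lemma pos_even: "pos p s (2 * m) = (nx p ^^ m) s"
  by (induction m) auto

lemma pos_odd: "pos p s (Suc (2 * m)) = (nx p ^^ m) (Suc s)"
  by (induction m) auto

lemma funpow_nx_mono: "s \<le> s' \<Longrightarrow> (nx p ^^ m) s \<le> (nx p ^^ m) s'"
  by (induction m) (auto intro: nx_mono)

lemma pos_add_even: "pos p s (k + 2 * m) = (nx p ^^ m) (pos p s k)"
  by (induction m) auto

text \<open>
  A failure of strict growth is inherited two steps later, because \<open>nx\<close> is monotone.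
\<close>
lemma pos_strict_down:
  assumes "pos p s (Suc j) < pos p s (Suc (Suc j))" "pos p s (Suc (Suc j)) < pos p s (Suc (Suc (Suc j)))" "i \<le> Suc (Suc j)"
  shows "pos p s i < pos p s (Suc i)"
  using assms
proof (induction j)
  case 0
  then consider "i = 0" | "i = Suc 0" | "i = Suc (Suc 0)" by linarith
  then show ?case using 0 by cases auto
next
  case (Suc j)
  have "pos p s (Suc j) < pos p s (Suc (Suc j))"
  proof (rule ccontr)
    assume "\<not> ?thesis"
    then have "nx p (pos p s (Suc (Suc j))) \<le> nx p (pos p s (Suc j))" by (intro nx_mono) simp
    then show False using Suc.prems(2) by simp
  qed
  then show ?case using Suc by (cases "i = Suc (Suc (Suc j))") auto
qed

text \<open>
  Piece \<open>j\<close> extends from \<open>pos p s j\<close> to \<open>pos p s (j + 1)\<close>. The inequalities say that the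
  pieces are nonempty and normal; the one at \<open>j = r + 1\<close> expresses normality of the last
  piece.
\<close>
definition chain_at :: "'a list \<Rightarrow> nat \<Rightarrow> nat \<Rightarrow> nat \<Rightarrow> bool" where
  "chain_at p s r t \<longleftrightarrow> (\<forall>j\<le>Suc r. pos p s j < pos p s (Suc j)) \<and> pos p s (Suc r) = t"

lemma chain_atI:
  assumes "r > 0" "pos p s r < pos p s (Suc r)" "pos p s (Suc r) < pos p s (Suc (Suc r))" "pos p s (Suc r) = t"
  shows "chain_at p s r t"
  using assms pos_strict_down[of p s "r - 1"] by (auto simp: chain_at_def)

lemma chain_at_le: "chain_at p s r t \<Longrightarrow> t \<le> length p"
  unfolding chain_at_def using nx_le[of p "pos p s r"]
  by (metis le_refl less_Suc_eq_le less_le_trans pos.simps(3))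

lemma chain_at_pos:
  assumes "chain_at p s r t" shows "s < t"
proof -
  have "j \<le> Suc r \<Longrightarrow> s + j \<le> pos p s j" for j
  proof (induction j)
    case (Suc j)
    then have "pos p s j < pos p s (Suc j)" using assms by (simp add: chain_at_def)
    then show ?case using Suc by simp
  qed simp
  from this[of "Suc r"] show ?thesis using assms by (simp add: chain_at_def)
qed

text \<open>
  Minimality of \<open>u\<^sub>j u\<^sub>j\<^sub>+\<^sub>1 = 0\<close> says that \<open>u\<^sub>j\<^sub>+\<^sub>1\<close> ends at \<open>nx\<close> of the beginning of \<open>u\<^sub>j\<close>,
  and normality of the last piece that the next position lies further on.
\<close>
lemma factorization_pos:
  assumes "chain_factorization Q R us" "prefix (concat us) (drop s p)" "s \<le> length p"
  shows "(\<forall>j\<le>length us. pos p s j = s + length (concat (take j us))) \<and>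
         (\<forall>j\<le>length us. pos p s j < pos p s (Suc j))"
  using assms
proof (induction us rule: rev_induct)
  case Nil
  then show ?case by (simp add: chain_factorization_def)
next
  case (snoc u us)
  let ?k = "length us"
  obtain q where q: "drop s p = concat (us @ [u]) @ q" using snoc.prems by (auto simp: prefix_def)
  have len: "s + length (concat us) + length u \<le> length p"
    using arg_cong[OF q, of length] snoc.prems by simp
  show ?case
  proof (cases "us = []")
    case True
    then have "length u = 1" using snoc.prems by (simp add: factorization_single)
    moreover have "Suc s < nx p s" using len \<open>length u = 1\<close> by (intro nx_ge) simp
    ultimately show ?thesis using True by (auto simp: le_Suc_eq)
  next
    case False
    have prem: "chain_factorization Q R us" "normal_path Q R u" "zero_minimally R (last us) u"
      using snoc.prems False by (auto simp: factorization_snoc)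
    have IH: "\<forall>j\<le>?k. pos p s j = s + length (concat (take j us))"
        "\<forall>j\<le>?k. pos p s j < pos p s (Suc j)"
      using snoc.IH[OF prem(1)] snoc.prems by (auto simp: prefix_def)
    obtain vs v where us: "us = vs @ [v]" using False by (cases us rule: rev_cases) auto
    define a where "a = s + length (concat vs)"
    define b where "b = s + length (concat us)"
    have ab: "pos p s (length vs) = a" "pos p s (Suc (length vs)) = b"
      using IH(1) us by (auto simp: a_def b_def)
    have sl: "slice p a b' = take (b' - a) (v @ u @ q)" if "a \<le> b'" for b'
    proof -
      have "drop a p = v @ u @ q"
        using q us by (metis a_def add.commute append.assoc append_eq_conv_conj concat.simps concat_append drop_drop append_Nil2)
      then show ?thesis by (simp add: slice_def drop_take)
    qed
    have "drop b p = u @ q"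
      using q by (metis b_def add.commute append.assoc append_eq_conv_conj concat.simps concat_append drop_drop append_Nil2)
    then have slb: "slice p b (b + length u) = u" by (simp add: slice_def drop_take)
    have bv: "b = a + length v" by (simp add: a_def b_def us)
    have bl: "b + length u \<le> length p" using len by (simp add: b_def)
    have nx: "nx p a = b + length u"
    proof (rule nx_eqI[OF bl])
      show "\<not> normal R (slice p a (b + length u))"
        using prem(3) us by (simp add: sl bv zero_minimally_def)
      fix b' assume b': "b' < b + length u"
      show "normal R (slice p a b')"
      proof (cases "a \<le> b'")
        case True
        have *: "strict_prefix (take (b' - b) u) u"
        proof -
          have "u \<noteq> []" using prem(2) by (auto simp: normal_path_def quiver_path_def)
          then have "length (take (b' - b) u) < length u" using b' by (cases u) auto
          then show ?thesis using take_is_prefix[of "b' - b" u] by (auto simp: strict_prefix_def)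
        qed
        have "normal R (v @ take (b' - b) u)"
          using prem(3) * us by (simp add: zero_minimally_def)
        moreover have "take (b' - a) (v @ u @ q) = take (b' - a) (v @ take (b' - b) u)"
          using b' bv by (simp add: min_def)
        moreover have "sublist (take (b' - a) (v @ take (b' - b) u)) (v @ take (b' - b) u)"
          by (rule sublist_take)
        ultimately show ?thesis using sl[OF True] normal_sublist by simp
      next
        case False
        then show ?thesis by (simp add: slice_def normal_short)
      qed
    qed
    have e: "pos p s (Suc (Suc (length vs))) = b + length u" using nx ab by simp
    have "b + length u < nx p b"
      using normal_slice_iff[OF bl, of b] slb prem(2) by (simp add: normal_path_def)
    then have e2: "pos p s (Suc (Suc (length vs))) < pos p s (Suc (Suc (Suc (length vs))))"
      using e ab(2) by simp
    have k: "?k = Suc (length vs)" by (simp add: us)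
    show ?thesis
      using IH e e2 b_def
      by (auto simp: k le_Suc_eq all_conj_distrib us)
  qed
qed

lemma chain_at_factorization:
  assumes "quiver_path Q p" "chain_at p s r t"
  shows "\<exists>us. chain_factorization Q R us \<and> length us = Suc r \<and> concat us = slice p s t \<and>
    last us = slice p (pos p s r) t"
  using assms(2)
proof (induction r arbitrary: t)
  case 0
  have "s < length p" "t = Suc s" using 0 chain_at_le[OF 0] by (auto simp: chain_at_def)
  then have len: "length (slice p s t) = 1" by simp
  then have "slice p s t \<noteq> []" by auto
  then have "quiver_path Q (slice p s t)"
    using quiver_path_sublist[OF assms(1) sublist_slice_list] by blast
  with len show ?case by (intro exI[of _ "[slice p s t]"]) (simp add: factorization_single)
next
  case (Suc r)
  define b where "b = pos p s (Suc r)"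
  define a where "a = pos p s r"
  have "chain_at p s r b" using Suc.prems by (auto simp: chain_at_def b_def)
  then obtain us where us: "chain_factorization Q R us" "length us = Suc r" "concat us = slice p s b"
      "last us = slice p a b"
    using Suc.IH a_def by blast
  have t: "t = nx p a" "t \<le> length p" using Suc.prems chain_at_le[OF Suc.prems] by (auto simp: chain_at_def a_def)
  have "\<forall>j\<le>Suc (Suc r). pos p s j < pos p s (Suc j)" "pos p s (Suc (Suc r)) = t"
    using Suc.prems by (simp_all add: chain_at_def)
  then have ab: "a < b" "b < t"
    unfolding a_def b_def by (metis le_SucI le_refl, metis le_refl le_SucI)
  have sb: "s < b" using \<open>chain_at p s r b\<close> by (rule chain_at_pos)
  have tn: "t < nx p b" using Suc.prems
    by (auto simp: chain_at_def b_def)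
  define u where "u = slice p b t"
  have "length u > 0" using ab t by (simp add: u_def)
  then have u_ne: "u \<noteq> []" by simp
  have norm: "normal_path Q R u"
    using quiver_path_sublist[OF assms(1) sublist_slice_list] u_ne tn t normal_slice_iff
    by (auto simp: normal_path_def u_def)
  have "length (slice p a b) > 0" using ab t by simp
  then have ne: "slice p a b \<noteq> []" by simp
  have app: "slice p a b @ u = slice p a t" using ab by (simp add: u_def slice_append)
  have comp: "target Q (slice p a b) = source Q u"
    using quiver_path_append[OF ne u_ne] app quiver_path_sublist[OF assms(1) sublist_slice_list] ne
    by (metis append_is_Nil_conv)
  have zm: "zero_minimally R (slice p a b) u"
    unfolding zero_minimally_def
  proof (intro conjI allI impI)
    show "\<not> normal R (slice p a b @ u)" using app t normal_slice_iff[of t p a] by simp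
    fix v assume v: "strict_prefix v u"
    then obtain w where w: "u = v @ w" "w \<noteq> []" by (auto simp: strict_prefix_def prefix_def)
    have "length u = t - b" using t by (simp add: u_def)
    then have lv: "b + length v < t" using w ab by (cases w) auto
    have "slice p b (b + length v) = v"
    proof -
      have "slice p b (b + length v) = take (length v) u"
        using lv by (simp add: u_def slice_def drop_take min_def)
      then show ?thesis using w by simp
    qed
    then have "slice p a b @ v = slice p a (b + length v)"
      using slice_append[of a b "b + length v" p] ab by simp
    then show "normal R (slice p a b @ v)"
      using normal_slice_iff[of "b + length v" p a] lv t by simp
  qed
  have "us \<noteq> []" using us by auto
  then have "chain_factorization Q R (us @ [u])"
    using us norm comp zm by (simp add: factorization_snoc)
  moreover have "concat (us @ [u]) = slice p s t" using us(3) sb ab by (simp add: u_def slice_append)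
  ultimately show ?case using us(2) by (intro exI[of _ "us @ [u]"]) (simp add: u_def b_def)
qed

lemma chain_slice_iff:
  assumes "quiver_path Q p" "s \<le> t" "t \<le> length p"
  shows "chain Q R r (slice p s t) \<longleftrightarrow> chain_at p s r t"
proof
  assume "chain Q R r (slice p s t)"
  then obtain us where us: "chain_factorization Q R us" "length us = Suc r" "concat us = slice p s t"
    by (auto simp: chain_def)
  have "prefix (concat us) (drop s p)"
    using us(3) by (simp add: slice_def drop_take take_is_prefix)
  from factorization_pos[OF us(1) this] assms us show "chain_at p s r t"
    by (auto simp: chain_at_def)
next
  assume "chain_at p s r t"
  then show "chain Q R r (slice p s t)"
    using chain_at_factorization[OF assms(1), of s r t] unfolding chain_def by auto
qed

end

section \<open>Triangular matchings\<close>

definition finsupp :: "('b \<Rightarrow> 'k::field) \<Rightarrow> bool" where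
  "finsupp f \<longleftrightarrow> finite {x. f x \<noteq> 0}"

lemma finsupp_zero [simp]: "finsupp (\<lambda>x. 0)"
  by (simp add: finsupp_def)

lemma finsupp_single [simp]: "finsupp (single x)"
  unfolding finsupp_def by (rule finite_subset[of _ "{x}"]) (auto simp: single_def)

lemma finsupp_add_mult: "finsupp f \<Longrightarrow> finsupp g \<Longrightarrow> finsupp (\<lambda>x. f x + c * g x)"
  unfolding finsupp_def by (rule finite_subset[of _ "{x. f x \<noteq> 0} \<union> {x. g x \<noteq> 0}"]) auto

lemma finsupp_sum: "(\<And>i. i \<in> J \<Longrightarrow> finsupp (g i)) \<Longrightarrow> finsupp (\<lambda>x. \<Sum>i\<in>J. c i * g i x)"
proof (induction J rule: infinite_finite_induct)
  case (insert i J)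
  have "finsupp (\<lambda>x. (\<Sum>i\<in>J. c i * g i x) + c i * g i x)"
    using insert by (intro finsupp_add_mult) auto
  then show ?case using insert by (simp add: add.commute)
qed auto

lemma sum_single:
  assumes "finite J" "{x. f x \<noteq> 0} \<subseteq> J"
  shows "f = (\<lambda>x. \<Sum>i\<in>J. f i * single i x)"
proof
  fix x
  have "(\<Sum>i\<in>J. f i * single i x) = (\<Sum>i\<in>J. if x = i then f i else 0)"
    by (rule sum.cong) (auto simp: single_def)
  then show "f x = (\<Sum>i\<in>J. f i * single i x)"
    using assms by (auto simp: sum.delta' sum.delta)
qed

text \<open>
  The algebra of discrete Morse theory. The matrix of \<open>D\<close> with columns \<open>up i\<close> and rows \<open>lo j\<close>
  is triangular with respect to \<open>m\<close>, with nonzero diagonal entries. It may be infinite, so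
  finite columns and a weight in the natural numbers replace finiteness.
\<close>
locale triangular_matching =
  fixes D :: "('b \<Rightarrow> 'k::field) \<Rightarrow> 'b \<Rightarrow> 'k"
    and I :: "'i set" and up lo :: "'i \<Rightarrow> 'b" and m :: "'i \<Rightarrow> nat"
  assumes linear: "\<And>f g c. finsupp f \<Longrightarrow> finsupp g \<Longrightarrow>
      D (\<lambda>x. f x + c * g x) = (\<lambda>y. D f y + c * D g y)"
    and inj_up: "inj_on up I" and inj_lo: "inj_on lo I"
    and diagonal: "\<And>i. i \<in> I \<Longrightarrow> D (single (up i)) (lo i) \<noteq> 0"
    and triangular: "\<And>i j. i \<in> I \<Longrightarrow> j \<in> I \<Longrightarrow> D (single (up i)) (lo j) \<noteq> 0 \<Longrightarrow> j \<noteq> i \<Longrightarrow> m j < m i"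
    and finite_column: "\<And>i. i \<in> I \<Longrightarrow> finsupp (D (single (up i)))"
begin

lemma linear_zero: "D (\<lambda>x. 0) = (\<lambda>y. 0)"
proof
  fix y
  have "D (\<lambda>x. 0) y = D (\<lambda>x. 0) y + 1 * D (\<lambda>x. 0) y"
    using fun_cong[OF linear[of "\<lambda>x. 0" "\<lambda>x. 0" 1], of y]
    by (simp only: mult_zero_right add_0_right finsupp_zero simp_thms)
  then show "D (\<lambda>x. 0) y = 0" by (simp only: mult_1 add_cancel_right_right)
qed

lemma linear_sum:
  assumes "finite J" "\<And>i. i \<in> J \<Longrightarrow> finsupp (g i)"
  shows "D (\<lambda>x. \<Sum>i\<in>J. c i * g i x) = (\<lambda>y. \<Sum>i\<in>J. c i * D (g i) y)"
  using assms
proof (induction J rule: finite_induct)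
  case (insert i J)
  have "D (\<lambda>x. (\<Sum>i\<in>J. c i * g i x) + c i * g i x) =
      (\<lambda>y. D (\<lambda>x. \<Sum>i\<in>J. c i * g i x) y + c i * D (g i) y)"
    using insert by (intro linear finsupp_sum) auto
  then show ?case using insert by (simp add: add.commute)
qed (simp add: linear_zero)

lemma finite_index: "finsupp f \<Longrightarrow> inj_on h I \<Longrightarrow> finite {i \<in> I. f (h i) \<noteq> 0}"
  unfolding finsupp_def using finite_vimage_IntI[of "{x. f x \<noteq> 0}" h I]
  by (simp add: vimage_def Int_def conj_commute)

text \<open>
  At an index of maximal weight in the support of \<open>u\<close> only the diagonal entry contributes.
\<close>
lemma injective:
  assumes u: "finsupp u" "{x. u x \<noteq> 0} \<subseteq> up ` I" and zero: "\<And>j. j \<in> I \<Longrightarrow> D u (lo j) = 0"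
  shows "u = (\<lambda>x. 0)"
proof (rule ccontr)
  assume nz: "u \<noteq> (\<lambda>x. 0)"
  define J where "J = {i \<in> I. u (up i) \<noteq> 0}"
  have fin: "finite J" unfolding J_def by (rule finite_index[OF u(1) inj_up])
  have "J \<noteq> {}" using nz u(2) by (fastforce simp: J_def)
  then have "Max (m ` J) \<in> m ` J" using fin by (intro Max_in) auto
  then obtain i where i': "i \<in> J" "Max (m ` J) = m i" by auto
  then have i: "i \<in> J" "\<And>j. j \<in> J \<Longrightarrow> m j \<le> m i" using fin by (auto simp flip: i'(2))
  have injJ: "inj_on up J" using inj_up by (rule inj_on_subset) (auto simp: J_def)
  have "u = (\<lambda>x. \<Sum>b\<in>up ` J. u b * single b x)"
    using fin u(2) by (intro sum_single) (auto simp: J_def)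
  also have "\<dots> = (\<lambda>x. \<Sum>j\<in>J. u (up j) * single (up j) x)"
    by (simp add: sum.reindex[OF injJ])
  finally have "D u = (\<lambda>y. \<Sum>j\<in>J. u (up j) * D (single (up j)) y)"
    using linear_sum[OF fin, of "\<lambda>j. single (up j)" "\<lambda>j. u (up j)"] by simp
  then have "D u (lo i) = (\<Sum>j\<in>J. u (up j) * D (single (up j)) (lo i))" by simp
  also have "\<dots> = (\<Sum>j\<in>{i}. u (up j) * D (single (up j)) (lo i))"
  proof (rule sum.mono_neutral_right)
    show "\<forall>j\<in>J - {i}. u (up j) * D (single (up j)) (lo i) = 0"
    proof
      fix j assume j: "j \<in> J - {i}"
      then have "D (single (up j)) (lo i) = 0"
        using triangular[of j i] i by (force simp: J_def)
      then show "u (up j) * D (single (up j)) (lo i) = 0" by simp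
    qed
  qed (use fin i in auto)
  finally show False using zero[of i] diagonal[of i] i by (simp add: J_def)
qed

lemma solvable_combination:
  assumes c: "finsupp c"
    and solv: "\<And>j. j \<in> I \<Longrightarrow> c (lo j) \<noteq> 0 \<Longrightarrow> \<exists>u. finsupp u \<and> {x. u x \<noteq> 0} \<subseteq> up ` I \<and>
      (\<forall>k\<in>I. D u (lo k) = single (lo j) (lo k))"
  shows "\<exists>u. finsupp u \<and> {x. u x \<noteq> 0} \<subseteq> up ` I \<and> (\<forall>k\<in>I. D u (lo k) = c (lo k))"
proof -
  define J where "J = {j \<in> I. c (lo j) \<noteq> 0}"
  have fin: "finite J" unfolding J_def by (rule finite_index[OF c inj_lo])
  have "\<forall>j\<in>J. \<exists>u. finsupp u \<and> {x. u x \<noteq> 0} \<subseteq> up ` I \<and> (\<forall>k\<in>I. D u (lo k) = single (lo j) (lo k))"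
    using solv by (auto simp: J_def)
  then obtain u where u: "\<And>j. j \<in> J \<Longrightarrow> finsupp (u j)" "\<And>j. j \<in> J \<Longrightarrow> {x. u j x \<noteq> 0} \<subseteq> up ` I"
    "\<And>j k. j \<in> J \<Longrightarrow> k \<in> I \<Longrightarrow> D (u j) (lo k) = single (lo j) (lo k)"
    by (auto simp: bchoice_iff)
  define v where "v = (\<lambda>x. \<Sum>j\<in>J. c (lo j) * u j x)"
  have "{x. v x \<noteq> 0} \<subseteq> up ` I"
  proof
    fix x assume "x \<in> {x. v x \<noteq> 0}"
    then have "(\<Sum>j\<in>J. c (lo j) * u j x) \<noteq> 0" by (simp add: v_def)
    then obtain j where "j \<in> J" "c (lo j) * u j x \<noteq> 0"
      by (rule sum.not_neutral_contains_not_neutral)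
    then show "x \<in> up ` I" using u(2)[of j] by auto
  qed
  moreover have "D v (lo k) = c (lo k)" if k: "k \<in> I" for k
  proof -
    have "D v (lo k) = (\<Sum>j\<in>J. c (lo j) * D (u j) (lo k))"
      unfolding v_def using linear_sum[OF fin, of u "\<lambda>j. c (lo j)"] u(1) by simp
    also have "\<dots> = (\<Sum>j\<in>J. if j = k then c (lo j) else 0)"
    proof (rule sum.cong[OF refl])
      fix j assume "j \<in> J"
      then show "c (lo j) * D (u j) (lo k) = (if j = k then c (lo j) else 0)"
        using u(3)[of j k] k inj_on_eq_iff[OF inj_lo, of k j] by (auto simp: single_def J_def)
    qed
    also have "\<dots> = c (lo k)" using fin k by (simp add: J_def)
    finally show ?thesis .
  qed
  moreover have "finsupp v" unfolding v_def by (intro finsupp_sum u)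
  ultimately show ?thesis by blast
qed

text \<open>
  Elimination: the rest of a column has smaller weights, where the system is solvable by
  induction.
\<close>
lemma solvable_single:
  "i \<in> I \<Longrightarrow> \<exists>u. finsupp u \<and> {x. u x \<noteq> 0} \<subseteq> up ` I \<and> (\<forall>k\<in>I. D u (lo k) = single (lo i) (lo k))"
proof (induction "m i" arbitrary: i rule: less_induct)
  case less
  define e where "e = D (single (up i)) (lo i)"
  have e: "e \<noteq> 0" using diagonal less.prems by (simp add: e_def)
  define c where "c = (\<lambda>y. single (lo i) y + (- inverse e) * D (single (up i)) y)"
  have "finsupp c" unfolding c_def using less.prems by (intro finsupp_add_mult finite_column) auto
  moreover have "\<exists>u. finsupp u \<and> {x. u x \<noteq> 0} \<subseteq> up ` I \<and> (\<forall>k\<in>I. D u (lo k) = single (lo j) (lo k))"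
    if j: "j \<in> I" "c (lo j) \<noteq> 0" for j
  proof (rule less.hyps[OF _ j(1)])
    have "j \<noteq> i" using j e by (auto simp: c_def e_def single_def)
    then have "lo j \<noteq> lo i" using inj_on_eq_iff[OF inj_lo] j less.prems by blast
    then show "m j < m i" using triangular[OF less.prems j(1)] j(2) \<open>j \<noteq> i\<close>
      by (auto simp: c_def single_def)
  qed
  ultimately obtain u where u: "finsupp u" "{x. u x \<noteq> 0} \<subseteq> up ` I" "\<forall>k\<in>I. D u (lo k) = c (lo k)"
    using solvable_combination by blast
  define v where "v = (\<lambda>x. u x + inverse e * single (up i) x)"
  have "D v = (\<lambda>y. D u y + inverse e * D (single (up i)) y)"
    unfolding v_def by (intro linear u) simp
  moreover have "finsupp v" unfolding v_def by (intro finsupp_add_mult u) simp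
  moreover have "{x. v x \<noteq> 0} \<subseteq> up ` I" using u(2) less.prems by (auto simp: v_def single_def)
  ultimately show ?case using u(3) by (intro exI[of _ v]) (simp add: c_def)
qed

lemma solvable:
  assumes "finsupp c"
  shows "\<exists>u. finsupp u \<and> {x. u x \<noteq> 0} \<subseteq> up ` I \<and> (\<forall>k\<in>I. D u (lo k) = c (lo k))"
  using solvable_combination[OF assms solvable_single] by blast

end

context monomial_quiver
begin

section \<open>Words of chains and the cobar differential\<close>

definition is_chain :: "'a list \<Rightarrow> bool" where
  "is_chain \<gamma> \<longleftrightarrow> (\<exists>r. chain Q R r \<gamma>)"

definition cdeg :: "'a list \<Rightarrow> nat" where
  "cdeg \<gamma> = (THE r. chain Q R r \<gamma>)"

definition wdeg :: "'a list list \<Rightarrow> nat" where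
  "wdeg y = sum_list (map cdeg y)"

lemma chain_unique: "chain Q R r \<gamma> \<Longrightarrow> chain Q R r' \<gamma> \<Longrightarrow> r = r'"
  unfolding chain_def by (metis factorization_unique add_right_cancel)

lemma cdeg_eq: "chain Q R r \<gamma> \<Longrightarrow> cdeg \<gamma> = r"
  unfolding cdeg_def using chain_unique by blast

lemma chain_cdeg: "is_chain \<gamma> \<Longrightarrow> chain Q R (cdeg \<gamma>) \<gamma>"
  using cdeg_eq by (auto simp: is_chain_def)

lemma wdeg_simps [simp]: "wdeg [] = 0" "wdeg (a # y) = cdeg a + wdeg y" "wdeg (y @ y') = wdeg y + wdeg y'"
  by (simp_all add: wdeg_def)

text \<open>
  The blocks into which \<open>D\<close> decomposes a single chain, and at the same time the arguments at
  which a higher product does not vanish.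
\<close>
definition good :: "'a list list \<Rightarrow> bool" where
  "good b \<longleftrightarrow> (\<forall>\<gamma>\<in>set b. is_chain \<gamma>) \<and> chain Q R (Suc (wdeg b)) (concat b)"

definition merge :: "nat \<Rightarrow> nat \<Rightarrow> 'b list list \<Rightarrow> 'b list list" where
  "merge i l y = take i y @ concat (slice y i l) # drop l y"

text \<open>
  A function on words is read as a linear combination of words. The derivation \<open>D\<close> replaces
  one letter by a good block, so the coefficient of \<open>D z\<close> at \<open>y\<close> collects the coefficients of
  \<open>z\<close> at the words in which a good block of \<open>y\<close> is merged. The sign counts the lengths up to
  and including the first letter of the block.
\<close>
definition cobar_diff :: "('a list list \<Rightarrow> 'k::field) \<Rightarrow> 'a list list \<Rightarrow> 'k" where
  "cobar_diff z y = (\<Sum>i<length y. \<Sum>l\<le>length y.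
     if i < l \<and> good (slice y i l) then (-1) ^ wdeg (take (Suc i) y) * z (merge i l y) else 0)"

lemma cobar_diff_linear: "cobar_diff (\<lambda>x. f x + c * g x) y = cobar_diff f y + c * cobar_diff g y"
  unfolding cobar_diff_def sum_distrib_left sum.distrib[symmetric]
  by (intro sum.cong refl) (auto simp: algebra_simps)

lemma cobar_diff_add: "cobar_diff (\<lambda>x. f x + g x) y = cobar_diff f y + cobar_diff g y"
  using cobar_diff_linear[of f 1 g] by simp

lemma cobar_diff_scale: "cobar_diff (\<lambda>x. c * g x) y = c * cobar_diff g y"
  unfolding cobar_diff_def by (auto simp: sum_distrib_left intro!: sum.cong)

lemma cobar_diff_cong:
  assumes "\<And>i l. i < l \<Longrightarrow> l \<le> length y \<Longrightarrow> good (slice y i l) \<Longrightarrow> f (merge i l y) = g (merge i l y)"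
  shows "cobar_diff f y = cobar_diff g y"
  unfolding cobar_diff_def using assms by (intro sum.cong refl if_cong) auto

lemma take_slice_drop:
  assumes "i \<le> l"
  shows "y = take i y @ slice y i l @ drop l y"
proof -
  have "take l y = take i y @ slice y i l"
    using append_take_drop_id[of i "take l y"] assms by (simp add: slice_def min_def)
  then show ?thesis using append_take_drop_id[of l y] by (metis append.assoc)
qed

lemma wdeg_merge:
  assumes "i < l" "l \<le> length y" "good (slice y i l)"
  shows "wdeg (merge i l y) = Suc (wdeg y)"
proof -
  have "cdeg (concat (slice y i l)) = Suc (wdeg (slice y i l))"
    using assms(3) by (auto simp: good_def intro: cdeg_eq)
  moreover have "wdeg y = wdeg (take i y) + wdeg (slice y i l) + wdeg (drop l y)"
    using assms(1) by (subst take_slice_drop[of i l y]) auto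
  ultimately show ?thesis by (simp add: merge_def)
qed

lemma concat_merge: "i \<le> l \<Longrightarrow> concat (merge i l y) = concat y"
  using arg_cong[OF take_slice_drop[of i l y], of concat] by (simp add: merge_def)

text \<open>
  The automorphism given by the parity of the degree; it is the sign in the Leibniz rule for
  \<open>D\<close>.
\<close>
definition iota :: "('a list list \<Rightarrow> 'k::field) \<Rightarrow> 'a list list \<Rightarrow> 'k" where
  "iota z y = (-1) ^ wdeg y * z y"

lemma cobar_diff_iota: "cobar_diff (iota z) y = - iota (cobar_diff z) y"
proof -
  have "cobar_diff (iota z) y = cobar_diff (\<lambda>v. (-1) ^ Suc (wdeg y) * z v) y"
    by (rule cobar_diff_cong) (simp add: iota_def wdeg_merge)
  then show ?thesis by (simp add: cobar_diff_scale iota_def del: power_Suc) simp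
qed

lemma iota_iota: "iota (iota z) = z"
  by (simp add: iota_def fun_eq_iff)

text \<open>
  The product of the tensor algebra, that is, concatenation of words extended bilinearly.
\<close>
definition conv :: "('b list \<Rightarrow> 'k::field) \<Rightarrow> ('b list \<Rightarrow> 'k) \<Rightarrow> 'b list \<Rightarrow> 'k" where
  "conv f g y = (\<Sum>k\<le>length y. f (take k y) * g (drop k y))"

lemma conv_Cons: "conv f g (a # ys) = f [] * g (a # ys) + conv (\<lambda>v. f (a # v)) g ys"
  unfolding conv_def by (simp add: sum.atMost_Suc_shift del: sum.atMost_Suc)

text \<open>
  The terms of \<open>D z\<close> in which the first letter of a word arises from a merge, without their
  sign; it serves to prove the Leibniz rule by recursion on words.
\<close>
definition head_part :: "('a list list \<Rightarrow> 'k::field) \<Rightarrow> 'a list list \<Rightarrow> 'k" where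
  "head_part z y = (\<Sum>l\<le>length y. if 0 < l \<and> good (take l y) then z (concat (take l y) # drop l y) else 0)"

lemma cobar_diff_Cons:
  "cobar_diff z (a # ys) = (-1) ^ cdeg a * (head_part z (a # ys) + cobar_diff (\<lambda>v. z (a # v)) ys)"
proof -
  have s: "slice (a # ys) 0 l = take l (a # ys)" "slice (a # ys) (Suc i) (Suc l) = slice ys i l"
      "slice (a # ys) (Suc i) 0 = []" for i l
    by (simp_all add: slice_def)
  have "cobar_diff z (a # ys) =
      (\<Sum>l\<le>Suc (length ys). if 0 < l \<and> good (take l (a # ys)) then (-1) ^ cdeg a * z (merge 0 l (a # ys)) else 0)
    + (\<Sum>i<length ys. \<Sum>l\<le>length ys. if i < l \<and> good (slice ys i l)
        then (-1) ^ (cdeg a + wdeg (take (Suc i) ys)) * z (merge (Suc i) (Suc l) (a # ys)) else 0)"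
    unfolding cobar_diff_def
    by (simp add: s sum.lessThan_Suc_shift sum.atMost_Suc_shift del: sum.atMost_Suc sum.lessThan_Suc cong: if_cong)
  also have "\<dots> = (-1) ^ cdeg a * (head_part z (a # ys) + cobar_diff (\<lambda>v. z (a # v)) ys)"
    unfolding head_part_def cobar_diff_def merge_def s
    by (auto simp: sum_distrib_left distrib_left power_add mult.assoc s(1) simp del: sum.atMost_Suc intro!: arg_cong2[of _ _ _ _ "(+)"] sum.cong)
  finally show ?thesis .
qed

lemma conv_add_left: "conv (\<lambda>v. f v + f' v) g y = conv f g y + conv f' g y"
  and conv_scale_left: "conv (\<lambda>v. c * f v) g y = c * conv f g y"
  by (simp_all add: conv_def algebra_simps sum.distrib sum_distrib_left)

lemma head_part_conv:
  "head_part (conv f g) (a # ys) = f [] * head_part g (a # ys) + conv (\<lambda>v. head_part f (a # v)) g ys"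
proof -
  let ?y = "a # ys"
  let ?n = "length ?y"
  define G where "G l k = (if 0 < l \<and> l \<le> k \<and> good (take l ?y)
      then f (concat (take l ?y) # drop l (take k ?y)) * g (drop k ?y) else 0)" for l k
  have sh: "(\<Sum>k\<le>?n - l. h (l + k)) = (\<Sum>k\<le>?n. if l \<le> k then h k else (0::'b))" if "l \<le> ?n" for l h
  proof -
    have "(\<Sum>k\<le>?n. if l \<le> k then h k else 0) = (\<Sum>k\<in>{l..?n}. h k)"
      by (rule sum.mono_neutral_cong_right) auto
    also have "\<dots> = (\<Sum>k\<in>{0..?n - l}. h (l + k))"
      using that sum.shift_bounds_cl_nat_ivl[of h 0 l "?n - l"] by (simp add: add.commute)
    finally show ?thesis by (simp add: atLeast0AtMost)
  qed
  have c: "conv (\<lambda>v. f (x # v)) g (drop l ?y) =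
      (\<Sum>k\<le>?n. if l \<le> k then f (x # drop l (take k ?y)) * g (drop k ?y) else 0)" if "l \<le> ?n" for x l
    unfolding conv_def sh[OF that, symmetric] by (simp add: drop_take add.commute)
  have "head_part (conv f g) ?y =
     (\<Sum>l\<le>?n. if 0 < l \<and> good (take l ?y) then
        f [] * g (concat (take l ?y) # drop l ?y) + conv (\<lambda>v. f (concat (take l ?y) # v)) g (drop l ?y) else 0)"
    unfolding head_part_def conv_Cons ..
  also have "\<dots> = f [] * head_part g ?y + (\<Sum>l\<le>?n. if 0 < l \<and> good (take l ?y) then
        conv (\<lambda>v. f (concat (take l ?y) # v)) g (drop l ?y) else 0)"
    unfolding head_part_def sum_distrib_left sum.distrib[symmetric] by (intro sum.cong) auto
  also have "(\<Sum>l\<le>?n. if 0 < l \<and> good (take l ?y) then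
        conv (\<lambda>v. f (concat (take l ?y) # v)) g (drop l ?y) else 0) = (\<Sum>l\<le>?n. \<Sum>k\<le>?n. G l k)"
    by (rule sum.cong) (auto simp: c G_def simp del: take_Suc_Cons intro!: sum.cong)
  also have "\<dots> = (\<Sum>k\<le>?n. \<Sum>l\<le>?n. G l k)" by (rule sum.swap)
  also have "\<dots> = (\<Sum>k\<le>length ys. \<Sum>l\<le>?n. G l (Suc k))"
  proof -
    have "(\<Sum>l\<le>?n. G l 0) = 0" by (rule sum.neutral) (auto simp: G_def)
    then show ?thesis
      using sum.atMost_Suc_shift[of "\<lambda>k. \<Sum>l\<le>?n. G l k" "length ys"]
      by (simp del: sum.atMost_Suc)
  qed
  also have "\<dots> = conv (\<lambda>v. head_part f (a # v)) g ys"
    unfolding conv_def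
  proof (rule sum.cong[OF refl])
    fix k assume k: "k \<in> {..length ys}"
    have "(\<Sum>l\<le>?n. G l (Suc k)) = (\<Sum>l\<le>Suc k. G l (Suc k))"
      using k by (intro sum.mono_neutral_right) (auto simp: G_def)
    also have "\<dots> = head_part f (a # take k ys) * g (drop k ys)"
      unfolding head_part_def sum_distrib_right using k
    proof (intro sum.cong)
      fix l assume "l \<in> {..length (a # take k ys)}"
      then have l: "l \<le> Suc k" using k by auto
      then have "take l (a # take k ys) = take l ?y"
        by (cases l) (auto simp: min_def)
      then show "G l (Suc k) = (if 0 < l \<and> good (take l (a # take k ys))
          then f (concat (take l (a # take k ys)) # drop l (a # take k ys)) else 0) * g (drop k ys)"
        using l by (simp add: G_def)
    qed auto
    finally show "(\<Sum>l\<le>?n. G l (Suc k)) = head_part f (a # take k ys) * g (drop k ys)" .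
  qed
  finally show ?thesis .
qed

text \<open>
  The Leibniz rule: a good block of a product that comes from one letter lies in one of the
  factors.
\<close>
lemma cobar_diff_conv: "cobar_diff (conv f g) y = conv (cobar_diff f) g y + conv (iota f) (cobar_diff g) y"
proof (induction y arbitrary: f)
  case Nil
  then show ?case by (simp add: conv_def cobar_diff_def)
next
  case (Cons a ys)
  let ?s = "(-1) ^ cdeg a :: 'b"
  let ?f = "\<lambda>v. f (a # v)"
  have 1: "cobar_diff (\<lambda>v. conv f g (a # v)) ys = f [] * cobar_diff (\<lambda>v. g (a # v)) ys + cobar_diff (conv ?f g) ys"
    using cobar_diff_linear[of "conv ?f g" "f []" "\<lambda>v. g (a # v)" ys] by (simp add: conv_Cons add.commute)
  have 2: "conv (cobar_diff f) g (a # ys) = ?s * (conv (\<lambda>v. head_part f (a # v)) g ys + conv (cobar_diff ?f) g ys)"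
    by (simp add: conv_Cons cobar_diff_Cons conv_add_left conv_scale_left) (simp add: cobar_diff_def)
  have 3: "conv (iota f) (cobar_diff g) (a # ys) = f [] * cobar_diff g (a # ys) + ?s * conv (iota ?f) (cobar_diff g) ys"
    unfolding conv_scale_left[symmetric] by (simp add: conv_Cons iota_def power_add mult.assoc)
  show ?case
    unfolding cobar_diff_Cons[of "conv f g"] head_part_conv 1 Cons.IH 2 3 cobar_diff_Cons[of g]
    by (simp add: algebra_simps)
qed

lemma cobar_diff_square_conv: "cobar_diff (cobar_diff (conv f g)) y = conv (cobar_diff (cobar_diff f)) g y + conv f (cobar_diff (cobar_diff g)) y"
proof -
  have "cobar_diff (cobar_diff (conv f g)) y = cobar_diff (\<lambda>v. conv (cobar_diff f) g v + conv (iota f) (cobar_diff g) v) y"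
    by (simp add: cobar_diff_conv[abs_def])
  also have "\<dots> = conv (cobar_diff (cobar_diff f)) g y + conv (iota (cobar_diff f)) (cobar_diff g) y
      + conv (cobar_diff (iota f)) (cobar_diff g) y + conv f (cobar_diff (cobar_diff g)) y"
    by (simp add: cobar_diff_add cobar_diff_conv iota_iota)
  also have "conv (cobar_diff (iota f)) (cobar_diff g) y = - conv (iota (cobar_diff f)) (cobar_diff g) y"
    by (simp add: cobar_diff_iota[abs_def] conv_def sum_negf)
  finally show ?thesis by simp
qed

section \<open>Words over a fixed path\<close>

text \<open>
  Arrows are chains of length zero, so a path is also a word of arrows. These words represent
  the elements of \<open>A\<close> in the tensor algebra.
\<close>
definition arr :: "'b list \<Rightarrow> 'b list list" where
  "arr p = map (\<lambda>a. [a]) p"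

lemma arr_simps [simp]: "concat (arr p) = p" "length (arr p) = length p" "arr (p @ q) = arr p @ arr q"
    "arr [] = []" "arr (a # p) = [a] # arr p" "arr p = [] \<longleftrightarrow> p = []" "take k (arr p) = arr (take k p)"
    "drop k (arr p) = arr (drop k p)" 
proof -
  show "concat (arr p) = p" by (induction p) (auto simp: arr_def)
qed (simp_all add: arr_def take_map drop_map)

definition Blk :: "'a list list \<Rightarrow> (nat \<times> nat) set" where
  "Blk y = {(i, l). i < l \<and> l \<le> length y \<and> good (slice y i l)}"

lemma finite_Blk: "finite (Blk y)"
  by (rule finite_subset[of _ "{..length y} \<times> {..length y}"]) (auto simp: Blk_def)

lemma cobar_diff_Blk: "cobar_diff z y = (\<Sum>(i, l)\<in>Blk y. (-1) ^ wdeg (take (Suc i) y) * z (merge i l y))"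
proof -
  have "cobar_diff z y = (\<Sum>(i, l)\<in>{..<length y} \<times> {..length y}.
     if i < l \<and> good (slice y i l) then (-1) ^ wdeg (take (Suc i) y) * z (merge i l y) else 0)"
    unfolding cobar_diff_def by (simp add: sum.cartesian_product)
  also have "\<dots> = (\<Sum>(i, l)\<in>Blk y. (-1) ^ wdeg (take (Suc i) y) * z (merge i l y))"
    by (rule sum.mono_neutral_cong_right) (auto simp: Blk_def split: if_splits)
  finally show ?thesis .
qed

lemma chain_path: "chain Q R r \<gamma> \<Longrightarrow> quiver_path Q \<gamma>"
  by (auto simp: chain_def factorization_path)

lemma chain_nonempty: "is_chain \<gamma> \<Longrightarrow> \<gamma> \<noteq> []"
  unfolding is_chain_def by (auto dest!: chain_path simp: quiver_path_def)

lemma arrow_chain: "a \<in> arcs Q \<Longrightarrow> chain Q R 0 [a]"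
  unfolding chain_def by (intro exI[of _ "[[a]]"]) (simp add: factorization_single quiver_path_iff)

lemma arrow_facts [simp]: "a \<in> arcs Q \<Longrightarrow> is_chain [a]" "a \<in> arcs Q \<Longrightarrow> cdeg [a] = 0"
  using arrow_chain by (auto simp: is_chain_def intro: cdeg_eq)

lemma wdeg_arr: "set p \<subseteq> arcs Q \<Longrightarrow> wdeg (arr p) = 0"
  by (induction p) auto

lemma arr_chains: "set p \<subseteq> arcs Q \<Longrightarrow> \<forall>\<gamma>\<in>set (arr p). is_chain \<gamma>"
  by (auto simp: arr_def)

lemma chain_snocE:
  assumes "chain Q R (Suc r) \<delta>"
  obtains us u where "chain_factorization Q R (us @ [u])" "us \<noteq> []" "length us = Suc r"
    "\<delta> = concat us @ u" "chain Q R r (concat us)" "normal R u" "\<not> normal R (last us @ u)" "u \<noteq> []"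
proof -
  obtain vs where vs: "chain_factorization Q R vs" "length vs = Suc (Suc r)" "concat vs = \<delta>"
    using assms by (auto simp: chain_def)
  obtain us u where us: "vs = us @ [u]" using vs(2) by (cases vs rule: rev_cases) auto
  have "us \<noteq> []" using us vs by auto
  then show thesis
    using that[of us u] vs us by (auto simp: chain_def factorization_snoc normal_path_def quiver_path_def
        zero_minimally_def)
qed

lemma chain_Suc_not_normal: "chain Q R (Suc r) \<delta> \<Longrightarrow> \<not> normal R \<delta>"
proof (erule chain_snocE)
  fix us u assume us: "us \<noteq> []" "\<delta> = concat us @ u" "\<not> normal R (last us @ u)"
  have "\<delta> = concat (butlast us) @ (last us @ u)"
    using us by (metis append.assoc append_butlast_last_id concat.simps concat_append append_Nil2)
  then show "\<not> normal R \<delta>" using us(3) normal_appendD by metis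
qed

lemma chain_Suc_length: "chain Q R (Suc r) \<delta> \<Longrightarrow> 2 \<le> length \<delta>"
  using chain_Suc_not_normal normal_short by (metis Suc_1 not_less_eq_eq)

text \<open>
  If a chain of length \<open>r + 1\<close> begins with a chain of length \<open>r\<close>, the latter consists of its
  first \<open>r + 1\<close> pieces.
\<close>
lemma chain_extension:
  assumes "chain Q R r \<gamma>" "chain Q R (Suc r) (\<gamma> @ c)"
  obtains us where "chain_factorization Q R us" "concat us = \<gamma>" "length us = Suc r" "us \<noteq> []"
    "chain_factorization Q R (us @ [c])" "\<not> normal R (last us @ c)"
proof -
  obtain us where us: "chain_factorization Q R us" "length us = Suc r" "concat us = \<gamma>"
    using assms(1) by (auto simp: chain_def)
  obtain vs u where vs: "chain_factorization Q R (vs @ [u])" "vs \<noteq> []" "length vs = Suc r"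
    "\<gamma> @ c = concat vs @ u" "\<not> normal R (last vs @ u)"
    using assms(2) by (rule chain_snocE)
  have "us = vs"
  proof (rule factorization_prefix_unique[OF us(1)])
    show "chain_factorization Q R vs" using factorization_butlast[OF vs(1,2)] .
    show "prefix (concat us) (\<gamma> @ c)" using us by simp
    show "prefix (concat vs) (\<gamma> @ c)" using vs(4) by (simp add: prefix_def)
  qed (use us vs in simp)
  then show thesis using that[of us] us vs by auto
qed

lemma extension_unique:
  assumes "chain Q R r \<gamma>" "chain Q R (Suc r) (\<gamma> @ c)" "chain Q R (Suc r) (\<gamma> @ c')" "c @ d = c' @ d'"
  shows "c = c'"
proof -
  obtain us where us: "chain_factorization Q R us" "concat us = \<gamma>" "length us = Suc r"
     "chain_factorization Q R (us @ [c])"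
    using chain_extension[OF assms(1,2)] by metis
  obtain us' where us': "chain_factorization Q R us'" "concat us' = \<gamma>" "length us' = Suc r"
     "chain_factorization Q R (us' @ [c'])"
    using chain_extension[OF assms(1,3)] by metis
  have "prefix (concat (us' @ [c'])) (\<gamma> @ c @ d)"
    using us' assms(4) by (auto simp: prefix_def)
  moreover have "prefix (concat (us @ [c])) (\<gamma> @ c @ d)" using us by (auto simp: prefix_def)
  moreover have "length (us @ [c]) = length (us' @ [c'])" using us us' by simp
  ultimately have "us @ [c] = us' @ [c']"
    using factorization_prefix_unique[OF us(4) us'(4)] by blast
  then show ?thesis by simp
qed

text \<open>
  \<open>D\<close> preserves the path that underlies a word, and the words over one path are finite in
  number.
\<close>
definition Words :: "'a list \<Rightarrow> 'a list list set" where
  "Words p = {y. concat y = p \<and> (\<forall>\<gamma>\<in>set y. is_chain \<gamma>)}"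

lemma finite_Words: "finite (Words p)"
proof -
  let ?A = "{q. set q \<subseteq> set p \<and> length q \<le> length p}"
  have "Words p \<subseteq> {y. set y \<subseteq> ?A \<and> length y \<le> length p}"
  proof
    fix y assume y: "y \<in> Words p"
    then have p: "p = concat y" and ne: "\<forall>\<gamma>\<in>set y. \<gamma> \<noteq> []" using chain_nonempty by (auto simp: Words_def)
    have "length y \<le> length (concat y)" using ne
    proof (induction y)
      case (Cons a y)
      then have "Suc 0 \<le> length a" by (simp add: Suc_leI)
      moreover have "length y \<le> length (concat y)" using Cons by simp
      ultimately show ?case by simp
    qed simp
    moreover have "length q \<le> length (concat y)" if "q \<in> set y" for q
      using that by (induction y) auto
    ultimately show "y \<in> {y. set y \<subseteq> ?A \<and> length y \<le> length p}" using p by auto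
  qed
  moreover have "finite ?A" by (rule finite_lists_length_le) simp
  then have "finite {y. set y \<subseteq> ?A \<and> length y \<le> length p}" by (rule finite_lists_length_le)
  ultimately show ?thesis by (rule finite_subset)
qed

lemma Words_finsupp: "{y. z y \<noteq> 0} \<subseteq> Words p \<Longrightarrow> finsupp z"
  unfolding finsupp_def using finite_Words finite_subset by blast

lemma set_take_slice_drop: "i \<le> l \<Longrightarrow> set y = set (take i y) \<union> set (slice y i l) \<union> set (drop l y)"
  using arg_cong[OF take_slice_drop[of i l y], of set] by auto

lemma merge_Words_iff:
  assumes "(i, l) \<in> Blk y"
  shows "merge i l y \<in> Words p \<longleftrightarrow> y \<in> Words p"
proof -
  have il: "i < l" "l \<le> length y" and g: "good (slice y i l)" using assms by (auto simp: Blk_def)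
  have "is_chain (concat (slice y i l))" using g by (auto simp: good_def is_chain_def)
  then show ?thesis
    using g il concat_merge[of i l y] set_take_slice_drop[of i l y] unfolding Words_def merge_def good_def
    by auto
qed

lemma cobar_diff_support:
  assumes "{y. z y \<noteq> 0} \<subseteq> Words p"
  shows "{y. cobar_diff z y \<noteq> 0} \<subseteq> Words p"
proof
  fix y assume "y \<in> {y. cobar_diff z y \<noteq> 0}"
  then obtain i l where "(i, l) \<in> Blk y" "z (merge i l y) \<noteq> 0"
    unfolding cobar_diff_Blk by (auto elim!: sum.not_neutral_contains_not_neutral)
  then show "y \<in> Words p" using assms merge_Words_iff by auto
qed

text \<open>
  The position in the path at which the first \<open>l\<close> letters of a word end.
\<close>
definition en :: "'b list list \<Rightarrow> nat \<Rightarrow> nat" where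
  "en y l = length (concat (take l y))"

lemma en_simps [simp]: "en y 0 = 0" "length y \<le> l \<Longrightarrow> en y l = length (concat y)"
  by (simp_all add: en_def)

lemma en_mono: "i \<le> l \<Longrightarrow> en y i \<le> en y l"
  using append_take_drop_id[of i "take l y"]
  by (simp add: en_def min_def) (metis concat_append length_append le_add1)

lemma en_le: "en y l \<le> length (concat y)"
  using en_mono[of l "max l (length y)" y] by simp

lemma concat_slice:
  assumes "i \<le> l"
  shows "concat (slice y i l) = slice (concat y) (en y i) (en y l)"
proof -
  have "concat y = concat (take l y) @ concat (drop l y)"
    by (metis append_take_drop_id concat_append)
  then have 1: "take (en y l) (concat y) = concat (take l y)" by (simp add: en_def)
  have "take l y = take i y @ slice y i l"
    using append_take_drop_id[of i "take l y"] assms by (simp add: slice_def min_def)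
  then have "concat (take l y) = concat (take i y) @ concat (slice y i l)" by simp
  then show ?thesis using 1 by (simp add: slice_def en_def)
qed

lemma wdeg_take_slice: "i \<le> l \<Longrightarrow> wdeg (take l y) = wdeg (take i y) + wdeg (slice y i l)"
  using append_take_drop_id[of i "take l y"] by (simp add: slice_def min_def) (metis wdeg_simps(3))

lemma word_block:
  assumes "quiver_path Q p" "y \<in> Words p" "i < l" "l \<le> length y"
  shows "good (slice y i l) \<longleftrightarrow> chain_at p (en y i) (Suc (wdeg (take l y) - wdeg (take i y))) (en y l)"
proof -
  have "set (slice y i l) \<subseteq> set y" using set_take_slice_drop[of i l y] assms(3) by auto
  then have "good (slice y i l) \<longleftrightarrow> chain Q R (Suc (wdeg (slice y i l))) (concat (slice y i l))"
    using assms(2) by (auto simp: good_def Words_def)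
  also have "\<dots> \<longleftrightarrow> chain_at p (en y i) (Suc (wdeg (slice y i l))) (en y l)"
    using assms(2,3) concat_slice[of i l y] en_mono[of i l y] en_le[of y l]
    by (subst chain_slice_iff[OF assms(1), symmetric]) (auto simp: Words_def)
  finally show ?thesis using wdeg_take_slice[of i l y] assms(3) by simp
qed

lemma word_piece:
  assumes "quiver_path Q p" "y \<in> Words p" "l < length y"
  shows "chain_at p (en y l) (cdeg (y ! l)) (en y (Suc l))"
proof -
  have s: "slice y l (Suc l) = [y ! l]" using assms(3) by (simp add: slice_def take_Suc_conv_app_nth)
  have "y ! l = slice p (en y l) (en y (Suc l))"
    using concat_slice[of l "Suc l" y] assms(2) by (simp add: s Words_def)
  moreover have "chain Q R (cdeg (y ! l)) (y ! l)"
    using assms by (intro chain_cdeg) (auto simp: Words_def)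
  ultimately show ?thesis
    using chain_slice_iff[OF assms(1), of "en y l" "en y (Suc l)"] en_mono[of l "Suc l" y] en_le[of y "Suc l"] assms(2)
    by (auto simp: Words_def)
qed

lemma en_Suc_less:
  assumes "quiver_path Q p" "y \<in> Words p" "i < l" "l \<le> length y"
  shows "en y i < en y l"
proof -
  have "en y i < en y (Suc i)"
    using chain_at_pos[OF word_piece[OF assms(1,2)], of i] assms by simp
  also have "\<dots> \<le> en y l" using assms by (intro en_mono) simp
  finally show ?thesis .
qed

lemma wdeg_take_Suc: "l < length y \<Longrightarrow> wdeg (take (Suc l) y) = wdeg (take l y) + cdeg (y ! l)"
  by (simp add: take_Suc_conv_app_nth)

lemma wdeg_take_le: "wdeg (take i y) \<le> wdeg y"
  by (metis append_take_drop_id le_add1 wdeg_simps(3))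

text \<open>
  A chain that starts no earlier than the term \<open>k\<close> of the position sequence of \<open>a\<close> ends
  strictly after its term \<open>k + r\<close>. Half of the terms of both sequences are iterates of \<open>nx\<close>
  applied to these starting points, and one strict inequality is left over.
\<close>
lemma level_step:
  assumes "chain_at p s r t" "pos p a k \<le> s" "\<forall>j\<le>k + r. pos p a j < pos p a (Suc j)"
  shows "pos p a (k + r) < t"
proof (cases "even r")
  case True
  then obtain m where m: "r = 2 * m" by auto
  have "pos p a (k + r) = (nx p ^^ m) (pos p a k)" by (simp add: m pos_add_even)
  also have "\<dots> \<le> (nx p ^^ m) s" using assms(2) by (rule funpow_nx_mono)
  also have "\<dots> = pos p s r" by (simp add: m pos_even)
  also have "\<dots> < t" using assms(1) by (auto simp: chain_at_def)
  finally show ?thesis .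
next
  case False
  then obtain m where m: "Suc r = 2 * m" by (metis even_Suc evenE)
  have "pos p a (k + r) < pos p a (k + Suc r)" using assms(3) by simp
  also have "\<dots> = (nx p ^^ m) (pos p a k)" unfolding m by (rule pos_add_even)
  also have "\<dots> \<le> (nx p ^^ m) s" using assms(2) by (rule funpow_nx_mono)
  also have "\<dots> = pos p s (Suc r)" by (simp add: m pos_even)
  also have "\<dots> = t" using assms(1) by (simp add: chain_at_def)
  finally show ?thesis .
qed

text \<open>
  Induction along the letters: a word that has reached the level of the position sequence
  stays above it.
\<close>
lemma level_run:
  assumes "quiver_path Q p" "y \<in> Words p" "\<forall>j\<le>wdeg y + c. pos p 0 j < pos p 0 (Suc j)"
    and "pos p 0 (wdeg (take l y) + c) \<le> en y l" "l < l'" "l' \<le> length y"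
  shows "pos p 0 (wdeg (take l' y) + c) < en y l'"
  using assms(5,6)
proof (induction l' rule: less_induct)
  case (less l')
  then obtain k where k: "l' = Suc k" by (cases l') auto
  have "pos p 0 (wdeg (take k y) + c) \<le> en y k"
    using less.IH[of k] less.prems assms(4) k by (cases "k = l") auto
  then have "pos p 0 (wdeg (take k y) + c + cdeg (y ! k)) < en y (Suc k)"
    using less.prems k wdeg_take_le[of l' y] wdeg_take_Suc[of k y] assms(3)
    by (intro level_step[OF word_piece[OF assms(1,2)]]) auto
  then show ?case using k less.prems by (simp add: wdeg_take_Suc ac_simps)
qed

text \<open>
  The first letter ends exactly on the level of the position sequence of the whole path,
  shifted by one; further letters only gain.
\<close>
lemma level_lower_strict:
  assumes "quiver_path Q p" "y \<in> Words p" "chain_at p 0 \<rho> (length p)" "Suc (wdeg y) \<le> \<rho>"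
    and "2 \<le> l" "l \<le> length y"
  shows "pos p 0 (Suc (wdeg (take l y))) < en y l"
proof -
  have l0: "0 < length y" using assms(5,6) by linarith
  then have "chain_at p 0 (cdeg (y ! 0)) (en y (Suc 0))"
    using word_piece[OF assms(1,2), of 0] by simp
  then have "pos p 0 (wdeg (take 1 y) + 1) \<le> en y 1"
    using assms(5,6) wdeg_take_Suc[OF l0] l0 by (simp add: chain_at_def)
  then show ?thesis
    using level_run[OF assms(1,2), of 1 1 l] assms(3-6) by (auto simp: chain_at_def)
qed

lemma level_lower:
  assumes "quiver_path Q p" "y \<in> Words p" "chain_at p 0 \<rho> (length p)" "Suc (wdeg y) \<le> \<rho>"
    and "1 \<le> l" "l \<le> length y"
  shows "pos p 0 (Suc (wdeg (take l y))) \<le> en y l"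
proof (cases "l = 1")
  case True
  have l0: "0 < length y" using assms(5,6) by linarith
  then have "chain_at p 0 (cdeg (y ! 0)) (en y (Suc 0))"
    using word_piece[OF assms(1,2), of 0] by simp
  then show ?thesis
    using assms(5,6) wdeg_take_Suc[OF l0] l0 True by (simp add: chain_at_def)
qed (use level_lower_strict[OF assms(1-4), of l] assms(5,6) in auto)

text \<open>
  A word whose degree is one less than that of the chain \<open>p\<close> cannot run ahead by two steps:
  it would stay ahead and end beyond \<open>p\<close>.
\<close>
lemma level_upper:
  assumes "quiver_path Q p" "y \<in> Words p" "chain_at p 0 \<rho> (length p)" "Suc (wdeg y) = \<rho>" "l < length y"
  shows "en y l < pos p 0 (wdeg (take l y) + 2)"
proof (rule ccontr)
  assume "\<not> ?thesis"
  then have "pos p 0 (wdeg (take (length y) y) + 2) < en y (length y)"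
    using level_run[OF assms(1,2), of 2 l "length y"] assms(3-5) by (auto simp: chain_at_def)
  then show False using assms(2,3,4) by (auto simp: Words_def chain_at_def)
qed

section \<open>The matching of words of chains\<close>

type_synonym 'b idx = "'b list list \<times> 'b list \<times> 'b list \<times> 'b list"

text \<open>
  An index \<open>(rest, \<gamma>, c, d)\<close> stands for a matched pair: the letters \<open>\<gamma>\<close> and the arrows of
  \<open>c\<close>, where \<open>\<gamma> c\<close> is the next longer chain, are merged to the letter \<open>\<gamma> c\<close>. The length of
  the tail is the weight for triangularity.
\<close>
fun lo :: "'b idx \<Rightarrow> 'b list list" where "lo (rest, \<gamma>, c, d) = rest @ [\<gamma>] @ arr (c @ d)"
fun up :: "'b idx \<Rightarrow> 'b list list" where "up (rest, \<gamma>, c, d) = rest @ [\<gamma> @ c] @ arr d"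
fun tail_length :: "'b idx \<Rightarrow> nat" where "tail_length (rest, \<gamma>, c, d) = length (c @ d)"

definition Idx :: "'a list \<Rightarrow> 'a idx set" where
  "Idx p = {(rest, \<gamma>, c, d). lo (rest, \<gamma>, c, d) \<in> Words p \<and> chain Q R (Suc (cdeg \<gamma>)) (\<gamma> @ c) \<and> normal R (c @ d)}"

lemma IdxD:
  assumes "(rest, \<gamma>, c, d) \<in> Idx p"
  shows "is_chain \<gamma>" "chain Q R (cdeg \<gamma>) \<gamma>" "chain Q R (Suc (cdeg \<gamma>)) (\<gamma> @ c)" "normal R (c @ d)"
    "lo (rest, \<gamma>, c, d) \<in> Words p" "up (rest, \<gamma>, c, d) \<in> Words p" "c \<noteq> []"
proof -
  show 1: "is_chain \<gamma>" "chain Q R (Suc (cdeg \<gamma>)) (\<gamma> @ c)" "normal R (c @ d)" "lo (rest, \<gamma>, c, d) \<in> Words p"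
    using assms by (auto simp: Idx_def Words_def)
  then show "up (rest, \<gamma>, c, d) \<in> Words p" by (auto simp: Words_def is_chain_def)
  show "chain Q R (cdeg \<gamma>) \<gamma>" using 1 by (intro chain_cdeg)
  then show "c \<noteq> []" using 1(2) chain_unique[of "Suc (cdeg \<gamma>)" \<gamma> "cdeg \<gamma>"] by auto
qed

lemma arrow_suffix:
  assumes "rest @ [\<gamma>] @ arr b = rest' @ [\<gamma>'] @ arr b'" "length b < length b'"
  shows "\<exists>x e. \<gamma> = [x] \<and> b' = e @ x # b"
proof -
  define e where "e = take (length b' - Suc (length b)) b'"
  define f where "f = drop (length b' - Suc (length b)) b'"
  have f: "b' = e @ f" "length f = Suc (length b)" using assms(2) by (auto simp: e_def f_def)
  have "(rest @ [\<gamma>]) @ arr b = (rest' @ [\<gamma>'] @ arr e) @ arr f" using assms(1) f(1) by simp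
  then have "rest @ (\<gamma> # arr b) = (rest' @ [\<gamma>'] @ arr e) @ arr f" by simp
  then have "\<gamma> # arr b = arr f" using f(2) by (subst (asm) append_eq_append_conv) auto
  then obtain x f' where "f = x # f'" "\<gamma> = [x]" "arr b = arr f'" by (cases f) auto
  moreover have "b = f'" using \<open>arr b = arr f'\<close> by (metis arr_simps(1))
  ultimately show ?thesis using f(1) by auto
qed

text \<open>
  The suffix of arrows is determined as the longest one whose underlying path is normal. A
  longer suffix would contain the letter in front as an arrow, and be normal as well.
\<close>
lemma arrow_suffix_unique:
  assumes eq: "rest @ [\<gamma>] @ arr b = rest' @ [\<gamma>'] @ arr b'" and n: "normal R b" "normal R b'"
    and "length \<gamma> = 1 \<Longrightarrow> \<not> normal R (\<gamma> @ b)" "length \<gamma>' = 1 \<Longrightarrow> \<not> normal R (\<gamma>' @ b')"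
  shows "rest = rest' \<and> \<gamma> = \<gamma>' \<and> b = b'"
proof -
  have "\<not> length b < length b'"
  proof
    assume "length b < length b'"
    then obtain x e where x: "\<gamma> = [x]" "b' = e @ x # b" using arrow_suffix[OF eq] by blast
    then show False using assms(4) n(2) normal_appendD[of R e "x # b"] by simp
  qed
  moreover have "\<not> length b' < length b"
  proof
    assume "length b' < length b"
    then obtain x e where x: "\<gamma>' = [x]" "b = e @ x # b'" using arrow_suffix[OF eq[symmetric]] by blast
    then show False using assms(5) n(1) normal_appendD[of R e "x # b'"] by simp
  qed
  ultimately have "length b = length b'" by simp
  then have "rest = rest' \<and> \<gamma> = \<gamma>' \<and> arr b = arr b'" using eq by simp
  then show ?thesis by (metis arr_simps(1))
qed

lemma lo_side:
  assumes "(rest, \<gamma>, c, d) \<in> Idx p" shows "\<not> normal R (\<gamma> @ c @ d)"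
  using chain_Suc_not_normal[OF IdxD(3)[OF assms]] normal_appendD[of R "\<gamma> @ c" d] by auto

lemma up_side:
  assumes "(rest, \<gamma>, c, d) \<in> Idx p" shows "length (\<gamma> @ c) \<noteq> 1"
  using chain_Suc_length[OF IdxD(3)[OF assms]] by auto

lemma inj_on_lo: "inj_on lo (Idx p)"
proof (rule inj_onI)
  fix i j assume "i \<in> Idx p" "j \<in> Idx p" "lo i = lo j"
  moreover obtain rest \<gamma> c d where "i = (rest, \<gamma>, c, d)" by (cases i) auto
  moreover obtain rest' \<gamma>' c' d' where "j = (rest', \<gamma>', c', d')" by (cases j) auto
  ultimately have ij: "(rest, \<gamma>, c, d) \<in> Idx p" "(rest', \<gamma>', c', d') \<in> Idx p"
     "rest @ [\<gamma>] @ arr (c @ d) = rest' @ [\<gamma>'] @ arr (c' @ d')"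
    and i: "i = (rest, \<gamma>, c, d)" "j = (rest', \<gamma>', c', d')" by auto
  have "rest = rest' \<and> \<gamma> = \<gamma>' \<and> c @ d = c' @ d'"
    using arrow_suffix_unique[OF ij(3) IdxD(4)[OF ij(1)] IdxD(4)[OF ij(2)]] lo_side[OF ij(1)] lo_side[OF ij(2)]
    by auto
  moreover from this have "c = c'"
    using extension_unique[OF IdxD(2,3)[OF ij(1)], of c' d d'] IdxD(3)[OF ij(2)] by auto
  ultimately show "i = j" using i by simp
qed

lemma inj_on_up: "inj_on up (Idx p)"
proof (rule inj_onI)
  fix i j assume "i \<in> Idx p" "j \<in> Idx p" "up i = up j"
  moreover obtain rest \<gamma> c d where "i = (rest, \<gamma>, c, d)" by (cases i) auto
  moreover obtain rest' \<gamma>' c' d' where "j = (rest', \<gamma>', c', d')" by (cases j) auto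
  ultimately have ij: "(rest, \<gamma>, c, d) \<in> Idx p" "(rest', \<gamma>', c', d') \<in> Idx p"
     "rest @ [\<gamma> @ c] @ arr d = rest' @ [\<gamma>' @ c'] @ arr d'"
    and i: "i = (rest, \<gamma>, c, d)" "j = (rest', \<gamma>', c', d')" by auto
  have n: "normal R d" "normal R d'"
    using IdxD(4)[OF ij(1)] IdxD(4)[OF ij(2)] normal_appendD by blast+
  have eq: "rest = rest' \<and> \<gamma> @ c = \<gamma>' @ c' \<and> d = d'"
    by (rule arrow_suffix_unique[OF ij(3) n]) (use up_side[OF ij(1)] up_side[OF ij(2)] in blast)+
  then have deg: "cdeg \<gamma> = cdeg \<gamma>'"
    using chain_unique[OF IdxD(3)[OF ij(1)], of "Suc (cdeg \<gamma>')"] IdxD(3)[OF ij(2)] by simp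
  obtain us us' where "chain_factorization Q R us" "concat us = \<gamma>" "length us = Suc (cdeg \<gamma>)"
    "chain_factorization Q R us'" "concat us' = \<gamma>'" "length us' = Suc (cdeg \<gamma>')"
    using IdxD(2)[OF ij(1)] IdxD(2)[OF ij(2)] by (auto simp: chain_def)
  note u = this
  have "us = us'"
  proof (rule factorization_prefix_unique[OF u(1,4)])
    show "prefix (concat us) (\<gamma> @ c)" using u(2) by simp
    show "prefix (concat us') (\<gamma> @ c)" using u(5) eq by simp
  qed (use u deg in simp)
  then have "\<gamma> = \<gamma>'" using u by simp
  then show "i = j" using eq i by simp
qed

text \<open>
  In an upper word the last piece of the chain in front of the arrows and the path of these
  arrows form a normal path; in a lower word they do not.
\<close>
lemma lo_neq_up:
  assumes "i \<in> Idx p" "j \<in> Idx p"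
  shows "lo i \<noteq> up j"
proof
  assume "lo i = up j"
  moreover obtain rest \<gamma> c d where "i = (rest, \<gamma>, c, d)" by (cases i) auto
  moreover obtain rest' \<gamma>' c' d' where "j = (rest', \<gamma>', c', d')" by (cases j) auto
  ultimately have ij: "(rest, \<gamma>, c, d) \<in> Idx p" "(rest', \<gamma>', c', d') \<in> Idx p"
     "rest @ [\<gamma>] @ arr (c @ d) = rest' @ [\<gamma>' @ c'] @ arr d'" using assms by auto
  have n: "normal R d'" using IdxD(4)[OF ij(2)] normal_appendD by blast
  have eq: "rest = rest' \<and> \<gamma> = \<gamma>' @ c' \<and> c @ d = d'"
    by (rule arrow_suffix_unique[OF ij(3) IdxD(4)[OF ij(1)] n])
      (use lo_side[OF ij(1)] up_side[OF ij(2)] in blast)+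
  obtain us where us: "chain_factorization Q R (us @ [c'])" "concat us = \<gamma>'" "length us = Suc (cdeg \<gamma>')"
    using chain_extension[OF IdxD(2,3)[OF ij(2)]] by metis
  obtain vs where vs: "chain_factorization Q R vs" "concat vs = \<gamma>" "\<not> normal R (last vs @ c)"
    using chain_extension[OF IdxD(2,3)[OF ij(1)]] by metis
  have "vs = us @ [c']" using factorization_unique[OF vs(1) us(1)] vs us eq by simp
  then have "\<not> normal R (c' @ c)" using vs by simp
  moreover have "c' @ d' = (c' @ c) @ d" using eq by simp
  ultimately show False using IdxD(4)[OF ij(2)] normal_appendD by metis
qed

lemma split_arrow_suffix:
  "(\<exists>b. y = arr b \<and> normal R b) \<or>
   (\<exists>rest \<gamma> b. y = rest @ [\<gamma>] @ arr b \<and> normal R b \<and> (length \<gamma> = 1 \<longrightarrow> \<not> normal R (\<gamma> @ b)))"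
proof (induction y)
  case Nil
  show ?case by (intro disjI1 exI[of _ "[]"]) (simp add: normal_short)
next
  case (Cons g y)
  then consider b where "y = arr b" "normal R b"
    | rest \<gamma> b where "y = rest @ [\<gamma>] @ arr b" "normal R b" "length \<gamma> = 1 \<longrightarrow> \<not> normal R (\<gamma> @ b)"
    by blast
  then show ?case
  proof cases
    case 1
    show ?thesis
    proof (cases "length g = 1 \<and> normal R (g @ b)")
      case True
      then obtain x where "g = [x]" by (auto simp: length_Suc_conv)
      then show ?thesis using 1 True by (intro disjI1 exI[of _ "x # b"]) auto
    next
      case False
      then show ?thesis using 1 by (intro disjI2 exI[of _ "[]"] exI[of _ g] exI[of _ b]) auto
    qed
  next
    case 2
    then show ?thesis by (intro disjI2 exI[of _ "g # rest"] exI[of _ \<gamma>] exI[of _ b]) auto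
  qed
qed

lemma extend_chain:
  assumes us: "chain_factorization Q R us" and b: "quiver_path Q (concat us @ b)" "normal R b"
    and nn: "\<not> normal R (last us @ b)"
  obtains c d where "b = c @ d" "chain_factorization Q R (us @ [c])"
proof -
  define P where "P k \<longleftrightarrow> \<not> normal R (last us @ take k b)" for k
  have "P (length b)" using nn by (simp add: P_def)
  define k where "k = (LEAST k. P k)"
  have Pk: "P k" unfolding k_def using \<open>P (length b)\<close> by (rule LeastI)
  have less: "\<not> P k'" if "k' < k" for k' using that not_less_Least by (auto simp: k_def)
  have ne: "us \<noteq> []" using us by (simp add: chain_factorization_def)
  have lu: "normal_path Q R (last us)" using us ne by (auto simp: chain_factorization_def)
  define c where "c = take k b"
  have "\<not> normal R (last us @ c)" using Pk by (simp add: P_def c_def)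
  then have "c \<noteq> []" using lu by (auto simp: normal_path_def)
  have path: "quiver_path Q (concat us @ c)"
    using b(1) \<open>c \<noteq> []\<close> by (intro quiver_path_sublist[OF b(1)]) (auto simp: c_def intro!: prefix_imp_sublist take_is_prefix)
  have cn: "concat us \<noteq> []" using ne factorization_path[OF us] by (auto simp: quiver_path_def)
  have "target Q (concat us) = target Q (last us)"
  proof -
    have "concat us = concat (butlast us) @ last us" using ne
      by (metis append_butlast_last_id concat.simps concat_append append_Nil2)
    moreover have "last us \<noteq> []" using lu by (auto simp: normal_path_def quiver_path_def)
    ultimately show ?thesis by (simp add: target_def)
  qed
  then have tc: "target Q (last us) = source Q c" "quiver_path Q c"
    using quiver_path_append[OF cn \<open>c \<noteq> []\<close>] path by auto
  have "normal R c" using b(2) normal_appendD[of R "take k b" "drop k b"] by (simp add: c_def)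
  moreover have "zero_minimally R (last us) c"
    unfolding zero_minimally_def
  proof (intro conjI allI impI)
    show "\<not> normal R (last us @ c)" using Pk by (simp add: P_def c_def)
    fix v assume v: "strict_prefix v c"
    then obtain w where w: "c = v @ w" "w \<noteq> []" by (auto simp: strict_prefix_def prefix_def)
    then have "length v < length c" by simp
    moreover have "v = take (length v) c" using w by simp
    ultimately have "length v < length c" "v = take (length v) b"
      by (simp_all add: c_def min_def split: if_splits)
    then have "\<not> P (length v)" by (intro less) (auto simp: c_def)
    then show "normal R (last us @ v)" using \<open>v = take (length v) b\<close> by (simp add: P_def)
  qed
  ultimately have "chain_factorization Q R (us @ [c])"
    using us ne tc by (simp add: factorization_snoc normal_path_def)
  moreover have "b = c @ drop k b" by (simp add: c_def)
  ultimately show thesis using that by blast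
qed

text \<open>
  Cut off the longest normal suffix of arrows, with underlying path \<open>b\<close>, and look at the last
  piece of the chain in front of it. If this piece followed by \<open>b\<close> is not normal, the chain
  can be extended within \<open>b\<close> and the word is lower. Otherwise the chain is the extension of
  its first pieces and the word is upper.
\<close>
lemma Words_cover:
  assumes p: "quiver_path Q p" "\<not> normal R p" and y: "y \<in> Words p"
  shows "y \<in> lo ` Idx p \<or> y \<in> up ` Idx p"
proof -
  have arcs: "set p \<subseteq> arcs Q" using p(1) by (simp add: quiver_path_iff)
  have yp: "concat y = p" using y by (simp add: Words_def)
  have "y \<noteq> arr b" if "normal R b" for b using that yp p(2) by auto
  then obtain rest \<gamma> b where y': "y = rest @ [\<gamma>] @ arr b" "normal R b" "length \<gamma> = 1 \<longrightarrow> \<not> normal R (\<gamma> @ b)"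
    using split_arrow_suffix[of y] by blast
  have ch: "chain Q R (cdeg \<gamma>) \<gamma>" using y y'(1) by (auto simp: Words_def intro!: chain_cdeg)
  then obtain us where us: "chain_factorization Q R us" "concat us = \<gamma>" "length us = Suc (cdeg \<gamma>)"
    by (auto simp: chain_def)
  have "p = concat rest @ (\<gamma> @ b)" using yp y'(1) by simp
  then have sub: "sublist (\<gamma> @ b) p" by (simp only: sublist_append_leftI)
  have ne: "\<gamma> \<noteq> []" using chain_path[OF ch] by (simp add: quiver_path_def)
  then have path: "quiver_path Q (concat us @ b)" using quiver_path_sublist[OF p(1) sub] us by simp
  show ?thesis
  proof (cases "normal R (last us @ b)")
    case False
    obtain c d where cd: "b = c @ d" "chain_factorization Q R (us @ [c])"
      using extend_chain[OF us(1) path y'(2) False] by blast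
    have "chain Q R (Suc (cdeg \<gamma>)) (\<gamma> @ c)"
      using cd us by (auto simp: chain_def intro!: exI[of _ "us @ [c]"])
    then have "(rest, \<gamma>, c, d) \<in> Idx p" using y y' cd by (auto simp: Idx_def)
    then show ?thesis using y' cd by (intro disjI1 image_eqI[of _ _ "(rest, \<gamma>, c, d)"]) auto
  next
    case True
    have "length us \<noteq> 1"
    proof
      assume "length us = 1"
      then have "us = [\<gamma>]" using us by (auto simp: length_Suc_conv)
      then show False using True y' us by (simp add: factorization_single)
    qed
    then obtain vs v where vs: "us = vs @ [v]" "vs \<noteq> []" using us(3)
      by (cases us rule: rev_cases) auto
    have fv: "chain_factorization Q R vs" using us(1) vs factorization_butlast by blast
    then have cv: "chain Q R (length vs - 1) (concat vs)" using vs by (auto simp: chain_def)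
    then have d: "cdeg (concat vs) = length vs - 1" "is_chain (concat vs)"
      by (auto simp: is_chain_def intro: cdeg_eq)
    have "\<gamma> = concat vs @ v" using vs us by simp
    have "set (v @ b) \<subseteq> arcs Q"
      using arcs yp y'(1) \<open>\<gamma> = concat vs @ v\<close> by auto
    then have "lo (rest, concat vs, v, b) \<in> Words p"
      using y y'(1) d arr_chains[of "v @ b"] \<open>\<gamma> = concat vs @ v\<close> by (auto simp: Words_def)
    moreover have "chain Q R (Suc (cdeg (concat vs))) (concat vs @ v)"
      using ch d us vs by (cases "length vs") auto
    ultimately have "(rest, concat vs, v, b) \<in> Idx p" using True vs by (auto simp: Idx_def)
    then show ?thesis using y' \<open>\<gamma> = concat vs @ v\<close>
      by (intro disjI2 image_eqI[of _ _ "(rest, concat vs, v, b)"]) auto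
  qed
qed

lemma slice_append_list:
  "l \<le> length xs \<Longrightarrow> slice (xs @ ys) i l = slice xs i l"
  "length xs \<le> l \<Longrightarrow> i \<le> length xs \<Longrightarrow> slice (xs @ ys) i l = drop i xs @ take (l - length xs) ys"
  "length xs \<le> i \<Longrightarrow> i \<le> l \<Longrightarrow> slice (xs @ ys) i l = slice ys (i - length xs) (l - length xs)"
  by (simp_all add: slice_def)

lemma slice_arr: "slice (arr p) i l = arr (slice p i l)"
  by (simp add: slice_def)

text \<open>
  A chain of positive length is not normal, so no good block consists of arrows of the normal
  path \<open>c d\<close>.
\<close>
lemma lo_block_start:
  assumes i: "(rest, \<gamma>, c, d) \<in> Idx p" and b: "(k, l) \<in> Blk (lo (rest, \<gamma>, c, d))"
  shows "k \<le> length rest"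
proof (rule ccontr)
  assume "\<not> k \<le> length rest"
  then have k: "Suc (length rest) \<le> k" by simp
  have kl: "k < l" "good (slice (lo (rest, \<gamma>, c, d)) k l)" using b by (auto simp: Blk_def)
  have "lo (rest, \<gamma>, c, d) = (rest @ [\<gamma>]) @ arr (c @ d)" by simp
  then have "slice (lo (rest, \<gamma>, c, d)) k l = arr (slice (c @ d) (k - Suc (length rest)) (l - Suc (length rest)))"
    using slice_append_list(3)[of "rest @ [\<gamma>]" k l "arr (c @ d)"] k kl(1) by (simp add: slice_arr[symmetric])
  then have "\<not> normal R (slice (c @ d) (k - Suc (length rest)) (l - Suc (length rest)))"
    using kl(2) chain_Suc_not_normal by (auto simp: good_def)
  then show False using IdxD(4)[OF i] normal_sublist sublist_slice_list by blast
qed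

lemma arrows_of_word:
  assumes "quiver_path Q p" "rest @ [\<gamma>] @ arr b \<in> Words p"
  shows "set b \<subseteq> arcs Q"
  using assms by (auto simp: Words_def quiver_path_iff)

text \<open>
  The extension of \<open>\<gamma>\<close> to the next longer chain is unique, so the only good block that starts
  at \<open>\<gamma>\<close> is the matched one.
\<close>
lemma lo_block_at:
  assumes p: "quiver_path Q p" and i: "(rest, \<gamma>, c, d) \<in> Idx p"
  shows "(length rest, l) \<in> Blk (lo (rest, \<gamma>, c, d)) \<longleftrightarrow> l = Suc (length rest + length c)"
    and "merge (length rest) (Suc (length rest + length c)) (lo (rest, \<gamma>, c, d)) = up (rest, \<gamma>, c, d)"
proof -
  have arcs: "set (c @ d) \<subseteq> arcs Q"
    using arrows_of_word[OF p, of rest \<gamma> "c @ d"] IdxD(5)[OF i] by simp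
  have sl: "slice (lo (rest, \<gamma>, c, d)) (length rest) (Suc (length rest + k)) = \<gamma> # arr (take k (c @ d))" for k
    using slice_append_list(2)[of rest "Suc (length rest + k)" "length rest" "[\<gamma>] @ arr (c @ d)"]
    by (simp del: take_append arr_simps(3))
  have sub: "set (take k (c @ d)) \<subseteq> arcs Q" for k
    using arcs set_take_subset[of k "c @ d"] by (rule order_trans[rotated])
  have wd: "wdeg (\<gamma> # arr (take k (c @ d))) = cdeg \<gamma>" for k
    using wdeg_arr[OF sub[of k]] by (simp del: take_append)
  have chs: "\<forall>g\<in>set (\<gamma> # arr (take k (c @ d))). is_chain g" for k
    using arr_chains[OF sub[of k]] IdxD(1)[OF i] by (simp del: take_append)
  have good: "good (\<gamma> # arr (take k (c @ d))) \<longleftrightarrow> chain Q R (Suc (cdeg \<gamma>)) (\<gamma> @ take k (c @ d))" for k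
    using chs[of k] wd[of k] by (simp add: good_def del: take_append)
  show "(length rest, l) \<in> Blk (lo (rest, \<gamma>, c, d)) \<longleftrightarrow> l = Suc (length rest + length c)"
  proof
    assume "(length rest, l) \<in> Blk (lo (rest, \<gamma>, c, d))"
    then have l: "length rest < l" "l \<le> length rest + Suc (length (c @ d))" "good (slice (lo (rest, \<gamma>, c, d)) (length rest) l)"
      by (auto simp: Blk_def)
    define k where "k = l - Suc (length rest)"
    have lk: "l = Suc (length rest + k)" "k \<le> length (c @ d)" using l by (auto simp: k_def)
    have "chain Q R (Suc (cdeg \<gamma>)) (\<gamma> @ take k (c @ d))" using l(3) sl good lk by metis
    then have "c = take k (c @ d)"
      using extension_unique[OF IdxD(2,3)[OF i], of "take k (c @ d)" d "drop k (c @ d)"] append_take_drop_id by metis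
    then have "length c = k" using lk by (metis length_take min.absorb2)
    then show "l = Suc (length rest + length c)" using lk by simp
  next
    assume l: "l = Suc (length rest + length c)"
    have "good (slice (lo (rest, \<gamma>, c, d)) (length rest) l)"
      using good[of "length c"] sl[of "length c"] IdxD(3)[OF i] l by simp
    then show "(length rest, l) \<in> Blk (lo (rest, \<gamma>, c, d))" using l by (simp add: Blk_def)
  qed
  show "merge (length rest) (Suc (length rest + length c)) (lo (rest, \<gamma>, c, d)) = up (rest, \<gamma>, c, d)"
    unfolding merge_def sl by simp
qed

lemma lo_block_within:
  assumes i: "(rest, \<gamma>, c, d) \<in> Idx p" and b: "(k, l) \<in> Blk (lo (rest, \<gamma>, c, d))" and l: "l \<le> length rest"
  shows "merge k l (lo (rest, \<gamma>, c, d)) \<in> lo ` Idx p"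
proof -
  have kl: "k < l" using b by (simp add: Blk_def)
  have eq: "merge k l (lo (rest, \<gamma>, c, d)) = lo (merge k l rest, \<gamma>, c, d)"
    using l kl by (simp add: merge_def slice_append_list)
  then have "(merge k l rest, \<gamma>, c, d) \<in> Idx p"
    using merge_Words_iff[OF b, of p] IdxD(3-5)[OF i] by (simp add: Idx_def)
  then show ?thesis using eq by blast
qed

text \<open>
  Suppose that a block which starts before \<open>\<gamma>\<close> and ends after it gives an upper word. The
  last piece of the new chain begins before the part of the block that comes from \<open>c d\<close>,
  because the levels of a word of two or more letters exceed those of the chain
  (\<open>level_lower_strict\<close>). So the tail of arrows of the matched lower word is longer.
\<close>
lemma lo_block_across:
  assumes p: "quiver_path Q p" and i: "(rest, \<gamma>, c, d) \<in> Idx p" and j: "j \<in> Idx p"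
    and b: "(k, l) \<in> Blk (lo (rest, \<gamma>, c, d))" and kl: "k < length rest" "length rest < l"
    and m: "merge k l (lo (rest, \<gamma>, c, d)) = up j"
  shows "length (c @ d) < tail_length j"
proof -
  obtain rest' \<gamma>' c' d' where jd: "j = (rest', \<gamma>', c', d')" by (cases j) auto
  define e where "e = l - Suc (length rest)"
  have le: "l = Suc (length rest + e)" using kl by (simp add: e_def)
  have lle: "l \<le> length rest + Suc (length (c @ d))" and good: "good (slice (lo (rest, \<gamma>, c, d)) k l)"
    using b by (auto simp: Blk_def)
  have ele: "e \<le> length (c @ d)" using lle le by simp
  define w where "w = drop k rest @ [\<gamma>] @ arr (take e (c @ d))"
  have sl: "slice (lo (rest, \<gamma>, c, d)) k l = w"
    using slice_append_list(2)[of rest l k "[\<gamma>] @ arr (c @ d)"] kl le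
    by (simp add: w_def del: take_append arr_simps(3))
  define \<delta> where "\<delta> = concat w"
  have dchain: "chain Q R (Suc (wdeg w)) \<delta>" and wchains: "\<forall>g\<in>set w. is_chain g"
    using good sl by (auto simp: good_def \<delta>_def)
  have "lo (rest, \<gamma>, c, d) = rest @ \<gamma> # arr (c @ d)" by simp
  moreover have "drop l (rest @ \<gamma> # arr x) = arr (drop e x)" "take k (rest @ \<gamma> # arr x) = take k rest" for x
    using le kl by simp_all
  ultimately have "merge k l (lo (rest, \<gamma>, c, d)) = take k rest @ [\<delta>] @ arr (drop e (c @ d))"
    unfolding merge_def sl by (simp add: \<delta>_def del: arr_simps(3) drop_append)
  then have eq: "take k rest @ [\<delta>] @ arr (drop e (c @ d)) = rest' @ [\<gamma>' @ c'] @ arr d'" using m jd by simp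
  have j': "(rest', \<gamma>', c', d') \<in> Idx p" using j jd by simp
  have n: "normal R (drop e (c @ d))" "normal R d'"
    using IdxD(4)[OF i] IdxD(4)[OF j'] normal_appendD[of R "take e (c @ d)" "drop e (c @ d)"] normal_appendD[of R c' d']
    by (auto simp del: drop_append take_append)
  have "take k rest = rest' \<and> \<delta> = \<gamma>' @ c' \<and> drop e (c @ d) = d'"
    by (rule arrow_suffix_unique[OF eq n]) (use up_side[OF j'] chain_Suc_length[OF dchain] in auto)
  then have d: "\<delta> = \<gamma>' @ c'" "drop e (c @ d) = d'" by auto
  have dd: "Suc (wdeg w) = Suc (cdeg \<gamma>')" using chain_unique[OF dchain] IdxD(3)[OF j'] d by simp
  have path: "quiver_path Q \<delta>" by (rule chain_path[OF dchain])
  have at: "chain_at \<delta> 0 (Suc (wdeg w)) (length \<delta>)"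
    using dchain chain_slice_iff[OF path, of 0 "length \<delta>"] by simp
  have at': "chain_at \<delta> 0 (cdeg \<gamma>') (length \<gamma>')"
    using IdxD(2)[OF j'] chain_slice_iff[OF path, of 0 "length \<gamma>'"] d by (simp add: slice_def)
  have wW: "w \<in> Words \<delta>" using wchains by (simp add: Words_def \<delta>_def)
  define n where "n = Suc (length (drop k rest))"
  have n: "2 \<le> n" "n \<le> length w" using kl by (auto simp: n_def w_def)
  have arcs: "set (c @ d) \<subseteq> arcs Q"
    using arrows_of_word[OF p, of rest \<gamma> "c @ d"] IdxD(5)[OF i] by simp
  have "set (take e (c @ d)) \<subseteq> arcs Q" using arcs set_take_subset[of e "c @ d"] by blast
  then have we: "wdeg (arr (take e (c @ d))) = 0" by (rule wdeg_arr)
  have twn: "take n w = drop k rest @ [\<gamma>]" by (simp add: n_def w_def)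
  then have "wdeg (take n w) = wdeg w"
    using we by (simp add: w_def del: take_append)
  then have "pos \<delta> 0 (Suc (wdeg w)) < en w n"
    using level_lower_strict[OF path wW at _ n] by simp
  moreover have "pos \<delta> 0 (Suc (wdeg w)) = length \<gamma>'" using at' dd by (simp add: chain_at_def)
  moreover have "en w n + e = length \<delta>"
  proof -
    have "w = take n w @ arr (take e (c @ d))" unfolding twn by (simp add: w_def)
    then have "\<delta> = concat (take n w) @ take e (c @ d)" by (metis \<delta>_def arr_simps(1) concat_append)
    then show ?thesis using ele by (simp add: en_def)
  qed
  moreover have "length \<delta> = length \<gamma>' + length c'" by (simp add: d)
  ultimately have "e < length c'" by simp
  moreover have "length d' = length (c @ d) - e" using d(2) by (metis length_drop)
  ultimately show ?thesis using jd ele by simp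
qed

lemma cobar_diff_single: "cobar_diff (single x) y = (\<Sum>(k, l)\<in>{(k, l) \<in> Blk y. merge k l y = x}. (-1) ^ wdeg (take (Suc k) y))"
  unfolding cobar_diff_Blk using finite_Blk[of y]
  by (intro sum.mono_neutral_cong_right) (auto simp: single_def split: if_splits)

lemma lo_merges_to_up:
  assumes p: "quiver_path Q p" and i: "i \<in> Idx p" and j: "j \<in> Idx p"
    and b: "(k, l) \<in> Blk (lo j)" "merge k l (lo j) = up i"
  shows "(j = i \<and> k = length (fst i) \<and> l = Suc (length (fst i) + length (fst (snd (snd i))))) \<or> tail_length j < tail_length i"
proof -
  obtain rest \<gamma> c d where jd: "j = (rest, \<gamma>, c, d)" by (cases j) auto
  have j': "(rest, \<gamma>, c, d) \<in> Idx p" using j jd by simp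
  have "k \<le> length rest" using lo_block_start[OF j'] b jd by simp
  then consider "k = length rest" | "l \<le> length rest" | "k < length rest" "length rest < l" by linarith
  then show ?thesis
  proof cases
    case 1
    then have "l = Suc (length rest + length c)" using lo_block_at(1)[OF p j'] b jd by simp
    then have "up i = up j" using b(2) lo_block_at(2)[OF p j'] jd 1 by simp
    then have "i = j" using inj_on_up[of p] i j by (simp add: inj_on_eq_iff)
    then show ?thesis using 1 \<open>l = _\<close> jd by simp
  next
    case 2
    then have "up i \<in> lo ` Idx p" using lo_block_within[OF j', of k l] b jd by simp
    then show ?thesis using lo_neq_up i by fastforce
  next
    case 3
    then show ?thesis using lo_block_across[OF p j' i, of k l] b jd by simp
  qed
qed

lemma triangular_matching_Words:
  assumes p: "quiver_path Q p"
  shows "triangular_matching (cobar_diff :: (_ \<Rightarrow> 'k::field) \<Rightarrow> _) (Idx p) up lo tail_length"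
proof
  fix f g :: "'a list list \<Rightarrow> 'k" and c
  show "cobar_diff (\<lambda>x. f x + c * g x) = (\<lambda>y. cobar_diff f y + c * cobar_diff g y)" by (simp add: cobar_diff_linear fun_eq_iff)
next
  show "inj_on up (Idx p)" "inj_on lo (Idx p)" by (rule inj_on_up inj_on_lo)+
next
  fix i assume i: "i \<in> Idx p"
  obtain rest \<gamma> c d where id: "i = (rest, \<gamma>, c, d)" by (cases i) auto
  have i': "(rest, \<gamma>, c, d) \<in> Idx p" using i id by simp
  have "{(k, l) \<in> Blk (lo i). merge k l (lo i) = up i} = {(length rest, Suc (length rest + length c))}"
    using lo_merges_to_up[OF p i i] lo_block_at[OF p i'] id by auto
  then show "cobar_diff (single (up i)) (lo i) \<noteq> (0::'k)" by (simp add: cobar_diff_single)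
  have "up i \<in> Words p" using IdxD(6)[OF i'] id by simp
  then show "finsupp (cobar_diff (single (up i) :: _ \<Rightarrow> 'k))"
    by (intro Words_finsupp[of _ p] cobar_diff_support) (auto simp: single_def)
next
  fix i j assume ij: "i \<in> Idx p" "j \<in> Idx p" "cobar_diff (single (up i)) (lo j) \<noteq> (0::'k)" "j \<noteq> i"
  have "{(k, l) \<in> Blk (lo j). merge k l (lo j) = up i} \<noteq> {}"
    using ij(3) unfolding cobar_diff_single by (metis (no_types, lifting) sum.empty)
  then show "tail_length j < tail_length i" using lo_merges_to_up[OF p ij(1,2)] ij(4) by blast
qed

text \<open>
  A cycle that vanishes on lower words is supported on upper words, where triangularity
  applies.
\<close>
lemma cycle_zero:
  fixes z :: "'a list list \<Rightarrow> 'k::field"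
  assumes p: "quiver_path Q p" "\<not> normal R p" and z: "{y. z y \<noteq> 0} \<subseteq> Words p"
    and lo: "\<And>j. j \<in> Idx p \<Longrightarrow> z (lo j) = 0" and cycle: "\<And>y. cobar_diff z y = 0"
  shows "z = (\<lambda>y. 0)"
proof -
  interpret triangular_matching "cobar_diff :: (_ \<Rightarrow> 'k) \<Rightarrow> _" "Idx p" up lo tail_length
    by (rule triangular_matching_Words[OF p(1)])
  show ?thesis
  proof (rule injective[OF Words_finsupp[OF z]])
    show "{x. z x \<noteq> 0} \<subseteq> up ` Idx p" using Words_cover[OF p] z lo by blast
  qed (simp add: cycle)
qed

section \<open>The cobar differential squares to zero\<close>

text \<open>
  Only the block consisting of all letters can be merged to a word with one letter.
\<close>
lemma cobar_diff_single_chain: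
  assumes y: "y \<in> Words p" and p: "chain Q R \<rho> p"
  shows "cobar_diff (single [p]) y = (if Suc (wdeg y) = \<rho> then (-1) ^ cdeg (hd y) else 0)"
proof -
  have "y \<noteq> []" using y chain_path[OF p] by (auto simp: Words_def quiver_path_def)
  have "{(k, l) \<in> Blk y. merge k l y = [p]} = (if Suc (wdeg y) = \<rho> then {(0, length y)} else {})"
  proof -
    have "k = 0 \<and> l = length y" if "(k, l) \<in> Blk y" "merge k l y = [p]" for k l
      using that(1) arg_cong[OF that(2), of length] by (simp add: Blk_def merge_def)
    moreover have "(0, length y) \<in> Blk y \<longleftrightarrow> Suc (wdeg y) = \<rho>"
    proof -
      have "(0, length y) \<in> Blk y \<longleftrightarrow> chain Q R (Suc (wdeg y)) p"
        using \<open>y \<noteq> []\<close> y by (simp add: Blk_def good_def Words_def slice_def)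
      then show ?thesis using p chain_unique[OF p] by blast
    qed
    moreover have "merge 0 (length y) y = [p]" using y by (simp add: merge_def Words_def)
    ultimately show ?thesis by auto
  qed
  moreover have "wdeg (take (Suc 0) y) = cdeg (hd y)" using \<open>y \<noteq> []\<close> by (cases y) auto
  ultimately show ?thesis by (simp add: cobar_diff_single)
qed

lemma chain_at_even: "chain_at p s (2 * m) t \<Longrightarrow> t = (nx p ^^ m) (Suc s)"
  by (simp add: chain_at_def pos_odd)

lemma chain_at_strict:
  assumes "chain_at p s r t"
  shows "pos p s r < pos p s (Suc r)" "pos p s (Suc r) < pos p s (Suc (Suc r))"
proof -
  have "\<forall>j\<le>Suc r. pos p s j < pos p s (Suc j)" using assms unfolding chain_at_def by (rule conjunct1)
  then show "pos p s r < pos p s (Suc r)" "pos p s (Suc r) < pos p s (Suc (Suc r))"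
    by (metis le_SucI order_refl, metis order_refl)
qed

lemma chain_at_odd: "chain_at p s (Suc (2 * m)) t \<Longrightarrow> t = (nx p ^^ Suc m) s"
  using pos_even[of p s "Suc m"] by (simp add: chain_at_def)

text \<open>
  The combinatorial core. At a lower word \<open>y\<close> of the right degree exactly two good blocks
  occur, and they contribute opposite signs. One is the matched block, which starts at \<open>\<gamma>\<close>.
  Write \<open>P j\<close> for the positions of the chain \<open>p\<close>. If \<open>\<gamma>\<close> ends no later than \<open>P \<rho>\<close>, where the
  last piece of \<open>p\<close> begins, the other block starts at the first letter and ends at \<open>P \<rho>\<close>.
  Otherwise \<open>\<gamma>\<close> has odd length and the other block ends together with \<open>\<gamma>\<close>. The letters
  between the first one and \<open>\<gamma>\<close> have even length, hence the end of a block starting at letter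
  \<open>k\<close> is governed by the numbers \<open>x k\<close>, which increase weakly with \<open>k\<close> and reach the end of
  \<open>\<gamma>\<close>; the block starts at the last letter before this value is attained.
\<close>
lemma cobar_diff_square_single_lo:
  assumes i: "(rest, \<gamma>, c, d) \<in> Idx p" and ch: "chain Q R \<rho> p"
    and deg: "wdeg (lo (rest, \<gamma>, c, d)) + 2 = \<rho>"
  shows "cobar_diff (cobar_diff (single [p])) (lo (rest, \<gamma>, c, d)) = (0 :: 'k::field)"
proof -
  define y where "y = lo (rest, \<gamma>, c, d)"
  define J where "J = length rest"
  define b where "b = c @ d"
  define r where "r = cdeg \<gamma>"
  define n where "n = length y"
  define S where "S = en y"
  define w where "w l = wdeg (take l y)" for l
  define P where "P = pos p 0"
  let ?N = "\<lambda>m. (nx p ^^ m)"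
  have y: "y = rest @ \<gamma> # arr b" by (simp add: y_def b_def)
  have path: "quiver_path Q p" by (rule chain_path[OF ch])
  have at: "chain_at p 0 \<rho> (length p)" using ch chain_slice_iff[OF path, of 0 "length p"] by simp
  have yW: "y \<in> Words p" using IdxD(5)[OF i] by (simp add: y_def)
  have yp: "concat y = p" using yW by (simp add: Words_def)
  have arcs: "set b \<subseteq> arcs Q" using arrows_of_word[OF path, of rest \<gamma> b] yW y by simp
  have n: "n = Suc (J + length b)" by (simp add: n_def y J_def)
  have Sn: "S n = length p" by (simp add: S_def n_def yp)
  have Sle: "S l \<le> length p" for l using en_le[of y l] by (simp add: S_def yp)
  have Sless: "S k < S l" if "k < l" "l \<le> n" for k l
    using en_Suc_less[OF path yW] that by (simp add: S_def n_def)
  have takeJ: "take (Suc (J + k)) y = rest @ \<gamma> # arr (take k b)" for k by (simp add: y J_def)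
  have wl: "w l + 2 = \<rho>" if "Suc J \<le> l" for l
  proof -
    define k where "k = l - Suc J"
    have "wdeg (arr (take k b)) = 0" "wdeg (arr b) = 0"
      using arcs set_take_subset[of k b] by (auto intro!: wdeg_arr)
    moreover have lk: "l = Suc (J + k)" using that by (simp add: k_def)
    moreover have "wdeg y + 2 = \<rho>" using deg by (simp only: y_def)
    ultimately show ?thesis unfolding w_def lk takeJ by (simp add: y)
  qed
  have SJ: "S (Suc (J + k)) = S (Suc J) + k" if "k \<le> length b" for k
    using that takeJ[of k] takeJ[of 0] by (simp add: S_def en_def)
  have wSuc: "w (Suc l) = w l + cdeg (y ! l)" if "l < n" for l
    using wdeg_take_Suc[of l y] that by (simp add: w_def n_def)
  have yJ: "y ! J = \<gamma>" by (simp add: y J_def nth_append)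
  have wJ: "w J + r + 2 = \<rho>" using wSuc[of J] yJ wl[of "Suc J"] n by (simp add: r_def)
  have piece: "chain_at p (S l) (cdeg (y ! l)) (S (Suc l))" if "l < n" for l
    using word_piece[OF path yW, of l] that by (simp add: S_def n_def)
  have block: "(k, l) \<in> Blk y \<longleftrightarrow> chain_at p (S k) (Suc (w l - w k)) (S l)" if "k < l" "l \<le> n" for k l
    using word_block[OF path yW that(1)] that by (simp add: Blk_def S_def w_def n_def)
  have Pstrict: "P j < P (Suc j)" if "j \<le> Suc \<rho>" for j using at that by (simp add: chain_at_def P_def)
  have P_end: "P (Suc \<rho>) = length p" using at by (simp add: chain_at_def P_def)
  have Padd: "?N m (P k) = P (k + 2 * m)" for m k by (simp add: P_def pos_add_even)
  have Nmono: "?N m s \<le> ?N m t" if "s \<le> t" for m s t using that by (rule funpow_nx_mono)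
  have Nadd: "?N (m + m') s = ?N m (?N m' s)" for m m' s by (simp add: funpow_add)
  have low: "P (Suc (w l)) \<le> S l" if "1 \<le> l" "l \<le> n" for l
    using level_lower[OF path yW at, of l] that deg y_def by (simp add: P_def w_def S_def n_def)
  have upper: "S l < P (w l + 2)" if "l \<le> J" for l
  proof -
    let ?u = "up (rest, \<gamma>, c, d)"
    have "take l ?u = take l y" using that by (simp add: y J_def)
    moreover have "Suc (wdeg ?u) = \<rho>"
    proof -
      have "cdeg (\<gamma> @ c) = Suc r" using IdxD(3)[OF i] cdeg_eq by (simp add: r_def)
      moreover have "wdeg (arr d) = 0" "wdeg (arr b) = 0" using arcs by (auto intro!: wdeg_arr simp: b_def)
      ultimately show ?thesis using deg y_def y by (simp add: r_def)
    qed
    moreover have "l < length ?u" using that by (simp add: J_def)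
    ultimately show ?thesis
      using level_upper[OF path IdxD(6)[OF i] at, of l] by (simp add: S_def en_def w_def P_def)
  qed
  have ev: "even (cdeg (y ! l))" if "1 \<le> l" "l < J" for l
  proof (rule ccontr)
    assume "odd (cdeg (y ! l))"
    then obtain m where m: "cdeg (y ! l) = Suc (2 * m)" by (auto elim: oddE)
    have "S (Suc l) = ?N (Suc m) (S l)" using piece[of l] that n m chain_at_odd by simp
    moreover have "?N (Suc m) (P (Suc (w l))) \<le> ?N (Suc m) (S l)"
      using low[of l] that n by (intro Nmono) simp
    moreover have "?N (Suc m) (P (Suc (w l))) = P (w (Suc l) + 2)"
      unfolding Padd using wSuc[of l] that n m by simp
    ultimately show False using upper[of "Suc l"] that by simp
  qed
  have wev: "\<exists>e. w l = w k + 2 * e" if "1 \<le> k" "k \<le> l" "l \<le> J" for k l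
    using that(2,3)
  proof (induction l rule: dec_induct)
    case (step l)
    then obtain e where "w l = w k + 2 * e" by auto
    moreover have "w (Suc l) = w l + cdeg (y ! l)" "even (cdeg (y ! l))"
      using step wSuc[of l] ev[of l] that(1) n by simp_all
    moreover obtain m where "cdeg (y ! l) = 2 * m" using calculation(3) by auto
    ultimately show ?case by (intro exI[of _ "e + m"]) simp
  qed simp
  have J1: "1 \<le> J"
  proof (rule ccontr)
    assume "\<not> 1 \<le> J"
    then have J0: "J = 0" by simp
    then have "S 1 = P (Suc r)" using piece[of 0] yJ n by (simp add: chain_at_def r_def P_def S_def)
    moreover have "\<rho> = r + 2" using wJ J0 by (simp add: w_def)
    ultimately have "length p = nx p (S 1)" using P_end by (simp add: P_def)
    moreover have "normal R (slice p (S 1) (length p))"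
    proof -
      have "p = \<gamma> @ b" using yp y J0 by (simp add: J_def)
      moreover have "S 1 = length \<gamma>" using y J0 by (simp add: S_def en_def J_def)
      ultimately show ?thesis using IdxD(4)[OF i] by (simp add: slice_def b_def)
    qed
    ultimately show False using normal_slice_iff[of "length p" p "S 1"] by simp
  qed
  \<comment> \<open>The letters strictly between the first one and \<open>\<gamma>\<close> have even lengths; \<open>a k\<close> is half the sum of the lengths of the letters \<open>k, \<dots>, J - 1\<close>.\<close>
  define a where "a k = (w J - w k) div 2" for k
  \<comment> \<open>\<open>T k\<close> is where the letters \<open>k, \<dots>, J - 1\<close> would end if their steps of \<open>nx\<close> were applied to \<open>S k\<close> without first passing to the next position.\<close>
  define T where "T k = ?N (a k) (S k)" for k
  have TJ: "T J = S J" by (simp add: T_def a_def)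
  have wa: "w J = w k + 2 * a k" if "1 \<le> k" "k \<le> J" for k
    using wev[OF that order_refl] by (auto simp: a_def)
  have TSuc: "T (Suc k) = ?N (a k) (Suc (S k))" if k: "1 \<le> k" "k < J" for k
  proof -
    obtain m where m: "cdeg (y ! k) = 2 * m" using ev[OF k] by auto
    have "S (Suc k) = ?N m (Suc (S k))" using piece[of k] k n m chain_at_even by simp
    moreover have "a k = a (Suc k) + m" using wa[of k] wa[of "Suc k"] wSuc[of k] m k n by simp
    ultimately show ?thesis by (simp add: T_def Nadd)
  qed
  have Tmono: "T k \<le> T l" if "1 \<le> k" "k \<le> l" "l \<le> J" for k l
    using that(2,3)
  proof (induction l rule: dec_induct)
    case (step l)
    have "T l \<le> ?N (a l) (Suc (S l))" unfolding T_def by (rule Nmono) simp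
    then show ?case using step TSuc[of l] that(1) by simp
  qed simp
  have AinB: "(J, l) \<in> Blk y \<longleftrightarrow> l = Suc (J + length c)" for l
    using lo_block_at(1)[OF path i, of l] by (simp only: y_def[symmetric] J_def)
  have start: "k \<le> J" if "(k, l) \<in> Blk y" for k l
    using lo_block_start[OF i, of k l] that by (simp only: y_def[symmetric] J_def)
  have Blk_le: "k < l \<and> l \<le> n" if "(k, l) \<in> Blk y" for k l using that by (simp add: Blk_def n_def)
  have cb: "length c \<le> length b" by (simp add: b_def)
  have w1: "w 1 = cdeg (hd y)" by (cases y) (simp_all add: w_def y)
  have block0: "(0, l) \<in> Blk y \<longleftrightarrow> Suc J \<le> l \<and> S l = P \<rho>" if "0 < l" "l \<le> n" for l
  proof
    assume "(0, l) \<in> Blk y"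
    then have "S l = P (w l + 2)"
      using block[of 0 l] that by (simp add: chain_at_def P_def S_def w_def)
    then show "Suc J \<le> l \<and> S l = P \<rho>" using upper[of l] wl[of l] by (cases "l \<le> J") auto
  next
    assume l: "Suc J \<le> l \<and> S l = P \<rho>"
    have "chain_at p 0 (Suc (w l)) (S l)"
      using l at wl[of l] by (auto simp: chain_at_def P_def)
    then show "(0, l) \<in> Blk y" using block[of 0 l] that by (simp add: S_def w_def)
  qed
  have blockmid: "(k, l) \<in> Blk y \<longleftrightarrow> l = Suc J \<and> odd r \<and>
      ?N (Suc r div 2) (T k) < S (Suc J) \<and> ?N (Suc r div 2) (T (Suc k)) = S (Suc J)"
    if k: "1 \<le> k" "k < J" and l: "k < l" "l \<le> n" for k l
  proof -
    consider (short) "l \<le> J" | (even) "Suc J \<le> l" "even r" | (odd) "Suc J \<le> l" "odd r" by linarith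
    then show ?thesis
    proof cases
      case short
      have "\<not> (k, l) \<in> Blk y"
      proof
        assume "(k, l) \<in> Blk y"
        then have c: "chain_at p (S k) (Suc (w l - w k)) (S l)" using block l by simp
        obtain h where wh: "w l = w k + 2 * h" using wev[of k l] k l short by auto
        then have h: "w l - w k = 2 * h" by simp
        have "S l = ?N (Suc h) (S k)" using chain_at_odd[of p "S k" h "S l"] c h by simp
        moreover have "?N (Suc h) (P (Suc (w k))) \<le> ?N (Suc h) (S k)"
          using low[of k] k n by (intro Nmono) simp
        moreover have "?N (Suc h) (P (Suc (w k))) = P (Suc (w l + 2))" unfolding Padd by (simp add: wh)
        moreover have "P (w l + 2) < P (Suc (w l + 2))"
          using wev[of l J] wJ short k l by (intro Pstrict) auto
        ultimately show False using upper[OF short] by simp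
      qed
      then show ?thesis using short by auto
    next
      case even
      have "\<not> (k, l) \<in> Blk y"
      proof
        assume "(k, l) \<in> Blk y"
        then have c: "chain_at p (S k) (Suc (w l - w k)) (S l)" using block l by simp
        obtain h where h: "r = 2 * h" using even(2) by auto
        have wd: "w l - w k = 2 * (a k + h)" using wl[OF even(1)] wJ wa[of k] k h by simp
        have "S l = ?N (Suc (a k + h)) (S k)" using chain_at_odd[of p "S k" "a k + h" "S l"] c wd by simp
        moreover have "?N (Suc (a k + h)) (P (Suc (w k))) \<le> ?N (Suc (a k + h)) (S k)"
          using low[of k] k n by (intro Nmono) simp
        moreover have "?N (Suc (a k + h)) (P (Suc (w k))) = length p"
          unfolding Padd P_end[symmetric] using wJ wa[of k] k h by (simp add: algebra_simps)
        ultimately have Sl: "length p \<le> S l" by simp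
        have AA: "?N (Suc h) (S J) = S (Suc (J + length c))"
        proof -
          have "chain_at p (S J) (Suc (w (Suc (J + length c)) - w J)) (S (Suc (J + length c)))"
            using AinB block[of J "Suc (J + length c)"] n cb by simp
          moreover have "w (Suc (J + length c)) - w J = 2 * h"
            using wl[of "Suc (J + length c)"] wJ h by simp
          ultimately show ?thesis
            using chain_at_odd[of p "S J" h "S (Suc (J + length c))"] by simp
        qed
        have "pos p (S k) (Suc (Suc (w l - w k))) < pos p (S k) (Suc (Suc (Suc (w l - w k))))"
          by (rule chain_at_strict(2)[OF c])
        moreover have "pos p (S k) (Suc (Suc (w l - w k))) = S l" using c by (simp add: chain_at_def)
        moreover have "pos p (S k) (Suc (Suc (Suc (w l - w k)))) = ?N (Suc (a k + h)) (Suc (S k))"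
          using pos_odd[of p "S k" "Suc (a k + h)"] wd by simp
        moreover have "?N (Suc (a k + h)) (Suc (S k)) = ?N (Suc h) (T (Suc k))"
          using TSuc[OF k] Nadd[of "Suc h" "a k"] by (simp add: add.commute)
        moreover have "?N (Suc h) (T (Suc k)) \<le> ?N (Suc h) (S J)"
          using Tmono[of "Suc k" J] k TJ by (intro Nmono) simp
        ultimately show False using Sl Sle[of "Suc (J + length c)"] AA by simp
      qed
      then show ?thesis using even by auto
    next
      case odd
      define h where "h = Suc r div 2"
      have rh: "Suc r = 2 * h" using odd(2) by (auto simp: h_def elim!: oddE)
      have wd: "Suc (w l - w k) = 2 * (a k + h)" using wl[OF odd(1)] wJ wa[of k] k rh by simp
      have 1: "pos p (S k) (Suc (w l - w k)) = ?N h (T k)"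
        unfolding wd pos_even T_def by (simp add: Nadd add.commute)
      have 2: "pos p (S k) (Suc (Suc (w l - w k))) = ?N h (T (Suc k))"
        unfolding wd pos_odd TSuc[OF k] by (simp add: Nadd add.commute)
      have SJh: "S (Suc J) = ?N h (S J)"
        using piece[of J] n yJ rh chain_at_odd[of p "S J" "h - 1" "S (Suc J)"] by (cases h) (auto simp: r_def)
      have le: "?N h (T (Suc k)) \<le> S (Suc J)" unfolding SJh
        using Tmono[of "Suc k" J] k TJ by (intro Nmono) simp
      have "(k, l) \<in> Blk y \<longleftrightarrow> chain_at p (S k) (Suc (w l - w k)) (S l)" using block l by simp
      also have "\<dots> \<longleftrightarrow> l = Suc J \<and> ?N h (T k) < S (Suc J) \<and> ?N h (T (Suc k)) = S (Suc J)"
      proof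
        assume c: "chain_at p (S k) (Suc (w l - w k)) (S l)"
        then have Sl: "S l = ?N h (T (Suc k))" using 2 by (simp add: chain_at_def)
        have lJ: "l = Suc J"
        proof (rule ccontr)
          assume "l \<noteq> Suc J"
          then have "S (Suc J) < S l" using odd(1) l by (intro Sless) auto
          then show False using Sl le by simp
        qed
        have "pos p (S k) (Suc (w l - w k)) < pos p (S k) (Suc (Suc (w l - w k)))"
          by (rule chain_at_strict(1)[OF c])
        then show "l = Suc J \<and> ?N h (T k) < S (Suc J) \<and> ?N h (T (Suc k)) = S (Suc J)"
          using 1 2 Sl lJ by simp
      next
        assume asm: "l = Suc J \<and> ?N h (T k) < S (Suc J) \<and> ?N h (T (Suc k)) = S (Suc J)"
        show "chain_at p (S k) (Suc (w l - w k)) (S l)"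
        proof (rule chain_atI)
          show "pos p (S k) (Suc (w l - w k)) < pos p (S k) (Suc (Suc (w l - w k)))"
            "pos p (S k) (Suc (Suc (w l - w k))) = S l" using 1 2 asm by simp_all
          have "?N (Suc (a k + h)) (P (Suc (w k))) \<le> ?N (Suc (a k + h)) (S k)"
            using low[of k] k n by (intro Nmono) simp
          moreover have "?N (Suc (a k + h)) (P (Suc (w k))) = P (Suc (Suc \<rho>))"
            unfolding Padd using wJ wa[of k] k rh by (intro arg_cong[of _ _ P]) (simp add: algebra_simps)
          moreover have "pos p (S k) (Suc (Suc (Suc (w l - w k)))) = ?N (Suc (a k + h)) (S k)"
            using pos_even[of p "S k" "Suc (a k + h)"] wd by simp
          moreover have "P (Suc \<rho>) < P (Suc (Suc \<rho>))" by (rule Pstrict) simp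
          ultimately show "pos p (S k) (Suc (Suc (w l - w k))) < pos p (S k) (Suc (Suc (Suc (w l - w k))))"
            using P_end Sle[of l] 2 asm by simp
        qed simp
      qed
      finally show ?thesis using odd(2) by (simp add: h_def)
    qed
  qed
  define sg where "sg = (\<lambda>(k, l). (-1) ^ wdeg (take (Suc k) y) * cobar_diff (single [p]) (merge k l y) :: 'k)"
  have sum: "cobar_diff (cobar_diff (single [p])) y = sum sg (Blk y)"
    unfolding cobar_diff_Blk[of "cobar_diff (single [p])"] sg_def ..
  have sg: "sg (k, l) = (-1) ^ (w (Suc k) + (if k = 0 then Suc (w l) else w 1))" if "(k, l) \<in> Blk y" for k l
  proof -
    have kl: "k < l" "l \<le> length y" "good (slice y k l)" using that by (auto simp: Blk_def)
    have W: "merge k l y \<in> Words p" using merge_Words_iff[OF that] yW by simp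
    have "Suc (wdeg (merge k l y)) = \<rho>" using wdeg_merge[OF kl] deg y_def by simp
    then have "cobar_diff (single [p]) (merge k l y) = ((-1) ^ cdeg (hd (merge k l y)) :: 'k)"
      using cobar_diff_single_chain[OF W ch] by simp
    moreover have "cdeg (hd (merge k l y)) = (if k = 0 then Suc (w l) else w 1)"
    proof (cases "k = 0")
      case True
      then show ?thesis using kl by (auto simp: merge_def good_def w_def slice_def intro!: cdeg_eq)
    next
      case False
      have "y \<noteq> []" using kl by auto
      then have "hd (merge k l y) = hd y" using False by (cases y; cases k) (auto simp: merge_def)
      then show ?thesis using False w1 by simp
    qed
    ultimately show ?thesis by (simp add: sg_def w_def power_add)
  qed
  define A where "A = (J, Suc (J + length c))"
  have A: "A \<in> Blk y" using AinB by (simp add: A_def)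
  have "\<exists>B. Blk y = {A, B} \<and> B \<noteq> A \<and> sg A = - sg B"
  proof (cases "S (Suc J) \<le> P \<rho>")
    case True
    \<comment> \<open>The block from the first letter to \<open>P \<rho>\<close> takes \<open>k0\<close> arrows after \<open>\<gamma>\<close>.\<close>
    define k0 where "k0 = P \<rho> - S (Suc J)"
    define B where "B = (0::nat, Suc (J + k0))"
    have "P \<rho> < length p" using Pstrict[of \<rho>] P_end by simp
    then have k0: "k0 \<le> length b" using Sn n SJ[of "length b"] by (simp add: k0_def)
    have SB: "S (Suc (J + k0)) = P \<rho>" using SJ[OF k0] True by (simp add: k0_def)
    have B: "B \<in> Blk y" unfolding B_def using block0[of "Suc (J + k0)"] SB k0 n by simp
    have "x = A \<or> x = B" if x: "x \<in> Blk y" for x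
    proof -
      obtain k l where kl: "x = (k, l)" by (cases x) auto
      have klB: "(k, l) \<in> Blk y" using x kl by simp
      have le: "k < l" "l \<le> n" using Blk_le[OF klB] by auto
      consider "k = 0" | "k = J" | "1 \<le> k" "k < J" using start[OF klB] by linarith
      then show ?thesis
      proof cases
        case 1
        then have Sl: "S l = P \<rho>" using block0[of l] klB le by simp
        have "l = Suc (J + k0)"
        proof (rule ccontr)
          assume "l \<noteq> Suc (J + k0)"
          then have "l < Suc (J + k0) \<or> Suc (J + k0) < l" by linarith
          then show False using Sless[of l "Suc (J + k0)"] Sless[of "Suc (J + k0)" l] Sl SB k0 n le by auto
        qed
        then show ?thesis using kl 1 by (simp add: B_def)
      next
        case 2
        then show ?thesis using AinB klB kl by (simp add: A_def)
      next
        case 3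
        then have c: "odd r" "?N (Suc r div 2) (T k) < S (Suc J)"
          using blockmid[of k l] klB le by auto
        have "P \<rho> \<le> ?N (Suc r div 2) (T k)"
        proof -
          have "?N (Suc r div 2 + a k) (P (Suc (w k))) \<le> ?N (Suc r div 2 + a k) (S k)"
            using low[of k] 3 n by (intro Nmono) simp
          moreover have "?N (Suc r div 2 + a k) (P (Suc (w k))) = P \<rho>"
            unfolding Padd using c(1) wJ wa[of k] 3 by (intro arg_cong[of _ _ P]) (auto elim!: oddE)
          ultimately show ?thesis by (simp add: T_def Nadd)
        qed
        then show ?thesis using c True by simp
      qed
    qed
    then have "Blk y = {A, B}" using A B by auto
    moreover have "B \<noteq> A" using J1 by (simp add: A_def B_def)
    moreover have "sg A = - sg B"
    proof -
      have "w (Suc J) = w (Suc (J + k0))" using wl[of "Suc J"] wl[of "Suc (J + k0)"] by simp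
      then show ?thesis using sg[of J "Suc (J + length c)"] sg[of 0 "Suc (J + k0)"] A B J1
        by (simp add: A_def B_def power_add)
    qed
    ultimately show ?thesis by blast
  next
    case False
    have r: "odd r"
    proof
      assume "even r"
      then obtain h where h: "r = 2 * h" by auto
      have "S (Suc J) = ?N h (Suc (S J))" using piece[of J] n yJ h chain_at_even by (simp add: r_def)
      also have "\<dots> \<le> ?N h (P (w J + 2))" using upper[of J] by (intro Nmono) simp
      also have "\<dots> = P \<rho>" unfolding Padd using wJ h by (intro arg_cong[of _ _ P]) simp
      finally show False using False by simp
    qed
    define h where "h = Suc r div 2"
    have rh: "Suc r = 2 * h" using r by (auto simp: h_def elim!: oddE)
    define x where "x k = ?N h (T k)" for k
    have xJ: "x J = S (Suc J)"
      using piece[of J] n yJ rh chain_at_odd[of p "S J" "h - 1" "S (Suc J)"] TJ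
      by (cases h) (auto simp: r_def x_def)
    have xmono: "x k \<le> x l" if "1 \<le> k" "k \<le> l" "l \<le> J" for k l
      unfolding x_def using Tmono[OF that] by (rule Nmono)
    have S1: "S 1 = P (Suc (w 1))"
      using piece[of 0] n wSuc[of 0] by (simp add: chain_at_def P_def S_def w_def)
    have "x 1 = ?N (h + a 1) (S 1)" by (simp add: x_def T_def Nadd)
    also have "\<dots> = P \<rho>" unfolding S1 Padd
      using wJ wa[of 1] J1 rh by (intro arg_cong[of _ _ P]) simp
    finally have x1: "x 1 < x J" using False xJ by simp
    \<comment> \<open>The other block starts at the last letter before \<open>x\<close> attains its final value.\<close>
    define k1 where "k1 = (LEAST k. 1 \<le> k \<and> x k = x J)"
    have k1: "1 \<le> k1 \<and> x k1 = x J" unfolding k1_def by (rule LeastI[of _ J]) (use J1 in simp)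
    have k1_le: "k1 \<le> J" unfolding k1_def by (rule Least_le) (use J1 in simp)
    have k1_less: "\<not> (1 \<le> k \<and> x k = x J)" if "k < k1" for k
      using not_less_Least that unfolding k1_def by blast
    have "k1 \<noteq> 1" using x1 k1 by auto
    define k2 where "k2 = k1 - 1"
    have k2: "1 \<le> k2" "k2 < J" "k1 = Suc k2" using k1 k1_le \<open>k1 \<noteq> 1\<close> by (auto simp: k2_def)
    have xk2: "x k2 < x J" using k1_less[of k2] k2 xmono[of k2 J] by (simp add: order.strict_iff_order)
    define B where "B = (k2, Suc J)"
    have B: "B \<in> Blk y" unfolding B_def
      using blockmid[of k2 "Suc J"] k2 n r xk2 k1 xJ by (simp add: x_def h_def)
    have "z = A \<or> z = B" if z: "z \<in> Blk y" for z
    proof -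
      obtain k l where kl: "z = (k, l)" by (cases z) auto
      have klB: "(k, l) \<in> Blk y" using z kl by simp
      have le: "k < l" "l \<le> n" using Blk_le[OF klB] by auto
      consider "k = 0" | "k = J" | "1 \<le> k" "k < J" using start[OF klB] by linarith
      then show ?thesis
      proof cases
        case 1
        then have "Suc J \<le> l" "S l = P \<rho>" using block0[of l] klB le by auto
        then show ?thesis using False Sless[of "Suc J" l] le by (cases "l = Suc J") auto
      next
        case 2
        then show ?thesis using AinB klB kl by (simp add: A_def)
      next
        case 3
        then have c: "l = Suc J" "x k < x J" "x (Suc k) = x J"
          using blockmid[of k l] klB le xJ by (auto simp: x_def h_def)
        have "k = k2"
        proof (rule ccontr)
          assume "k \<noteq> k2"
          then consider "k < k2" | "k2 < k" by linarith
          then show False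
          proof cases
            case 1
            then show False using k1_less[of "Suc k"] c k2 by simp
          next
            case 2
            then show False using xmono[of k1 k] k1 k2 c 3 by simp
          qed
        qed
        then show ?thesis using kl c by (simp add: B_def)
      qed
    qed
    then have "Blk y = {A, B}" using A B by auto
    moreover have "B \<noteq> A" using k2 by (simp add: A_def B_def)
    moreover have "sg A = - sg B"
    proof -
      obtain e where "w J = w (Suc k2) + 2 * e" using wev[of "Suc k2" J] k2 by auto
      moreover have "w (Suc J) = w J + r" using wSuc[of J] yJ n by (simp add: r_def)
      ultimately have "(-1 :: 'k) ^ w (Suc J) = - ((-1) ^ w (Suc k2))" using r by (simp add: power_add power_mult)
      then show ?thesis using sg[of J "Suc (J + length c)"] sg[of k2 "Suc J"] A B J1 k2
        by (simp add: A_def B_def power_add)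
    qed
    ultimately show ?thesis by blast
  qed
  then obtain B where "Blk y = {A, B}" "B \<noteq> A" "sg A = - sg B" by blast
  then show ?thesis unfolding y_def[symmetric] sum by simp
qed

lemma conv_single: "conv (single u) (single v) = single (u @ v)"
proof
  fix y
  have "conv (single u) (single v) y = (\<Sum>k\<le>length y. if take k y = u \<and> drop k y = v then 1 else 0)"
    unfolding conv_def by (intro sum.cong) (auto simp: single_def)
  also have "\<dots> = (\<Sum>k\<le>length y. if k = length u then single (u @ v) y else 0)"
  proof (intro sum.cong refl)
    fix k assume k: "k \<in> {..length y}"
    have "take k y = u \<and> drop k y = v \<longleftrightarrow> k = length u \<and> y = u @ v"
    proof
      assume tk: "take k y = u \<and> drop k y = v"
      moreover have "length (take k y) = k" using k by simp
      ultimately show "k = length u \<and> y = u @ v" by (metis append_take_drop_id)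
    qed auto
    then show "(if take k y = u \<and> drop k y = v then 1 else 0) = (if k = length u then single (u @ v) y else 0)"
      by (auto simp: single_def)
  qed
  also have "\<dots> = single (u @ v) y" by (auto simp: single_def)
  finally show "conv (single u) (single v) y = single (u @ v) y" .
qed

lemma cobar_diff_zero: "cobar_diff (\<lambda>x. 0) y = 0"
  using cobar_diff_scale[of 0 "\<lambda>x. 0" y] by simp

lemma cobar_diff_sum: "finite J \<Longrightarrow> cobar_diff (\<lambda>x. \<Sum>i\<in>J. c i * g i x) y = (\<Sum>i\<in>J. c i * cobar_diff (g i) y)"
proof (induction J rule: finite_induct)
  case empty
  then show ?case by (simp add: cobar_diff_zero)
next
  case (insert i J)
  then show ?case using cobar_diff_linear[of "\<lambda>x. \<Sum>i\<in>J. c i * g i x" "c i" "g i" y] by (simp add: add.commute)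
qed

lemma cobar_diff_square_single_word:
  assumes "\<And>g y. g \<in> set v \<Longrightarrow> cobar_diff (cobar_diff (single [g])) y = (0 :: 'k::field)"
  shows "cobar_diff (cobar_diff (single v)) y = (0 :: 'k)"
  using assms
proof (induction v arbitrary: y)
  case Nil
  have "cobar_diff (single []) = (\<lambda>y. 0 :: 'k)"
    unfolding cobar_diff_Blk[abs_def] by (auto simp: single_def merge_def fun_eq_iff intro!: sum.neutral)
  then show ?case by (simp add: cobar_diff_zero)
next
  case (Cons g v)
  have "single (g # v) = (conv (single [g]) (single v) :: _ \<Rightarrow> 'k)" by (simp add: conv_single)
  then have "cobar_diff (cobar_diff (single (g # v))) y =
      (conv (cobar_diff (cobar_diff (single [g]))) (single v) y + conv (single [g]) (cobar_diff (cobar_diff (single v))) y :: 'k)"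
    by (simp only: cobar_diff_square_conv)
  also have "\<dots> = (0 :: 'k)" using Cons by (simp add: conv_def)
  finally show ?case .
qed

lemma cobar_diff_square_combination:
  fixes x :: "'a list list \<Rightarrow> 'k::field"
  assumes "{v. x v \<noteq> 0} \<subseteq> Words p"
    and "\<And>v y. x v \<noteq> 0 \<Longrightarrow> cobar_diff (cobar_diff (single v)) y = (0 :: 'k)"
  shows "cobar_diff (cobar_diff x) y = 0"
proof -
  have x: "x = (\<lambda>y. \<Sum>v\<in>Words p. x v * single v y)" by (rule sum_single[OF finite_Words assms(1)])
  have "cobar_diff x = (\<lambda>y. \<Sum>v\<in>Words p. x v * cobar_diff (single v) y)"
    by (subst x) (simp add: cobar_diff_sum[OF finite_Words] fun_eq_iff)
  then have "cobar_diff (cobar_diff x) y = (\<Sum>v\<in>Words p. x v * cobar_diff (cobar_diff (single v)) y)"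
    by (simp add: cobar_diff_sum[OF finite_Words])
  also have "\<dots> = 0" using assms(2) by (intro sum.neutral) auto
  finally show ?thesis .
qed

lemma Words_piece_length:
  assumes "v \<in> Words p" "v \<noteq> [p]" "g \<in> set v"
  shows "length g < length p"
proof -
  obtain v1 v2 where v: "v = v1 @ g # v2" using assms(3) by (meson split_list)
  then have "v1 \<noteq> [] \<or> v2 \<noteq> []" using assms(1,2) by (auto simp: Words_def)
  then have "concat v1 \<noteq> [] \<or> concat v2 \<noteq> []"
    using assms(1) v chain_nonempty by (cases v1; cases v2) (auto simp: Words_def)
  moreover have "p = concat v1 @ g @ concat v2" using assms(1) v by (auto simp: Words_def)
  ultimately show ?thesis by auto
qed

text \<open>
  Induction on the length of \<open>\<gamma>\<close>. The letters of words in \<open>D \<gamma>\<close> are shorter than \<open>\<gamma>\<close>, so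
  \<open>D\<^sup>2\<close> vanishes on \<open>D \<gamma>\<close>, that is, \<open>D\<^sup>2 \<gamma>\<close> is a cycle. By \<open>cycle_zero\<close> it remains to look at
  lower words, and there only at those of the degree in which \<open>D\<^sup>2 \<gamma>\<close> lives.
\<close>
lemma cobar_diff_square_single_chain:
  "is_chain \<gamma> \<Longrightarrow> cobar_diff (cobar_diff (single [\<gamma>])) y = (0 :: 'k::field)"
proof (induction "length \<gamma>" arbitrary: \<gamma> y rule: less_induct)
  case less
  define \<rho> where "\<rho> = cdeg \<gamma>"
  have ch: "chain Q R \<rho> \<gamma>" using less.prems by (simp add: \<rho>_def chain_cdeg)
  have path: "quiver_path Q \<gamma>" by (rule chain_path[OF ch])
  define e where "e = (single [\<gamma>] :: _ \<Rightarrow> 'k)"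
  have supp: "{y. e y \<noteq> 0} \<subseteq> Words \<gamma>" using less.prems by (auto simp: e_def single_def Words_def)
  have Dsupp: "{y. cobar_diff e y \<noteq> 0} \<subseteq> Words \<gamma>" by (rule cobar_diff_support[OF supp])
  have deg: "Suc (wdeg y) = \<rho>" if "cobar_diff e y \<noteq> 0" for y
    using that Dsupp cobar_diff_single_chain[of y \<gamma> \<rho>] ch by (auto simp: e_def split: if_splits)
  have "cobar_diff (cobar_diff e) = (\<lambda>y. 0)"
  proof (cases "normal R \<gamma>")
    case True
    then have "\<rho> = 0" using ch chain_Suc_not_normal by (cases \<rho>) auto
    then have "cobar_diff e = (\<lambda>y. 0)" using deg by (auto simp: fun_eq_iff)
    then have "cobar_diff (cobar_diff e) = cobar_diff (\<lambda>y. 0)" by simp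
    then show ?thesis by (simp add: cobar_diff_zero fun_eq_iff)
  next
    case False
    show ?thesis
    proof (rule cycle_zero[OF path False])
      show "{y. cobar_diff (cobar_diff e) y \<noteq> 0} \<subseteq> Words \<gamma>" by (rule cobar_diff_support[OF Dsupp])
    next
      fix j assume j: "j \<in> Idx \<gamma>"
      obtain rest g c d where jd: "j = (rest, g, c, d)" by (cases j) auto
      show "cobar_diff (cobar_diff e) (lo j) = 0"
      proof (cases "wdeg (lo j) + 2 = \<rho>")
        case True
        then show ?thesis using cobar_diff_square_single_lo[of rest g c d \<gamma> \<rho>] j jd ch by (simp add: e_def)
      next
        case False
        have "cobar_diff e (merge k l (lo j)) = 0" if "k < l" "l \<le> length (lo j)" "good (slice (lo j) k l)" for k l
          using wdeg_merge[OF that] deg[of "merge k l (lo j)"] False by auto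
        then have "cobar_diff (cobar_diff e) (lo j) = cobar_diff (\<lambda>x. 0) (lo j)" by (intro cobar_diff_cong) auto
        then show ?thesis by (simp add: cobar_diff_zero)
      qed
    next
      fix y
      show "cobar_diff (cobar_diff (cobar_diff e)) y = 0"
      proof (rule cobar_diff_square_combination[OF Dsupp])
        fix v y assume v: "cobar_diff e v \<noteq> 0"
        have "v \<noteq> [\<gamma>]" using deg[OF v] by (auto simp: \<rho>_def)
        moreover have vW: "v \<in> Words \<gamma>" using v Dsupp by auto
        ultimately have short: "\<And>g. g \<in> set v \<Longrightarrow> length g < length \<gamma>"
          using Words_piece_length by blast
        have chains: "\<And>g. g \<in> set v \<Longrightarrow> is_chain g" using vW by (simp add: Words_def)
        show "cobar_diff (cobar_diff (single v)) y = (0 :: 'k)"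
          using cobar_diff_square_single_word[of v y] less.hyps[OF short chains] by blast
      qed
    qed
  qed
  then show ?case by (simp add: e_def fun_eq_iff)
qed

lemma cobar_diff_square:
  assumes "{v. x v \<noteq> 0} \<subseteq> Words p"
  shows "cobar_diff (cobar_diff x) y = (0 :: 'k::field)"
proof (rule cobar_diff_square_combination[OF assms])
  fix v y assume "x v \<noteq> 0"
  then have "is_chain g" if "g \<in> set v" for g using assms that by (auto simp: Words_def)
  then show "cobar_diff (cobar_diff (single v)) y = (0 :: 'k)"
    using cobar_diff_square_single_word[of v y] cobar_diff_square_single_chain by blast
qed

text \<open>
  The triangular system gives \<open>u\<close> with \<open>D u = z\<close> on lower words, and the cycle \<open>z - D u\<close>
  vanishes by \<open>cycle_zero\<close>.
\<close>
lemma acyclic: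
  fixes z :: "'a list list \<Rightarrow> 'k::field"
  assumes p: "quiver_path Q p" "\<not> normal R p" and z: "{y. z y \<noteq> 0} \<subseteq> Words p"
    and cycle: "\<And>y. cobar_diff z y = 0"
  shows "\<exists>u. {y. u y \<noteq> 0} \<subseteq> Words p \<and> (\<forall>y. cobar_diff u y = z y)"
proof -
  interpret triangular_matching "cobar_diff :: (_ \<Rightarrow> 'k) \<Rightarrow> _" "Idx p" up lo tail_length
    by (rule triangular_matching_Words[OF p(1)])
  obtain u where u: "finsupp u" "{x. u x \<noteq> 0} \<subseteq> up ` Idx p" "\<forall>k\<in>Idx p. cobar_diff u (lo k) = z (lo k)"
    using solvable[OF Words_finsupp[OF z]] by blast
  have "up ` Idx p \<subseteq> Words p" using IdxD(6) by force
  then have uW: "{x. u x \<noteq> 0} \<subseteq> Words p" using u(2) by (rule order_trans[rotated])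
  define x where "x = (\<lambda>y. z y + (-1) * cobar_diff u y)"
  have "x = (\<lambda>y. 0)"
  proof (rule cycle_zero[OF p])
    have "{y. x y \<noteq> 0} \<subseteq> {y. z y \<noteq> 0} \<union> {y. cobar_diff u y \<noteq> 0}" by (auto simp: x_def)
    then show "{y. x y \<noteq> 0} \<subseteq> Words p" using z cobar_diff_support[OF uW] by (rule order_trans[OF _ Un_least])
    show "\<And>j. j \<in> Idx p \<Longrightarrow> x (lo j) = 0" using u(3) by (simp add: x_def)
    show "\<And>y. cobar_diff x y = 0" unfolding x_def cobar_diff_linear using cycle cobar_diff_square[OF uW] by simp
  qed
  then show ?thesis using uW by (intro exI[of _ u]) (simp add: x_def fun_eq_iff)
qed

section \<open>Lifting bar words to combinations of words of chains\<close>

text \<open>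
  The words in the bar differential of \<open>w\<close>.
\<close>
definition mrg :: "nat \<Rightarrow> 'b list list \<Rightarrow> 'b list list" where
  "mrg i w = take i w @ [w ! i @ w ! (i + 1)] @ drop (i + 2) w"

text \<open>
  The prescribed boundary of \<open>F w\<close>: the difference between cutting \<open>w\<close> and multiplying in the
  tensor algebra, and multiplying neighbours in \<open>A\<close>. It depends only on the values of \<open>F\<close> at
  shorter words.
\<close>
definition obstruction :: "('b list list \<Rightarrow> 'c list \<Rightarrow> 'k::field) \<Rightarrow> 'b list list \<Rightarrow> 'c list \<Rightarrow> 'k" where
  "obstruction F w y = (\<Sum>i<length w - 1. (-1) ^ i *
     (conv (F (take (Suc i) w)) (F (drop (Suc i) w)) y - F (mrg i w) y))"

lemma mrg_props:
  assumes "Suc i < length w"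
  shows "length (mrg i w) = length w - 1" "concat (mrg i w) = concat w"
proof -
  show "length (mrg i w) = length w - 1" using assms by (simp add: mrg_def)
  have "w = take i w @ [w ! i, w ! Suc i] @ drop (Suc (Suc i)) w"
    using assms id_take_nth_drop[of i w] Cons_nth_drop_Suc[of "Suc i" w] by simp
  then have "concat w = concat (take i w @ [w ! i, w ! Suc i] @ drop (Suc (Suc i)) w)" by simp
  then show "concat (mrg i w) = concat w" by (simp add: mrg_def)
qed

lemma conv_assoc: "conv (conv f g) h y = conv f (conv g h) y"
proof (induction y arbitrary: f)
  case Nil
  show ?case by (simp add: conv_def)
next
  case (Cons a ys)
  have "conv (\<lambda>v. conv f g (a # v)) h ys = f [] * conv (\<lambda>v. g (a # v)) h ys + conv (conv (\<lambda>v. f (a # v)) g) h ys"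
    by (simp add: conv_Cons conv_add_left conv_scale_left)
  then show ?case
    using Cons[of "\<lambda>v. f (a # v)"] by (simp add: conv_Cons[of _ _ a ys] algebra_simps) (simp add: conv_def)
qed

lemma conv_diff_left: "conv (\<lambda>v. f v - f' v) g y = conv f g y - conv f' g y"
  and conv_diff_right: "conv f (\<lambda>v. g v - g' v) y = conv f g y - conv f g' y"
  and conv_scale_right: "conv f (\<lambda>v. c * g v) y = c * conv f g y"
  by (simp_all add: conv_def algebra_simps sum_subtractf sum_distrib_left)

lemma conv_sum_left: "conv (\<lambda>v. \<Sum>i\<in>I. f i v) g y = (\<Sum>i\<in>I. conv (f i) g y)"
  and conv_sum_right: "conv g (\<lambda>v. \<Sum>i\<in>I. f i v) y = (\<Sum>i\<in>I. conv g (f i) y)"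
  unfolding conv_def sum_distrib_right sum_distrib_left by (rule sum.swap)+

lemma nth_mrg:
  assumes "Suc i < length w"
  shows "j < i \<Longrightarrow> mrg i w ! j = w ! j" "mrg i w ! i = w ! i @ w ! Suc i"
    "i < j \<Longrightarrow> mrg i w ! j = w ! Suc j"
  using assms by (auto simp: mrg_def nth_append min_def)

text \<open>
  The simplicial identity behind the vanishing of the square of the bar differential.
\<close>
lemma mrg_mrg:
  assumes "i \<le> j" "Suc (Suc j) < length w"
  shows "mrg j (mrg i w) = mrg i (mrg (Suc j) w)"
proof (rule nth_equalityI)
  have l: "length (mrg i w) = length w - 1" "length (mrg (Suc j) w) = length w - 1"
    using assms by (auto simp: mrg_props)
  have l2: "Suc j < length (mrg i w)" "Suc i < length (mrg (Suc j) w)" using l assms by auto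
  show "length (mrg j (mrg i w)) = length (mrg i (mrg (Suc j) w))" using l l2 by (simp add: mrg_props)
  fix k assume "k < length (mrg j (mrg i w))"
  note nm = nth_mrg[OF l2(1)] nth_mrg[OF l2(2)] nth_mrg[of i w] nth_mrg[of "Suc j" w]
  have ij: "Suc i < length w" "Suc (Suc j) < length w" using assms by auto
  consider "k < i" | "k = i" "i = j" | "k = i" "i < j" | "i < k" "k < j" | "i < k" "k = j" | "j < k"
    using assms(1) by linarith
  then show "mrg j (mrg i w) ! k = mrg i (mrg (Suc j) w) ! k"
  proof cases
    case 1 then show ?thesis using assms(1) ij by (simp add: nm)
  next
    case 2
    then have "i = k" "j = k" by auto
    then show ?thesis using ij l2 by (simp add: nth_mrg)
  next
    case 3 then show ?thesis using ij by (simp add: nm)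
  next
    case 4 then show ?thesis using ij by (simp add: nm)
  next
    case 5 then show ?thesis using ij by (simp add: nm)
  next
    case 6 then show ?thesis using assms(1) ij by (simp add: nm)
  qed
qed

lemma take_mrg: "i < k \<Longrightarrow> Suc i < length w \<Longrightarrow> take k (mrg i w) = mrg i (take (Suc k) w)"
  and take_mrg': "k \<le> i \<Longrightarrow> Suc i < length w \<Longrightarrow> take k (mrg i w) = take k w"
  and drop_mrg: "i < k \<Longrightarrow> Suc i < length w \<Longrightarrow> drop k (mrg i w) = drop (Suc k) w"
  and drop_mrg': "k \<le> i \<Longrightarrow> Suc i < length w \<Longrightarrow> drop k (mrg i w) = mrg (i - k) (drop k w)"
proof -
  assume "i < k" "Suc i < length w"
  then obtain m where "k = Suc (i + m)" using less_imp_Suc_add by blast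
  then show "take k (mrg i w) = mrg i (take (Suc k) w)" "drop k (mrg i w) = drop (Suc k) w"
    using \<open>Suc i < length w\<close> by (auto simp: mrg_def min_def drop_take add.commute)
next
  assume "k \<le> i" "Suc i < length w"
  then show "take k (mrg i w) = take k w" "drop k (mrg i w) = mrg (i - k) (drop k w)"
    by (auto simp: mrg_def min_def drop_take add.commute)
qed

text \<open>
  A double sum over pairs \<open>(i, j)\<close> with \<open>j < N - 1\<close> is a sum over pairs of distinct indices
  below \<open>N\<close>, where \<open>j\<close> skips \<open>i\<close>. Written over ordered pairs it lets the terms of a squared
  differential cancel one by one.
\<close>
lemma square_sum_split:
  fixes h :: "nat \<Rightarrow> nat \<Rightarrow> 'x::comm_monoid_add"
  shows "(\<Sum>i<N. \<Sum>j<N - 1. h i j) = (\<Sum>i<N. \<Sum>j<i. h i j) + (\<Sum>i<N. \<Sum>j<i. h j (i - 1))"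
proof -
  have swap: "(\<Sum>i<N. \<Sum>j\<in>{i<..<N}. h i (j - 1)) = (\<Sum>j<N. \<Sum>i<j. h i (j - 1))"
    by (subst sum.Sigma, simp, simp, subst sum.Sigma, simp, simp)
      (rule sum.reindex_bij_witness[of _ "\<lambda>(j, i). (i, j)" "\<lambda>(i, j). (j, i)"]; auto)
  have "(\<Sum>j<N - 1. h i j) = (\<Sum>j<i. h i j) + (\<Sum>j\<in>{i<..<N}. h i (j - 1))" if "i < N" for i
  proof -
    have "(\<Sum>j<N - 1. h i j) = (\<Sum>j<i. h i j) + (\<Sum>j\<in>{i..<N - 1}. h i j)"
      using that by (simp add: lessThan_atLeast0 sum.atLeastLessThan_concat)
    also have "(\<Sum>j\<in>{i..<N - 1}. h i j) = (\<Sum>j\<in>{i<..<N}. h i (j - 1))"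
      using that by (intro sum.reindex_bij_witness[of _ "\<lambda>j. j - 1" Suc]) auto
    finally show ?thesis .
  qed
  then have "(\<Sum>i<N. \<Sum>j<N - 1. h i j) = (\<Sum>i<N. (\<Sum>j<i. h i j) + (\<Sum>j\<in>{i<..<N}. h i (j - 1)))"
    by (intro sum.cong) auto
  then show ?thesis by (simp only: sum.distrib swap)
qed

lemma triangle_swap: "(\<Sum>i<N. \<Sum>j\<in>{i<..<N}. h i j) = (\<Sum>i<(N::nat). \<Sum>j<i. h j i)"
  by (subst sum.Sigma, simp, simp, subst sum.Sigma, simp, simp)
    (rule sum.reindex_bij_witness[of _ "\<lambda>(j, i). (i, j)" "\<lambda>(i, j). (j, i)"]; auto)

text \<open>
  The obstruction is a cycle. Inserting the recursion once more produces triple products,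
  products with a merge in the left or in the right factor, and double merges; each of them
  occurs twice with opposite signs.
\<close>
lemma cobar_diff_obstruction:
  fixes F :: "'a list list \<Rightarrow> 'a list list \<Rightarrow> 'k::field"
  assumes Dprefix: "\<And>i y. Suc i < length w \<Longrightarrow> cobar_diff (F (take (Suc i) w)) y = obstruction F (take (Suc i) w) y"
    and Dsuffix: "\<And>i y. Suc i < length w \<Longrightarrow> cobar_diff (F (drop (Suc i) w)) y = obstruction F (drop (Suc i) w) y"
    and Dmrg: "\<And>i y. Suc i < length w \<Longrightarrow> cobar_diff (F (mrg i w)) y = obstruction F (mrg i w) y"
    and deg: "\<And>i y. Suc i < length w \<Longrightarrow> F (take (Suc i) w) y \<noteq> 0 \<Longrightarrow> wdeg y = i"
  shows "cobar_diff (obstruction F w) y = 0"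
proof -
  define N where "N = length w - 1"
  define t d where "t i = take (Suc i) w" and "d i = drop (Suc i) w" for i
  \<comment> \<open>Triple products, merges in the left factor, merges in the right factor, and double merges.\<close>
  define C where "C i j = conv (conv (F (t j)) (F (slice w (Suc j) (Suc i)))) (F (d i)) y" for i j
  define E where "E i j = conv (F (mrg j (t i))) (F (d i)) y" for i j
  define G where "G i j = conv (F (t j)) (F (mrg (i - j - 1) (d j))) y" for i j
  define M where "M i j = F (mrg j (mrg i w)) y" for i j
  let ?s = "\<lambda>i. (-1 :: 'k) ^ i"
  have len: "length w - 1 = N" by (simp add: N_def)
  have iN: "Suc i < length w \<longleftrightarrow> i < N" for i by (auto simp: N_def)
  have iota: "iota (F (t i)) = (\<lambda>v. ?s i * F (t i) v)" if "i < N" for i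
    using deg[of i] that iN by (auto simp: iota_def t_def fun_eq_iff)
  have 1: "cobar_diff (obstruction F w) y = (\<Sum>i<N. ?s i * (conv (obstruction F (t i)) (F (d i)) y
      + ?s i * conv (F (t i)) (obstruction F (d i)) y - obstruction F (mrg i w) y))"
  proof -
    have eq: "obstruction F w = (\<lambda>v. \<Sum>i<N. ?s i * (conv (F (t i)) (F (d i)) v + (-1) * F (mrg i w) v))"
      unfolding obstruction_def[abs_def] len t_def d_def by (intro ext sum.cong) simp_all
    have "cobar_diff (obstruction F w) y = (\<Sum>i<N. ?s i * cobar_diff (\<lambda>v. conv (F (t i)) (F (d i)) v + (-1) * F (mrg i w) v) y)"
      unfolding eq by (rule cobar_diff_sum) simp
    also have "\<dots> = (\<Sum>i<N. ?s i * (cobar_diff (conv (F (t i)) (F (d i))) y - cobar_diff (F (mrg i w)) y))"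
      by (simp only: cobar_diff_linear) simp
    also have "\<dots> = (\<Sum>i<N. ?s i * (conv (obstruction F (t i)) (F (d i)) y
      + ?s i * conv (F (t i)) (obstruction F (d i)) y - obstruction F (mrg i w) y))"
    proof (rule sum.cong[OF refl])
      fix i assume i: "i \<in> {..<N}"
      have "cobar_diff (F (t i)) = obstruction F (t i)" "cobar_diff (F (d i)) = obstruction F (d i)"
        using i Dprefix[of i] Dsuffix[of i] iN by (auto simp: t_def d_def)
      then show "?s i * (cobar_diff (conv (F (t i)) (F (d i))) y - cobar_diff (F (mrg i w)) y) =
          ?s i * (conv (obstruction F (t i)) (F (d i)) y + ?s i * conv (F (t i)) (obstruction F (d i)) y - obstruction F (mrg i w) y)"
        using i iN Dmrg[of i y] by (simp add: cobar_diff_conv iota conv_scale_left)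
    qed
    finally show ?thesis .
  qed
  have 2: "conv (obstruction F (t i)) (F (d i)) y = (\<Sum>j<i. ?s j * (C i j - E i j))" if "i < N" for i
  proof -
    have "obstruction F (t i) = (\<lambda>v. \<Sum>j<i. ?s j * (conv (F (t j)) (F (slice w (Suc j) (Suc i))) v - F (mrg j (t i)) v))"
    proof
      fix v
      have "length (t i) - 1 = i" using that by (simp add: t_def N_def)
      then show "obstruction F (t i) v = (\<Sum>j<i. ?s j * (conv (F (t j)) (F (slice w (Suc j) (Suc i))) v - F (mrg j (t i)) v))"
        unfolding obstruction_def by (intro sum.cong) (auto simp: t_def slice_def min_def)
    qed
    then show ?thesis by (simp add: conv_sum_left conv_scale_left conv_diff_left C_def E_def)
  qed
  have 3: "conv (F (t i)) (obstruction F (d i)) y = (\<Sum>j\<in>{i<..<N}. ?s (j - i - 1) * (C j i - G j i))" if "i < N" for i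
  proof -
    have "obstruction F (d i) v = (\<Sum>j\<in>{i<..<N}. ?s (j - i - 1) *
        (conv (F (slice w (Suc i) (Suc j))) (F (d j)) v - F (mrg (j - i - 1) (d i)) v))" for v
    proof -
      have l: "length (d i) - 1 = N - i - 1" using that by (simp add: d_def N_def)
      have "slice w (Suc i) (Suc j) = take (Suc (j - i - 1)) (d i)" "d j = drop (Suc (j - i - 1)) (d i)"
        if "i < j" for j
      proof -
        have "Suc (j - i - 1) = j - i" using that by simp
        then show "slice w (Suc i) (Suc j) = take (Suc (j - i - 1)) (d i)" "d j = drop (Suc (j - i - 1)) (d i)"
          using that by (simp_all only: slice_def d_def drop_take drop_drop diff_Suc_Suc) simp_all
      qed
      then show ?thesis
        unfolding obstruction_def l
        by (intro sum.reindex_bij_witness[of _ "\<lambda>j. j - i - 1" "\<lambda>j. Suc (i + j)"]) auto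
    qed
    then have "obstruction F (d i) = (\<lambda>v. \<Sum>j\<in>{i<..<N}. ?s (j - i - 1) *
        (conv (F (slice w (Suc i) (Suc j))) (F (d j)) v - F (mrg (j - i - 1) (d i)) v))" by blast
    then show ?thesis unfolding C_def conv_assoc
      by (simp add: conv_sum_right conv_scale_right conv_diff_right G_def)
  qed
  have 4: "obstruction F (mrg i w) y = (\<Sum>j<N - 1. ?s j *
      (conv (F (take (Suc j) (mrg i w))) (F (drop (Suc j) (mrg i w))) y - M i j))" if "i < N" for i
    using that by (simp add: obstruction_def M_def mrg_props iN N_def)
  define H where "H i j = conv (F (take (Suc j) (mrg i w))) (F (drop (Suc j) (mrg i w))) y" for i j
  have H1: "H i j = G i j" if "j < i" "i < N" for i j
    using that iN by (simp add: H_def G_def take_mrg' drop_mrg' t_def d_def)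
  have H2: "H j (i - 1) = E i j" if "j < i" "i < N" for i j
    using that iN by (simp add: H_def E_def take_mrg drop_mrg t_def d_def)
  have M1: "M j (i - 1) = M i j" if "j < i" "i < N" for i j
    using that mrg_mrg[of j "i - 1" w] iN[of i] by (simp add: M_def)
  have "cobar_diff (obstruction F w) y = (\<Sum>i<N. ?s i * (\<Sum>j<i. ?s j * (C i j - E i j)))
     + (\<Sum>i<N. \<Sum>j\<in>{i<..<N}. ?s (j - i - 1) * (C j i - G j i))
     - (\<Sum>i<N. \<Sum>j<N - 1. ?s i * ?s j * (H i j - M i j))"
  proof -
    have "?s i * (conv (obstruction F (t i)) (F (d i)) y
      + ?s i * conv (F (t i)) (obstruction F (d i)) y - obstruction F (mrg i w) y) =
      ?s i * (\<Sum>j<i. ?s j * (C i j - E i j)) + (\<Sum>j\<in>{i<..<N}. ?s (j - i - 1) * (C j i - G j i))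
      - (\<Sum>j<N - 1. ?s i * ?s j * (H i j - M i j))" if "i < N" for i
    proof -
      have dist: "?s i * (X + ?s i * Y - Z) = ?s i * X + Y - ?s i * Z" for X Y Z
        by (simp add: distrib_left right_diff_distrib)
      show ?thesis
        unfolding 2[OF that] 3[OF that] 4[OF that] H_def dist
        by (simp only: sum_distrib_left mult.assoc)
    qed
    then have "cobar_diff (obstruction F w) y = (\<Sum>i<N. ?s i * (\<Sum>j<i. ?s j * (C i j - E i j))
      + (\<Sum>j\<in>{i<..<N}. ?s (j - i - 1) * (C j i - G j i)) - (\<Sum>j<N - 1. ?s i * ?s j * (H i j - M i j)))"
      unfolding 1 by (intro sum.cong) auto
    then show ?thesis by (simp only: sum.distrib sum_subtractf)
  qed
  also have "\<dots> = (\<Sum>i<N. \<Sum>j<i. ?s i * ?s j * (C i j - E i j) + ?s (i - j - 1) * (C i j - G i j)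
     - ?s i * ?s j * (H i j - M i j) - ?s j * ?s (i - 1) * (H j (i - 1) - M j (i - 1)))"
    unfolding triangle_swap square_sum_split
    by (simp add: sum.distrib sum_subtractf sum_distrib_left mult.assoc)
  also have "\<dots> = 0"
  proof (intro sum.neutral ballI)
    fix i j assume ij: "i \<in> {..<N}" "j \<in> {..<i}"
    then obtain k where k: "i = Suc (j + k)" using less_imp_Suc_add by auto
    have s: "?s (i - j - 1) = - (?s i * ?s j)" "?s j * ?s (i - 1) = - (?s i * ?s j)"
      by (simp_all add: k power_add)
    have "H i j = G i j" "H j (i - 1) = E i j" "M j (i - 1) = M i j"
      using ij H1[of j i] H2[of j i] M1[of j i] by simp_all
    then show "?s i * ?s j * (C i j - E i j) + ?s (i - j - 1) * (C i j - G i j)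
     - ?s i * ?s j * (H i j - M i j) - ?s j * ?s (i - 1) * (H j (i - 1) - M j (i - 1)) = 0"
      unfolding s by (simp add: algebra_simps)
  qed
  finally show ?thesis .
qed

text \<open>
  Words of arbitrary nonempty paths, normal or not, that compose to a path. Merging letters
  leads out of the bar words but not out of these, so that the recursion for \<open>F\<close> need not
  distinguish whether a merged letter is zero in \<open>A\<close>.
\<close>
definition path_word :: "'a list list \<Rightarrow> bool" where
  "path_word w \<longleftrightarrow> w \<noteq> [] \<and> [] \<notin> set w \<and> quiver_path Q (concat w)"

lemma bar_word_iff: "bar_word Q R w \<longleftrightarrow> path_word w \<and> (\<forall>a\<in>set w. normal R a)"
proof (cases "w \<noteq> [] \<and> [] \<notin> set w")
  case True
  then have "\<forall>p\<in>set w. p \<noteq> []" by metis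
  then show ?thesis
    using True quiver_path_concat[of w] by (auto simp: bar_word_def path_word_def normal_path_def)
next
  case False
  then show ?thesis by (auto simp: bar_word_def path_word_def normal_path_def quiver_path_def)
qed

lemma path_word_append:
  assumes "path_word (u @ v)" 
  shows "u \<noteq> [] \<Longrightarrow> path_word u" "v \<noteq> [] \<Longrightarrow> path_word v"
proof -
  assume "u \<noteq> []"
  then have "concat u \<noteq> []" using assms by (cases u) (auto simp: path_word_def)
  then show "path_word u" using assms \<open>u \<noteq> []\<close> quiver_path_sublist[of "concat u @ concat v" "concat u"]
    by (auto simp: path_word_def)
next
  assume "v \<noteq> []"
  then have "concat v \<noteq> []" using assms by (cases v) (auto simp: path_word_def)
  then show "path_word v" using assms \<open>v \<noteq> []\<close> quiver_path_sublist[of "concat u @ concat v" "concat v"]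
    by (auto simp: path_word_def)
qed

lemma set_mrg:
  assumes "Suc i < length w"
  shows "set (mrg i w) = set (take i w) \<union> {w ! i @ w ! Suc i} \<union> set (drop (Suc (Suc i)) w)"
    and "set w = set (take i w) \<union> {w ! i, w ! Suc i} \<union> set (drop (Suc (Suc i)) w)"
proof -
  show "set (mrg i w) = set (take i w) \<union> {w ! i @ w ! Suc i} \<union> set (drop (Suc (Suc i)) w)"
    by (simp add: mrg_def)
  have "w = take i w @ [w ! i, w ! Suc i] @ drop (Suc (Suc i)) w"
    using assms id_take_nth_drop[of i w] Cons_nth_drop_Suc[of "Suc i" w] by simp
  then have "set w = set (take i w @ [w ! i, w ! Suc i] @ drop (Suc (Suc i)) w)" by (rule arg_cong)
  then show "set w = set (take i w) \<union> {w ! i, w ! Suc i} \<union> set (drop (Suc (Suc i)) w)" by simp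
qed

lemma path_word_parts:
  assumes "path_word w" "Suc i < length w"
  shows "path_word (take (Suc i) w)" "path_word (drop (Suc i) w)" "path_word (mrg i w)"
proof -
  have "take (Suc i) w \<noteq> []" "drop (Suc i) w \<noteq> []" using assms(2) by auto
  moreover have "path_word (take (Suc i) w @ drop (Suc i) w)" using assms(1) by simp
  ultimately show "path_word (take (Suc i) w)" "path_word (drop (Suc i) w)"
    using path_word_append by blast+
  have ne: "[] \<notin> set w" using assms(1) by (simp add: path_word_def)
  then have "w ! i \<noteq> []" using assms(2) nth_mem[of i w] by (metis Suc_lessD)
  then have "[] \<notin> set (mrg i w)"
    unfolding set_mrg(1)[OF assms(2)] using ne by (auto dest: in_set_takeD in_set_dropD)
  moreover have "mrg i w \<noteq> []" by (simp add: mrg_def)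
  ultimately show "path_word (mrg i w)"
    using assms(1) mrg_props(2)[OF assms(2)] by (simp add: path_word_def)
qed

lemma not_normal_append: "\<not> normal R a \<or> \<not> normal R b \<Longrightarrow> \<not> normal R (a @ b)"
  using normal_appendD by blast

lemma obstruction_cong:
  assumes "\<And>v. v \<noteq> [] \<Longrightarrow> length v < length w \<Longrightarrow> F v = G v"
  shows "obstruction F w = obstruction G w"
proof
  fix y
  show "obstruction F w y = obstruction G w y"
    unfolding obstruction_def
  proof (rule sum.cong[OF refl])
    fix i assume "i \<in> {..<length w - 1}"
    then have i: "Suc i < length w" by auto
    then have "w \<noteq> []" by auto
    then have "F (take (Suc i) w) = G (take (Suc i) w)" "F (drop (Suc i) w) = G (drop (Suc i) w)"
      "F (mrg i w) = G (mrg i w)"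
      using i mrg_props(1)[OF i] by (auto intro!: assms simp: mrg_def)
    then show "(-1) ^ i * (conv (F (take (Suc i) w)) (F (drop (Suc i) w)) y - F (mrg i w) y) =
        (-1) ^ i * (conv (G (take (Suc i) w)) (G (drop (Suc i) w)) y - G (mrg i w) y)" by simp
  qed
qed

text \<open>
  The requirements on the value \<open>u\<close> of \<open>F\<close> at \<open>w\<close>. The degree is part of them because the
  induction uses it for the sign in the Leibniz rule.
\<close>
definition is_lift :: "('a list list \<Rightarrow> 'a list list \<Rightarrow> 'k::field) \<Rightarrow> 'a list list \<Rightarrow> ('a list list \<Rightarrow> 'k) \<Rightarrow> bool" where
  "is_lift F w u \<longleftrightarrow> {y. u y \<noteq> 0} \<subseteq> Words (concat w) \<and> (\<forall>y. u y \<noteq> 0 \<longrightarrow> Suc (wdeg y) = length w) \<and>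
     (\<forall>y. cobar_diff u y = obstruction F w y)"

text \<open>
  Recursion on the length of the bar word, in which the values at shorter words are already
  chosen.
\<close>
primrec lift_upto :: "nat \<Rightarrow> 'a list list \<Rightarrow> 'a list list \<Rightarrow> 'k::field" where
  "lift_upto 0 = (\<lambda>w y. 0)"
| "lift_upto (Suc n) = (\<lambda>w. if length w = Suc n then
      (if \<not> bar_word Q R w then \<lambda>y. 0 else if n = 0 then single (arr (concat w))
       else SOME u. is_lift (lift_upto n) w u)
     else lift_upto n w)"

definition lift :: "'a list list \<Rightarrow> 'a list list \<Rightarrow> 'k::field" where
  "lift w = lift_upto (length w) w"

lemma lift_upto_eq: "length w \<le> n \<Longrightarrow> lift_upto n w = lift w"
proof (induction n)
  case (Suc n)
  show ?case
  proof (cases "length w = Suc n")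
    case True
    then show ?thesis by (simp only: lift_def)
  qed (use Suc in simp)
qed (simp add: lift_def)

lemma lift_not_bar: "\<not> bar_word Q R w \<Longrightarrow> lift w = (\<lambda>y. 0)"
  unfolding lift_def by (cases "length w") simp_all

lemma lift_letter: "bar_word Q R [a] \<Longrightarrow> lift [a] = single (arr a)"
  unfolding lift_def by simp

lemma lift_choice:
  assumes "bar_word Q R w" "length w \<ge> 2"
  shows "lift w = (SOME u :: _ \<Rightarrow> 'k::field. is_lift lift w u)"
proof -
  obtain n where n: "length w = Suc n" "n \<noteq> 0" using assms(2) by (cases "length w") auto
  have "obstruction (lift_upto n) w = (obstruction lift w :: _ \<Rightarrow> 'k)"
    by (rule obstruction_cong) (use n in \<open>auto intro!: lift_upto_eq\<close>)
  then have eq: "is_lift (lift_upto n) w u \<longleftrightarrow> is_lift lift w u" for u :: "_ \<Rightarrow> 'k" by (simp add: is_lift_def)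
  have "lift w = (SOME u :: _ \<Rightarrow> 'k. is_lift (lift_upto n) w u)"
    unfolding lift_def n(1) using n assms(1) by simp
  then show ?thesis by (simp only: eq)
qed

lemma Words_normal:
  assumes "normal R p" "y \<in> Words p"
  shows "y = arr p"
proof -
  have "length g = 1" if g: "g \<in> set y" for g
  proof -
    have "chain Q R (cdeg g) g" using assms(2) g by (auto simp: Words_def intro: chain_cdeg)
    moreover have "sublist g p" using g assms(2) by (auto simp: Words_def dest!: split_list)
    then have "normal R g" using assms(1) normal_sublist by blast
    ultimately have "chain Q R 0 g" using chain_Suc_not_normal by (cases "cdeg g") auto
    then obtain us where "chain_factorization Q R us" "length us = 1" "concat us = g" by (auto simp: chain_def)
    then show ?thesis by (auto simp: length_Suc_conv factorization_single)
  qed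
  moreover have "(\<forall>g\<in>set y. length g = 1) \<Longrightarrow> y = arr (concat y)"
  proof (induction y)
    case (Cons g y)
    then obtain x where "g = [x]" by (auto simp: length_Suc_conv)
    then show ?case using Cons by simp
  qed simp
  ultimately show ?thesis using assms(2) by (simp add: Words_def)
qed

lemma conv_support:
  assumes "{y. f y \<noteq> 0} \<subseteq> Words p" "{y. g y \<noteq> 0} \<subseteq> Words q" "conv f g y \<noteq> 0"
  shows "\<exists>u v. y = u @ v \<and> f u \<noteq> 0 \<and> g v \<noteq> 0" "y \<in> Words (p @ q)"
proof -
  obtain k where "f (take k y) * g (drop k y) \<noteq> 0"
    using assms(3) unfolding conv_def by (auto elim: sum.not_neutral_contains_not_neutral)
  then have k: "f (take k y) \<noteq> 0" "g (drop k y) \<noteq> 0" by auto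
  then show "\<exists>u v. y = u @ v \<and> f u \<noteq> 0 \<and> g v \<noteq> 0" by (metis append_take_drop_id)
  have "take k y \<in> Words p" "drop k y \<in> Words q" using assms(1,2) k by auto
  then have "take k y @ drop k y \<in> Words (p @ q)" unfolding Words_def by (auto simp del: append_take_drop_id)
  then show "y \<in> Words (p @ q)" by simp
qed

lemma obstruction_support:
  assumes "\<And>v. path_word v \<Longrightarrow> length v < length w \<Longrightarrow> is_lift F v (F v)" "path_word w" "obstruction F w y \<noteq> 0"
  shows "y \<in> Words (concat w) \<and> wdeg y + 2 = length w"
proof -
  obtain i where i: "i < length w - 1"
    "(-1) ^ i * (conv (F (take (Suc i) w)) (F (drop (Suc i) w)) y - F (mrg i w) y) \<noteq> 0"
    using assms(3) unfolding obstruction_def by (auto elim: sum.not_neutral_contains_not_neutral)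
  then have iw: "Suc i < length w" by simp
  note parts = path_word_parts[OF assms(2) iw]
  have L: "is_lift F (take (Suc i) w) (F (take (Suc i) w))" "is_lift F (drop (Suc i) w) (F (drop (Suc i) w))"
    "is_lift F (mrg i w) (F (mrg i w))"
    using parts iw mrg_props[OF iw] by (auto intro!: assms(1))
  have "conv (F (take (Suc i) w)) (F (drop (Suc i) w)) y \<noteq> 0 \<or> F (mrg i w) y \<noteq> 0" using i(2) by auto
  then consider "conv (F (take (Suc i) w)) (F (drop (Suc i) w)) y \<noteq> 0" | "F (mrg i w) y \<noteq> 0" by blast
  then show ?thesis
  proof cases
    case 1
    have "{v. F (take (Suc i) w) v \<noteq> 0} \<subseteq> Words (concat (take (Suc i) w))"
      "{v. F (drop (Suc i) w) v \<noteq> 0} \<subseteq> Words (concat (drop (Suc i) w))"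
      using L by (simp_all add: is_lift_def)
    note c = conv_support[OF this 1]
    have "concat (take (Suc i) w) @ concat (drop (Suc i) w) = concat w"
      by (metis append_take_drop_id concat_append)
    moreover obtain u v where "y = u @ v" "F (take (Suc i) w) u \<noteq> 0" "F (drop (Suc i) w) v \<noteq> 0" using c(1) by blast
    then have "y = u @ v" "Suc (wdeg u) = length (take (Suc i) w)" "Suc (wdeg v) = length (drop (Suc i) w)"
      using L unfolding is_lift_def by blast+
    then have "wdeg y + 2 = length (take (Suc i) w) + length (drop (Suc i) w)"
      by (simp del: length_take length_drop)
    ultimately show ?thesis using c(2) iw by simp
  next
    case 2
    have "y \<in> Words (concat (mrg i w))" "Suc (wdeg y) = length (mrg i w)"
      using L(3) 2 by (auto simp: is_lift_def)
    then show ?thesis using mrg_props[OF iw] iw by simp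
  qed
qed

text \<open>
  Over a path that is not normal the obstruction is a cycle, hence a boundary. Over a normal
  path all words consist of arrows and have degree zero; so the obstruction can only be
  nonzero for two letters, where \<open>F [a] F [b] = F [ab]\<close> makes it vanish.
\<close>
lemma lift_exists:
  assumes IH: "\<And>v. path_word v \<Longrightarrow> length v < length w \<Longrightarrow> is_lift lift v (lift v :: _ \<Rightarrow> 'k::field)"
    and w: "bar_word Q R w" "2 \<le> length w"
  shows "\<exists>u :: _ \<Rightarrow> 'k. is_lift lift w u"
proof -
  let ?p = "concat w"
  let ?z = "obstruction lift w :: _ \<Rightarrow> 'k"
  have pw: "path_word w" using w bar_word_iff by blast
  have path: "quiver_path Q ?p" using pw by (simp add: path_word_def)
  have supp: "y \<in> Words ?p \<and> wdeg y + 2 = length w" if "?z y \<noteq> 0" for y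
    using obstruction_support[of w lift y] IH pw that by blast
  show ?thesis
  proof (cases "normal R ?p")
    case True
    have "?z y = 0" for y
    proof (rule ccontr)
      assume z: "?z y \<noteq> 0"
      then have y: "y = arr ?p" using supp[of y] Words_normal[OF True] by blast
      moreover have "set ?p \<subseteq> arcs Q" using path by (simp add: quiver_path_iff)
      ultimately have "wdeg y = 0" using wdeg_arr[of ?p] by simp
      then have "length w = 2" using supp[OF z] by simp
      then obtain a b where ab: "w = [a, b]" by (auto simp: length_Suc_conv numeral_2_eq_2)
      have "bar_word Q R [a]" "bar_word Q R [b]" using w(1) ab by (simp_all add: bar_word_def)
      moreover have "bar_word Q R [a @ b]"
        using True path ab by (simp add: bar_word_def normal_path_def)
      ultimately have "?z y = 0"
        by (simp add: obstruction_def ab lift_letter mrg_def conv_single)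
      then show False using z by simp
    qed
    then show ?thesis
      by (intro exI[of _ "\<lambda>y. 0"]) (simp add: is_lift_def cobar_diff_zero)
  next
    case False
    have "cobar_diff ?z y = 0" for y
    proof (rule cobar_diff_obstruction)
      fix i y assume i: "Suc i < length w"
      note parts = path_word_parts[OF pw i]
      have L: "is_lift lift (take (Suc i) w) (lift (take (Suc i) w) :: _ \<Rightarrow> 'k)"
        "is_lift lift (drop (Suc i) w) (lift (drop (Suc i) w) :: _ \<Rightarrow> 'k)"
        "is_lift lift (mrg i w) (lift (mrg i w) :: _ \<Rightarrow> 'k)"
        using parts i mrg_props[OF i] by (auto intro!: IH)
      then show "cobar_diff (lift (take (Suc i) w)) y = (obstruction lift (take (Suc i) w) y :: 'k)"
        "cobar_diff (lift (drop (Suc i) w)) y = (obstruction lift (drop (Suc i) w) y :: 'k)"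
        "cobar_diff (lift (mrg i w)) y = (obstruction lift (mrg i w) y :: 'k)" by (auto simp: is_lift_def)
      show "wdeg y = i" if "lift (take (Suc i) w) y \<noteq> (0::'k)"
        using L(1) that i by (auto simp: is_lift_def)
    qed
    moreover have "{y. ?z y \<noteq> 0} \<subseteq> Words ?p" using supp by auto
    ultimately obtain u :: "_ \<Rightarrow> 'k" where u: "{y. u y \<noteq> 0} \<subseteq> Words ?p" "\<forall>y. cobar_diff u y = ?z y"
      using acyclic[OF path False] by blast
    \<comment> \<open>\<open>D\<close> lowers \<open>wdeg\<close> by one, so the other components of \<open>u\<close> do not contribute to the obstruction.\<close>
    define u' where "u' = (\<lambda>y. if Suc (wdeg y) = length w then u y else 0)"
    have "cobar_diff u' y = ?z y" for y
    proof (cases "wdeg y + 2 = length w")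
      case True
      have "cobar_diff u' y = cobar_diff u y" by (rule cobar_diff_cong) (use True in \<open>simp add: u'_def wdeg_merge\<close>)
      then show ?thesis using u by simp
    next
      case False
      have "cobar_diff u' y = cobar_diff (\<lambda>x. 0) y" by (rule cobar_diff_cong) (use False in \<open>auto simp: u'_def wdeg_merge\<close>)
      then show ?thesis using supp[of y] False by (auto simp: cobar_diff_zero)
    qed
    moreover have "{y. u' y \<noteq> 0} \<subseteq> Words ?p" using u(1) by (auto simp: u'_def)
    ultimately show ?thesis by (intro exI[of _ u']) (simp add: is_lift_def u'_def)
  qed
qed

text \<open>
  A letter that is zero in \<open>A\<close> survives in one factor of each product and in each merged
  word, and \<open>F\<close> is zero there.
\<close>
lemma obstruction_not_bar:
  assumes "\<not> bar_word Q R w" "path_word w"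
  shows "obstruction lift w y = (0::'k::field)"
  unfolding obstruction_def
proof (rule sum.neutral, rule ballI)
  fix i assume "i \<in> {..<length w - 1}"
  then have i: "Suc i < length w" by auto
  obtain a where a: "a \<in> set w" "\<not> normal R a" using assms bar_word_iff by blast
  have "set w = set (take (Suc i) w) \<union> set (drop (Suc i) w)" by (metis append_take_drop_id set_append)
  then have "\<not> bar_word Q R (take (Suc i) w) \<or> \<not> bar_word Q R (drop (Suc i) w)"
    using a bar_word_iff by blast
  then have "lift (take (Suc i) w) = (\<lambda>y. 0::'k) \<or> lift (drop (Suc i) w) = (\<lambda>y. 0::'k)"
    using lift_not_bar by blast
  then have 1: "conv (lift (take (Suc i) w)) (lift (drop (Suc i) w)) y = (0::'k)"
    by (auto simp: conv_def)
  have "\<exists>b\<in>set (mrg i w). \<not> normal R b"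
    using a set_mrg[OF i] not_normal_append[of "w ! i" "w ! Suc i"] by auto
  then have "\<not> bar_word Q R (mrg i w)" using bar_word_iff by blast
  then have "lift (mrg i w) y = (0::'k)" by (simp add: lift_not_bar)
  then show "(- 1) ^ i * (conv (lift (take (Suc i) w)) (lift (drop (Suc i) w)) y - lift (mrg i w) y) = (0::'k)"
    using 1 by simp
qed

lemma lift_is_lift: "path_word w \<Longrightarrow> is_lift lift w (lift w :: _ \<Rightarrow> 'k::field)"
proof (induction "length w" arbitrary: w rule: less_induct)
  case less
  consider "\<not> bar_word Q R w" | a where "bar_word Q R w" "w = [a]" | "bar_word Q R w" "2 \<le> length w"
    using less.prems by (cases w rule: remdups_adj.cases) (auto simp: path_word_def)
  then show ?case
  proof cases
    case 1
    then show ?thesis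
      using obstruction_not_bar[OF 1 less.prems, where 'k = 'k] by (simp add: is_lift_def lift_not_bar cobar_diff_zero)
  next
    case 2
    have "set a \<subseteq> arcs Q" using less.prems 2 by (auto simp: path_word_def quiver_path_iff)
    then have aW: "arr a \<in> Words a" "wdeg (arr a) = 0" using arr_chains wdeg_arr by (auto simp: Words_def)
    have "cobar_diff (single (arr a)) y = (0::'k)" for y
    proof -
      have "merge k l y \<noteq> arr a" if "(k, l) \<in> Blk y" for k l
      proof
        assume m: "merge k l y = arr a"
        have g: "k < l" "l \<le> length y" "good (slice y k l)" using that by (auto simp: Blk_def)
        have "wdeg (merge k l y) = Suc (wdeg y)" by (rule wdeg_merge[OF g])
        then show False using m aW by simp
      qed
      then show ?thesis unfolding cobar_diff_Blk by (auto simp: single_def intro!: sum.neutral)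
    qed
    then show ?thesis using 2 aW by (auto simp: is_lift_def lift_letter obstruction_def single_def)
  next
    case 3
    have "\<exists>u :: _ \<Rightarrow> 'k. is_lift lift w u" by (rule lift_exists[OF less.hyps 3]) auto
    then show ?thesis unfolding lift_choice[OF 3] by (rule someI_ex)
  qed
qed

lemma lift_support:
  assumes "lift w y \<noteq> (0::'k::field)"
  shows "bar_word Q R w \<and> y \<in> Words (concat w) \<and> Suc (wdeg y) = length w"
proof -
  have bar: "bar_word Q R w"
  proof (rule ccontr)
    assume "\<not> bar_word Q R w"
    then have "lift w = (\<lambda>y. 0::'k)" by (rule lift_not_bar)
    then show False using assms by simp
  qed
  then have "path_word w" by (simp add: bar_word_iff)
  then have "is_lift lift w (lift w :: _ \<Rightarrow> 'k)" by (rule lift_is_lift)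
  then show ?thesis using assms bar unfolding is_lift_def by blast
qed

lemma cobar_diff_lift: "bar_word Q R w \<Longrightarrow> cobar_diff (lift w) y = (obstruction lift w y :: 'k::field)"
  using lift_is_lift[of w, where 'k='k] bar_word_iff[of w] by (simp add: is_lift_def)

text \<open>
  The linear part of \<open>F\<close>: it maps the bar construction to the span of the chains.
\<close>
definition kappa :: "'a list list \<Rightarrow> 'k::field" where
  "kappa w = lift w [concat w]"

lemma sum_nonzeroD: "sum g A \<noteq> (0 :: 'x::comm_monoid_add) \<Longrightarrow> \<exists>a\<in>A. g a \<noteq> 0"
  by (meson sum.neutral)

lemma factorization_consecutive: "chain_factorization Q R (A @ [p, q] @ B) \<Longrightarrow> \<not> normal R (p @ q)"
  by (auto simp: chain_factorization_def successively_append_iff zero_minimally_def)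

lemma factorization_nth:
  assumes "chain_factorization Q R w" "Suc i < length w"
  shows "\<not> normal R (w ! i @ w ! Suc i)"
proof -
  have "w = take i w @ [w ! i, w ! Suc i] @ drop (Suc (Suc i)) w"
    using assms(2) id_take_nth_drop[of i w] Cons_nth_drop_Suc[of "Suc i" w] by simp
  then show ?thesis using assms(1) factorization_consecutive by metis
qed

lemma factorization_bar_word: "chain_factorization Q R us \<Longrightarrow> bar_word Q R us"
  unfolding chain_factorization_def bar_word_def by (auto elim: successively_mono)

lemma lift_Nil: "path_word w \<Longrightarrow> lift w [] = (0 :: 'k::field)"
proof (rule ccontr)
  assume "path_word w" "lift w [] \<noteq> (0::'k)"
  then have "concat w = []" using lift_support[OF \<open>lift w [] \<noteq> (0::'k)\<close>] by (simp add: Words_def)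
  then show False using \<open>path_word w\<close> by (simp add: path_word_def quiver_path_def)
qed

lemma kappa_not_bar: "\<not> bar_word Q R w \<Longrightarrow> kappa w = 0"
  by (simp add: kappa_def lift_not_bar)

text \<open>
  A word with a single letter has no good blocks, and it is not a product of nonempty words.
  Hence the equation for \<open>D (F w)\<close>, read at this word, contains only the merged words.
\<close>
lemma kappa_boundary:
  assumes w: "bar_word Q R w"
  shows "(\<Sum>i<length w - 1. (-1) ^ i * kappa (mrg i w)) = (0 :: 'k::field)"
proof -
  let ?p = "concat w"
  have "Blk [?p] = {}"
  proof -
    have "(k, l) \<notin> Blk [?p]" for k l
    proof
      assume "(k, l) \<in> Blk [?p]"
      then have "good [?p]" by (auto simp: Blk_def slice_def le_Suc_eq)
      then have c: "is_chain ?p" "chain Q R (Suc (cdeg ?p)) ?p" by (auto simp: good_def)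
      show False using chain_unique[OF c(2) chain_cdeg[OF c(1)]] by simp
    qed
    then show ?thesis by auto
  qed
  then have "cobar_diff (lift w) [?p] = (0::'k)" by (simp add: cobar_diff_Blk)
  then have "obstruction lift w [?p] = (0::'k)" using cobar_diff_lift[OF w, of "[?p]", where 'k='k] by simp
  moreover have "obstruction lift w [?p] = (\<Sum>i<length w - 1. - ((-1) ^ i * kappa (mrg i w)) :: 'k)"
    unfolding obstruction_def
  proof (rule sum.cong[OF refl])
    fix i assume "i \<in> {..<length w - 1}"
    then have i: "Suc i < length w" by auto
    have "path_word w" using w bar_word_iff by blast
    note parts = path_word_parts[OF this i]
    have "conv (lift (take (Suc i) w)) (lift (drop (Suc i) w)) [?p] = (0::'k)"
      using lift_Nil[OF parts(1), where 'k='k] lift_Nil[OF parts(2), where 'k='k] by (simp add: conv_def)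
    then show "(-1) ^ i * (conv (lift (take (Suc i) w)) (lift (drop (Suc i) w)) [?p] - lift (mrg i w) [?p]) =
        - ((-1) ^ i * kappa (mrg i w) :: 'k)"
      using mrg_props(2)[OF i] by (simp add: kappa_def)
  qed
  ultimately show ?thesis by (simp add: sum_negf)
qed

text \<open>
  Let \<open>us\<close> consist of \<open>vs\<close> and a last piece \<open>u\<close>, and compare the coefficients of \<open>D (F us)\<close>
  at the lower word \<open>(\<gamma>, arrows of u)\<close>, \<open>\<gamma> = concat vs\<close>. Its only good block is the whole
  word, so the left side is \<open>\<plusminus> kappa us\<close>. On the right side merged words vanish, since
  neighbours in \<open>us\<close> have product zero, and among the products only \<open>F vs F [u]\<close> reaches the
  end of \<open>\<gamma>\<close> with its first factor. It contributes \<open>kappa vs\<close>.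
\<close>
lemma kappa_chain: "chain_factorization Q R us \<Longrightarrow> kappa us = (1 :: 'k::field)"
proof (induction us rule: rev_induct)
  case Nil
  then show ?case by (simp add: chain_factorization_def)
next
  case (snoc u vs)
  show ?case
  proof (cases "vs = []")
    case True
    then obtain x where u: "u = [x]" using snoc.prems by (auto simp: factorization_single length_Suc_conv)
    have "bar_word Q R [u]" using snoc.prems True factorization_bar_word by fastforce
    then show ?thesis using True u by (simp add: kappa_def lift_letter single_def)
  next
    case False
    define w where "w = vs @ [u]"
    define m where "m = length vs - 1"
    define \<gamma> where "\<gamma> = concat vs"
    \<comment> \<open>The lower word at which the coefficients are compared.\<close>
    define x where "x = [\<gamma>] @ arr u"
    have fw: "chain_factorization Q R w" using snoc.prems by (simp add: w_def)
    have fv: "chain_factorization Q R vs" using snoc.prems False factorization_butlast by blast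
    have kv: "kappa vs = (1::'k)" by (rule snoc.IH[OF fv])
    have bw: "bar_word Q R w" by (rule factorization_bar_word[OF fw])
    have pw: "path_word w" using bw bar_word_iff by blast
    have lv: "length vs = Suc m" using False by (simp add: m_def)
    have c\<gamma>: "chain Q R m \<gamma>" using fv lv by (auto simp: chain_def \<gamma>_def)
    then have d\<gamma>: "cdeg \<gamma> = m" "is_chain \<gamma>" by (auto simp: is_chain_def intro: cdeg_eq)
    have cw: "chain Q R (Suc m) (\<gamma> @ u)" using fw lv by (auto simp: chain_def \<gamma>_def w_def intro!: exI[of _ w])
    have path: "quiver_path Q (\<gamma> @ u)" by (rule chain_path[OF cw])
    have arcs: "set u \<subseteq> arcs Q" using path by (auto simp: quiver_path_iff)
    have nu: "normal R u" "u \<noteq> []" using bw by (auto simp: bar_word_def normal_path_def quiver_path_def w_def)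
    have xlo: "x = lo ([], \<gamma>, u, [])" by (simp add: x_def)
    have i: "([], \<gamma>, u, []) \<in> Idx (\<gamma> @ u)"
      using cw d\<gamma> nu arr_chains[OF arcs] by (auto simp: Idx_def Words_def)
    have "(k, l) \<in> Blk x \<longleftrightarrow> k = 0 \<and> l = Suc (length u)" for k l
      using lo_block_start[OF i, of k l] lo_block_at(1)[OF path i, of l] by (auto simp: xlo)
    then have "Blk x = {(0, Suc (length u))}" by auto
    moreover have "merge 0 (Suc (length u)) x = [\<gamma> @ u]" using lo_block_at(2)[OF path i] by (simp add: xlo)
    moreover have "wdeg (take (Suc 0) x) = m" by (simp add: x_def d\<gamma>)
    ultimately have "cobar_diff (lift w) x = (-1) ^ m * (kappa w :: 'k)"
      by (simp add: cobar_diff_Blk kappa_def) (simp add: w_def \<gamma>_def)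
    moreover have "obstruction lift w x = ((-1) ^ m :: 'k)"
    proof -
      have lw: "length w - 1 = Suc m" using lv by (simp add: w_def)
      have "obstruction lift w x = (\<Sum>i<Suc m. (-1) ^ i * (conv (lift (take (Suc i) w)) (lift (drop (Suc i) w)) x) :: 'k)"
        unfolding obstruction_def lw
      proof (rule sum.cong[OF refl])
        fix i assume "i \<in> {..<Suc m}"
        then have i: "Suc i < length w" using lw by auto
        have "w ! i @ w ! Suc i \<in> set (mrg i w)" by (simp add: mrg_def)
        then have "\<not> bar_word Q R (mrg i w)"
          using factorization_nth[OF fw i] bar_word_iff by blast
        then show "(-1) ^ i * (conv (lift (take (Suc i) w)) (lift (drop (Suc i) w)) x - lift (mrg i w) x) =
            ((-1) ^ i * conv (lift (take (Suc i) w)) (lift (drop (Suc i) w)) x :: 'k)"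
          by (simp add: lift_not_bar)
      qed
      also have "\<dots> = (-1) ^ m * conv (lift (take (Suc m) w)) (lift (drop (Suc m) w)) x"
      proof -
        have "conv (lift (take (Suc i) w)) (lift (drop (Suc i) w)) x = (0::'k)" if "i < m" for i
        proof (rule ccontr)
          assume nz: "conv (lift (take (Suc i) w)) (lift (drop (Suc i) w)) x \<noteq> (0::'k)"
          have "{y. lift v y \<noteq> (0::'k)} \<subseteq> Words (concat v)" for v using lift_support by blast
          from conv_support(1)[OF this this nz] obtain a b where ab: "x = a @ b"
            "lift (take (Suc i) w) a \<noteq> (0::'k)" by blast
          have si: "Suc i < length w" using that lw by auto
          have a: "concat a = concat (take (Suc i) w)" using lift_support[OF ab(2)] by (simp add: Words_def)
          have "path_word (take (Suc i) w)" using path_word_parts[OF pw si] by simp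
          then have "a \<noteq> []" using a by (auto simp: path_word_def quiver_path_def)
          then have "length \<gamma> \<le> length (concat a)" using ab(1) by (cases a) (auto simp: x_def)
          moreover have "length (concat (take (Suc i) w)) < length \<gamma>"
          proof -
            have "\<gamma> = concat (take (Suc i) vs) @ concat (drop (Suc i) vs)"
              unfolding \<gamma>_def by (metis append_take_drop_id concat_append)
            moreover have "drop (Suc i) vs \<noteq> []" using that lv by simp
            then obtain g gs where "drop (Suc i) vs = g # gs" by (cases "drop (Suc i) vs") auto
            moreover from this have "g \<in> set vs" by (metis in_set_dropD list.set_intros(1))
            then have "g \<noteq> []" using factorization_nonempty[OF fv] by blast
            moreover have "take (Suc i) w = take (Suc i) vs" using that lv by (simp add: w_def)
            ultimately show ?thesis by simp
          qed
          ultimately show False using a by simp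
        qed
        then show ?thesis by simp
      qed
      also have "\<dots> = (-1) ^ m * conv (lift vs) (lift [u]) x" using lv by (simp add: w_def)
      also have "conv (lift vs) (lift [u]) x = (1::'k)"
      proof -
        have "bar_word Q R [u]" using bw by (simp add: bar_word_def w_def)
        then have lu: "lift [u] = (single (arr u) :: _ \<Rightarrow> 'k)" by (rule lift_letter)
        have "drop k x = arr u \<longleftrightarrow> k = 1" if "k \<le> length x" for k
        proof
          assume "drop k x = arr u"
          then have "length (drop k x) = length u" by simp
          moreover have "length (drop k x) + k = length x" using that by simp
          moreover have "length x = Suc (length u)" by (simp add: x_def)
          ultimately show "k = 1" by simp
        qed (simp add: x_def)
        then have "conv (lift vs) (lift [u]) x = (\<Sum>k\<le>length x. if k = 1 then lift vs (take k x) else (0::'k))"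
          unfolding conv_def lu by (intro sum.cong) (auto simp: single_def)
        also have "\<dots> = lift vs (take 1 x)" by (subst sum.delta) (simp_all add: x_def)
        also have "\<dots> = 1" using kv by (simp add: kappa_def x_def \<gamma>_def)
        finally show ?thesis .
      qed
      finally show ?thesis by simp
    qed
    ultimately show ?thesis using cobar_diff_lift[OF bw, of x, where 'k='k] by (simp add: w_def)
  qed
qed

section \<open>Homology of the bar construction\<close>

text \<open>
  The linear extension of a function \<open>K\<close> on words.
\<close>
definition ev :: "('b \<Rightarrow> 'k::field) \<Rightarrow> ('b \<Rightarrow> 'k) \<Rightarrow> 'k" where
  "ev K x = (\<Sum>w | x w \<noteq> 0. x w * K w)"

lemma ev_alt: "finite J \<Longrightarrow> {w. x w \<noteq> 0} \<subseteq> J \<Longrightarrow> ev K x = (\<Sum>w\<in>J. x w * K w)"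
  unfolding ev_def by (rule sum.mono_neutral_left) auto

lemma ev_linear:
  assumes "finsupp x" "finsupp y"
  shows "ev K (\<lambda>w. x w + c * y w) = ev K x + c * ev K y"
proof -
  let ?J = "{w. x w \<noteq> 0} \<union> {w. y w \<noteq> 0}"
  have J: "finite ?J" using assms by (simp add: finsupp_def)
  have "ev K (\<lambda>w. x w + c * y w) = (\<Sum>w\<in>?J. (x w + c * y w) * K w)"
    by (rule ev_alt[OF J]) auto
  also have "\<dots> = (\<Sum>w\<in>?J. x w * K w) + c * (\<Sum>w\<in>?J. y w * K w)"
    by (simp add: algebra_simps sum.distrib sum_distrib_left)
  also have "\<dots> = ev K x + c * ev K y"
    using ev_alt[OF J, of x K] ev_alt[OF J, of y K] by simp
  finally show ?thesis .
qed

lemma ev_single: "ev K (single w) = K w"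
  using ev_alt[of "{w}" "single w" K] by (simp add: single_def)

lemma ev_zero: "ev K (\<lambda>w. 0) = 0"
  by (simp add: ev_def)

lemma ev_cong: "(\<And>w. x w \<noteq> 0 \<Longrightarrow> K w = K' w) \<Longrightarrow> ev K x = ev K' x"
  unfolding ev_def by (intro sum.cong) auto

lemma ev_sum:
  assumes "finite J" "\<And>i. i \<in> J \<Longrightarrow> finsupp (g i)"
  shows "ev K (\<lambda>x. \<Sum>i\<in>J. c i * g i x) = (\<Sum>i\<in>J. c i * ev K (g i))"
  using assms
proof (induction J rule: finite_induct)
  case (insert i J)
  have "ev K (\<lambda>x. (\<Sum>i\<in>J. c i * g i x) + c i * g i x) = ev K (\<lambda>x. \<Sum>i\<in>J. c i * g i x) + c i * ev K (g i)"
    using insert by (intro ev_linear finsupp_sum) auto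
  then show ?case using insert by (simp add: add.commute)
qed (simp add: ev_zero)

lemma bar_diff_word_alt:
  "bar_diff_word R w = (\<lambda>v. \<Sum>i<length w - 1. (if normal R (w ! i @ w ! Suc i) then (-1) ^ i else 0) * single (mrg i w) v)"
  unfolding bar_diff_word_def mrg_def by (intro ext sum.cong) auto

lemma finsupp_bar_diff_word: "finsupp (bar_diff_word R w)"
  unfolding bar_diff_word_alt by (rule finsupp_sum) simp

lemma bar_diff_ev: "bar_diff R x v = ev (\<lambda>w. bar_diff_word R w v) x"
  by (simp add: bar_diff_def ev_def)

lemma bar_diff_single: "bar_diff R (single w) = bar_diff_word R w"
  by (simp add: fun_eq_iff bar_diff_ev ev_single)

lemma bar_diff_linear:
  "finsupp x \<Longrightarrow> finsupp y \<Longrightarrow> bar_diff R (\<lambda>w. x w + c * y w) = (\<lambda>v. bar_diff R x v + c * bar_diff R y v)"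
  by (simp add: fun_eq_iff bar_diff_ev ev_linear)

lemma finsupp_bar_diff: "finsupp x \<Longrightarrow> finsupp (bar_diff R x)"
  unfolding bar_diff_def[abs_def] by (rule finsupp_sum) (rule finsupp_bar_diff_word)

lemma ev_bar_diff_word:
  "ev K (bar_diff_word R w) = (\<Sum>i<length w - 1. (if normal R (w ! i @ w ! Suc i) then (-1) ^ i else 0) * K (mrg i w))"
  unfolding bar_diff_word_alt by (subst ev_sum) (simp_all add: ev_single)

lemma ev_bar_diff:
  assumes "finsupp x"
  shows "ev K (bar_diff R x) = ev (\<lambda>w. ev K (bar_diff_word R w)) x"
  unfolding bar_diff_def[abs_def] ev_def[of "\<lambda>w. ev K (bar_diff_word R w)"]
  by (rule ev_sum) (use assms finsupp_bar_diff_word in \<open>auto simp: finsupp_def\<close>)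

lemma mrg_bar_word:
  assumes "bar_word Q R w" "Suc i < length w"
  shows "bar_word Q R (mrg i w) \<longleftrightarrow> normal R (w ! i @ w ! Suc i)"
proof -
  have "path_word w" "\<forall>a\<in>set w. normal R a" using assms(1) bar_word_iff by auto
  then have "path_word (mrg i w)" using path_word_parts[OF _ assms(2)] by blast
  moreover have "\<forall>a\<in>set (take i w) \<union> set (drop (Suc (Suc i)) w). normal R a"
    using \<open>\<forall>a\<in>set w. normal R a\<close> by (auto dest: in_set_takeD in_set_dropD)
  ultimately show ?thesis using set_mrg(1)[OF assms(2)] bar_word_iff by auto
qed

text \<open>
  The bar differential omits merges to zero; if \<open>K\<close> vanishes outside the bar words, these may
  be included in the sum.
\<close>
lemma ev_bar_diff_word_bar:
  assumes "bar_word Q R w" "\<And>v. \<not> bar_word Q R v \<Longrightarrow> K v = 0"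
  shows "ev K (bar_diff_word R w) = (\<Sum>i<length w - 1. (-1) ^ i * K (mrg i w))"
  unfolding ev_bar_diff_word
proof (rule sum.cong[OF refl])
  fix i assume "i \<in> {..<length w - 1}"
  then show "(if normal R (w ! i @ w ! Suc i) then (- 1) ^ i else 0) * K (mrg i w) = (- 1) ^ i * K (mrg i w)"
    using mrg_bar_word[OF assms(1), of i] assms(2)[of "mrg i w"] by auto
qed

lemma bar_spaceD: "x \<in> bar_space Q R \<Longrightarrow> finsupp x" "x \<in> bar_space Q R \<Longrightarrow> x w \<noteq> 0 \<Longrightarrow> bar_word Q R w"
  by (auto simp: bar_space_def finsupp_def)

lemma bar_spaceI: "finsupp x \<Longrightarrow> (\<And>w. x w \<noteq> 0 \<Longrightarrow> bar_word Q R w) \<Longrightarrow> x \<in> bar_space Q R"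
  by (auto simp: bar_space_def finsupp_def)

lemma bar_diff_word_support:
  assumes "bar_word Q R w" "bar_diff_word R w v \<noteq> (0 :: 'k::field)"
  shows "\<exists>i. Suc i < length w \<and> v = mrg i w \<and> bar_word Q R v"
proof -
  have "(\<Sum>i<length w - 1. (if normal R (w ! i @ w ! Suc i) then (-1) ^ i else 0) * single (mrg i w) v) \<noteq> (0 :: 'k)"
    using assms(2) unfolding bar_diff_word_alt .
  then obtain i where "i \<in> {..<length w - 1}"
    "(if normal R (w ! i @ w ! Suc i) then (-1) ^ i else 0) * single (mrg i w) v \<noteq> (0 :: 'k)"
    by (blast dest: sum_nonzeroD)
  then have "Suc i < length w" "v = mrg i w" "normal R (w ! i @ w ! Suc i)"
    by (auto simp: single_def split: if_splits)
  then show ?thesis using mrg_bar_word[OF assms(1)] by blast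
qed

lemma bar_diff_in_space:
  fixes x :: "'a list list \<Rightarrow> 'k::field"
  assumes "x \<in> bar_space Q R" shows "bar_diff R x \<in> bar_space Q R"
proof (rule bar_spaceI)
  show "finsupp (bar_diff R x)" using assms bar_spaceD(1) finsupp_bar_diff by blast
  fix v assume "bar_diff R x v \<noteq> 0"
  then have "(\<Sum>w | x w \<noteq> 0. x w * bar_diff_word R w v) \<noteq> 0" unfolding bar_diff_def .
  then obtain w where "w \<in> {w. x w \<noteq> 0}" "x w * bar_diff_word R w v \<noteq> 0"
    by (blast dest: sum_nonzeroD)
  then have "x w \<noteq> 0" "bar_diff_word R w v \<noteq> (0 :: 'k)" by auto
  then show "bar_word Q R v" using bar_diff_word_support bar_spaceD(2)[OF assms] by blast
qed

lemma bar_diff_bar_diff: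
  fixes x :: "'a list list \<Rightarrow> 'k::field"
  assumes "x \<in> bar_space Q R"
  shows "bar_diff R (bar_diff R x) = 0"
proof
  fix v
  show "bar_diff R (bar_diff R x) v = 0 v"
  proof (cases "bar_word Q R v")
    case False
    then show ?thesis using bar_spaceD(2)[OF bar_diff_in_space[OF bar_diff_in_space[OF assms]], of v] by auto
  next
    case v: True
    define K where "K w = (single v w :: 'k)" for w
    have K0: "K w = 0" if "\<not> bar_word Q R w" for w using v that by (auto simp: K_def single_def)
    define K' where "K' w = (if bar_word Q R w then bar_diff_word R w v else 0 :: 'k)" for w
    have KK: "bar_diff_word R w v = (\<Sum>i<length w - 1. (-1) ^ i * K (mrg i w))" if "bar_word Q R w" for w
    proof -
      have "bar_diff_word R w v = ev K (bar_diff_word R w)"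
        unfolding ev_bar_diff_word by (simp add: bar_diff_word_alt K_def single_def eq_commute)
      then show ?thesis using ev_bar_diff_word_bar[OF that, of K] K0 by simp
    qed
    have "bar_diff R (bar_diff R x) v = ev (\<lambda>w. bar_diff_word R w v) (bar_diff R x)" by (rule bar_diff_ev)
    also have "\<dots> = ev K' (bar_diff R x)"
      by (rule ev_cong) (use bar_spaceD(2)[OF bar_diff_in_space[OF assms]] in \<open>simp add: K'_def\<close>)
    also have "\<dots> = ev (\<lambda>w. ev K' (bar_diff_word R w)) x" by (rule ev_bar_diff[OF bar_spaceD(1)[OF assms]])
    also have "\<dots> = ev (\<lambda>w. 0) x"
    proof (rule ev_cong)
      fix w assume "x w \<noteq> 0"
      then have w: "bar_word Q R w" by (rule bar_spaceD(2)[OF assms])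
      define N where "N = length w - 1"
      have "ev K' (bar_diff_word R w) = (\<Sum>i<N. (-1) ^ i * K' (mrg i w))"
        unfolding N_def by (rule ev_bar_diff_word_bar[OF w]) (simp add: K'_def)
      also have "\<dots> = (\<Sum>i<N. \<Sum>j<N - 1. (-1) ^ i * (-1) ^ j * K (mrg j (mrg i w)))"
      proof (rule sum.cong[OF refl])
        fix i assume "i \<in> {..<N}"
        then have i: "Suc i < length w" by (simp add: N_def)
        show "(-1) ^ i * K' (mrg i w) = (\<Sum>j<N - 1. (-1) ^ i * (-1) ^ j * K (mrg j (mrg i w)))"
        proof (cases "bar_word Q R (mrg i w)")
          case True
          then show ?thesis using i by (simp add: K'_def KK mrg_props N_def sum_distrib_left mult.assoc)
        next
          case False
          have "K (mrg j (mrg i w)) = 0" if "j < N - 1" for j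
          proof -
            have j: "Suc j < length (mrg i w)" using that i by (simp add: mrg_props N_def)
            have "path_word w" using w bar_word_iff by blast
            then have pw: "path_word (mrg i w)" using path_word_parts[OF _ i] by blast
            then obtain a where a: "a \<in> set (mrg i w)" "\<not> normal R a" using False bar_word_iff by blast
            have "\<exists>b\<in>set (mrg j (mrg i w)). \<not> normal R b"
              using a set_mrg[OF j] not_normal_append[of "mrg i w ! j" "mrg i w ! Suc j"] by auto
            then show ?thesis using K0 bar_word_iff by blast
          qed
          then show ?thesis using False by (simp add: K'_def)
        qed
      qed
      also have "\<dots> = (\<Sum>i<N. \<Sum>j<i. (-1) ^ i * (-1) ^ j * K (mrg j (mrg i w))
          + (-1) ^ j * (-1) ^ (i - 1) * K (mrg (i - 1) (mrg j w)))"
        unfolding square_sum_split by (simp add: sum.distrib)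
      also have "\<dots> = 0"
      proof (intro sum.neutral ballI)
        fix i j assume ij: "i \<in> {..<N}" "j \<in> {..<i}"
        then obtain k where k: "i = Suc (j + k)" using less_imp_Suc_add by auto
        have "mrg (i - 1) (mrg j w) = mrg j (mrg i w)"
          using mrg_mrg[of j "j + k" w] ij k by (simp add: N_def)
        then show "(-1) ^ i * (-1) ^ j * K (mrg j (mrg i w))
          + (-1) ^ j * (-1) ^ (i - 1) * K (mrg (i - 1) (mrg j w)) = 0"
          by (simp add: k power_add)
      qed
      finally show "ev K' (bar_diff_word R w) = 0" .
    qed
    finally show ?thesis by (simp add: ev_def)
  qed
qed

text \<open>
  Here \<open>us\<close> followed by \<open>u\<close> is the factorization of a chain, and \<open>u v\<close> is nonzero in \<open>A\<close>: a
  bar word is matched at the first place where it fails to be the factorization of a chain,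
  either because a letter is too long and can be split, or because the letter \<open>v\<close> has a
  nonzero product with the last piece \<open>u\<close> of the chain before it.
\<close>
fun bar_lo :: "'b list list \<times> 'b list \<times> 'b list \<times> 'b list list \<Rightarrow> 'b list list" where
  "bar_lo (us, u, v, rest) = us @ [u @ v] @ rest"
fun bar_up :: "'b list list \<times> 'b list \<times> 'b list \<times> 'b list list \<Rightarrow> 'b list list" where
  "bar_up (us, u, v, rest) = us @ [u, v] @ rest"
fun bar_rest :: "'b list list \<times> 'b list \<times> 'b list \<times> 'b list list \<Rightarrow> nat" where
  "bar_rest (us, u, v, rest) = length rest"

definition BIdx :: "('a list list \<times> 'a list \<times> 'a list \<times> 'a list list) set" where
  "BIdx = {(us, u, v, rest). chain_factorization Q R (us @ [u]) \<and> normal R (u @ v) \<and> bar_word Q R (us @ [u, v] @ rest)}"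

lemma BIdxD:
  assumes "(us, u, v, rest) \<in> BIdx"
  shows "chain_factorization Q R (us @ [u])" "normal R (u @ v)" "bar_word Q R (us @ [u, v] @ rest)" "v \<noteq> []"
    "bar_word Q R (us @ [u @ v] @ rest)"
proof -
  show 1: "chain_factorization Q R (us @ [u])" "normal R (u @ v)" "bar_word Q R (us @ [u, v] @ rest)"
    using assms by (auto simp: BIdx_def)
  then show "v \<noteq> []" by (auto simp: bar_word_def normal_path_def quiver_path_def)
  show "bar_word Q R (us @ [u @ v] @ rest)"
    using 1 by (auto simp: bar_word_iff path_word_def)
qed

text \<open>
  The letter \<open>u v\<close> is longer than the piece \<open>u\<close> that minimality prescribes.
\<close>
lemma bar_lo_short:
  assumes "chain_factorization Q R F" "F @ X = us @ [u @ v] @ Y" "chain_factorization Q R (us @ [u])" "v \<noteq> []"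
  shows "length F \<le> length us"
proof (rule ccontr)
  assume l: "\<not> length F \<le> length us"
  define k where "k = Suc (length us)"
  have "take k F = take k (F @ X)" using l by (simp add: k_def)
  also have "\<dots> = us @ [u @ v]" unfolding assms(2) by (simp add: k_def)
  finally have t: "take k F = us @ [u @ v]" .
  have "chain_factorization Q R (take k F @ drop k F)" using assms(1) by simp
  then have "chain_factorization Q R (take k F)" by (rule factorization_butlast) (simp add: t)
  then have "us @ [u @ v] = us @ [u]" unfolding t
    using factorization_prefix_unique[OF _ assms(3), of "us @ [u @ v]" "concat us @ u @ v"]
    by (simp add: prefix_def)
  then show False using assms(4) by simp
qed

lemma bar_up_neq_lo:
  assumes "chain_factorization Q R (us @ [u])" "normal R (u @ v)" "us @ [u, v] @ X = us' @ [u' @ v'] @ Y"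
    "chain_factorization Q R (us' @ [u'])" "v' \<noteq> []"
  shows False
proof -
  have "length (us @ [u]) \<le> length us'"
    using bar_lo_short[OF assms(1), of "v # X" us' u' v' Y] assms(3-5) by simp
  then have "us' = (us @ [u]) @ drop (length (us @ [u])) us'"
  proof -
    assume l: "length (us @ [u]) \<le> length us'"
    have "take (length (us @ [u])) (us' @ [u' @ v'] @ Y) = us @ [u]"
      unfolding assms(3)[symmetric] by simp
    then have "take (length (us @ [u])) us' = us @ [u]" using l by simp
    then show ?thesis using append_take_drop_id[of "length (us @ [u])" us'] by simp
  qed
  then obtain Z where Z0: "us' = us @ [u] @ Z" by simp
  then have Z: "us' = us @ [u] @ Z" "v # X = Z @ [u' @ v'] @ Y" using assms(3) by simp_all
  show False
  proof (cases Z)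
    case Nil
    then have "chain_factorization Q R (us @ [u, u'] @ [])" "v = u' @ v'" using assms(4) Z by auto
    then show False using factorization_consecutive assms(2) normal_appendD[of R "u @ u'" v'] by fastforce
  next
    case (Cons z Z')
    then have "z = v" "chain_factorization Q R (us @ [u, v] @ (Z' @ [u']))" using assms(4) Z by auto
    then show False using factorization_consecutive assms(2) by blast
  qed
qed

lemma inj_on_bar_lo: "inj_on bar_lo BIdx"
proof (rule inj_onI)
  fix i j assume "i \<in> BIdx" "j \<in> BIdx" "bar_lo i = bar_lo j"
  moreover obtain us u v X where i: "i = (us, u, v, X)" by (cases i) auto
  moreover obtain us' u' v' X' where j: "j = (us', u', v', X')" by (cases j) auto
  ultimately have ij: "(us, u, v, X) \<in> BIdx" "(us', u', v', X') \<in> BIdx" "us @ [u @ v] @ X = us' @ [u' @ v'] @ X'"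
    by auto
  have 1: "length us \<le> length us'"
    using bar_lo_short[of us "[u @ v] @ X" us' u' v' X'] BIdxD[OF ij(1)] BIdxD[OF ij(2)] ij(3) factorization_butlast[of us "[u]"]
    by (cases "us = []") auto
  have 2: "length us' \<le> length us"
    using bar_lo_short[of us' "[u' @ v'] @ X'" us u v X] BIdxD[OF ij(1)] BIdxD[OF ij(2)] ij(3) factorization_butlast[of us' "[u']"]
    by (cases "us' = []") auto
  have eq: "us = us'" "u @ v = u' @ v'" "X = X'" using 1 2 ij(3) by auto
  have "us @ [u] = us' @ [u']"
  proof (rule factorization_prefix_unique[OF BIdxD(1)[OF ij(1)] BIdxD(1)[OF ij(2)]])
    show "prefix (concat (us @ [u])) (concat us @ u @ v)" by (simp add: prefix_def)
    show "prefix (concat (us' @ [u'])) (concat us @ u @ v)" using eq by (simp add: prefix_def)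
  qed (use eq in simp)
  then show "i = j" using eq i j by simp
qed

lemma inj_on_bar_up: "inj_on bar_up BIdx"
proof (rule inj_onI)
  fix i j assume "i \<in> BIdx" "j \<in> BIdx" "bar_up i = bar_up j"
  moreover obtain us u v X where i: "i = (us, u, v, X)" by (cases i) auto
  moreover obtain us' u' v' X' where j: "j = (us', u', v', X')" by (cases j) auto
  ultimately have ij: "(us, u, v, X) \<in> BIdx" "(us', u', v', X') \<in> BIdx" "us @ [u, v] @ X = us' @ [u', v'] @ X'"
    by auto
  have *: "\<not> length a < length a'"
    if ab: "(a, b, c, Y) \<in> BIdx" "(a', b', c', Y') \<in> BIdx" "a @ [b, c] @ Y = a' @ [b', c'] @ Y'"
    for a b c Y a' b' c' Y'
  proof
    assume "length a < length a'"
    then have l: "length a \<le> length a'" by simp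
    define Z where "Z = drop (length a) a'"
    have "take (length a) (a' @ [b', c'] @ Y') = a" unfolding ab(3)[symmetric] by simp
    then have "take (length a) a' = a" using l by simp
    then have Z1: "a' = a @ Z" using append_take_drop_id[of "length a" a'] by (simp add: Z_def)
    have Z2: "Z \<noteq> []" using \<open>length a < length a'\<close> by (simp add: Z_def)
    have "a @ ([b, c] @ Y) = a @ (Z @ [b', c'] @ Y')" using ab(3) unfolding Z1 by simp
    then have Z3: "[b, c] @ Y = Z @ [b', c'] @ Y'" by (simp only: same_append_eq)
    note Z = Z1 Z2 Z3
    then obtain Z' where "Z = b # Z'" by (cases Z) auto
    then obtain W where "a' @ [b'] = a @ [b, c] @ W" using Z by (cases Z') auto
    then have "chain_factorization Q R (a @ [b, c] @ W)" using BIdxD(1)[OF ab(2)] by simp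
    then show False using factorization_consecutive BIdxD(2)[OF ab(1)] by blast
  qed
  have "length us = length us'" using *[OF ij] *[OF ij(2,1) ij(3)[symmetric]] by simp
  then show "i = j" using ij(3) i j by simp
qed

text \<open>
  Read \<open>w\<close> from the left as long as it is the factorization of a chain. If the next letter
  has nonzero product with the last piece, \<open>w\<close> is upper. Otherwise a shortest prefix of this
  letter gives product zero; it is the whole letter, or else \<open>w\<close> is lower.
\<close>
lemma bar_cover:
  "bar_word Q R w \<Longrightarrow> chain_factorization Q R w \<or> w \<in> bar_lo ` BIdx \<or> w \<in> bar_up ` BIdx"
proof (induction w rule: rev_induct)
  case Nil
  then show ?case by (simp add: bar_word_def)
next
  case (snoc b w)
  show ?case
  proof (cases "w = []")
    case True
    then have b: "normal_path Q R b" using snoc.prems by (simp add: bar_word_def)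
    then obtain x b' where x: "b = x # b'" by (cases b) (auto simp: normal_path_def quiver_path_def)
    show ?thesis
    proof (cases "b' = []")
      case True
      then show ?thesis using b x \<open>w = []\<close> by (simp add: factorization_single normal_path_def)
    next
      case False
      have "quiver_path Q ([x] @ b')" using b x by (simp add: normal_path_def)
      then have q: "quiver_path Q [x]" "quiver_path Q b'" "target Q [x] = source Q b'"
        using quiver_path_append[of "[x]" b'] False by auto
      have "normal R b'" using b x normal_appendD[of R "[x]" b'] by (simp add: normal_path_def)
      then have "([], [x], b', []) \<in> BIdx"
        using q b x by (auto simp: BIdx_def factorization_single bar_word_def normal_path_def normal_short)
      then have "bar_lo ([], [x], b', []) \<in> bar_lo ` BIdx" by (rule imageI)
      then show ?thesis using x True by simp
    qed
  next
    case False
    then have bw: "bar_word Q R w" using snoc.prems by (auto simp: bar_word_def successively_append_iff)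
    consider "chain_factorization Q R w" | i where "i \<in> BIdx" "w = bar_lo i" | i where "i \<in> BIdx" "w = bar_up i"
      using snoc.IH[OF bw] by blast
    then show ?thesis
    proof cases
      case 1
      have pb: "normal R b" "quiver_path Q (concat w @ b)"
        using snoc.prems by (auto simp: bar_word_iff path_word_def)
      obtain vs u where w: "w = vs @ [u]" using False by (cases w rule: rev_cases) auto
      show ?thesis
      proof (cases "normal R (last w @ b)")
        case True
        then have "(vs, u, b, []) \<in> BIdx" using 1 snoc.prems w by (simp add: BIdx_def)
        then have "bar_up (vs, u, b, []) \<in> bar_up ` BIdx" by (rule imageI)
        then show ?thesis using w by simp
      next
        case nn: False
        obtain c d where cd: "b = c @ d" "chain_factorization Q R (w @ [c])"
          using extend_chain[OF 1 pb(2,1) nn] by blast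
        show ?thesis
        proof (cases "d = []")
          case True
          then show ?thesis using cd by simp
        next
          case False
          have "c \<noteq> []" using factorization_nonempty[OF cd(2)] by auto
          then have "bar_word Q R (w @ [c, d] @ [])"
            using snoc.prems cd(1) False normal_appendD[of R c d] by (auto simp: bar_word_iff path_word_def)
          then have "(w, c, d, []) \<in> BIdx" using cd pb by (simp add: BIdx_def)
          then have "bar_lo (w, c, d, []) \<in> bar_lo ` BIdx" by (rule imageI)
          then show ?thesis using cd by simp
        qed
      qed
    next
      case 2
      obtain us u v X where i: "i = (us, u, v, X)" by (cases i) auto
      have I: "(us, u, v, X) \<in> BIdx" using 2 i by simp
      have "bar_word Q R (us @ [u, v] @ (X @ [b]))"
        using snoc.prems 2(2) i BIdxD(3)[OF I] by (auto simp: bar_word_iff path_word_def)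
      then have "(us, u, v, X @ [b]) \<in> BIdx" using BIdxD[OF I] by (simp add: BIdx_def)
      then have "bar_lo (us, u, v, X @ [b]) \<in> bar_lo ` BIdx" by (rule imageI)
      then show ?thesis using 2 i by simp
    next
      case 3
      obtain us u v X where i: "i = (us, u, v, X)" by (cases i) auto
      have I: "(us, u, v, X) \<in> BIdx" using 3 i by simp
      have "(us, u, v, X @ [b]) \<in> BIdx" using BIdxD[OF I] snoc.prems 3 i by (simp add: BIdx_def)
      then have "bar_up (us, u, v, X @ [b]) \<in> bar_up ` BIdx" by (rule imageI)
      then show ?thesis using 3 i by simp
    qed
  qed
qed

text \<open>
  Merges inside the chain give zero in \<open>A\<close>. The merge of \<open>u\<close> and \<open>v\<close> is the matched one, and
  later merges leave \<open>us, u\<close> at the beginning, so the result can be a lower word only with a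
  shorter rest.
\<close>
lemma bar_merges:
  assumes i: "(us, u, v, X) \<in> BIdx" and j: "j \<in> BIdx"
    and a: "Suc a < length (us @ [u, v] @ X)" and m: "mrg a (us @ [u, v] @ X) = bar_lo j"
    and n: "normal R ((us @ [u, v] @ X) ! a @ (us @ [u, v] @ X) ! Suc a)"
  shows "(j = (us, u, v, X) \<and> a = length us) \<or> bar_rest j < length X"
proof -
  obtain us' u' v' Y where jd: "j = (us', u', v', Y)" by (cases j) auto
  have j': "(us', u', v', Y) \<in> BIdx" using j jd by simp
  have m': "mrg a (us @ [u, v] @ X) = us' @ [u' @ v'] @ Y" using m jd by simp
  consider "a < length us" | "a = length us" | "a = Suc (length us)" | "length us + 2 \<le> a" by linarith
  then show ?thesis
  proof cases
    case 1
    have "\<not> normal R ((us @ [u]) ! a @ (us @ [u]) ! Suc a)"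
      using 1 by (intro factorization_nth[OF BIdxD(1)[OF i]]) simp
    moreover have "(us @ [u]) ! a = (us @ [u, v] @ X) ! a" "(us @ [u]) ! Suc a = (us @ [u, v] @ X) ! Suc a"
      using 1 by (auto simp: nth_append)
    ultimately show ?thesis using n by simp
  next
    case 2
    have "mrg a (us @ [u, v] @ X) = bar_lo (us, u, v, X)" using 2 by (simp add: mrg_def nth_append)
    with m have "bar_lo j = bar_lo (us, u, v, X)" by (rule trans[OF sym])
    then have "j = (us, u, v, X)" using inj_on_bar_lo i j by (simp only: inj_on_eq_iff)
    then show ?thesis using 2 by simp
  next
    case 3
    then obtain c X' where X: "X = c # X'" using a by (cases X) auto
    have "mrg a (us @ [u, v] @ X) = us @ [u, v @ c] @ X'" using 3 X by (simp add: mrg_def nth_append)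
    then have eq: "(us @ [u]) @ (v @ c) # X' = us' @ [u' @ v'] @ Y" using m' by simp
    have "length (us @ [u]) \<le> length us'"
      by (rule bar_lo_short[OF BIdxD(1)[OF i] eq BIdxD(1)[OF j'] BIdxD(4)[OF j']])
    moreover have "length ((us @ [u]) @ (v @ c) # X') = length (us' @ [u' @ v'] @ Y)" using eq by (rule arg_cong)
    ultimately show ?thesis using X jd by simp
  next
    case 4
    then obtain e where e: "a = length us + 2 + e" using le_Suc_ex by blast
    have "mrg (length A + e) (A @ X) = A @ mrg e X" for A
      by (simp add: mrg_def nth_append)
    from this[of "us @ [u, v]"] have "mrg a (us @ [u, v] @ X) = us @ [u, v] @ mrg e X" using e by simp
    then show ?thesis
      using bar_up_neq_lo[OF BIdxD(1,2)[OF i] _ BIdxD(1)[OF j'] BIdxD(4)[OF j']] m' by metis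
  qed
qed

lemma triangular_matching_bar:
  "triangular_matching (bar_diff R :: (_ \<Rightarrow> 'k::field) \<Rightarrow> _) BIdx bar_up bar_lo bar_rest"
proof
  show "\<And>f g c. finsupp f \<Longrightarrow> finsupp g \<Longrightarrow>
    bar_diff R (\<lambda>x. f x + c * g x) = (\<lambda>y. bar_diff R f y + c * bar_diff R g y :: 'k)" by (rule bar_diff_linear)
  show "inj_on bar_up BIdx" "inj_on bar_lo BIdx" by (rule inj_on_bar_up inj_on_bar_lo)+
next
  fix i assume i: "i \<in> BIdx"
  obtain us u v X where id: "i = (us, u, v, X)" by (cases i) auto
  have i': "(us, u, v, X) \<in> BIdx" using i id by simp
  let ?w = "us @ [u, v] @ X"
  let ?t = "\<lambda>a. (if normal R (?w ! a @ ?w ! Suc a) then (-1) ^ a else 0) * single (mrg a ?w) (bar_lo i) :: 'k"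
  have "bar_diff R (single (bar_up i)) (bar_lo i) = (\<Sum>a<length ?w - 1. ?t a)"
    unfolding bar_diff_single bar_diff_word_alt id by simp
  also have "\<dots> = (\<Sum>a\<in>{length us}. ?t a)"
  proof (rule sum.mono_neutral_right)
    show "\<forall>a\<in>{..<length ?w - 1} - {length us}. ?t a = 0"
    proof
      fix a assume a: "a \<in> {..<length ?w - 1} - {length us}"
      show "?t a = 0"
      proof (rule ccontr)
        assume "?t a \<noteq> 0"
        then have "normal R (?w ! a @ ?w ! Suc a)" "mrg a ?w = bar_lo i"
          by (auto simp: single_def split: if_splits)
        then show False using bar_merges[OF i' i, of a] a id by auto
      qed
    qed
  qed auto
  also have "\<dots> = (-1) ^ length us"
    using BIdxD(2)[OF i'] by (simp add: id nth_append mrg_def single_def)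
  finally show "bar_diff R (single (bar_up i)) (bar_lo i) \<noteq> (0::'k)" by simp
  show "finsupp (bar_diff R (single (bar_up i)) :: _ \<Rightarrow> 'k)"
    unfolding bar_diff_single by (rule finsupp_bar_diff_word)
next
  fix i j assume i: "i \<in> BIdx" and j: "j \<in> BIdx"
    and nz: "bar_diff R (single (bar_up i)) (bar_lo j) \<noteq> (0::'k)" and ne: "j \<noteq> i"
  obtain us u v X where id: "i = (us, u, v, X)" by (cases i) auto
  have i': "(us, u, v, X) \<in> BIdx" using i id by simp
  have "(\<Sum>a<length (bar_up i) - 1. (if normal R (bar_up i ! a @ bar_up i ! Suc a) then (-1) ^ a else 0) *
      single (mrg a (bar_up i)) (bar_lo j)) \<noteq> (0::'k)"
    using nz unfolding bar_diff_single bar_diff_word_alt .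
  then obtain a where a: "a \<in> {..<length (bar_up i) - 1}"
    "(if normal R (bar_up i ! a @ bar_up i ! Suc a) then (-1) ^ a else 0) * single (mrg a (bar_up i)) (bar_lo j) \<noteq> (0::'k)"
    by (blast dest: sum_nonzeroD)
  then have "normal R (bar_up i ! a @ bar_up i ! Suc a)" "mrg a (bar_up i) = bar_lo j"
    by (auto simp: single_def split: if_splits)
  then show "bar_rest j < bar_rest i" using bar_merges[OF i' j, of a] a ne id by auto
qed

definition chain_part :: "('a list list \<Rightarrow> 'k::field) \<Rightarrow> 'a list list \<Rightarrow> 'k" where
  "chain_part x w = (if chain_factorization Q R w then x w else 0)"

text \<open>
  Neighbouring pieces of a chain have product zero.
\<close>
lemma chain_part_cycle: "finsupp x \<Longrightarrow> bar_diff R (chain_part x) = (\<lambda>v. 0)"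
proof -
  assume "finsupp x"
  have "bar_diff_word R w v = (0::'b)" if "chain_factorization Q R w" for w v
    unfolding bar_diff_word_alt using factorization_nth[OF that] by (intro sum.neutral) auto
  then show ?thesis
    by (auto simp: fun_eq_iff bar_diff_ev ev_def chain_part_def intro!: sum.neutral)
qed

text \<open>
  Subtracting a boundary makes \<open>x\<close> vanish on lower words. What is left after removing the
  chains is supported on upper words and its boundary vanishes on lower words, so it is zero.
  For a cycle this says that Tor is spanned by the chains; the weaker hypothesis is used to
  construct primitives of functionals.
\<close>
lemma bar_decomposition:
  fixes x :: "'a list list \<Rightarrow> 'k::field"
  assumes xs: "x \<in> bar_space Q R" and xc: "\<And>k. k \<in> BIdx \<Longrightarrow> bar_diff R x (bar_lo k) = 0"
  obtains u y where "u \<in> bar_space Q R" "x = (\<lambda>w. bar_diff R u w + chain_part y w)" "y \<in> bar_space Q R"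
proof -
  interpret triangular_matching "bar_diff R :: (_ \<Rightarrow> 'k) \<Rightarrow> _" BIdx bar_up bar_lo bar_rest
    by (rule triangular_matching_bar)
  have fx: "finsupp x" by (rule bar_spaceD(1)[OF xs])
  obtain u where u: "finsupp u" "{w. u w \<noteq> 0} \<subseteq> bar_up ` BIdx" "\<forall>k\<in>BIdx. bar_diff R u (bar_lo k) = x (bar_lo k)"
    using solvable[OF fx] by blast
  have up_bar: "bar_word Q R w" if "w \<in> bar_up ` BIdx" for w using that BIdxD(3) by force
  have us: "u \<in> bar_space Q R" using u up_bar by (intro bar_spaceI) auto
  define y where "y = (\<lambda>w. x w + (-1) * bar_diff R u w)"
  have fd: "finsupp (bar_diff R u)" by (rule finsupp_bar_diff[OF u(1)])
  have fy: "finsupp y" unfolding y_def by (rule finsupp_add_mult[OF fx fd])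
  have ys: "y \<in> bar_space Q R"
  proof (rule bar_spaceI[OF fy])
    fix w assume "y w \<noteq> 0"
    then have "x w \<noteq> 0 \<or> bar_diff R u w \<noteq> 0" by (auto simp: y_def)
    then show "bar_word Q R w" using bar_spaceD(2)[OF xs] bar_spaceD(2)[OF bar_diff_in_space[OF us]] by blast
  qed
  have dy: "bar_diff R y (bar_lo k) = 0" if "k \<in> BIdx" for k
    unfolding y_def bar_diff_linear[OF fx fd] bar_diff_bar_diff[OF us] by (simp add: xc[OF that])
  define z where "z = (\<lambda>w. y w + (-1) * chain_part y w)"
  have fc: "finsupp (chain_part y)"
    using fy unfolding finsupp_def by (rule rev_finite_subset) (auto simp: chain_part_def)
  have fz: "finsupp z" unfolding z_def by (rule finsupp_add_mult[OF fy fc])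
  have "z = (\<lambda>w. 0)"
  proof (rule injective[OF fz])
    show "{w. z w \<noteq> 0} \<subseteq> bar_up ` BIdx"
    proof
      fix w assume "w \<in> {w. z w \<noteq> 0}"
      then have w: "y w \<noteq> 0" "\<not> chain_factorization Q R w" by (auto simp: z_def chain_part_def split: if_splits)
      then have "bar_word Q R w" using bar_spaceD(2)[OF ys] by blast
      moreover have "w \<notin> bar_lo ` BIdx" using u(3) w(1) by (auto simp: y_def)
      ultimately show "w \<in> bar_up ` BIdx" using bar_cover w(2) by blast
    qed
    show "\<And>j. j \<in> BIdx \<Longrightarrow> bar_diff R z (bar_lo j) = 0"
      unfolding z_def bar_diff_linear[OF fy fc] chain_part_cycle[OF fy] by (simp add: dy)
  qed
  then have "y w = chain_part y w" for w by (simp add: z_def fun_eq_iff)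
  moreover have "x = (\<lambda>w. bar_diff R u w + y w)" by (simp add: y_def)
  ultimately have "x = (\<lambda>w. bar_diff R u w + chain_part y w)" by simp
  then show thesis using that us ys by blast
qed

end

section \<open>Signs\<close>

text \<open>
  The rescaling of words by \<open>(-1)^theta\<close> turns the signs of the identities into those of the
  cobar differential. The part \<open>\<Sum> (n - i) (r\<^sub>i + 1)\<close> is the Koszul sign for shifting \<open>n\<close>
  elements of degrees \<open>r\<^sub>i + 1\<close>; the rest changes the signs of the single chains.
\<close>
fun theta :: "nat list \<Rightarrow> nat" where
  "theta [] = 0"
| "theta (r # rs) = length rs * (r + 1) + (r choose 2) + 1 + theta rs"

lemma theta_append: "theta (A @ B) = theta A + theta B + length B * (sum_list A + length A)"
  by (induction A) (simp_all add: algebra_simps)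

lemma choose_two_add: "(m + n) choose 2 = (m choose 2) + (n choose 2) + m * n"
proof (induction n)
  case (Suc n)
  have s: "Suc k choose 2 = k + (k choose 2)" for k by (simp add: numeral_2_eq_2)
  have "(m + Suc n) choose 2 = (m + n) + ((m + n) choose 2)" using s[of "m + n"] by simp
  then show ?case using Suc s[of n] by simp
qed simp

lemma choose_two_Suc: "Suc k choose 2 = k + (k choose 2)"
  by (simp add: numeral_2_eq_2)

definition double_sum :: "nat list \<Rightarrow> nat" where
  "double_sum rs = (\<Sum>j<length rs. \<Sum>i<j. rs ! i * (rs ! j + 1))"

lemma double_sum_Cons: "double_sum (a # rs) = a * (sum_list rs + length rs) + double_sum rs"
proof -
  have "double_sum (a # rs) = (\<Sum>j<length rs. a * (rs ! j + 1) + (\<Sum>i<j. rs ! i * (rs ! j + 1)))"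
    unfolding double_sum_def by (simp add: sum.lessThan_Suc_shift del: sum.lessThan_Suc)
  also have "\<dots> = a * (\<Sum>j<length rs. rs ! j + 1) + double_sum rs"
    by (simp add: sum.distrib sum_distrib_left double_sum_def distrib_left)
  also have "(\<Sum>j<length rs. rs ! j + 1) = sum_list rs + length rs"
    unfolding sum.distrib by (simp add: sum_list_sum_nth atLeast0LessThan)
  finally show ?thesis .
qed

lemma sign_exponent_parity_aux:
  "even ((Suc (length rs) choose 2) + 1 + double_sum rs + Suc (sum_list rs) + theta rs + (Suc (sum_list rs) choose 2))"
proof (induction rs)
  case Nil
  then show ?case by (simp add: double_sum_def numeral_2_eq_2)
next
  case (Cons a rs)
  let ?n = "length rs" and ?S = "sum_list rs"
  have "Suc (length (a # rs)) choose 2 = Suc ?n + (Suc ?n choose 2)" using choose_two_Suc[of "Suc ?n"] by simp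
  moreover have "Suc (sum_list (a # rs)) choose 2 = (Suc ?S choose 2) + (a choose 2) + a * Suc ?S"
    using choose_two_add[of "Suc ?S" a] by (simp add: algebra_simps)
  ultimately have "(Suc (length (a # rs)) choose 2) + 1 + double_sum (a # rs) + Suc (sum_list (a # rs)) + theta (a # rs)
       + (Suc (sum_list (a # rs)) choose 2)
     = ((Suc ?n choose 2) + 1 + double_sum rs + Suc ?S + theta rs + (Suc ?S choose 2))
       + 2 * (?n + 1 + a * ?S + a * ?n + a + (a choose 2))"
    by (simp add: double_sum_Cons algebra_simps)
  then show ?case using Cons by (metis even_add dvd_triv_left)
qed

text \<open>
  The exponent \<open>M\<close> of the theorem, expressed by \<open>theta\<close> of the arguments and of the product.
\<close>
lemma sign_exponent_parity:
  assumes "rs \<noteq> []"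
  shows "even (sign_exponent rs (Suc (sum_list rs)) + hd rs + theta rs + (Suc (sum_list rs) choose 2))"
proof -
  let ?n = "length rs"
  have "1 \<le> (Suc ?n choose 2)" using assms by (cases rs) (auto simp: numeral_2_eq_2)
  then have "sign_exponent rs (Suc (sum_list rs)) + 2 =
      (Suc ?n choose 2) + 1 + double_sum rs + Suc (sum_list rs) + hd rs"
    using assms by (simp add: sign_exponent_def Let_def double_sum_def hd_conv_nth)
  then have "sign_exponent rs (Suc (sum_list rs)) + hd rs + theta rs + (Suc (sum_list rs) choose 2) + 2 =
     ((Suc ?n choose 2) + 1 + double_sum rs + Suc (sum_list rs) + theta rs + (Suc (sum_list rs) choose 2)) + 2 * hd rs"
    by simp
  moreover have "even (((Suc ?n choose 2) + 1 + double_sum rs + Suc (sum_list rs) + theta rs + (Suc (sum_list rs) choose 2)) + 2 * hd rs)"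
    by (rule dvd_add[OF sign_exponent_parity_aux dvd_triv_left])
  ultimately have "even (sign_exponent rs (Suc (sum_list rs)) + hd rs + theta rs + (Suc (sum_list rs) choose 2) + 2)"
    by (simp only:)
  moreover have "even (X + 2) \<longleftrightarrow> even X" for X :: nat by simp
  ultimately show ?thesis by blast
qed

lemma sign_parity: "(-1 :: 'k::field) ^ m = (if even m then 1 else -1)"
  by simp

lemma parity_sign_nat: "parity_sign (int m) = (-1 :: 'k::field) ^ m"
  by (simp add: parity_sign_def)

lemma parity_sign_cong: "even (e - e') \<Longrightarrow> parity_sign e = parity_sign e'"
  by (auto simp: parity_sign_def)

text \<open>
  The sign in the identities, for a product inserted on a block \<open>B\<close> after the letters \<open>A\<close>,
  becomes the sign of \<open>cobar_diff\<close> up to rescaling before and after.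
\<close>
lemma insertion_sign:
  assumes "B \<noteq> []"
  shows "parity_sign (int (length A + length B * length C) + (2 - int (length B)) * int (sum_list A + length A)) *
      (-1) ^ sign_exponent B (Suc (sum_list B)) =
    - ((-1 :: 'k::field) ^ (sum_list A + hd B) * (-1) ^ theta (A @ B @ C) * (-1) ^ theta (A @ [Suc (sum_list B)] @ C))"
proof -
  define a where "a = length A" define b where "b = length B" define c where "c = length C"
  define SA where "SA = sum_list A" define SB where "SB = sum_list B"
  define q where "q = (Suc SB choose 2)"
  define M where "M = sign_exponent B (Suc SB)"
  have ev: "even (M + hd B + theta B + q)" using sign_exponent_parity[OF assms] by (simp add: M_def q_def SB_def)
  have t1: "theta (A @ B @ C) = theta A + theta B + theta C + (b + c) * (SA + a) + c * (SB + b)"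
    by (simp add: theta_append a_def b_def c_def SA_def SB_def algebra_simps)
  have t2: "theta (A @ [Suc SB] @ C) = theta A + (q + 1) + theta C + (1 + c) * (SA + a) + c * (Suc SB + 1)"
    by (simp add: theta_append a_def b_def c_def SA_def q_def algebra_simps)
  have p: "parity_sign (int (a + b * c) + (2 - int b) * int (SA + a)) = (-1 :: 'k) ^ (a + b * c + b * (SA + a))"
    unfolding parity_sign_nat[symmetric] by (rule parity_sign_cong) (simp add: algebra_simps)
  have "odd ((a + b * c + b * (SA + a) + M) + (SA + hd B + theta (A @ B @ C) + theta (A @ [Suc SB] @ C)))"
  proof -
    have eq: "(a + b * c + b * (SA + a) + M) + (SA + hd B + theta (A @ B @ C) + theta (A @ [Suc SB] @ C)) =
      (M + hd B + theta B + q) + 2 * (a + SA + b * c + b * (SA + a) + theta A + theta C + c * (SA + a) + c * SB + c) + 1"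
      unfolding t1 t2 by (simp add: algebra_simps)
    have "odd (E + 2 * H + 1)" if "even E" for E H :: nat using that by simp
    then show ?thesis unfolding eq using ev by blast
  qed
  then have "(-1 :: 'k) ^ (a + b * c + b * (SA + a) + M) = - ((-1) ^ (SA + hd B + theta (A @ B @ C) + theta (A @ [Suc SB] @ C)))"
    unfolding sign_parity by auto
  then show ?thesis
    using p by (simp add: power_add a_def[symmetric] b_def[symmetric] c_def[symmetric] SA_def[symmetric]
        SB_def[symmetric] M_def[symmetric])
qed

text \<open>
  The analogous statement for the product of two morphism components.
\<close>
lemma product_sign:
  assumes "1 \<le> length A" "1 \<le> length B"
  shows "parity_sign ((int (length A) - 1) + (1 - int (length B)) * int (sum_list A + length A)) *
      ((-1) ^ theta A * (-1) ^ theta B) = - ((-1 :: 'k::field) ^ sum_list A * (-1) ^ theta (A @ B))"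
proof -
  define a where "a = length A" define b where "b = length B" define SA where "SA = sum_list A"
  have t: "theta (A @ B) = theta A + theta B + b * (SA + a)" by (simp add: theta_append a_def b_def SA_def)
  have p: "parity_sign ((int a - 1) + (1 - int b) * int (SA + a)) = (-1 :: 'k) ^ (a + 1 + SA + a + b * (SA + a))"
    unfolding parity_sign_nat[symmetric] by (rule parity_sign_cong) (simp add: algebra_simps)
  have "(-1 :: 'k) ^ (a + 1 + SA + a + b * (SA + a)) = - ((-1) ^ (SA + b * (SA + a)))"
    by (simp add: power_add)
  then show ?thesis
    using p t by (simp add: power_add a_def[symmetric] b_def[symmetric] SA_def[symmetric])
qed

context monomial_quiver
begin

section \<open>Functionals on the bar construction\<close>

definition func :: "('a list list \<Rightarrow> 'k::field) set \<Rightarrow> ('a list list \<Rightarrow> 'k) \<Rightarrow> ('a list list \<Rightarrow> 'k) \<Rightarrow> 'k" where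
  "func V \<psi> = (\<lambda>x. if x \<in> V then ev \<psi> x else 0)"

definition restrict :: "('b \<Rightarrow> bool) \<Rightarrow> ('b \<Rightarrow> 'k::field) \<Rightarrow> 'b \<Rightarrow> 'k" where
  "restrict q x = (\<lambda>w. if q w then x w else 0)"

definition mrg_invariant :: "('a list list \<Rightarrow> bool) \<Rightarrow> bool" where
  "mrg_invariant q \<longleftrightarrow> (\<forall>w i. bar_word Q R w \<and> Suc i < length w \<longrightarrow> q (mrg i w) = q w)"

text \<open>
  What the bar construction and its cycles have in common; both carry graded duals, and the
  vertex actions restrict elements to the words with a given first or last vertex.
\<close>
definition closed_space :: "('a list list \<Rightarrow> 'k::field) set \<Rightarrow> bool" where
  "closed_space V \<longleftrightarrow> V \<subseteq> bar_space Q R \<and> (\<forall>x\<in>V. \<forall>y\<in>V. \<forall>c. (\<lambda>w. x w + c * y w) \<in> V) \<and>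
     (\<lambda>w. 0) \<in> V \<and> (\<forall>x\<in>V. \<forall>q. mrg_invariant q \<longrightarrow> restrict q x \<in> V)"

lemma finsupp_restrict: "finsupp x \<Longrightarrow> finsupp (restrict q x)"
  unfolding finsupp_def restrict_def by (rule rev_finite_subset) auto

lemma ev_restrict: "ev \<psi> (restrict q x) = ev (\<lambda>w. if q w then \<psi> w else 0) x" if "finsupp x"
proof -
  have J: "finite {w. x w \<noteq> 0}" using that by (simp add: finsupp_def)
  have "ev \<psi> (restrict q x) = (\<Sum>w | x w \<noteq> 0. restrict q x w * \<psi> w)"
    by (rule ev_alt[OF J]) (auto simp: restrict_def)
  then show ?thesis unfolding ev_def restrict_def by (simp add: if_distrib cong: if_cong) (intro sum.cong, auto)
qed

lemma closed_bar_space: "closed_space (bar_space Q R)"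
  unfolding closed_space_def
proof (intro conjI ballI allI impI)
  fix x y :: "'a list list \<Rightarrow> 'b" and c
  assume x: "x \<in> bar_space Q R" and y: "y \<in> bar_space Q R"
  show "(\<lambda>w. x w + c * y w) \<in> bar_space Q R"
  proof (rule bar_spaceI[OF finsupp_add_mult[OF bar_spaceD(1)[OF x] bar_spaceD(1)[OF y]]])
    fix w assume "x w + c * y w \<noteq> 0"
    then have "x w \<noteq> 0 \<or> y w \<noteq> 0" by auto
    then show "bar_word Q R w" using bar_spaceD(2)[OF x] bar_spaceD(2)[OF y] by blast
  qed
next
  show "(\<lambda>w. 0) \<in> bar_space Q R" by (simp add: bar_space_def)
next
  fix x :: "'a list list \<Rightarrow> 'b" and q
  assume "x \<in> bar_space Q R"
  then show "restrict q x \<in> bar_space Q R"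
    by (intro bar_spaceI finsupp_restrict) (auto simp: restrict_def dest: bar_spaceD split: if_splits)
qed simp

lemma bar_diff_restrict:
  fixes x :: "'a list list \<Rightarrow> 'k::field"
  assumes x: "x \<in> bar_space Q R" and q: "mrg_invariant q"
  shows "bar_diff R (restrict q x) = restrict q (bar_diff R x)"
proof
  fix v
  have "bar_diff R (restrict q x) v = ev (\<lambda>w. if q w then bar_diff_word R w v else 0) x"
    unfolding bar_diff_ev by (rule ev_restrict[OF bar_spaceD(1)[OF x]])
  also have "\<dots> = ev (\<lambda>w. if q v then bar_diff_word R w v else 0) x"
  proof (rule ev_cong)
    fix w assume "x w \<noteq> 0"
    then have w: "bar_word Q R w" by (rule bar_spaceD(2)[OF x])
    show "(if q w then bar_diff_word R w v else 0) = (if q v then bar_diff_word R w v else (0::'k))"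
    proof (cases "bar_diff_word R w v = (0::'k)")
      case True
      then show ?thesis by simp
    next
      case False
      then obtain i where "Suc i < length w" "v = mrg i w" using bar_diff_word_support[OF w] by blast
      then have "q v = q w" using q w by (simp add: mrg_invariant_def)
      then show ?thesis by simp
    qed
  qed
  also have "\<dots> = restrict q (bar_diff R x) v"
    by (simp add: restrict_def bar_diff_ev ev_def)
  finally show "bar_diff R (restrict q x) v = restrict q (bar_diff R x) v" .
qed

lemma closed_bar_cycles: "closed_space (bar_cycles Q R)"
  unfolding closed_space_def
proof (intro conjI ballI allI impI)
  show "bar_cycles Q R \<subseteq> bar_space Q R" by (auto simp: bar_cycles_def)
next
  fix x y :: "'a list list \<Rightarrow> 'b" and c
  assume xy: "x \<in> bar_cycles Q R" "y \<in> bar_cycles Q R"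
  then have "bar_diff R (\<lambda>w. x w + c * y w) = (\<lambda>v. bar_diff R x v + c * bar_diff R y v)"
    by (intro bar_diff_linear bar_spaceD) (auto simp: bar_cycles_def)
  then show "(\<lambda>w. x w + c * y w) \<in> bar_cycles Q R"
    using xy closed_bar_space unfolding closed_space_def bar_cycles_def by (auto simp: fun_eq_iff)
next
  show "(\<lambda>w. 0) \<in> bar_cycles Q R" by (simp add: bar_cycles_def bar_space_def bar_diff_def fun_eq_iff)
next
  fix x :: "'a list list \<Rightarrow> 'b" and q
  assume x: "x \<in> bar_cycles Q R" and q: "mrg_invariant q"
  then have "bar_diff R (restrict q x) = restrict q (bar_diff R x)"
    by (intro bar_diff_restrict) (auto simp: bar_cycles_def)
  then show "restrict q x \<in> bar_cycles Q R"
    using x q closed_bar_space unfolding closed_space_def bar_cycles_def by (auto simp: restrict_def fun_eq_iff)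
qed

lemma closed_spaceD:
  assumes "closed_space V"
  shows "x \<in> V \<Longrightarrow> finsupp x" "x \<in> V \<Longrightarrow> x \<in> bar_space Q R" "x \<in> V \<Longrightarrow> y \<in> V \<Longrightarrow> (\<lambda>w. x w + y w) \<in> V"
    "x \<in> V \<Longrightarrow> (\<lambda>w. c * x w) \<in> V" "x \<in> V \<Longrightarrow> mrg_invariant q \<Longrightarrow> restrict q x \<in> V" "(\<lambda>w. 0) \<in> V"
proof -
  have V: "V \<subseteq> bar_space Q R" "(\<lambda>w. 0) \<in> V" and lin: "\<And>x y c. x \<in> V \<Longrightarrow> y \<in> V \<Longrightarrow> (\<lambda>w. x w + c * y w) \<in> V"
    and r: "\<And>x q. x \<in> V \<Longrightarrow> mrg_invariant q \<Longrightarrow> restrict q x \<in> V"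
    using assms unfolding closed_space_def by blast+
  show "(\<lambda>w. 0) \<in> V" by (rule V)
  show "x \<in> V \<Longrightarrow> finsupp x" using V bar_spaceD(1) by blast
  show "x \<in> V \<Longrightarrow> x \<in> bar_space Q R" using V by blast
  show "x \<in> V \<Longrightarrow> y \<in> V \<Longrightarrow> (\<lambda>w. x w + y w) \<in> V" using lin[of x y 1] by simp
  show "x \<in> V \<Longrightarrow> (\<lambda>w. c * x w) \<in> V" using lin[of "\<lambda>w. 0" x c] V by simp
  show "x \<in> V \<Longrightarrow> mrg_invariant q \<Longrightarrow> restrict q x \<in> V" by (rule r)
qed

lemma source_hd:
  assumes "w \<noteq> []" "[] \<notin> set w"
  shows "source Q (hd w) = source Q (concat w)"
proof -
  obtain a w' where w: "w = a # w'" using assms(1) by (cases w) auto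
  then have "a \<noteq> []" using assms(2) by auto
  then show ?thesis by (simp add: w source_def)
qed

lemma target_last:
  assumes "w \<noteq> []" "[] \<notin> set w"
  shows "target Q (last w) = target Q (concat w)"
proof -
  obtain w' a where w: "w = w' @ [a]" using assms(1) by (cases w rule: rev_cases) auto
  then have "a \<noteq> []" using assms(2) by auto
  then show ?thesis by (simp add: w target_def)
qed

lemma endpoint_invariant:
  "mrg_invariant (\<lambda>w. source Q (hd w) = i)" "mrg_invariant (\<lambda>w. target Q (last w) = i)"
proof -
  have "source Q (hd (mrg k w)) = source Q (hd w) \<and> target Q (last (mrg k w)) = target Q (last w)"
    if w: "bar_word Q R w" and k: "Suc k < length w" for w k
  proof -
    have pw: "path_word w" using w bar_word_iff by blast
    have pm: "path_word (mrg k w)" by (rule path_word_parts(3)[OF pw k])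
    show ?thesis
      using pw pm source_hd[of w] source_hd[of "mrg k w"] target_last[of w] target_last[of "mrg k w"] mrg_props(2)[OF k]
      by (simp add: path_word_def)
  qed
  then show "mrg_invariant (\<lambda>w. source Q (hd w) = i)" "mrg_invariant (\<lambda>w. target Q (last w) = i)"
    by (simp_all add: mrg_invariant_def)
qed

lemma graded_dual_simps [simp]:
  "scl (graded_dual Q V) = (\<lambda>c \<phi> x. c * \<phi> x)"
  "lact (graded_dual Q V) i \<phi> = (\<lambda>x. if x \<in> V then \<phi> (\<lambda>w. if source Q (hd w) = i then x w else 0) else 0)"
  "ract (graded_dual Q V) i \<phi> = (\<lambda>x. if x \<in> V then \<phi> (\<lambda>w. if target Q (last w) = i then x w else 0) else 0)"
  by (simp_all add: graded_dual_def)

lemma Ext_simps [simp]: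
  "scl (Ext Q R) = (\<lambda>c \<phi> x. c * \<phi> x)"
  "lact (Ext Q R) = lact (graded_dual Q (bar_cycles Q R))"
  "ract (Ext Q R) = ract (graded_dual Q (bar_cycles Q R))"
  "component (Ext Q R) n = {\<phi> \<in> component (graded_dual Q (bar_cycles Q R)) n. \<forall>x\<in>bar_space Q R. \<phi> (bar_diff R x) = 0}"
  by (simp_all add: Ext_def)

lemma componentD:
  assumes "\<phi> \<in> component (graded_dual Q V) n"
  shows "x \<notin> V \<Longrightarrow> \<phi> x = 0" "x \<in> V \<Longrightarrow> y \<in> V \<Longrightarrow> \<phi> (\<lambda>w. x w + y w) = \<phi> x + \<phi> y"
    "x \<in> V \<Longrightarrow> \<phi> (\<lambda>w. c * x w) = c * \<phi> x"
    "\<exists>W. finite W \<and> (\<forall>k m. \<forall>x\<in>V. bihomogeneous k m x \<and> \<not> (int k = n \<and> m \<in> W) \<longrightarrow> \<phi> x = 0)"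
  using assms by (simp_all add: graded_dual_def)

lemma component_zero:
  assumes "\<phi> \<in> component (graded_dual Q V) n" "closed_space V"
  shows "\<phi> (\<lambda>w. 0) = 0"
  using componentD(3)[OF assms(1) closed_spaceD(6)[OF assms(2)], of 0] by simp

lemma func_component:
  assumes V: "closed_space V" and W: "finite W"
    and \<psi>: "\<And>w. bar_word Q R w \<Longrightarrow> \<psi> w \<noteq> 0 \<Longrightarrow> int (length w) = n \<and> length (concat w) \<in> W"
  shows "func V \<psi> \<in> component (graded_dual Q V) n"
proof -
  have 1: "func V \<psi> (\<lambda>w. x w + y w) = func V \<psi> x + func V \<psi> y" if "x \<in> V" "y \<in> V" for x y
    using that closed_spaceD[OF V] ev_linear[of x y \<psi> 1] by (simp add: func_def)
  have 2: "func V \<psi> (\<lambda>w. c * x w) = c * func V \<psi> x" if "x \<in> V" for x c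
    using that closed_spaceD[OF V] ev_linear[of "\<lambda>w. 0" x \<psi> c] by (simp add: func_def ev_zero)
  have 3: "func V \<psi> x = 0" if "x \<in> V" "bihomogeneous k m x" "\<not> (int k = n \<and> m \<in> W)" for k m x
  proof -
    have "x w * \<psi> w = 0" for w
    proof (cases "x w = 0")
      case False
      then have "bar_word Q R w" "length w = k" "length (concat w) = m"
        using closed_spaceD(2)[OF V that(1)] bar_spaceD(2) that(2) by (auto simp: bihomogeneous_def)
      then show ?thesis using \<psi>[of w] that(3) by auto
    qed simp
    then have "ev \<psi> x = 0" unfolding ev_def by (intro sum.neutral) blast
    then show ?thesis by (simp add: func_def)
  qed
  show ?thesis
    using 1 2 3 W by (auto simp: graded_dual_def) (auto simp: func_def)
qed

lemma functional_ev:
  assumes V: "closed_space V" and \<phi>: "\<phi> \<in> component (graded_dual Q V) n"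
    and x: "finite J" "\<And>i. i \<in> J \<Longrightarrow> g i \<in> V"
  shows "\<phi> (\<lambda>w. \<Sum>i\<in>J. c i * g i w) = (\<Sum>i\<in>J. c i * \<phi> (g i)) \<and> (\<lambda>w. \<Sum>i\<in>J. c i * g i w) \<in> V"
  using x
proof (induction J rule: finite_induct)
  case empty
  then show ?case using component_zero[OF \<phi> V] closed_spaceD(6)[OF V] by simp
next
  case (insert i J)
  then have IH: "\<phi> (\<lambda>w. \<Sum>i\<in>J. c i * g i w) = (\<Sum>i\<in>J. c i * \<phi> (g i))" "(\<lambda>w. \<Sum>i\<in>J. c i * g i w) \<in> V" by auto
  have g: "g i \<in> V" "(\<lambda>w. c i * g i w) \<in> V" using insert closed_spaceD(4)[OF V] by auto
  have eq: "(\<lambda>w. \<Sum>i\<in>insert i J. c i * g i w) = (\<lambda>w. c i * g i w + (\<Sum>i\<in>J. c i * g i w))"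
    using insert by simp
  show ?case
    unfolding eq using componentD(2)[OF \<phi> g(2) IH(2)] componentD(3)[OF \<phi> g(1)] closed_spaceD(3)[OF V g(2) IH(2)]
      IH(1) insert by simp
qed

lemma single_bar_space: "bar_word Q R w \<Longrightarrow> single w \<in> bar_space Q R"
  by (rule bar_spaceI[OF finsupp_single]) (auto simp: single_def split: if_splits)

text \<open>
  Elements of the bar construction are finite combinations of words.
\<close>
lemma functional_words:
  assumes \<phi>: "\<phi> \<in> component (graded_dual Q (bar_space Q R)) n" and x: "x \<in> bar_space Q R"
  shows "\<phi> x = ev (\<lambda>w. \<phi> (single w)) x"
proof -
  have f: "finite {w. x w \<noteq> 0}" using bar_spaceD(1)[OF x] by (simp add: finsupp_def)
  have "\<phi> x = \<phi> (\<lambda>w. \<Sum>i\<in>{w. x w \<noteq> 0}. x i * single i w)"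
    by (subst (1) sum_single[OF f order_refl]) simp
  also have "\<dots> = (\<Sum>i\<in>{w. x w \<noteq> 0}. x i * \<phi> (single i))"
    using functional_ev[OF closed_bar_space \<phi> f, of single x]
    by (simp add: single_bar_space bar_spaceD(2)[OF x])
  finally show ?thesis by (simp only: ev_def)
qed

lemma single_chain_cycle: "chain_factorization Q R us \<Longrightarrow> single us \<in> (bar_cycles Q R :: (_ \<Rightarrow> 'k::field) set)"
proof -
  assume us: "chain_factorization Q R us"
  have "chain_part (single us) = (single us :: _ \<Rightarrow> 'k)" using us by (auto simp: chain_part_def single_def)
  then have "bar_diff R (single us) = (\<lambda>v. 0 :: 'k)" using chain_part_cycle[of "single us :: _ \<Rightarrow> 'k"] by simp
  then show ?thesis using single_bar_space[OF factorization_bar_word[OF us]] by (simp add: bar_cycles_def fun_eq_iff)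
qed

text \<open>
  Modulo boundaries every cycle is a combination of the cycles of chains.
\<close>
lemma Ext_eqI:
  fixes \<phi> \<phi>' :: "('a list list \<Rightarrow> 'k::field) \<Rightarrow> 'k"
  assumes "\<phi> \<in> component (Ext Q R) n" "\<phi>' \<in> component (Ext Q R) n'"
    and eq: "\<And>us. chain_factorization Q R us \<Longrightarrow> \<phi> (single us) = \<phi>' (single us)"
  shows "\<phi> = \<phi>'"
proof
  fix x
  have \<phi>: "\<phi> \<in> component (graded_dual Q (bar_cycles Q R)) n" "\<And>x. x \<in> bar_space Q R \<Longrightarrow> \<phi> (bar_diff R x) = 0"
    and \<phi>': "\<phi>' \<in> component (graded_dual Q (bar_cycles Q R)) n'" "\<And>x. x \<in> bar_space Q R \<Longrightarrow> \<phi>' (bar_diff R x) = 0"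
    using assms(1,2) by auto
  show "\<phi> x = \<phi>' x"
  proof (cases "x \<in> bar_cycles Q R")
    case False
    then show ?thesis using componentD(1)[OF \<phi>(1)] componentD(1)[OF \<phi>'(1)] by simp
  next
    case True
    obtain u y where uy: "u \<in> bar_space Q R" "x = (\<lambda>w. bar_diff R u w + chain_part y w)" "y \<in> bar_space Q R"
      using bar_decomposition[of x] True by (auto simp: bar_cycles_def)
    define J where "J = {w. chain_part y w \<noteq> 0}"
    have J: "finite J"
      using bar_spaceD(1)[OF uy(3)] unfolding J_def finsupp_def by (rule rev_finite_subset) (auto simp: chain_part_def)
    have fact: "chain_factorization Q R us" if "us \<in> J" for us
      using that by (auto simp: J_def chain_part_def split: if_splits)
    have sc: "\<And>us. us \<in> J \<Longrightarrow> single us \<in> (bar_cycles Q R :: (_ \<Rightarrow> 'k) set)" using fact single_chain_cycle by blast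
    have cp: "chain_part y = (\<lambda>w. \<Sum>us\<in>J. chain_part y us * single us w)"
      by (rule sum_single[OF J]) (simp add: J_def)
    have bd: "bar_diff R u \<in> bar_cycles Q R"
      using uy(1) by (simp add: bar_cycles_def bar_diff_in_space bar_diff_bar_diff)
    have *: "\<psi> x = (\<Sum>us\<in>J. chain_part y us * \<psi> (single us))"
      if \<psi>: "\<psi> \<in> component (graded_dual Q (bar_cycles Q R)) k" "\<And>x. x \<in> bar_space Q R \<Longrightarrow> \<psi> (bar_diff R x) = 0" for \<psi> k
    proof -
      have L: "\<psi> (chain_part y) = (\<Sum>us\<in>J. chain_part y us * \<psi> (single us))" "chain_part y \<in> bar_cycles Q R"
        using functional_ev[OF closed_bar_cycles \<psi>(1) J, of single, where c = "chain_part y"] sc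
        unfolding cp[symmetric] by simp_all
      have "\<psi> x = \<psi> (bar_diff R u) + \<psi> (chain_part y)"
        unfolding uy(2) by (rule componentD(2)[OF \<psi>(1) bd L(2)])
      then show ?thesis using L(1) \<psi>(2)[OF uy(1)] by simp
    qed
    show ?thesis using *[OF \<phi>] *[OF \<phi>'] eq fact by simp
  qed
qed

end

section \<open>Coordinates of Ext classes and kernels\<close>

lemma sum_fun_apply: "(\<Sum>a\<in>A. f a) x = (\<Sum>a\<in>A. f a x)"
  by (induction A rule: infinite_finite_induct) auto

context monomial_quiver
begin

text \<open>
  The bar cycle \<open>[u\<^sub>0|\<dots>|u\<^sub>r]\<close> of a chain.
\<close>
definition factors :: "'a list \<Rightarrow> 'a list list" where
  "factors \<gamma> = (THE us. chain_factorization Q R us \<and> concat us = \<gamma>)"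

lemma factors_eq: "chain_factorization Q R us \<Longrightarrow> factors (concat us) = us"
  unfolding factors_def using factorization_unique by blast

lemma factorization_chain: "chain_factorization Q R us \<Longrightarrow> chain Q R (length us - 1) (concat us)"
  unfolding chain_def by (intro exI[of _ us]) (auto simp: chain_factorization_def)

lemma factorization_is_chain: "chain_factorization Q R us \<Longrightarrow> is_chain (concat us)"
  using factorization_chain by (auto simp: is_chain_def)

lemma factors:
  assumes "is_chain \<gamma>"
  shows "chain_factorization Q R (factors \<gamma>)" "concat (factors \<gamma>) = \<gamma>" "length (factors \<gamma>) = Suc (cdeg \<gamma>)"
proof -
  obtain us where us: "chain_factorization Q R us" "concat us = \<gamma>" "length us = Suc (cdeg \<gamma>)"
    using chain_cdeg[OF assms] by (auto simp: chain_def)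
  then have "factors \<gamma> = us" using factors_eq by blast
  then show "chain_factorization Q R (factors \<gamma>)" "concat (factors \<gamma>) = \<gamma>" "length (factors \<gamma>) = Suc (cdeg \<gamma>)"
    using us by auto
qed

text \<open>
  The coefficient of \<open>\<gamma>\<^sup>\<or>\<close> in a class of Ext.
\<close>
definition coord :: "(('a list list \<Rightarrow> 'k::field) \<Rightarrow> 'k) \<Rightarrow> 'a list \<Rightarrow> 'k" where
  "coord \<phi> \<gamma> = (if is_chain \<gamma> then \<phi> (single (factors \<gamma>)) else 0)"

text \<open>
  The coefficient of \<open>\<gamma>\<^sub>1\<^sup>\<or> \<otimes> \<dots> \<otimes> \<gamma>\<^sub>n\<^sup>\<or>\<close> in a tensor product of classes; it is zero if the
  number of factors is different.
\<close>
fun tens :: "(('a list list \<Rightarrow> 'k::field) \<Rightarrow> 'k) list \<Rightarrow> 'a list list \<Rightarrow> 'k" where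
  "tens [] [] = 1"
| "tens (x # xs) (g # y) = coord x g * tens xs y"
| "tens [] (g # y) = 0"
| "tens (x # xs) [] = 0"

lemma tens_length: "tens xs y \<noteq> 0 \<Longrightarrow> length y = length xs"
  by (induction xs y rule: tens.induct) auto

lemma tens_append: "length xs = length y \<Longrightarrow> tens (xs @ xs') (y @ y') = tens xs y * tens xs' y'"
  by (induction xs y rule: tens.induct) auto

lemma coord_scale: "coord (\<lambda>x. c * \<phi> x) g = c * coord \<phi> g"
  by (simp add: coord_def)

lemma coord_add: "coord (\<lambda>z. \<phi> z + \<psi> z) g = coord \<phi> g + coord \<psi> g"
  by (simp add: coord_def)

lemma tens_add: "tens (xs @ [\<phi> + \<psi>] @ ys) y = tens (xs @ [\<phi>] @ ys) y + tens (xs @ [\<psi>] @ ys) y"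
proof (induction xs arbitrary: y)
  case Nil
  then show ?case by (cases y) (simp_all add: coord_add distrib_right)
next
  case (Cons x xs)
  then show ?case by (cases y) (simp_all add: distrib_left)
qed

lemma tens_scale: "tens (xs @ [\<lambda>x. c * \<phi> x] @ ys) y = c * tens (xs @ [\<phi>] @ ys) y"
proof (induction xs arbitrary: y)
  case Nil
  then show ?case by (cases y) (simp_all add: coord_scale)
next
  case (Cons x xs)
  then show ?case by (cases y) simp_all
qed

lemma Ext_component: "\<phi> \<in> component (Ext Q R) n \<Longrightarrow> \<phi> \<in> component (graded_dual Q (bar_cycles Q R)) n"
  by simp

lemma coord_degree:
  fixes \<phi> :: "('a list list \<Rightarrow> 'k::field) \<Rightarrow> 'k"
  assumes \<phi>: "\<phi> \<in> component (Ext Q R) d"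
  shows "\<exists>W. finite W \<and> (\<forall>g. coord \<phi> g \<noteq> 0 \<longrightarrow> int (cdeg g) + 1 = d \<and> length g \<in> W)"
proof -
  obtain W where W: "finite W" "\<And>k m x. x \<in> bar_cycles Q R \<Longrightarrow> bihomogeneous k m x \<Longrightarrow>
      \<not> (int k = d \<and> m \<in> W) \<Longrightarrow> \<phi> x = 0"
    using componentD(4)[OF Ext_component[OF \<phi>]] by blast
  have "int (cdeg g) + 1 = d \<and> length g \<in> W" if "coord \<phi> g \<noteq> 0" for g
  proof -
    have g: "is_chain g" "\<phi> (single (factors g)) \<noteq> 0" using that by (auto simp: coord_def split: if_splits)
    have "bihomogeneous (Suc (cdeg g)) (length g) (single (factors g) :: _ \<Rightarrow> 'k)"
      using factors[OF g(1)] by (simp add: bihomogeneous_def single_def)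
    then have "int (Suc (cdeg g)) = d \<and> length g \<in> W"
      using W(2)[OF single_chain_cycle[OF factors(1)[OF g(1)]]] g(2) by blast
    then show ?thesis by simp
  qed
  then show ?thesis using W(1) by blast
qed

lemma tens_degree:
  fixes xs :: "(('a list list \<Rightarrow> 'k::field) \<Rightarrow> 'k) list"
  assumes "homogeneous (Ext Q R) ds xs"
  shows "\<exists>W. finite W \<and> (\<forall>y. tens xs y \<noteq> 0 \<longrightarrow> ds = map (\<lambda>g. int (cdeg g) + 1) y \<and> length (concat y) \<in> W)"
  using assms unfolding homogeneous_def
proof (induction ds xs rule: list_all2_induct)
  case Nil
  show ?case by (intro exI[of _ "{0}"]) (auto dest: tens_length)
next
  case (Cons d ds x xs)
  obtain W where W: "finite W" "\<And>y. tens xs y \<noteq> 0 \<Longrightarrow> ds = map (\<lambda>g. int (cdeg g) + 1) y \<and> length (concat y) \<in> W"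
    using Cons.IH by blast
  obtain W' where W': "finite W'" "\<And>g. coord x g \<noteq> 0 \<Longrightarrow> int (cdeg g) + 1 = d \<and> length g \<in> W'"
    using coord_degree[OF Cons.hyps(1)] by blast
  have "d # ds = map (\<lambda>g. int (cdeg g) + 1) y \<and> length (concat y) \<in> (\<lambda>(a, b). a + b) ` (W' \<times> W)"
    if nz: "tens (x # xs) y \<noteq> 0" for y
  proof -
    obtain g y' where y: "y = g # y'" using nz by (cases y) auto
    then have "coord x g \<noteq> 0" "tens xs y' \<noteq> 0" using nz by auto
    then show ?thesis using W(2)[of y'] W'(2)[of g] y by force
  qed
  moreover have "finite ((\<lambda>(a, b). a + b) ` (W' \<times> W))" using W W' by simp
  ultimately show ?case by blast
qed

text \<open>
  A kernel \<open>K\<close> describes the map from the bar construction to the tensor algebra that sends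
  \<open>w\<close> to the combination of words \<open>y\<close> with coefficients \<open>K w y\<close>. This is its transpose,
  evaluated on a tensor product of classes.
\<close>
definition khat :: "('a list list \<Rightarrow> 'a list list \<Rightarrow> 'k::field) \<Rightarrow> (('a list list \<Rightarrow> 'k) \<Rightarrow> 'k) list \<Rightarrow> 'a list list \<Rightarrow> 'k" where
  "khat K xs w = (\<Sum>y\<in>Words (concat w). K w y * tens xs y)"

definition kern where
  "kern V K xs = func V (khat K xs)"

text \<open>
  The transpose has degree \<open>d\<close>, where the dual of a chain of length \<open>r\<close> counts as degree
  \<open>r + 1\<close>.
\<close>
definition kernel_degree :: "nat \<Rightarrow> int \<Rightarrow> ('a list list \<Rightarrow> 'a list list \<Rightarrow> 'k::field) \<Rightarrow> bool" where
  "kernel_degree n d K \<longleftrightarrow> (\<forall>w y. bar_word Q R w \<and> y \<in> Words (concat w) \<and> K w y \<noteq> 0 \<and> length y = n \<longrightarrow>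
     int (length w) = int (wdeg y) + int n + d)"

lemma sum_degrees: "sum_list (map (\<lambda>g. int (cdeg g) + 1) y) = int (wdeg y) + int (length y)"
  by (induction y) auto

lemma kern_component:
  assumes V: "closed_space V" and K: "kernel_degree n d K" and xs: "homogeneous (Ext Q R) ds xs" "length xs = n"
  shows "kern V K xs \<in> component (graded_dual Q V) (sum_list ds + d)"
proof -
  obtain W where W: "finite W" "\<And>y. tens xs y \<noteq> 0 \<Longrightarrow> ds = map (\<lambda>g. int (cdeg g) + 1) y \<and> length (concat y) \<in> W"
    using tens_degree[OF xs(1)] by blast
  show ?thesis unfolding kern_def
  proof (rule func_component[OF V W(1)])
    fix w assume w: "bar_word Q R w" "khat K xs w \<noteq> 0"
    then obtain y where y: "y \<in> Words (concat w)" "K w y * tens xs y \<noteq> 0"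
      unfolding khat_def by (blast dest: sum_nonzeroD)
    then have t: "tens xs y \<noteq> 0" "K w y \<noteq> 0" by auto
    have "length y = n" using tens_length[OF t(1)] xs by simp
    moreover have "int (length w) = int (wdeg y) + int n + d"
      using K w(1) y(1) t(2) \<open>length y = n\<close> unfolding kernel_degree_def by blast
    moreover have "concat y = concat w" using y(1) by (simp add: Words_def)
    ultimately show "int (length w) = sum_list ds + d \<and> length (concat w) \<in> W"
      using W(2)[OF t(1)] sum_degrees[of y] by simp
  qed
qed

lemma coord_lact:
  fixes \<phi> :: "('a list list \<Rightarrow> 'k::field) \<Rightarrow> 'k"
  assumes \<phi>: "\<phi> \<in> component (Ext Q R) a"
  shows "coord (lact (Ext Q R) i \<phi>) g = (if source Q g = i then coord \<phi> g else 0)"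
    and "coord (ract (Ext Q R) i \<phi>) g = (if target Q g = i then coord \<phi> g else 0)"
proof -
  have z: "\<phi> (\<lambda>w. 0) = 0" by (rule component_zero[OF Ext_component[OF \<phi>] closed_bar_cycles])
  have "coord (lact (Ext Q R) i \<phi>) g = (if source Q g = i then coord \<phi> g else 0) \<and>
    coord (ract (Ext Q R) i \<phi>) g = (if target Q g = i then coord \<phi> g else 0)"
  proof (cases "is_chain g")
    case True
    define us where "us = factors g"
    have us: "chain_factorization Q R us" "concat us = g" using factors[OF True] by (auto simp: us_def)
    have pw: "path_word us" using factorization_bar_word[OF us(1)] bar_word_iff by blast
    have s: "source Q (hd us) = source Q g" "target Q (last us) = target Q g"
      using source_hd[of us] target_last[of us] pw us(2) by (auto simp: path_word_def)
    have c: "single us \<in> (bar_cycles Q R :: (_ \<Rightarrow> 'k) set)" by (rule single_chain_cycle[OF us(1)])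
    have "(\<lambda>w. if source Q (hd w) = i then single us w else 0) = (if source Q g = i then single us else (\<lambda>w. 0 :: 'k))"
      "(\<lambda>w. if target Q (last w) = i then single us w else 0) = (if target Q g = i then single us else (\<lambda>w. 0 :: 'k))"
      using s by (auto simp: single_def)
    note e = this
    have l: "lact (Ext Q R) i \<phi> (single us) = (if source Q g = i then \<phi> (single us) else 0)"
      unfolding Ext_simps(2) graded_dual_simps(2) e(1) using c z by simp
    have r: "ract (Ext Q R) i \<phi> (single us) = (if target Q g = i then \<phi> (single us) else 0)"
      unfolding Ext_simps(3) graded_dual_simps(3) e(2) using c z by simp
    show ?thesis
      unfolding coord_def us_def[symmetric] l r using True by simp
  qed (simp add: coord_def)
  then show "coord (lact (Ext Q R) i \<phi>) g = (if source Q g = i then coord \<phi> g else 0)"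
    "coord (ract (Ext Q R) i \<phi>) g = (if target Q g = i then coord \<phi> g else 0)" by blast+
qed

text \<open>
  Consecutive letters of a word meet at a vertex.
\<close>
lemma tens_balanced:
  assumes "x \<in> component (Ext Q R) a" "x' \<in> component (Ext Q R) b" "path_word y"
  shows "tens (xs @ [ract (Ext Q R) i x, x'] @ ys) y = tens (xs @ [x, lact (Ext Q R) i x'] @ ys) y"
  using assms(3)
proof (induction xs arbitrary: y)
  case Nil
  show ?case
  proof (cases "\<exists>g g' y'. y = g # g' # y'")
    case True
    then obtain g g' y' where y: "y = g # g' # y'" by blast
    have "g \<noteq> []" "g' \<noteq> []" using Nil y by (auto simp: path_word_def)
    then have "target Q g = source Q (g' @ concat y')"
      using Nil y quiver_path_append[of g "g' @ concat y'"] by (simp add: path_word_def)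
    then have "target Q g = source Q g'" using \<open>g' \<noteq> []\<close> by (simp add: source_def)
    then show ?thesis using y by (simp add: coord_lact[OF assms(1)] coord_lact[OF assms(2)] del: Ext_simps)
  next
    case False
    then show ?thesis by (cases y; cases "tl y") auto
  qed
next
  case (Cons z xs)
  show ?case
  proof (cases y)
    case (Cons g y')
    show ?thesis
    proof (cases y')
      case Nil
      then show ?thesis using \<open>y = g # y'\<close> by (cases xs) auto
    next
      case (Cons g' y'')
      then have "path_word y'" using Cons.prems \<open>y = g # y'\<close> path_word_append(2)[of "[g]" y'] by simp
      then show ?thesis using Cons.IH \<open>y = g # y'\<close> by simp
    qed
  qed simp
qed

lemma tens_lact: "x \<in> component (Ext Q R) a \<Longrightarrow> y \<noteq> [] \<Longrightarrow>
    tens (lact (Ext Q R) i x # xs) y = (if source Q (hd y) = i then tens (x # xs) y else 0)"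
  by (cases y) (simp_all add: coord_lact del: Ext_simps)

lemma tens_ract: "x \<in> component (Ext Q R) a \<Longrightarrow> y \<noteq> [] \<Longrightarrow>
    tens (xs @ [ract (Ext Q R) i x]) y = (if target Q (last y) = i then tens (xs @ [x]) y else 0)"
proof (induction xs arbitrary: y)
  case Nil
  then show ?case by (cases y; cases "tl y") (auto simp: coord_lact simp del: Ext_simps)
next
  case (Cons z xs)
  then show ?case
  proof (cases y)
    case (Cons g y')
    show ?thesis
    proof (cases "y' = []")
      case True
      then show ?thesis using \<open>y = g # y'\<close> by (cases xs) auto
    next
      case False
      then show ?thesis using Cons.IH[OF Cons.prems(1) False] \<open>y = g # y'\<close> by simp
    qed
  qed simp
qed

lemma Words_path_word: "bar_word Q R w \<Longrightarrow> y \<in> Words (concat w) \<Longrightarrow> path_word y"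
  using bar_word_iff[of w] chain_nonempty by (auto simp: path_word_def Words_def quiver_path_def)

lemma Words_ends:
  assumes "bar_word Q R w" "y \<in> Words (concat w)"
  shows "source Q (hd y) = source Q (hd w)" "target Q (last y) = target Q (last w)"
proof -
  have "path_word w" "path_word y" "concat y = concat w"
    using assms bar_word_iff Words_path_word by (auto simp: Words_def)
  then show "source Q (hd y) = source Q (hd w)" "target Q (last y) = target Q (last w)"
    using source_hd[of w] source_hd[of y] target_last[of w] target_last[of y] by (auto simp: path_word_def)
qed

lemma khat_cong_tens:
  assumes "\<And>y. y \<in> Words (concat w) \<Longrightarrow> tens xs y = c * tens xs' y"
  shows "khat K xs w = c * khat K xs' w"
  unfolding khat_def sum_distrib_left using assms by (intro sum.cong) (auto simp: mult_ac)

lemma func_cong: "closed_space V \<Longrightarrow> (\<And>w. bar_word Q R w \<Longrightarrow> \<psi> w = \<psi>' w) \<Longrightarrow> func V \<psi> = func V \<psi>'"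
  unfolding func_def by (intro ext if_cong ev_cong refl) (auto dest: closed_spaceD(2) bar_spaceD(2))

lemma func_restrict:
  assumes V: "closed_space V" and q: "mrg_invariant q"
  shows "(\<lambda>x. if x \<in> V then func V \<psi> (\<lambda>w. if q w then x w else 0) else 0) = func V (\<lambda>w. if q w then \<psi> w else 0)"
proof
  fix x
  show "(if x \<in> V then func V \<psi> (\<lambda>w. if q w then x w else 0) else 0) = func V (\<lambda>w. if q w then \<psi> w else 0) x"
  proof (cases "x \<in> V")
    case True
    have "restrict q x \<in> V" by (rule closed_spaceD(5)[OF V True q])
    then show ?thesis
      using True ev_restrict[OF closed_spaceD(1)[OF V True], of \<psi> q] by (simp add: func_def restrict_def)
  qed (simp add: func_def)
qed

text \<open>
  The arguments enter only through \<open>tens\<close>, which is multilinear, balanced and compatible with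
  the outer actions.
\<close>
lemma multi_map_kern:
  fixes V :: "('a list list \<Rightarrow> 'k::field) set"
  assumes V: "closed_space V" and K: "kernel_degree n d K"
  shows "multi_map (Ext Q R) (graded_dual Q V) n d (kern V K)"
  unfolding multi_map_def
proof (intro conjI allI impI; (elim conjE)?)
  fix ds and xs :: "(('a list list \<Rightarrow> 'k) \<Rightarrow> 'k) list"
  assume "length xs = n" "homogeneous (Ext Q R) ds xs"
  then show "kern V K xs \<in> component (graded_dual Q V) (sum_list ds + d)"
    using kern_component[OF V K] by blast
next
  fix xs ys :: "(('a list list \<Rightarrow> 'k) \<Rightarrow> 'k) list" and x y :: "('a list list \<Rightarrow> 'k) \<Rightarrow> 'k"
  show "kern V K (xs @ [x + y] @ ys) = kern V K (xs @ [x] @ ys) + kern V K (xs @ [y] @ ys)"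
  proof
    fix z
    have "ev (khat K (xs @ [x + y] @ ys)) z = ev (khat K (xs @ [x] @ ys)) z + ev (khat K (xs @ [y] @ ys)) z"
      unfolding ev_def khat_def tens_add by (simp add: distrib_left sum.distrib)
    then show "kern V K (xs @ [x + y] @ ys) z = (kern V K (xs @ [x] @ ys) + kern V K (xs @ [y] @ ys)) z"
      by (simp add: kern_def func_def)
  qed
next
  fix xs ys :: "(('a list list \<Rightarrow> 'k) \<Rightarrow> 'k) list" and x :: "('a list list \<Rightarrow> 'k) \<Rightarrow> 'k" and c :: 'k
  show "kern V K (xs @ [scl (Ext Q R) c x] @ ys) = scl (graded_dual Q V) c (kern V K (xs @ [x] @ ys))"
  proof
    fix z
    have "khat K (xs @ [\<lambda>z. c * x z] @ ys) w = c * khat K (xs @ [x] @ ys) w" for w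
      by (rule khat_cong_tens) (rule tens_scale)
    then have "ev (khat K (xs @ [\<lambda>z. c * x z] @ ys)) z = c * ev (khat K (xs @ [x] @ ys)) z"
      unfolding ev_def by (simp add: sum_distrib_left mult_ac)
    then show "kern V K (xs @ [scl (Ext Q R) c x] @ ys) z = scl (graded_dual Q V) c (kern V K (xs @ [x] @ ys)) z"
      by (simp add: kern_def func_def)
  qed
next
  fix xs ys :: "(('a list list \<Rightarrow> 'k) \<Rightarrow> 'k) list" and x y :: "('a list list \<Rightarrow> 'k) \<Rightarrow> 'k" and a b i
  assume x: "x \<in> component (Ext Q R) a" and y: "y \<in> component (Ext Q R) b"
  show "kern V K (xs @ [ract (Ext Q R) i x, y] @ ys) = kern V K (xs @ [x, lact (Ext Q R) i y] @ ys)"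
    unfolding kern_def
  proof (rule func_cong[OF V])
    fix w assume w: "bar_word Q R w"
    show "khat K (xs @ [ract (Ext Q R) i x, y] @ ys) w = khat K (xs @ [x, lact (Ext Q R) i y] @ ys) w"
      unfolding khat_def
      by (intro sum.cong refl arg_cong2[of _ _ _ _ "(*)"] tens_balanced[OF x y] Words_path_word[OF w])
  qed
next
  fix xs :: "(('a list list \<Rightarrow> 'k) \<Rightarrow> 'k) list" and x :: "('a list list \<Rightarrow> 'k) \<Rightarrow> 'k" and a i
  assume x: "x \<in> component (Ext Q R) a"
  have "kern V K (lact (Ext Q R) i x # xs) = func V (\<lambda>w. if source Q (hd w) = i then khat K (x # xs) w else 0)"
    unfolding kern_def
  proof (rule func_cong[OF V])
    fix w assume w: "bar_word Q R w"
    have "khat K (lact (Ext Q R) i x # xs) w = (if source Q (hd w) = i then 1 else 0) * khat K (x # xs) w"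
    proof (rule khat_cong_tens)
      fix y assume y: "y \<in> Words (concat w)"
      then have "y \<noteq> []" using Words_path_word[OF w] by (auto simp: path_word_def)
      then show "tens (lact (Ext Q R) i x # xs) y = (if source Q (hd w) = i then 1 else 0) * tens (x # xs) y"
        using tens_lact[OF x, of y i xs] Words_ends(1)[OF w y] by (simp del: Ext_simps tens.simps)
    qed
    then show "khat K (lact (Ext Q R) i x # xs) w = (if source Q (hd w) = i then khat K (x # xs) w else 0)" by simp
  qed
  then show "kern V K (lact (Ext Q R) i x # xs) = lact (graded_dual Q V) i (kern V K (x # xs))"
    unfolding graded_dual_simps(2) kern_def func_restrict[OF V endpoint_invariant(1)] .
next
  fix xs :: "(('a list list \<Rightarrow> 'k) \<Rightarrow> 'k) list" and x :: "('a list list \<Rightarrow> 'k) \<Rightarrow> 'k" and a i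
  assume x: "x \<in> component (Ext Q R) a"
  have "kern V K (xs @ [ract (Ext Q R) i x]) = func V (\<lambda>w. if target Q (last w) = i then khat K (xs @ [x]) w else 0)"
    unfolding kern_def
  proof (rule func_cong[OF V])
    fix w assume w: "bar_word Q R w"
    have "khat K (xs @ [ract (Ext Q R) i x]) w = (if target Q (last w) = i then 1 else 0) * khat K (xs @ [x]) w"
    proof (rule khat_cong_tens)
      fix y assume y: "y \<in> Words (concat w)"
      then have "y \<noteq> []" using Words_path_word[OF w] by (auto simp: path_word_def)
      then show "tens (xs @ [ract (Ext Q R) i x]) y = (if target Q (last w) = i then 1 else 0) * tens (xs @ [x]) y"
        using tens_ract[OF x, of y xs i] Words_ends(2)[OF w y] by (simp del: Ext_simps tens.simps)
    qed
    then show "khat K (xs @ [ract (Ext Q R) i x]) w = (if target Q (last w) = i then khat K (xs @ [x]) w else 0)" by simp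
  qed
  then show "kern V K (xs @ [ract (Ext Q R) i x]) = ract (graded_dual Q V) i (kern V K (xs @ [x]))"
    unfolding graded_dual_simps(3) kern_def func_restrict[OF V endpoint_invariant(2)] .
qed

section \<open>The higher products\<close>

text \<open>
  The coefficient in the theorem, as a function of the list of chains.
\<close>
definition block_sign :: "'a list list \<Rightarrow> 'k::field" where
  "block_sign b = (if good b then (-1) ^ sign_exponent (map cdeg b) (Suc (wdeg b)) else 0)"

text \<open>
  The factor \<open>kappa\<close> identifies the span of the chains with Tor.
\<close>
definition mu_kernel :: "'a list list \<Rightarrow> 'a list list \<Rightarrow> 'k::field" where
  "mu_kernel w y = kappa w * block_sign y"

text \<open>
  The sign \<open>length w choose 2\<close> accounts for the sign conventions in the dual of the bar
  construction.
\<close>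
definition mor_kernel :: "'a list list \<Rightarrow> 'a list list \<Rightarrow> 'k::field" where
  "mor_kernel w y = (-1) ^ (length w choose 2) * (-1) ^ theta (map cdeg y) * lift w y"

definition mu :: "nat \<Rightarrow> (('a list list \<Rightarrow> 'k::field) \<Rightarrow> 'k) list \<Rightarrow> ('a list list \<Rightarrow> 'k) \<Rightarrow> 'k" where
  "mu n xs = kern (bar_cycles Q R) mu_kernel xs"

definition mor :: "nat \<Rightarrow> (('a list list \<Rightarrow> 'k::field) \<Rightarrow> 'k) list \<Rightarrow> ('a list list \<Rightarrow> 'k) \<Rightarrow> 'k" where
  "mor n xs = kern (bar_space Q R) mor_kernel xs"

lemma kappa_length:
  assumes "kappa w \<noteq> (0::'k::field)"
  shows "bar_word Q R w" "is_chain (concat w)" "length w = Suc (cdeg (concat w))"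
proof -
  have "lift w [concat w] \<noteq> (0::'k)" using assms by (simp add: kappa_def)
  from lift_support[OF this] show "bar_word Q R w" "is_chain (concat w)" "length w = Suc (cdeg (concat w))"
    by (auto simp: Words_def)
qed

lemma mu_kernel_degree: "kernel_degree n (2 - int n) (mu_kernel :: _ \<Rightarrow> _ \<Rightarrow> 'k::field)"
  unfolding kernel_degree_def
proof (intro allI impI; elim conjE)
  fix w y assume y: "y \<in> Words (concat w)" "mu_kernel w y \<noteq> (0::'k)" "length y = n"
  then have nz: "kappa w \<noteq> (0::'k)" "good y" by (auto simp: mu_kernel_def block_sign_def split: if_splits)
  have "cdeg (concat w) = Suc (wdeg y)" using nz(2) y(1) by (auto simp: good_def Words_def intro: cdeg_eq)
  then show "int (length w) = int (wdeg y) + int n + (2 - int n)" using kappa_length(3)[OF nz(1)] by simp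
qed

lemma mor_kernel_degree: "kernel_degree n (1 - int n) (mor_kernel :: _ \<Rightarrow> _ \<Rightarrow> 'k::field)"
  unfolding kernel_degree_def
proof (intro allI impI; elim conjE)
  fix w y assume y: "mor_kernel w y \<noteq> (0::'k)" "length y = n"
  then have "lift w y \<noteq> (0::'k)" by (auto simp: mor_kernel_def)
  from lift_support[OF this] show "int (length w) = int (wdeg y) + int n + (1 - int n)" by simp
qed

lemma khat_mu: "khat mu_kernel xs w = kappa w * (\<Sum>b\<in>Words (concat w). block_sign b * tens xs b)"
  by (simp add: khat_def mu_kernel_def sum_distrib_left mult.assoc)

text \<open>
  On the words over one path the functional is a multiple of \<open>kappa\<close>, which vanishes on
  boundaries.
\<close>
lemma mu_boundary:
  fixes x :: "'a list list \<Rightarrow> 'k::field"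
  assumes x: "x \<in> bar_space Q R"
  shows "mu n xs (bar_diff R x) = 0"
proof -
  have "ev (khat mu_kernel xs) (bar_diff R x) = ev (\<lambda>w. ev (khat mu_kernel xs) (bar_diff_word R w)) x"
    by (rule ev_bar_diff[OF bar_spaceD(1)[OF x]])
  also have "\<dots> = ev (\<lambda>w. 0) x"
  proof (rule ev_cong)
    fix w assume "x w \<noteq> 0"
    then have w: "bar_word Q R w" by (rule bar_spaceD(2)[OF x])
    let ?c = "\<Sum>b\<in>Words (concat w). block_sign b * tens xs b"
    have "ev (khat mu_kernel xs) (bar_diff_word R w) = (\<Sum>i<length w - 1. (-1) ^ i * khat mu_kernel xs (mrg i w))"
      by (rule ev_bar_diff_word_bar[OF w]) (simp add: khat_mu kappa_not_bar)
    also have "\<dots> = (\<Sum>i<length w - 1. (-1) ^ i * kappa (mrg i w) :: 'k) * ?c"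
      unfolding sum_distrib_right by (intro sum.cong) (auto simp: khat_mu mrg_props mult.assoc)
    finally show "ev (khat mu_kernel xs) (bar_diff_word R w) = 0" unfolding kappa_boundary[OF w] by simp
  qed
  finally show ?thesis by (simp add: mu_def kern_def func_def ev_def)
qed

lemma multi_map_mu: "multi_map (Ext Q R) (Ext Q R) n (2 - int n) (mu n :: _ \<Rightarrow> (_ \<Rightarrow> 'k::field) \<Rightarrow> 'k)"
proof -
  have m: "multi_map (Ext Q R) (graded_dual Q (bar_cycles Q R)) n (2 - int n) (mu n :: _ \<Rightarrow> (_ \<Rightarrow> 'k) \<Rightarrow> 'k)"
    using multi_map_kern[OF closed_bar_cycles mu_kernel_degree] unfolding mu_def[abs_def] .
  have c: "mu n xs \<in> component (Ext Q R) d \<longleftrightarrow> mu n xs \<in> component (graded_dual Q (bar_cycles Q R)) d"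
    for xs :: "(('a list list \<Rightarrow> 'k) \<Rightarrow> 'k) list" and d and n
    unfolding Ext_simps(4) using mu_boundary[of _ n xs] by blast
  show ?thesis using m unfolding multi_map_def c by (simp only: Ext_simps graded_dual_simps)
qed

lemma multi_map_mor: "multi_map (Ext Q R) (bar_dual Q R) n (1 - int n) (mor n :: _ \<Rightarrow> (_ \<Rightarrow> 'k::field) \<Rightarrow> 'k)"
  using multi_map_kern[OF closed_bar_space mor_kernel_degree] unfolding mor_def[abs_def] bar_dual_def .

text \<open>
  On the cycles of chains \<open>kappa\<close> is \<open>1\<close>, so only the signs of the decompositions remain.
\<close>
lemma coord_mu:
  fixes xs :: "(('a list list \<Rightarrow> 'k::field) \<Rightarrow> 'k) list"
  shows "coord (mu n xs) g = (\<Sum>b\<in>Words g. block_sign b * tens xs b)"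
proof (cases "is_chain g")
  case True
  have "single (factors g) \<in> (bar_cycles Q R :: (_ \<Rightarrow> 'k) set)"
    by (rule single_chain_cycle[OF factors(1)[OF True]])
  then show ?thesis
    using True factors[OF True]
    by (simp add: coord_def mu_def kern_def func_def ev_single khat_mu kappa_chain)
next
  case False
  have "block_sign b = (0::'k)" if "b \<in> Words g" for b
    using False that by (auto simp: block_sign_def good_def Words_def is_chain_def)
  then show ?thesis using False by (simp add: coord_def)
qed

lemma Words_splice:
  assumes "v \<in> Words p" "r < length v" "b \<in> Words (v ! r)"
  shows "take r v @ b @ drop (Suc r) v \<in> Words p"
proof -
  have "concat (take r v) @ v ! r @ concat (drop (Suc r) v) = concat (take r v @ v ! r # drop (Suc r) v)" by simp
  also have "\<dots> = p" using assms(1,2) id_take_nth_drop[of r v] by (simp add: Words_def)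
  finally show ?thesis
    using assms set_take_subset[of r v] set_drop_subset[of "Suc r" v] by (auto simp: Words_def)
qed

lemma tens_insert:
  assumes "length v = Suc (length xs + length ys)" "r = length xs"
  shows "tens (xs @ [\<phi>] @ ys) v = tens xs (take r v) * coord \<phi> (v ! r) * tens ys (drop (Suc r) v)"
proof -
  have "v = take r v @ v ! r # drop (Suc r) v" using assms by (intro id_take_nth_drop) simp
  then have "tens (xs @ [\<phi>] @ ys) v = tens (xs @ \<phi> # ys) (take r v @ v ! r # drop (Suc r) v)" by simp
  also have "\<dots> = tens xs (take r v) * tens (\<phi> # ys) (v ! r # drop (Suc r) v)"
    using assms by (intro tens_append) simp
  finally show ?thesis by (simp add: mult.assoc)
qed

text \<open>
  Inserting a product is merging a block. A word \<open>v\<close> together with a decomposition \<open>b\<close> of its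
  letter number \<open>r\<close> into \<open>s\<close> chains corresponds to the refined word \<open>y\<close> with its block from
  \<open>r\<close> to \<open>r + s\<close>.
\<close>
lemma khat_insert:
  fixes xs :: "(('a list list \<Rightarrow> 'k::field) \<Rightarrow> 'k) list"
  assumes s: "1 \<le> s" and n: "r + s + t = length xs"
  shows "khat K (take r xs @ [mu s (take s (drop r xs))] @ drop (r + s) xs) w =
    (\<Sum>y\<in>Words (concat w). tens xs y *
       (if (r, r + s) \<in> Blk y then block_sign (slice y r (r + s)) * K w (merge r (r + s) y) else 0))"
proof -
  let ?p = "concat w" and ?A = "take r xs" and ?B = "take s (drop r xs)" and ?C = "drop (r + s) xs"
  have len: "length ?A = r" "length ?B = s" "length ?C = t" using n by auto
  define h where "h = (\<lambda>v b. K w v * (tens ?A (take r v) * (block_sign b * tens ?B b) * tens ?C (drop (Suc r) v)))"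
  define S where "S = (SIGMA v:{v \<in> Words ?p. length v = Suc (r + t)}. {b \<in> Words (v ! r). good b \<and> length b = s})"
  define T where "T = {y \<in> Words ?p. length y = length xs \<and> (r, r + s) \<in> Blk y}"
  have "khat K (?A @ [mu s ?B] @ ?C) w = (\<Sum>v\<in>{v \<in> Words ?p. length v = Suc (r + t)}. K w v * tens (?A @ [mu s ?B] @ ?C) v)"
    unfolding khat_def
  proof (rule sum.mono_neutral_right[OF finite_Words])
    show "\<forall>v\<in>Words ?p - {v \<in> Words ?p. length v = Suc (r + t)}. K w v * tens (?A @ [mu s ?B] @ ?C) v = 0"
      using tens_length[of "?A @ [mu s ?B] @ ?C"] len by auto
  qed auto
  also have "\<dots> = (\<Sum>v\<in>{v \<in> Words ?p. length v = Suc (r + t)}. \<Sum>b\<in>{b \<in> Words (v ! r). good b \<and> length b = s}. h v b)"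
  proof (rule sum.cong[OF refl])
    fix v assume "v \<in> {v \<in> Words ?p. length v = Suc (r + t)}"
    then have v: "v \<in> Words ?p" "length v = Suc (r + t)" by auto
    have t: "tens (?A @ [mu s ?B] @ ?C) v = tens ?A (take r v) * coord (mu s ?B) (v ! r) * tens ?C (drop (Suc r) v)"
      using v len by (intro tens_insert) simp_all
    have "(\<Sum>b\<in>{b \<in> Words (v ! r). good b \<and> length b = s}. h v b) = (\<Sum>b\<in>Words (v ! r). h v b)"
    proof (rule sum.mono_neutral_left[OF finite_Words])
      have "h v b = 0" if "\<not> (good b \<and> length b = s)" for b
        using that tens_length[of ?B b] len by (auto simp: h_def block_sign_def)
      then show "\<forall>b\<in>Words (v ! r) - {b \<in> Words (v ! r). good b \<and> length b = s}. h v b = 0" by blast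
    qed auto
    then show "K w v * tens (?A @ [mu s ?B] @ ?C) v = (\<Sum>b\<in>{b \<in> Words (v ! r). good b \<and> length b = s}. h v b)"
      unfolding t coord_mu h_def by (simp add: sum_distrib_left sum_distrib_right)
  qed
  also have "\<dots> = (\<Sum>(v, b)\<in>S. h v b)" unfolding S_def by (rule sum.Sigma) (auto simp: finite_Words)
  also have "\<dots> = (\<Sum>y\<in>T. tens xs y * (block_sign (slice y r (r + s)) * K w (merge r (r + s) y)))"
  proof (rule sum.reindex_bij_witness[of S "\<lambda>y. (merge r (r + s) y, slice y r (r + s))" "\<lambda>(v, b). take r v @ b @ drop (Suc r) v"], goal_cases)
    case (1 a)
    obtain v b where a: "a = (v, b)" by force
    have v: "length v = Suc (r + t)" "concat b = v ! r" "length b = s" using 1 a by (auto simp: S_def Words_def)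
    have "take r v @ v ! r # drop (Suc r) v = v" using v by (intro id_take_nth_drop[symmetric]) simp
    then show ?case using v a by (simp add: merge_def slice_def)
  next
    case (2 a)
    obtain v b where a: "a = (v, b)" by force
    have v: "v \<in> Words ?p" "length v = Suc (r + t)" "b \<in> Words (v ! r)" "good b" "length b = s" using 2 a by (auto simp: S_def)
    have "take r v @ b @ drop (Suc r) v \<in> Words ?p" using v by (intro Words_splice) simp_all
    moreover have "slice (take r v @ b @ drop (Suc r) v) r (r + s) = b" using v by (simp add: slice_def)
    ultimately show ?case using v a n s by (simp add: T_def Blk_def)
  next
    case (3 y)
    then have y: "length y = r + s + t" using n by (simp add: T_def)
    have "take r y @ slice y r (r + s) @ drop (r + s) y = y" using take_slice_drop[of r "r + s" y] by simp
    then show ?case using y by (simp add: merge_def)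
  next
    case (4 y)
    then have y: "y \<in> Words ?p" "length y = r + s + t" "(r, r + s) \<in> Blk y" using n by (auto simp: T_def)
    have g: "good (slice y r (r + s))" using y by (simp add: Blk_def)
    have "merge r (r + s) y \<in> Words ?p" using merge_Words_iff[OF y(3)] y(1) by simp
    moreover have "slice y r (r + s) \<in> Words (merge r (r + s) y ! r)"
      using y(2) g by (simp add: merge_def nth_append Words_def good_def)
    ultimately show ?case using y(2) g by (simp add: S_def merge_def)
  next
    case (5 a)
    obtain v b where a: "a = (v, b)" by force
    have v: "length v = Suc (r + t)" "concat b = v ! r" "length b = s" using 5 a by (auto simp: S_def Words_def)
    have m: "merge r (r + s) (take r v @ b @ drop (Suc r) v) = v"
      using v id_take_nth_drop[of r v] by (simp add: merge_def slice_def)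
    have sl: "slice (take r v @ b @ drop (Suc r) v) r (r + s) = b" using v by (simp add: slice_def)
    have "tens xs (take r v @ b @ drop (Suc r) v) = tens (?A @ ?B @ ?C) (take r v @ b @ drop (Suc r) v)"
      using append_take_drop_id[of s "drop r xs"] append_take_drop_id[of r xs] by (simp add: add.commute)
    also have "\<dots> = tens ?A (take r v) * (tens ?B b * tens ?C (drop (Suc r) v))"
      using v len n by (simp add: tens_append)
    finally show ?case using a m sl by (simp add: h_def mult_ac)
  qed
  also have "\<dots> = (\<Sum>y\<in>Words ?p. tens xs y *
       (if (r, r + s) \<in> Blk y then block_sign (slice y r (r + s)) * K w (merge r (r + s) y) else 0))"
    unfolding T_def using tens_length[of xs]
    by (intro sum.mono_neutral_cong_left[OF finite_Words]) auto
  finally show ?thesis .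
qed

lemma block_insertion_sign:
  assumes b: "(r, r + s) \<in> Blk y" and y: "length y = r + s + t"
    and ds: "ds = map (\<lambda>g. int (cdeg g) + 1) y"
  shows "parity_sign (int (r + s * t) + (2 - int s) * sum_list (take r ds)) * block_sign (slice y r (r + s)) =
    - ((-1 :: 'k::field) ^ wdeg (take (Suc r) y) * (-1) ^ theta (map cdeg y) * (-1) ^ theta (map cdeg (merge r (r + s) y)))"
proof -
  let ?A = "map cdeg (take r y)" and ?B = "map cdeg (slice y r (r + s))" and ?C = "map cdeg (drop (r + s) y)"
  have s: "0 < s" and g: "good (slice y r (r + s))" using b by (auto simp: Blk_def)
  have ne: "?B \<noteq> []" using s y by (simp flip: length_0_conv)
  have hd: "hd ?B = cdeg (y ! r)" using s y by (simp add: slice_def hd_map hd_drop_conv_nth)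
  have "cdeg (concat (slice y r (r + s))) = Suc (wdeg (slice y r (r + s)))" using g by (auto simp: good_def intro: cdeg_eq)
  then have m: "map cdeg (merge r (r + s) y) = ?A @ [Suc (sum_list ?B)] @ ?C" by (simp add: merge_def wdeg_def)
  have yy: "map cdeg y = ?A @ ?B @ ?C" unfolding map_append[symmetric] using take_slice_drop[of r "r + s" y] by simp
  have l: "length ?A = r" "length ?B = s" "length ?C = t" using y by auto
  have d: "sum_list (take r ds) = int (sum_list ?A + length ?A)"
    unfolding ds take_map using y by (simp add: sum_degrees wdeg_def)
  have w: "wdeg (take (Suc r) y) = sum_list ?A + hd ?B"
    using wdeg_take_Suc[of r y] y s unfolding hd by (simp add: wdeg_def)
  have bs: "block_sign (slice y r (r + s)) = (-1 :: 'k) ^ sign_exponent ?B (Suc (sum_list ?B))"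
    using g by (simp add: block_sign_def wdeg_def)
  show ?thesis
    using insertion_sign[OF ne, of ?A ?C, where 'k = 'k] unfolding l d[unfolded l] m yy w bs by simp
qed

text \<open>
  The left side of the identities is the transpose of the composition of \<open>K\<close> with \<open>D\<close>, up to
  rescaling. The degrees \<open>ds\<close> can be read off from every word that contributes.
\<close>
lemma inner_khat:
  fixes xs :: "(('a list list \<Rightarrow> 'k::field) \<Rightarrow> 'k) list"
  assumes xs: "homogeneous (Ext Q R) ds xs"
  shows "(\<Sum>(r, s, t)\<in>{(r, s, t). 1 \<le> s \<and> r + s + t = length xs}.
      parity_sign (int (r + s * t) + (2 - int s) * sum_list (take r ds)) *
      khat K (take r xs @ [mu s (take s (drop r xs))] @ drop (r + s) xs) w) =
    - (\<Sum>y\<in>Words (concat w). (-1) ^ theta (map cdeg y) * tens xs y * cobar_diff (\<lambda>v. (-1) ^ theta (map cdeg v) * K w v) y)"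
proof -
  let ?T = "{(r, s, t). 1 \<le> s \<and> r + s + t = length xs}"
  let ?\<epsilon> = "\<lambda>r s t. parity_sign (int (r + s * t) + (2 - int s) * sum_list (take r ds)) :: 'k"
  define F where "F = (\<lambda>y r s. if (r, r + s) \<in> Blk y then block_sign (slice y r (r + s)) * K w (merge r (r + s) y) else 0)"
  have T: "finite ?T" by (rule finite_subset[of _ "{..length xs} \<times> {..length xs} \<times> {..length xs}"]) auto
  have "(\<Sum>(r, s, t)\<in>?T. ?\<epsilon> r s t * khat K (take r xs @ [mu s (take s (drop r xs))] @ drop (r + s) xs) w) =
      (\<Sum>(r, s, t)\<in>?T. \<Sum>y\<in>Words (concat w). ?\<epsilon> r s t * (tens xs y * F y r s))"
    unfolding F_def
  proof (rule sum.cong[OF refl])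
    fix a assume "a \<in> ?T"
    then obtain r s t where a: "a = (r, s, t)" and rst: "1 \<le> s" "r + s + t = length xs" by blast
    show "(case a of (r, s, t) \<Rightarrow> ?\<epsilon> r s t * khat K (take r xs @ [mu s (take s (drop r xs))] @ drop (r + s) xs) w) =
      (case a of (r, s, t) \<Rightarrow> \<Sum>y\<in>Words (concat w). ?\<epsilon> r s t * (tens xs y *
        (if (r, r + s) \<in> Blk y then block_sign (slice y r (r + s)) * K w (merge r (r + s) y) else 0)))"
      unfolding a prod.case khat_insert[OF rst] by (rule sum_distrib_left)
  qed
  also have "\<dots> = (\<Sum>y\<in>Words (concat w). \<Sum>(r, s, t)\<in>?T. ?\<epsilon> r s t * (tens xs y * F y r s))"
    unfolding split_beta by (rule sum.swap)
  also have "\<dots> = (\<Sum>y\<in>Words (concat w). - ((-1) ^ theta (map cdeg y) * tens xs y * cobar_diff (\<lambda>v. (-1) ^ theta (map cdeg v) * K w v) y))"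
  proof (rule sum.cong[OF refl])
    fix y assume y: "y \<in> Words (concat w)"
    show "(\<Sum>(r, s, t)\<in>?T. ?\<epsilon> r s t * (tens xs y * F y r s)) =
      - ((-1) ^ theta (map cdeg y) * tens xs y * cobar_diff (\<lambda>v. (-1) ^ theta (map cdeg v) * K w v) y)"
    proof (cases "tens xs y = 0")
      case False
      have ly: "length y = length xs" using False by (rule tens_length)
      have ds: "ds = map (\<lambda>g. int (cdeg g) + 1) y" using tens_degree[OF xs] False by blast
      let ?S = "{(r, s, t) \<in> ?T. (r, r + s) \<in> Blk y}"
      have "(\<Sum>(r, s, t)\<in>?T. ?\<epsilon> r s t * (tens xs y * F y r s)) = (\<Sum>(r, s, t)\<in>?S. ?\<epsilon> r s t * (tens xs y * F y r s))"
      proof (rule sum.mono_neutral_right[OF T])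
        show "\<forall>a\<in>?T - ?S. (case a of (r, s, t) \<Rightarrow> ?\<epsilon> r s t * (tens xs y * F y r s)) = 0"
        proof
          fix a assume a: "a \<in> ?T - ?S"
          then obtain r s t where rst: "a = (r, s, t)" using prod_cases3 by blast
          have "F y r s = 0" using a by (simp add: rst F_def)
          then show "(case a of (r, s, t) \<Rightarrow> ?\<epsilon> r s t * (tens xs y * F y r s)) = 0" by (simp add: rst)
        qed
      qed auto
      also have "\<dots> = (\<Sum>(i, l)\<in>Blk y. - ((-1) ^ theta (map cdeg y) * tens xs y *
          ((-1) ^ wdeg (take (Suc i) y) * ((-1) ^ theta (map cdeg (merge i l y)) * K w (merge i l y)))))"
      proof (rule sum.reindex_bij_witness[of ?S "\<lambda>(i, l). (i, l - i, length xs - l)" "\<lambda>(r, s, t). (r, r + s)"], goal_cases)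
        case (5 a)
        obtain r s t where a: "a = (r, s, t)" using prod_cases3 by blast
        have b: "(r, r + s) \<in> Blk y" "length y = r + s + t" using 5 a ly by auto
        have "?\<epsilon> r s t * (tens xs y * F y r s) = (?\<epsilon> r s t * block_sign (slice y r (r + s))) * (tens xs y * K w (merge r (r + s) y))"
          using b(1) by (simp add: F_def mult_ac)
        then show ?case unfolding a block_insertion_sign[OF b ds] by (simp add: mult_ac)
      qed (use ly in \<open>auto simp: Blk_def\<close>)
      also have "\<dots> = - ((-1) ^ theta (map cdeg y) * tens xs y * cobar_diff (\<lambda>v. (-1) ^ theta (map cdeg v) * K w v) y)"
        unfolding cobar_diff_Blk sum_distrib_left sum_negf[symmetric] by (intro sum.cong) auto
      finally show ?thesis .
    qed simp
  qed
  finally show ?thesis by (simp only: sum_negf)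
qed

lemma ev_sum_kernel: "ev (\<lambda>w. \<Sum>a\<in>A. c a * k a w) x = (\<Sum>a\<in>A. c a * ev (k a) x)"
  unfolding ev_def sum_distrib_left by (subst sum.swap) (simp add: mult_ac)

lemma inner_sum_kern:
  fixes xs :: "(('a list list \<Rightarrow> 'k::field) \<Rightarrow> 'k) list"
  assumes xs: "homogeneous (Ext Q R) ds xs" and N: "scl N = (\<lambda>c \<phi> x. c * \<phi> x)" and g: "\<And>n xs. g n xs = kern V K xs"
  shows "inner_sum N g mu ds xs = func V (\<lambda>w. - (\<Sum>y\<in>Words (concat w).
    (-1) ^ theta (map cdeg y) * tens xs y * cobar_diff (\<lambda>v. (-1) ^ theta (map cdeg v) * K w v) y))"
proof
  fix x
  show "inner_sum N g mu ds xs x = func V (\<lambda>w. - (\<Sum>y\<in>Words (concat w).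
    (-1) ^ theta (map cdeg y) * tens xs y * cobar_diff (\<lambda>v. (-1) ^ theta (map cdeg v) * K w v) y)) x"
    unfolding inner_sum_def N g sum_fun_apply split_beta kern_def func_def
      inner_khat[OF xs, symmetric, unfolded split_beta] ev_sum_kernel
    by (cases "x \<in> V") simp_all
qed

text \<open>
  After rescaling, the products are the coefficients of \<open>D\<close> on single chains.
\<close>
lemma block_sign_boundary:
  assumes v: "v \<in> Words p" and p: "is_chain p"
  shows "(-1) ^ theta (map cdeg v) * block_sign v = - ((-1) ^ theta [cdeg p]) * (cobar_diff (single [p]) v :: 'k::field)"
proof -
  have D: "cobar_diff (single [p]) v = (if Suc (wdeg v) = cdeg p then (-1) ^ cdeg (hd v) else (0::'k))"
    by (rule cobar_diff_single_chain[OF v chain_cdeg[OF p]])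
  have ne: "v \<noteq> []" using v chain_nonempty[OF p] by (auto simp: Words_def)
  have g: "good v \<longleftrightarrow> Suc (wdeg v) = cdeg p"
  proof
    assume "good v"
    then show "Suc (wdeg v) = cdeg p" using v cdeg_eq[of "Suc (wdeg v)" p] by (simp add: good_def Words_def)
  next
    assume "Suc (wdeg v) = cdeg p"
    then show "good v" using v chain_cdeg[OF p] by (simp add: good_def Words_def)
  qed
  show ?thesis
  proof (cases "Suc (wdeg v) = cdeg p")
    case True
    have "block_sign v = - ((-1 :: 'k) ^ theta (map cdeg v) * ((-1) ^ theta [cdeg p] * (-1) ^ cdeg (hd v)))"
      using insertion_sign[of "map cdeg v" "[]" "[]", where 'k = 'k] ne True g
      by (simp add: block_sign_def wdeg_def hd_map parity_sign_def mult_ac)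
    then show ?thesis unfolding D using True by (simp del: theta.simps)
  qed (simp add: D g block_sign_def)
qed

text \<open>
  By the previous facts this is the coefficient of \<open>D\<^sup>2\<close> at a single chain.
\<close>
lemma inner_sum_mu:
  fixes xs :: "(('a list list \<Rightarrow> 'k::field) \<Rightarrow> 'k) list"
  assumes xs: "homogeneous (Ext Q R) ds xs"
  shows "inner_sum (Ext Q R) mu mu ds xs = 0"
proof -
  have "cobar_diff (\<lambda>v. (-1) ^ theta (map cdeg v) * mu_kernel w v) y = (0::'k)" if y: "y \<in> Words (concat w)" for w y
  proof (cases "kappa w = (0::'k)")
    case True
    then show ?thesis by (simp add: mu_kernel_def cobar_diff_zero)
  next
    case False
    let ?p = "concat w"
    have p: "is_chain ?p" by (rule kappa_length(2)[OF False])
    have "(cobar_diff (\<lambda>v. (-1) ^ theta (map cdeg v) * mu_kernel w v) y :: 'k) =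
        cobar_diff (\<lambda>v. - (kappa w * (-1) ^ theta [cdeg ?p]) * cobar_diff (single [?p]) v) y"
    proof (rule cobar_diff_cong)
      fix i l assume "i < l" "l \<le> length y" "good (slice y i l)"
      then have "merge i l y \<in> Words ?p" using merge_Words_iff[of i l y ?p] y by (simp add: Blk_def)
      from block_sign_boundary[OF this p, where 'k = 'k]
      show "(-1) ^ theta (map cdeg (merge i l y)) * mu_kernel w (merge i l y) =
          - (kappa w * (-1) ^ theta [cdeg ?p]) * (cobar_diff (single [?p]) (merge i l y) :: 'k)"
        unfolding mu_kernel_def by (simp add: mult.left_commute[of _ "kappa w"] mult.assoc)
    qed
    then show ?thesis unfolding cobar_diff_scale cobar_diff_square_single_chain[OF p] by simp
  qed
  then have "inner_sum (Ext Q R) mu mu ds xs = func (bar_cycles Q R) (\<lambda>w. 0)"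
    by (simp add: inner_sum_kern[OF xs Ext_simps(1) mu_def, unfolded Ext_simps])
  then show ?thesis by (simp add: func_def ev_def fun_eq_iff)
qed

lemma a_infinity_mu: "a_infinity_algebra (Ext Q R) (mu :: nat \<Rightarrow> (('a list list \<Rightarrow> 'k::field) \<Rightarrow> 'k) list \<Rightarrow> _)"
  unfolding a_infinity_algebra_def using multi_map_mu inner_sum_mu by blast

end

section \<open>The morphism to the dual of the bar construction\<close>

lemma finite_compositions: "finite (compositions n)"
proof (rule finite_subset[OF _ finite_lists_length_le[of "{..n}" n]])
  show "compositions n \<subseteq> {is. set is \<subseteq> {..n} \<and> length is \<le> n}"
  proof
    fix "is" assume "is \<in> compositions n"
    then have "sum_list is = n" "0 \<notin> set is" by (auto simp: compositions_def)
    moreover have "0 \<notin> set is \<Longrightarrow> length is \<le> sum_list is" for "is" :: "nat list"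
      by (induction "is") auto
    ultimately show "is \<in> {is. set is \<subseteq> {..n} \<and> length is \<le> n}" using member_le_sum_list[of _ "is"] by auto
  qed
qed simp

text \<open>
  In a dga algebra only the differential and the binary product are nonzero.
\<close>
lemma sum_compositions:
  fixes G :: "nat list \<Rightarrow> 'x::comm_monoid_add"
  assumes n: "1 \<le> n" and G: "\<And>is. length is \<noteq> 1 \<Longrightarrow> length is \<noteq> 2 \<Longrightarrow> G is = 0"
  shows "sum G (compositions n) = G [n] + (\<Sum>a\<in>{1..<n}. G [a, n - a])"
proof -
  let ?P = "(\<lambda>a. [a, n - a]) ` {1..<n}"
  have "sum G (compositions n) = sum G (insert [n] ?P)"
  proof (rule sum.mono_neutral_right[OF finite_compositions])
    show "insert [n] ?P \<subseteq> compositions n" using n by (auto simp: compositions_def)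
    show "\<forall>is\<in>compositions n - insert [n] ?P. G is = 0"
    proof
      fix "is" assume i: "is \<in> compositions n - insert [n] ?P"
      have "length is \<noteq> 1"
      proof
        assume "length is = 1"
        then obtain a where "is = [a]" by (cases "is") auto
        then show False using i by (auto simp: compositions_def)
      qed
      moreover have "length is \<noteq> 2"
      proof
        assume "length is = 2"
        then obtain a b where ab: "is = [a, b]" by (auto simp: numeral_2_eq_2 length_Suc_conv)
        then have "a + b = n" "0 < a" "0 < b" using i by (auto simp: compositions_def)
        then have "b = n - a" "a \<in> {1..<n}" by auto
        then have "is \<in> ?P" using ab by blast
        then show False using i by blast
      qed
      ultimately show "G is = 0" by (rule G)
    qed
  qed
  also have "\<dots> = G [n] + sum G ?P" by (rule sum.insert) auto
  also have "sum G ?P = (\<Sum>a\<in>{1..<n}. G [a, n - a])" by (subst sum.reindex) (auto simp: inj_on_def)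
  finally show ?thesis .
qed

context monomial_quiver
begin

lemma func_add: "func V (\<lambda>w. k w + k' w) = func V k + func V k'"
  by (auto simp: func_def ev_def fun_eq_iff distrib_left sum.distrib)

lemma func_scale: "func V (\<lambda>w. c * k w) = (\<lambda>x. c * func V k x)"
  by (auto simp: func_def ev_def fun_eq_iff sum_distrib_left mult_ac)

lemma func_sum: "func V (\<lambda>w. \<Sum>a\<in>A. k a w) = (\<Sum>a\<in>A. func V (k a))"
proof
  fix x
  show "func V (\<lambda>w. \<Sum>a\<in>A. k a w) x = (\<Sum>a\<in>A. func V (k a)) x"
    unfolding sum_fun_apply func_def using ev_sum_kernel[of "\<lambda>a. 1" k A x] by (cases "x \<in> V") simp_all
qed

lemma khat_mor: "khat mor_kernel xs w = (-1) ^ (length w choose 2) *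
    (\<Sum>y\<in>Words (concat w). (-1) ^ theta (map cdeg y) * tens xs y * lift w y)"
  unfolding khat_def mor_kernel_def sum_distrib_left by (simp add: mult_ac)

text \<open>
  The rescaled kernel is \<open>F w\<close>, whose boundary is the obstruction.
\<close>
lemma inner_sum_mor:
  fixes xs :: "(('a list list \<Rightarrow> 'k::field) \<Rightarrow> 'k) list"
  assumes xs: "homogeneous (Ext Q R) ds xs"
  shows "inner_sum (bar_dual Q R) mor mu ds xs = func (bar_space Q R) (\<lambda>w. - ((-1) ^ (length w choose 2) *
    (\<Sum>y\<in>Words (concat w). (-1) ^ theta (map cdeg y) * tens xs y * obstruction lift w y)))"
proof -
  have N: "scl (bar_dual Q R) = (\<lambda>c (\<phi> :: ('a list list \<Rightarrow> 'k) \<Rightarrow> 'k) x. c * \<phi> x)" by (simp add: bar_dual_def)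
  show ?thesis unfolding inner_sum_kern[OF xs N mor_def]
  proof (rule func_cong[OF closed_bar_space])
    fix w assume w: "bar_word Q R w"
    have e: "(\<lambda>v. (-1) ^ theta (map cdeg v) * mor_kernel w v) = (\<lambda>v. (-1 :: 'k) ^ (length w choose 2) * lift w v)"
    proof
      fix v
      show "(-1) ^ theta (map cdeg v) * mor_kernel w v = (-1 :: 'k) ^ (length w choose 2) * lift w v"
        by (simp only: mor_kernel_def mult.assoc left_minus_one_mult_self
            mult.left_commute[of "(-1) ^ theta (map cdeg v)" "(-1) ^ (length w choose 2)"])
    qed
    show "- (\<Sum>y\<in>Words (concat w). (-1) ^ theta (map cdeg y) * tens xs y *
          cobar_diff (\<lambda>v. (-1) ^ theta (map cdeg v) * mor_kernel w v) y) =
      - ((-1) ^ (length w choose 2) * (\<Sum>y\<in>Words (concat w). (-1) ^ theta (map cdeg y) * tens xs y * obstruction lift w y))"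
      unfolding e cobar_diff_scale cobar_diff_lift[OF w] sum_distrib_left by (simp add: mult_ac)
  qed
qed

lemma diff_mor:
  fixes xs :: "(('a list list \<Rightarrow> 'k::field) \<Rightarrow> 'k) list"
  shows "bar_dual_diff Q R (mor n xs) = func (bar_space Q R) (\<lambda>w. (-1) ^ (length w choose 2) *
    (\<Sum>y\<in>Words (concat w). (-1) ^ theta (map cdeg y) * tens xs y * (\<Sum>i<length w - 1. (-1) ^ i * lift (mrg i w) y)))"
proof -
  have "bar_dual_diff Q R (mor n xs) = func (bar_space Q R) (\<lambda>w. (-1) ^ (length w - 1) * mor n xs (bar_diff_word R w))"
    unfolding bar_dual_diff_def func_def ev_def ..
  also have "\<dots> = func (bar_space Q R) (\<lambda>w. (-1) ^ (length w choose 2) *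
    (\<Sum>y\<in>Words (concat w). (-1) ^ theta (map cdeg y) * tens xs y * (\<Sum>i<length w - 1. (-1) ^ i * lift (mrg i w) y)))"
  proof (rule func_cong[OF closed_bar_space])
    fix w assume w: "bar_word Q R w"
    then obtain m where m: "length w = Suc m" by (cases w) (auto simp: bar_word_def)
    have "bar_diff_word R w \<in> (bar_space Q R :: (_ \<Rightarrow> 'k) set)"
      unfolding bar_diff_single[symmetric] by (rule bar_diff_in_space[OF single_bar_space[OF w]])
    then have "mor n xs (bar_diff_word R w) = ev (khat mor_kernel xs) (bar_diff_word R w)"
      by (simp add: mor_def kern_def func_def)
    also have "\<dots> = (\<Sum>i<m. (-1) ^ i * khat mor_kernel xs (mrg i w))"
    proof -
      have "khat mor_kernel xs v = 0" if "\<not> bar_word Q R v" for v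
        by (simp add: khat_def mor_kernel_def lift_not_bar[OF that])
      from ev_bar_diff_word_bar[OF w this] show ?thesis unfolding m diff_Suc_1 .
    qed
    also have "\<dots> = (\<Sum>i<m. \<Sum>y\<in>Words (concat w). (-1) ^ (m choose 2) * ((-1) ^ theta (map cdeg y) * tens xs y * ((-1) ^ i * lift (mrg i w) y)))"
    proof (rule sum.cong[OF refl])
      fix i assume "i \<in> {..<m}"
      then have i: "Suc i < length w" using m by simp
      have l: "length (mrg i w) = m" "concat (mrg i w) = concat w" using mrg_props[OF i] m by simp_all
      show "(-1) ^ i * khat mor_kernel xs (mrg i w) =
          (\<Sum>y\<in>Words (concat w). (-1) ^ (m choose 2) * ((-1) ^ theta (map cdeg y) * tens xs y * ((-1) ^ i * lift (mrg i w) y)))"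
        unfolding khat_mor l sum_distrib_left by (rule sum.cong[OF refl]) (simp only: mult_ac)
    qed
    also have "\<dots> = (-1) ^ (m choose 2) *
        (\<Sum>y\<in>Words (concat w). (-1) ^ theta (map cdeg y) * tens xs y * (\<Sum>i<m. (-1) ^ i * lift (mrg i w) y))"
      unfolding sum_distrib_left by (rule sum.swap)
    finally show "(-1) ^ (length w - 1) * mor n xs (bar_diff_word R w) = (-1) ^ (length w choose 2) *
      (\<Sum>y\<in>Words (concat w). (-1) ^ theta (map cdeg y) * tens xs y * (\<Sum>i<length w - 1. (-1) ^ i * lift (mrg i w) y))"
      unfolding m choose_two_Suc by (simp add: power_add mult.assoc)
  qed
  finally show ?thesis .
qed

lemma bar_word_split:
  assumes "bar_word Q R w" "i \<in> {1..<length w}"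
  shows "bar_word Q R (take i w)" "bar_word Q R (drop i w)"
proof -
  have w: "path_word (take i w @ drop i w)" "\<forall>a\<in>set w. normal R a" using assms(1) bar_word_iff by auto
  have "take i w \<noteq> []" "drop i w \<noteq> []" using assms(2) by auto
  then have "path_word (take i w)" "path_word (drop i w)" using path_word_append[OF w(1)] by blast+
  then show "bar_word Q R (take i w)" "bar_word Q R (drop i w)"
    using w(2) set_take_subset[of i w] set_drop_subset[of i w] unfolding bar_word_iff by blast+
qed

lemma mult_mor:
  fixes xs ys :: "(('a list list \<Rightarrow> 'k::field) \<Rightarrow> 'k) list"
  shows "bar_dual_mult Q R (mor a xs) (mor b ys) = func (bar_space Q R) (\<lambda>w. \<Sum>i\<in>{1..<length w}.
    (-1) ^ (i * (length w - i)) * (khat mor_kernel xs (take i w) * khat mor_kernel ys (drop i w)))"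
proof -
  have "bar_dual_mult Q R (mor a xs) (mor b ys) = func (bar_space Q R) (\<lambda>w. \<Sum>i\<in>{1..<length w}.
    (-1) ^ (i * (length w - i)) * (mor a xs (single (take i w)) * mor b ys (single (drop i w))))"
    unfolding bar_dual_mult_def func_def ev_def ..
  also have "\<dots> = func (bar_space Q R) (\<lambda>w. \<Sum>i\<in>{1..<length w}.
    (-1) ^ (i * (length w - i)) * (khat mor_kernel xs (take i w) * khat mor_kernel ys (drop i w)))"
  proof (rule func_cong[OF closed_bar_space])
    fix w assume w: "bar_word Q R w"
    have s: "mor c zs (single u) = khat mor_kernel zs u" if "bar_word Q R u" for c and zs :: "(('a list list \<Rightarrow> 'k) \<Rightarrow> 'k) list" and u
      using single_bar_space[OF that, where 'b = 'k] by (simp add: mor_def kern_def func_def ev_single)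
    show "(\<Sum>i\<in>{1..<length w}. (-1) ^ (i * (length w - i)) * (mor a xs (single (take i w)) * mor b ys (single (drop i w)))) =
      (\<Sum>i\<in>{1..<length w}. (-1) ^ (i * (length w - i)) * (khat mor_kernel xs (take i w) * khat mor_kernel ys (drop i w)))"
      by (rule sum.cong[OF refl]) (simp only: s bar_word_split[OF w])
  qed
  finally show ?thesis .
qed

text \<open>
  Pairs of words over two consecutive paths, the first with \<open>a\<close> letters, are the same as
  words over their product, cut after \<open>a\<close> letters.
\<close>
lemma product_khat:
  fixes xs :: "(('a list list \<Rightarrow> 'k::field) \<Rightarrow> 'k) list"
  assumes xs: "homogeneous (Ext Q R) ds xs" and a: "1 \<le> a" "a < length xs"
  shows "parity_sign ((int a - 1) + (1 - int (length xs - a)) * sum_list (take a ds)) *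
      (khat mor_kernel (take a xs) u * khat mor_kernel (drop a xs) v) =
    - ((-1) ^ (length u - 1) * ((-1) ^ (length u choose 2) * (-1) ^ (length v choose 2))) *
      (\<Sum>y\<in>Words (concat u @ concat v). (-1) ^ theta (map cdeg y) * tens xs y * (lift u (take a y) * lift v (drop a y)))"
proof -
  let ?A = "take a xs" and ?B = "drop a xs" and ?p = "concat u" and ?q = "concat v"
  let ?\<epsilon> = "parity_sign ((int a - 1) + (1 - int (length xs - a)) * sum_list (take a ds)) :: 'k"
  define \<sigma> where "\<sigma> = ((-1) ^ (length u choose 2) * (-1) ^ (length v choose 2) :: 'k)"
  define f where "f = (\<lambda>y. (-1) ^ theta (map cdeg y) * tens ?A y * lift u y)"
  define g where "g = (\<lambda>y. (-1) ^ theta (map cdeg y) * tens ?B y * lift v y)"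
  define k where "k = (\<lambda>y. - ((-1) ^ (length u - 1) * \<sigma>) *
      ((-1) ^ theta (map cdeg y) * tens xs y * (lift u (take a y) * lift v (drop a y))))"
  let ?P = "{(y1, y2) \<in> Words ?p \<times> Words ?q. length y1 = a}"
  let ?T = "{y \<in> Words (?p @ ?q). take a y \<in> Words ?p \<and> drop a y \<in> Words ?q \<and> a \<le> length y}"
  have lA: "length ?A = a" "length ?B = length xs - a" using a by auto
  have "?\<epsilon> * (khat mor_kernel ?A u * khat mor_kernel ?B v) = ?\<epsilon> * \<sigma> * (sum f (Words ?p) * sum g (Words ?q))"
    unfolding khat_mor \<sigma>_def f_def g_def by (simp add: mult_ac)
  also have "sum f (Words ?p) * sum g (Words ?q) = (\<Sum>(y1, y2)\<in>Words ?p \<times> Words ?q. f y1 * g y2)"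
    unfolding sum_product sum.cartesian_product ..
  also have "?\<epsilon> * \<sigma> * \<dots> = (\<Sum>(y1, y2)\<in>Words ?p \<times> Words ?q. ?\<epsilon> * \<sigma> * (f y1 * g y2))"
    unfolding sum_distrib_left split_beta ..
  also have "\<dots> = (\<Sum>(y1, y2)\<in>?P. ?\<epsilon> * \<sigma> * (f y1 * g y2))"
  proof (rule sum.mono_neutral_right)
    have "f y1 = 0" if "length y1 \<noteq> a" for y1 using that tens_length[of ?A y1] lA by (auto simp: f_def)
    note f0 = this
    show "\<forall>z\<in>Words ?p \<times> Words ?q - ?P. (case z of (y1, y2) \<Rightarrow> ?\<epsilon> * \<sigma> * (f y1 * g y2)) = 0"
    proof
      fix z assume z: "z \<in> Words ?p \<times> Words ?q - ?P"
      then obtain y1 y2 where y: "z = (y1, y2)" by blast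
      then have "f y1 = 0" using z by (intro f0) auto
      then show "(case z of (y1, y2) \<Rightarrow> ?\<epsilon> * \<sigma> * (f y1 * g y2)) = 0" by (simp add: y)
    qed
  qed (auto simp: finite_Words)
  also have "\<dots> = sum k ?T"
  proof (rule sum.reindex_bij_witness[of ?P "\<lambda>y. (take a y, drop a y)" "\<lambda>(y1, y2). y1 @ y2"], goal_cases)
    case (5 z)
    then obtain y1 y2 where z: "z = (y1, y2)" and y: "length y1 = a" by auto
    have t: "tens xs (y1 @ y2) = tens ?A y1 * tens ?B y2" using tens_append[of ?A y1 ?B y2] lA y by simp
    show ?case
    proof (cases "tens xs (y1 @ y2) = 0 \<or> lift u y1 = (0::'k)")
      case True
      then show ?thesis using t y z by (auto simp: k_def f_def g_def)
    next
      case False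
      then have nz: "tens xs (y1 @ y2) \<noteq> 0" "lift u y1 \<noteq> (0::'k)" by auto
      have ds: "ds = map (\<lambda>g. int (cdeg g) + 1) (y1 @ y2)" using tens_degree[OF xs] nz(1) by blast
      have l2: "length y2 = length xs - a" using tens_length[OF nz(1)] y by simp
      have w: "wdeg y1 = length u - 1" using lift_support[OF nz(2)] by linarith
      have d: "sum_list (take a ds) = int (sum_list (map cdeg y1) + length (map cdeg y1))"
        unfolding ds using y sum_degrees[of y1] by (simp add: wdeg_def take_map)
      have "?\<epsilon> * ((-1) ^ theta (map cdeg y1) * (-1) ^ theta (map cdeg y2)) =
          - ((-1) ^ wdeg y1 * (-1) ^ theta (map cdeg (y1 @ y2)))"
        using product_sign[of "map cdeg y1" "map cdeg y2", where 'k = 'k] a y l2 unfolding d by (simp add: wdeg_def)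
      note e = this
      have "?\<epsilon> * \<sigma> * (f y1 * g y2) =
          (?\<epsilon> * ((-1) ^ theta (map cdeg y1) * (-1) ^ theta (map cdeg y2))) * (\<sigma> * (tens ?A y1 * tens ?B y2) * (lift u y1 * lift v y2))"
        by (simp add: f_def g_def mult_ac)
      also have "\<dots> = k (y1 @ y2)" unfolding e w t[symmetric] using y by (simp add: k_def mult_ac)
      finally show ?thesis by (simp add: z)
    qed
  next
    case (2 z)
    then show ?case by (auto simp: Words_def)
  qed (auto simp: Words_def)
  also have "\<dots> = sum k (Words (?p @ ?q))"
  proof (rule sum.mono_neutral_left[OF finite_Words])
    show "\<forall>y\<in>Words (?p @ ?q) - ?T. k y = 0"
    proof
      fix y assume y: "y \<in> Words (?p @ ?q) - ?T"
      show "k y = 0"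
      proof (rule ccontr)
        assume "k y \<noteq> 0"
        then have "tens xs y \<noteq> 0" "lift u (take a y) \<noteq> (0::'k)" "lift v (drop a y) \<noteq> (0::'k)" by (auto simp: k_def)
        then show False using y tens_length[of xs y] a lift_support[of u "take a y"] lift_support[of v "drop a y"] by auto
      qed
    qed
  qed auto
  finally show ?thesis unfolding k_def \<sigma>_def sum_distrib_left .
qed

lemma conv_lift:
  assumes "path_word u" "path_word v"
  shows "conv (lift u) (lift v) y = (\<Sum>a\<in>{1..<length y}. lift u (take a y) * lift v (drop a y) :: 'k::field)"
  unfolding conv_def
proof (rule sum.mono_neutral_right)
  show "\<forall>k\<in>{..length y} - {1..<length y}. lift u (take k y) * lift v (drop k y) = (0 :: 'k)"
  proof
    fix k assume "k \<in> {..length y} - {1..<length y}"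
    then have "k = 0 \<or> k = length y" by auto
    then show "lift u (take k y) * lift v (drop k y) = (0 :: 'k)"
      using lift_Nil[OF assms(1), where 'k = 'k] lift_Nil[OF assms(2), where 'k = 'k] by auto
  qed
qed auto

text \<open>
  Summation over the cuts of \<open>w\<close> and over the cuts of the list of arguments gives the product
  terms in the equation for \<open>D (F w)\<close>.
\<close>
lemma morphism_identity:
  fixes xs :: "(('a list list \<Rightarrow> 'k::field) \<Rightarrow> 'k) list"
  assumes w: "bar_word Q R w" and xs: "homogeneous (Ext Q R) ds xs"
  shows "(\<Sum>a\<in>{1..<length xs}. parity_sign ((int a - 1) + (1 - int (length xs - a)) * sum_list (take a ds)) *
      (\<Sum>i\<in>{1..<length w}. (-1) ^ (i * (length w - i)) *
        (khat mor_kernel (take a xs) (take i w) * khat mor_kernel (drop a xs) (drop i w)))) =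
    - ((-1) ^ (length w choose 2) * (\<Sum>y\<in>Words (concat w). (-1) ^ theta (map cdeg y) * tens xs y *
      (\<Sum>i<length w - 1. (-1) ^ i * conv (lift (take (Suc i) w)) (lift (drop (Suc i) w)) y)))"
proof -
  let ?\<epsilon> = "\<lambda>a. parity_sign ((int a - 1) + (1 - int (length xs - a)) * sum_list (take a ds)) :: 'k"
  let ?t = "\<lambda>y. (-1) ^ theta (map cdeg y) * tens xs y :: 'k"
  let ?I = "{1..<length w}"
  have step: "(\<Sum>a\<in>{1..<length xs}. ?\<epsilon> a * ((-1) ^ (i * (length w - i)) *
        (khat mor_kernel (take a xs) (take i w) * khat mor_kernel (drop a xs) (drop i w)))) =
      - ((-1) ^ (i - 1) * (-1) ^ (length w choose 2)) *
        (\<Sum>y\<in>Words (concat w). ?t y * conv (lift (take i w)) (lift (drop i w)) y)" if i: "i \<in> ?I" for i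
  proof -
    let ?u = "take i w" and ?v = "drop i w"
    have l: "length ?u = i" "length ?v = length w - i" and c: "concat ?u @ concat ?v = concat w"
      using i by (auto simp flip: concat_append)
    have pw: "path_word ?u" "path_word ?v" using bar_word_split[OF w i] bar_word_iff by auto
    have ch: "(-1 :: 'k) ^ (length w choose 2) = (-1) ^ (i choose 2) * (-1) ^ ((length w - i) choose 2) * (-1) ^ (i * (length w - i))"
      using choose_two_add[of i "length w - i"] i by (simp add: power_add)
    have "(\<Sum>a\<in>{1..<length xs}. ?\<epsilon> a * ((-1) ^ (i * (length w - i)) * (khat mor_kernel (take a xs) ?u * khat mor_kernel (drop a xs) ?v))) =
      (\<Sum>a\<in>{1..<length xs}. - ((-1) ^ (i - 1) * (-1) ^ (length w choose 2)) *
        (\<Sum>y\<in>Words (concat w). ?t y * (lift ?u (take a y) * lift ?v (drop a y))))"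
    proof (rule sum.cong[OF refl])
      fix a assume "a \<in> {1..<length xs}"
      then have a: "1 \<le> a" "a < length xs" by auto
      have "?\<epsilon> a * ((-1) ^ (i * (length w - i)) * (khat mor_kernel (take a xs) ?u * khat mor_kernel (drop a xs) ?v)) =
          (-1) ^ (i * (length w - i)) * (?\<epsilon> a * (khat mor_kernel (take a xs) ?u * khat mor_kernel (drop a xs) ?v))"
        by (simp only: mult_ac)
      also have "\<dots> = - ((-1) ^ (i - 1) * (-1) ^ (length w choose 2)) *
        (\<Sum>y\<in>Words (concat w). ?t y * (lift ?u (take a y) * lift ?v (drop a y)))"
        unfolding product_khat[OF xs a] l c ch by (simp add: mult_ac)
      finally show "?\<epsilon> a * ((-1) ^ (i * (length w - i)) * (khat mor_kernel (take a xs) ?u * khat mor_kernel (drop a xs) ?v)) =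
        - ((-1) ^ (i - 1) * (-1) ^ (length w choose 2)) *
        (\<Sum>y\<in>Words (concat w). ?t y * (lift ?u (take a y) * lift ?v (drop a y)))" .
    qed
    also have "\<dots> = - ((-1) ^ (i - 1) * (-1) ^ (length w choose 2)) *
        (\<Sum>y\<in>Words (concat w). \<Sum>a\<in>{1..<length xs}. ?t y * (lift ?u (take a y) * lift ?v (drop a y)))"
      unfolding sum_distrib_left by (rule sum.swap)
    also have "(\<Sum>y\<in>Words (concat w). \<Sum>a\<in>{1..<length xs}. ?t y * (lift ?u (take a y) * lift ?v (drop a y))) =
        (\<Sum>y\<in>Words (concat w). ?t y * conv (lift ?u) (lift ?v) y)"
    proof (rule sum.cong[OF refl])
      fix y
      show "(\<Sum>a\<in>{1..<length xs}. ?t y * (lift ?u (take a y) * lift ?v (drop a y))) = ?t y * conv (lift ?u) (lift ?v) y"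
        using tens_length[of xs y] by (cases "tens xs y = 0") (simp_all add: conv_lift[OF pw] sum_distrib_left)
    qed
    finally show ?thesis .
  qed
  have "(\<Sum>a\<in>{1..<length xs}. ?\<epsilon> a * (\<Sum>i\<in>?I. (-1) ^ (i * (length w - i)) *
        (khat mor_kernel (take a xs) (take i w) * khat mor_kernel (drop a xs) (drop i w)))) =
      (\<Sum>i\<in>?I. \<Sum>a\<in>{1..<length xs}. ?\<epsilon> a * ((-1) ^ (i * (length w - i)) *
        (khat mor_kernel (take a xs) (take i w) * khat mor_kernel (drop a xs) (drop i w))))"
    unfolding sum_distrib_left by (rule sum.swap)
  also have "\<dots> = (\<Sum>i\<in>?I. - ((-1) ^ (i - 1) * (-1) ^ (length w choose 2)) *
        (\<Sum>y\<in>Words (concat w). ?t y * conv (lift (take i w)) (lift (drop i w)) y))"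
    by (rule sum.cong[OF refl step])
  also have "\<dots> = (\<Sum>i<length w - 1. - ((-1) ^ i * (-1) ^ (length w choose 2)) *
        (\<Sum>y\<in>Words (concat w). ?t y * conv (lift (take (Suc i) w)) (lift (drop (Suc i) w)) y))"
    by (rule sum.reindex_bij_witness[of _ Suc "\<lambda>i. i - 1"]) auto
  also have "\<dots> = (\<Sum>i<length w - 1. \<Sum>y\<in>Words (concat w). - ((-1) ^ (length w choose 2)) * (?t y *
        ((-1) ^ i * conv (lift (take (Suc i) w)) (lift (drop (Suc i) w)) y)))"
    unfolding sum_distrib_left by (simp add: mult_ac)
  also have "\<dots> = - ((-1) ^ (length w choose 2)) * (\<Sum>y\<in>Words (concat w). ?t y *
      (\<Sum>i<length w - 1. (-1) ^ i * conv (lift (take (Suc i) w)) (lift (drop (Suc i) w)) y))"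
    unfolding sum_distrib_left by (rule sum.swap)
  finally show ?thesis by simp
qed

text \<open>
  The equation for \<open>D (F w)\<close>, transposed: the left side is the boundary, the composition with
  one part gives the merged words, and the compositions with two parts give the products.
\<close>
lemma morphism_equation:
  fixes xs :: "(('a list list \<Rightarrow> 'k::field) \<Rightarrow> 'k) list"
  assumes ne: "xs \<noteq> []" and xs: "homogeneous (Ext Q R) ds xs"
  shows "inner_sum (bar_dual Q R) mor mu ds xs =
    (\<Sum>is \<in> compositions (length xs).
       scl (bar_dual Q R) (parity_sign
           ((\<Sum>j<length is. (int (length is) - 1 - int j) * (int (is ! j) - 1)) +
            (\<Sum>k<length is. (1 - int (is ! k)) * sum_list (take (sum_list (take k is)) ds))))
         (bar_dual_ops Q R (length is) (map2 mor is (blocks is xs))))"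
    (is "_ = sum ?G _")
proof -
  let ?n = "length xs"
  let ?\<epsilon> = "\<lambda>a. parity_sign ((int a - 1) + (1 - int (?n - a)) * sum_list (take a ds)) :: 'k"
  have N: "scl (bar_dual Q R) = (\<lambda>c (\<phi> :: ('a list list \<Rightarrow> 'k) \<Rightarrow> 'k) x. c * \<phi> x)" by (simp add: bar_dual_def)
  have G0: "?G is = 0" if "length is \<noteq> 1" "length is \<noteq> 2" for "is"
    using that by (simp add: N bar_dual_ops_def fun_eq_iff)
  have G1: "?G [?n] = bar_dual_diff Q R (mor ?n xs)"
    by (simp add: N bar_dual_ops_def parity_sign_def)
  have G2: "?G [a, ?n - a] = func (bar_space Q R) (\<lambda>w. ?\<epsilon> a * (\<Sum>i\<in>{1..<length w}.
    (-1) ^ (i * (length w - i)) * (khat mor_kernel (take a xs) (take i w) * khat mor_kernel (drop a xs) (drop i w))))" for a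
  proof -
    have "?G [a, ?n - a] = (\<lambda>x. ?\<epsilon> a * bar_dual_mult Q R (mor a (take a xs)) (mor (?n - a) (drop a xs)) x)"
      by (simp add: N bar_dual_ops_def lessThan_Suc numeral_2_eq_2)
    then show ?thesis unfolding mult_mor func_scale .
  qed
  have "sum ?G (compositions ?n) = ?G [?n] + (\<Sum>a\<in>{1..<?n}. ?G [a, ?n - a])"
    using ne by (intro sum_compositions G0) (simp_all add: Suc_le_eq)
  also have "\<dots> = inner_sum (bar_dual Q R) mor mu ds xs"
    unfolding G1 G2 diff_mor inner_sum_mor[OF xs] func_sum[symmetric] func_add[symmetric]
  proof (rule func_cong[OF closed_bar_space])
    fix w assume w: "bar_word Q R w"
    show "(-1) ^ (length w choose 2) * (\<Sum>y\<in>Words (concat w). (-1) ^ theta (map cdeg y) * tens xs y *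
          (\<Sum>i<length w - 1. (-1) ^ i * lift (mrg i w) y)) +
        (\<Sum>a\<in>{1..<?n}. ?\<epsilon> a * (\<Sum>i\<in>{1..<length w}. (-1) ^ (i * (length w - i)) *
          (khat mor_kernel (take a xs) (take i w) * khat mor_kernel (drop a xs) (drop i w)))) =
      - ((-1) ^ (length w choose 2) * (\<Sum>y\<in>Words (concat w). (-1) ^ theta (map cdeg y) * tens xs y * obstruction lift w y))"
      unfolding morphism_identity[OF w xs] obstruction_def
      by (simp add: right_diff_distrib sum_subtractf)
  qed
  finally show ?thesis by (rule sym)
qed

lemma a_infinity_morphism_mor:
  "a_infinity_morphism (Ext Q R) mu (bar_dual Q R) (bar_dual_ops Q R)
    (mor :: nat \<Rightarrow> (('a list list \<Rightarrow> 'k::field) \<Rightarrow> 'k) list \<Rightarrow> _)"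
  unfolding a_infinity_morphism_def using multi_map_mor morphism_equation by blast

section \<open>The quasi-isomorphism\<close>

lemma componentI:
  assumes "\<And>x. x \<notin> V \<Longrightarrow> \<phi> x = 0" "\<And>x y. x \<in> V \<Longrightarrow> y \<in> V \<Longrightarrow> \<phi> (\<lambda>w. x w + y w) = \<phi> x + \<phi> y"
    "\<And>c x. x \<in> V \<Longrightarrow> \<phi> (\<lambda>w. c * x w) = c * \<phi> x" "finite W"
    "\<And>k m x. x \<in> V \<Longrightarrow> bihomogeneous k m x \<Longrightarrow> \<not> (int k = n \<and> m \<in> W) \<Longrightarrow> \<phi> x = 0"
  shows "\<phi> \<in> component (graded_dual Q V) n"
proof -
  have "\<exists>W. finite W \<and> (\<forall>k m. \<forall>x\<in>V. bihomogeneous k m x \<and> \<not> (int k = n \<and> m \<in> W) \<longrightarrow> \<phi> x = 0)"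
    using assms(4,5) by blast
  then show ?thesis unfolding graded_dual_def graded_bimodule.simps mem_Collect_eq
    by (intro conjI allI ballI impI) (rule assms(1-3), assumption+)+
qed

lemma factorization_bar_diff: "chain_factorization Q R us \<Longrightarrow> bar_diff_word R us = (\<lambda>v. 0 :: 'k::field)"
  using single_chain_cycle[of us, where 'k = 'k] by (simp add: bar_cycles_def bar_diff_single fun_eq_iff)

text \<open>
  The dual form of \<open>bar_decomposition\<close>. Let \<open>U v\<close> be supported on upper words, with a
  boundary that agrees with \<open>v\<close> on lower words. For a bar word \<open>w\<close> with boundary \<open>\<Sum> b\<^sub>v v\<close>
  the combination \<open>\<Sum> b\<^sub>v U v\<close> differs from \<open>w\<close> by a boundary and chains, on which \<open>g\<close>
  vanishes. Hence \<open>v \<mapsto> \<plusminus> g (U v)\<close> is a primitive of \<open>g\<close>.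
\<close>
lemma primitive:
  fixes g :: "'a list list \<Rightarrow> 'k::field"
  assumes W: "finite W" "\<And>w. bar_word Q R w \<Longrightarrow> g w \<noteq> 0 \<Longrightarrow> int (length w) = d \<and> length (concat w) \<in> W"
    and boundary: "\<And>w. bar_word Q R w \<Longrightarrow> ev g (bar_diff_word R w) = 0"
    and chains: "\<And>us. chain_factorization Q R us \<Longrightarrow> g us = 0"
  shows "\<exists>z \<in> component (bar_dual Q R) (d - 1). func (bar_space Q R) g = bar_dual_diff Q R z"
proof -
  interpret triangular_matching "bar_diff R :: (_ \<Rightarrow> 'k) \<Rightarrow> _" BIdx bar_up bar_lo bar_rest
    by (rule triangular_matching_bar)
  have "\<exists>u. finsupp u \<and> {w. u w \<noteq> 0} \<subseteq> bar_up ` BIdx \<and> (\<forall>k\<in>BIdx. bar_diff R u (bar_lo k) = (single v (bar_lo k) :: 'k))" for v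
    using solvable[OF finsupp_single] .
  then obtain U where U: "\<And>v. finsupp (U v)" "\<And>v. {w. U v w \<noteq> 0} \<subseteq> bar_up ` BIdx"
    "\<And>v k. k \<in> BIdx \<Longrightarrow> bar_diff R (U v) (bar_lo k) = (single v (bar_lo k) :: 'k)"
    by metis
  have up_bar: "bar_word Q R w" if "w \<in> bar_up ` BIdx" for w using that BIdxD(3) by force
  have reconstruct: "ev (\<lambda>v. ev g (U v)) (bar_diff_word R w) = g w" if w: "bar_word Q R w" for w
  proof -
    let ?b = "bar_diff_word R w :: 'a list list \<Rightarrow> 'k"
    let ?J = "{v. ?b v \<noteq> 0}"
    define u where "u = (\<lambda>x. \<Sum>v\<in>?J. ?b v * U v x)"
    have J: "finite ?J" using finsupp_bar_diff_word[of w, where 'b = 'k] by (simp add: finsupp_def)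
    have fu: "finsupp u" unfolding u_def by (rule finsupp_sum) (rule U(1))
    have us: "u \<in> bar_space Q R"
    proof (rule bar_spaceI[OF fu])
      fix x assume "u x \<noteq> 0"
      then obtain v where "?b v * U v x \<noteq> 0" unfolding u_def by (blast dest: sum_nonzeroD)
      then show "bar_word Q R x" using U(2)[of v] up_bar by auto
    qed
    have du: "bar_diff R u (bar_lo k) = ?b (bar_lo k)" if k: "k \<in> BIdx" for k
    proof -
      have "bar_diff R u (bar_lo k) = (\<Sum>v\<in>?J. ?b v * bar_diff R (U v) (bar_lo k))"
        unfolding u_def using linear_sum[OF J U(1)] by simp
      also have "\<dots> = (\<Sum>v\<in>?J. ?b v * single v (bar_lo k))" by (simp add: U(3)[OF k])
      also have "\<dots> = ?b (bar_lo k)" by (subst (3) sum_single[OF J order_refl]) (rule refl)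
      finally show ?thesis .
    qed
    define e where "e = (\<lambda>x. single w x + (-1) * u x)"
    have es: "e \<in> bar_space Q R"
      unfolding e_def using closed_bar_space single_bar_space[OF w] us unfolding closed_space_def by blast
    have de: "bar_diff R e (bar_lo k) = 0" if "k \<in> BIdx" for k
      unfolding e_def bar_diff_linear[OF finsupp_single fu] bar_diff_single using du[OF that] by simp
    obtain u1 y where uy: "u1 \<in> bar_space Q R" "e = (\<lambda>w. bar_diff R u1 w + chain_part y w)" "y \<in> bar_space Q R"
      using bar_decomposition[OF es de] by blast
    have fc: "finsupp (chain_part y)"
      using bar_spaceD(1)[OF uy(3)] unfolding finsupp_def by (rule rev_finite_subset) (auto simp: chain_part_def)
    have "ev g e = ev g (bar_diff R u1) + ev g (chain_part y)"
      unfolding uy(2) using ev_linear[OF finsupp_bar_diff[OF bar_spaceD(1)[OF uy(1)]] fc, of g 1] by simp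
    also have "ev g (bar_diff R u1) = ev (\<lambda>w. 0) u1"
      unfolding ev_bar_diff[OF bar_spaceD(1)[OF uy(1)]] by (rule ev_cong) (rule boundary[OF bar_spaceD(2)[OF uy(1)]])
    also have "ev g (chain_part y) = ev (\<lambda>w. 0) (chain_part y)"
      by (rule ev_cong) (auto simp: chain_part_def chains split: if_splits)
    finally have "ev g e = 0" by (simp add: ev_def)
    moreover have "ev g e = g w + (-1) * ev g u" unfolding e_def ev_linear[OF finsupp_single fu] ev_single ..
    moreover have "ev g u = (\<Sum>v\<in>?J. ?b v * ev g (U v))" unfolding u_def by (rule ev_sum[OF J U(1)])
    ultimately show ?thesis by (simp add: ev_def[of _ ?b])
  qed
  \<comment> \<open>The sign compensates the one in the dual differential. Since \<open>U v\<close> need not be homogeneous, the degree and the weight are prescribed.\<close>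
  define \<zeta> where "\<zeta> = (\<lambda>v. if int (length v) = d - 1 \<and> length (concat v) \<in> W then (-1) ^ length v * ev g (U v) else 0)"
  have z: "func (bar_space Q R) \<zeta> \<in> component (graded_dual Q (bar_space Q R)) (d - 1)"
    by (rule func_component[OF closed_bar_space W(1)]) (auto simp: \<zeta>_def split: if_splits)
  have "bar_dual_diff Q R (func (bar_space Q R) \<zeta>) =
      func (bar_space Q R) (\<lambda>w. (-1) ^ (length w - 1) * func (bar_space Q R) \<zeta> (bar_diff_word R w))"
    unfolding bar_dual_diff_def func_def ev_def ..
  also have "\<dots> = func (bar_space Q R) g"
  proof (rule func_cong[OF closed_bar_space])
    fix w assume w: "bar_word Q R w"
    let ?b = "bar_diff_word R w :: 'a list list \<Rightarrow> 'k"
    have "?b \<in> bar_space Q R"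
      unfolding bar_diff_single[symmetric] by (rule bar_diff_in_space[OF single_bar_space[OF w]])
    then have f: "func (bar_space Q R) \<zeta> ?b = ev \<zeta> ?b" by (simp add: func_def)
    have b: "Suc (length v) = length w \<and> length (concat v) = length (concat w)" if "?b v \<noteq> 0" for v
      using bar_diff_word_support[OF w that] mrg_props[of _ w] by fastforce
    show "(-1) ^ (length w - 1) * func (bar_space Q R) \<zeta> ?b = g w"
    proof (cases "int (length w) = d \<and> length (concat w) \<in> W")
      case True
      have "ev \<zeta> ?b = ev (\<lambda>v. (-1) ^ (length w - 1) * ev g (U v)) ?b"
      proof (rule ev_cong)
        fix v assume "?b v \<noteq> 0"
        from b[OF this] have v: "length w = Suc (length v)" "length (concat v) = length (concat w)" by auto
        then show "\<zeta> v = (-1) ^ (length w - 1) * ev g (U v)" using True by (simp add: \<zeta>_def)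
      qed
      also have "\<dots> = (-1) ^ (length w - 1) * ev (\<lambda>v. ev g (U v)) ?b"
        unfolding ev_def by (simp add: sum_distrib_left mult_ac)
      finally show ?thesis unfolding f reconstruct[OF w] by simp
    next
      case False
      have "ev \<zeta> ?b = ev (\<lambda>v. 0) ?b"
      proof (rule ev_cong)
        fix v assume "?b v \<noteq> 0"
        from b[OF this] have v: "length w = Suc (length v)" "length (concat v) = length (concat w)" by auto
        then show "\<zeta> v = 0" using False by (auto simp: \<zeta>_def)
      qed
      moreover have "g w = 0" using W(2)[OF w] False by blast
      ultimately show ?thesis unfolding f by (simp add: ev_def)
    qed
  qed
  finally show ?thesis using z unfolding bar_dual_def by (intro bexI[of _ "func (bar_space Q R) \<zeta>"]) (simp_all only:)
qed

lemma bar_dual_diff_single: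
  assumes "bar_word Q R w"
  shows "bar_dual_diff Q R \<phi> (single w) = (-1) ^ (length w - 1) * (\<phi> (bar_diff_word R w) :: 'k::field)"
  using single_bar_space[OF assms, where 'b = 'k] ev_single[of "\<lambda>w. (-1) ^ (length w - 1) * \<phi> (bar_diff_word R w)" w]
  by (simp add: bar_dual_diff_def ev_def)

lemma functional_func:
  assumes "\<phi> \<in> component (graded_dual Q (bar_space Q R)) n"
  shows "\<phi> = func (bar_space Q R) (\<lambda>w. \<phi> (single w))"
  using functional_words[OF assms] componentD(1)[OF assms] by (auto simp: func_def fun_eq_iff)

lemma functional_support:
  fixes \<phi> :: "('a list list \<Rightarrow> 'k::field) \<Rightarrow> 'k"
  assumes "\<phi> \<in> component (graded_dual Q (bar_space Q R)) n"
  shows "\<exists>W. finite W \<and> (\<forall>w. bar_word Q R w \<and> \<phi> (single w) \<noteq> 0 \<longrightarrow> int (length w) = n \<and> length (concat w) \<in> W)"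
proof -
  obtain W where W: "finite W" "\<And>k m x. x \<in> bar_space Q R \<Longrightarrow> bihomogeneous k m x \<Longrightarrow> \<not> (int k = n \<and> m \<in> W) \<Longrightarrow> \<phi> x = 0"
    using componentD(4)[OF assms] by blast
  have b: "bihomogeneous (length w) (length (concat w)) (single w :: _ \<Rightarrow> 'k)" for w
    by (simp add: bihomogeneous_def single_def)
  have "int (length w) = n \<and> length (concat w) \<in> W" if "bar_word Q R w" "\<phi> (single w) \<noteq> 0" for w
    using W(2)[OF single_bar_space[OF that(1)] b] that(2) by blast
  then show ?thesis using W(1) by blast
qed

text \<open>
  The only word with one letter over a path is the path itself.
\<close>
lemma khat_singleton:
  fixes x :: "('a list list \<Rightarrow> 'k::field) \<Rightarrow> 'k"
  shows "(\<Sum>y\<in>Words (concat w). K y * tens [x] y) = K [concat w] * coord x (concat w)"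
proof -
  have "(\<Sum>y\<in>Words (concat w). K y * tens [x] y) = (\<Sum>y\<in>Words (concat w) \<inter> {[concat w]}. K y * tens [x] y)"
  proof (rule sum.mono_neutral_right[OF finite_Words])
    show "\<forall>y\<in>Words (concat w) - Words (concat w) \<inter> {[concat w]}. K y * tens [x] y = 0"
    proof
      fix y assume y: "y \<in> Words (concat w) - Words (concat w) \<inter> {[concat w]}"
      have "\<not> (\<exists>g. y = [g])" using y by (auto simp: Words_def)
      then have "length y \<noteq> length [x]" by (cases y) auto
      then have "tens [x] y = 0" using tens_length[of "[x]" y] by blast
      then show "K y * tens [x] y = 0" by simp
    qed
  qed auto
  also have "\<dots> = K [concat w] * coord x (concat w)"
  proof (cases "is_chain (concat w)")
    case True
    then have "Words (concat w) \<inter> {[concat w]} = {[concat w]}" by (auto simp: Words_def)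
    then show ?thesis by simp
  next
    case False
    then have "Words (concat w) \<inter> {[concat w]} = {}" by (auto simp: Words_def)
    then show ?thesis using False by (simp add: coord_def)
  qed
  finally show ?thesis .
qed

text \<open>
  A chain does not have two different lengths.
\<close>
lemma mu_one: "mu 1 [x] = (0 :: ('a list list \<Rightarrow> 'k::field) \<Rightarrow> 'k)"
proof -
  have "block_sign [g] = (0::'k)" for g using cdeg_eq[of "Suc (cdeg g)" g] by (auto simp: block_sign_def good_def)
  then have "khat mu_kernel [x] w = (0::'k)" for w
    unfolding khat_mu using khat_singleton[of block_sign x w] by simp
  then have "khat mu_kernel [x] = (\<lambda>w. 0 :: 'k)" by blast
  then show ?thesis by (simp add: mu_def kern_def func_def ev_def fun_eq_iff)
qed

text \<open>
  The first component is, up to sign, the composition with \<open>kappa\<close>; on the cycles of chains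
  it is the identity up to sign.
\<close>
lemma mor_one_single:
  assumes "chain_factorization Q R us"
  shows "mor 1 [x] (single us) = (-1) ^ length us * (x (single us) :: 'k::field)"
proof -
  let ?g = "concat us"
  have g: "is_chain ?g" by (rule factorization_is_chain[OF assms])
  have c: "cdeg ?g = length us - 1" by (rule cdeg_eq[OF factorization_chain[OF assms]])
  obtain r where r: "length us = Suc r" using assms by (cases us) (auto simp: chain_factorization_def)
  have "mor 1 [x] (single us) = khat mor_kernel [x] us"
    using single_bar_space[OF factorization_bar_word[OF assms], where 'b = 'k] by (simp add: mor_def kern_def func_def ev_single)
  also have "\<dots> = mor_kernel us [?g] * coord x ?g"
    unfolding khat_def by (rule khat_singleton)
  also have "\<dots> = (-1) ^ (Suc r choose 2) * (-1) ^ theta [r] * x (single us)"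
    using kappa_chain[OF assms, where 'k = 'k] factors_eq[OF assms] g c r
    by (simp add: mor_kernel_def coord_def kappa_def)
  also have "(-1) ^ (Suc r choose 2) * (-1) ^ theta [r] = (-1 :: 'k) ^ Suc r"
    by (simp add: choose_two_Suc power_add)
  finally show ?thesis by (simp only: r)
qed

lemma diff_mor_one: "bar_dual_diff Q R (mor 1 [x]) = (0 :: ('a list list \<Rightarrow> 'k::field) \<Rightarrow> 'k)"
proof -
  have "bar_dual_diff Q R (mor 1 [x]) = func (bar_space Q R) (\<lambda>w. 0 :: 'k)"
    unfolding diff_mor
  proof (rule func_cong[OF closed_bar_space])
    fix w assume w: "bar_word Q R w"
    have "(\<Sum>i<length w - 1. (-1) ^ i * lift (mrg i w) [concat w]) = (\<Sum>i<length w - 1. (-1) ^ i * kappa (mrg i w) :: 'k)"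
      by (rule sum.cong) (auto simp: kappa_def mrg_props)
    then have z: "(\<Sum>i<length w - 1. (-1) ^ i * lift (mrg i w) [concat w]) = (0 :: 'k)" using kappa_boundary[OF w] by simp
    have "(\<Sum>y\<in>Words (concat w). (-1) ^ theta (map cdeg y) * tens [x] y * (\<Sum>i<length w - 1. (-1) ^ i * lift (mrg i w) y)) =
      (\<Sum>y\<in>Words (concat w). ((-1) ^ theta (map cdeg y) * (\<Sum>i<length w - 1. (-1) ^ i * lift (mrg i w) y)) * tens [x] y)"
      by (simp only: mult_ac)
    also have "\<dots> = 0" unfolding khat_singleton[of "\<lambda>y. (-1) ^ theta (map cdeg y) * (\<Sum>i<length w - 1. (-1) ^ i * lift (mrg i w) y)"] z by simp
    finally show "(-1) ^ (length w choose 2) * (\<Sum>y\<in>Words (concat w). (-1) ^ theta (map cdeg y) * tens [x] y *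
        (\<Sum>i<length w - 1. (-1) ^ i * lift (mrg i w) y)) = (0 :: 'k)" by simp
  qed
  then show ?thesis by (simp add: func_def ev_def fun_eq_iff)
qed

lemma bar_dual_ops_one: "bar_dual_ops Q R 1 [\<phi>] = bar_dual_diff Q R \<phi>"
  by (simp add: bar_dual_ops_def)

lemma zero_component: "0 \<in> component (Ext Q R) n"
  by (auto simp: graded_dual_def)

text \<open>
  A coboundary vanishes on the cycles of chains, and these determine a class.
\<close>
lemma mor_one_injective:
  fixes x :: "('a list list \<Rightarrow> 'k::field) \<Rightarrow> 'k"
  assumes x: "x \<in> component (Ext Q R) d" and z: "z \<in> component (bar_dual Q R) n"
    and eq: "mor 1 [x] = bar_dual_diff Q R z"
  shows "x = 0"
proof (rule Ext_eqI[OF x zero_component])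
  fix us assume us: "chain_factorization Q R us"
  have "(-1) ^ length us * x (single us) = (-1) ^ (length us - 1) * z (bar_diff_word R us)"
    unfolding mor_one_single[OF us, symmetric] eq by (rule bar_dual_diff_single[OF factorization_bar_word[OF us]])
  also have "z (bar_diff_word R us) = 0"
    unfolding factorization_bar_diff[OF us] by (rule component_zero[OF z[unfolded bar_dual_def] closed_bar_space])
  finally show "x (single us) = 0 (single us)" by simp
qed

text \<open>
  Up to sign the class \<open>x\<close> is the restriction of \<open>y\<close> to cycles. The difference of \<open>y\<close> and the
  image of \<open>x\<close> vanishes on boundaries and on the cycles of chains, so it has a primitive.
\<close>
lemma mor_one_surjective:
  fixes y :: "('a list list \<Rightarrow> 'k::field) \<Rightarrow> 'k"
  assumes y: "y \<in> component (bar_dual Q R) d" and cocycle: "bar_dual_diff Q R y = 0"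
  shows "\<exists>x \<in> component (Ext Q R) d. \<exists>z \<in> component (bar_dual Q R) (d - 1). y = mor 1 [x] + bar_dual_diff Q R z"
proof -
  have y': "y \<in> component (graded_dual Q (bar_space Q R)) d" using y by (simp add: bar_dual_def)
  have vanish: "\<phi> (bar_diff_word R w) = 0" if "bar_dual_diff Q R \<phi> = 0" "bar_word Q R w" for \<phi> :: "('a list list \<Rightarrow> 'k) \<Rightarrow> 'k" and w
    using bar_dual_diff_single[OF that(2), of \<phi>] that(1) by simp
  have bw: "bar_diff_word R w \<in> (bar_space Q R :: (_ \<Rightarrow> 'k) set)" if "bar_word Q R w" for w
    unfolding bar_diff_single[symmetric] by (rule bar_diff_in_space[OF single_bar_space[OF that]])
  have ybd: "y (bar_diff R u) = 0" if u: "u \<in> bar_space Q R" for u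
  proof -
    have "y (bar_diff R u) = ev (\<lambda>w. ev (\<lambda>v. y (single v)) (bar_diff_word R w)) u"
      unfolding functional_words[OF y' bar_diff_in_space[OF u]] by (rule ev_bar_diff[OF bar_spaceD(1)[OF u]])
    also have "\<dots> = ev (\<lambda>w. 0) u"
    proof (rule ev_cong)
      fix w assume "u w \<noteq> 0"
      then have w: "bar_word Q R w" by (rule bar_spaceD(2)[OF u])
      show "ev (\<lambda>v. y (single v)) (bar_diff_word R w) = 0"
        using functional_words[OF y' bw[OF w]] vanish[OF cocycle w] by simp
    qed
    finally show ?thesis by (simp add: ev_def)
  qed
  \<comment> \<open>The sign cancels the one in \<open>mor_one_single\<close>.\<close>
  define x where "x = (\<lambda>c. if c \<in> bar_cycles Q R then (-1) ^ nat d * y c else 0)"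
  have x: "x \<in> component (Ext Q R) d"
  proof -
    have sub: "c \<in> bar_space Q R" if "c \<in> bar_cycles Q R" for c :: "'a list list \<Rightarrow> 'k" using that by (simp add: bar_cycles_def)
    note C = closed_spaceD[OF closed_bar_cycles]
    obtain W where W: "finite W" "\<forall>k m. \<forall>x\<in>bar_space Q R. bihomogeneous k m x \<and> \<not> (int k = d \<and> m \<in> W) \<longrightarrow> y x = 0"
      using componentD(4)[OF y'] by blast
    have "x \<in> component (graded_dual Q (bar_cycles Q R)) d"
      using C(3,4) W sub componentD(2,3)[OF y']
      by (intro componentI[OF _ _ _ W(1)]) (auto simp: x_def distrib_left mult.left_commute)
    moreover have "x (bar_diff R u) = 0" if "u \<in> bar_space Q R" for u using ybd[OF that] by (simp add: x_def)
    ultimately show ?thesis by simp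
  qed
  have "mor 1 [x] \<in> component (bar_dual Q R) (sum_list [d] + (1 - int 1))"
    by (rule conjunct1[OF multi_map_mor[of 1, where 'k = 'k, unfolded multi_map_def], rule_format])
      (simp add: homogeneous_def x del: Ext_simps)
  then have m: "mor 1 [x] \<in> component (graded_dual Q (bar_space Q R)) d" by (simp add: bar_dual_def)
  define g where "g = (\<lambda>w. y (single w) + (-1) * mor 1 [x] (single w))"
  obtain W1 W2 where W: "finite W1" "\<And>w. bar_word Q R w \<Longrightarrow> y (single w) \<noteq> 0 \<Longrightarrow> int (length w) = d \<and> length (concat w) \<in> W1"
    "finite W2" "\<And>w. bar_word Q R w \<Longrightarrow> mor 1 [x] (single w) \<noteq> 0 \<Longrightarrow> int (length w) = d \<and> length (concat w) \<in> W2"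
    using functional_support[OF y'] functional_support[OF m] by metis
  have "\<exists>z \<in> component (bar_dual Q R) (d - 1). func (bar_space Q R) g = bar_dual_diff Q R z"
  proof (rule primitive)
    show "finite (W1 \<union> W2)" using W by simp
    fix w assume w: "bar_word Q R w"
    show "int (length w) = d \<and> length (concat w) \<in> W1 \<union> W2" if "g w \<noteq> 0"
    proof -
      have "y (single w) \<noteq> 0 \<or> mor 1 [x] (single w) \<noteq> 0" using that by (auto simp: g_def)
      then show ?thesis using W(2,4)[OF w] by blast
    qed
    have "ev g (bar_diff_word R w) = y (bar_diff_word R w) - mor 1 [x] (bar_diff_word R w)"
      unfolding functional_words[OF y' bw[OF w]] functional_words[OF m bw[OF w]] g_def ev_def
      by (simp add: right_diff_distrib sum_subtractf)
    then show "ev g (bar_diff_word R w) = 0" using vanish[OF cocycle w] vanish[OF diff_mor_one w] by simp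
  next
    fix us assume us: "chain_factorization Q R us"
    have "x (single us) = (-1) ^ nat d * y (single us)"
      using single_chain_cycle[OF us, where 'k = 'k] by (simp add: x_def)
    then have "mor 1 [x] (single us) = (-1) ^ length us * ((-1) ^ nat d * y (single us))"
      using mor_one_single[OF us, of x] by simp
    also have "\<dots> = y (single us)"
    proof (cases "y (single us) = 0")
      case False
      then have "nat d = length us" using W(2)[OF factorization_bar_word[OF us]] by auto
      then show ?thesis by simp
    qed simp
    finally show "g us = 0" by (simp add: g_def)
  qed
  then obtain z where z: "z \<in> component (bar_dual Q R) (d - 1)" "func (bar_space Q R) g = bar_dual_diff Q R z" by blast
  have "y = func (bar_space Q R) (\<lambda>w. mor 1 [x] (single w) + g w)"
    using functional_func[OF y'] by (simp add: g_def)
  also have "\<dots> = mor 1 [x] + bar_dual_diff Q R z"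
    unfolding func_add functional_func[OF m, symmetric] z(2) ..
  finally show ?thesis using x z(1) by blast
qed

theorem canonical_mu: "canonical Q R (mu :: nat \<Rightarrow> (('a list list \<Rightarrow> 'k::field) \<Rightarrow> 'k) list \<Rightarrow> _)"
  unfolding canonical_def a_infinity_quasi_iso_def
proof (intro exI[of _ mor] conjI allI ballI impI)
  show "a_infinity_morphism (Ext Q R) mu (bar_dual Q R) (bar_dual_ops Q R)
      (mor :: nat \<Rightarrow> (('a list list \<Rightarrow> 'k) \<Rightarrow> 'k) list \<Rightarrow> _)" by (rule a_infinity_morphism_mor)
next
  fix d and x :: "('a list list \<Rightarrow> 'k) \<Rightarrow> 'k"
  assume x: "x \<in> component (Ext Q R) d"
    and "mu 1 [x] = 0 \<and> (\<exists>z\<in>component (bar_dual Q R) (d - 1). mor 1 [x] = bar_dual_ops Q R 1 [z])"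
  then have "x = 0" using mor_one_injective[OF x] unfolding bar_dual_ops_one by blast
  show "\<exists>u\<in>component (Ext Q R) (d - 1). x = mu 1 [u]"
    unfolding \<open>x = 0\<close> by (intro bexI[of _ 0] zero_component) (simp only: mu_one)
next
  fix d and y :: "('a list list \<Rightarrow> 'k) \<Rightarrow> 'k"
  assume y: "y \<in> component (bar_dual Q R) d" "bar_dual_ops Q R 1 [y] = 0"
  show "\<exists>x\<in>component (Ext Q R) d. \<exists>z\<in>component (bar_dual Q R) (d - 1).
      mu 1 [x] = 0 \<and> y = mor 1 [x] + bar_dual_ops Q R 1 [z]"
    using mor_one_surjective[OF y(1)] y(2) mu_one unfolding bar_dual_ops_one by blast
qed

section \<open>The dual basis\<close>

definition basis_kernel :: "'a list \<Rightarrow> 'a list list \<Rightarrow> 'k::field" where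
  "basis_kernel \<gamma> w = (if concat w = \<gamma> then kappa w else 0)"

lemma basis_component:
  fixes \<gamma> :: "'a list"
  shows "func (bar_cycles Q R) (basis_kernel \<gamma> :: _ \<Rightarrow> 'k::field) \<in> component (Ext Q R) (int (Suc (cdeg \<gamma>)))"
proof -
  have "func (bar_cycles Q R) (basis_kernel \<gamma> :: _ \<Rightarrow> 'k) \<in> component (graded_dual Q (bar_cycles Q R)) (int (Suc (cdeg \<gamma>)))"
  proof (rule func_component[OF closed_bar_cycles, of "{length \<gamma>}"])
    fix w assume "basis_kernel \<gamma> w \<noteq> (0::'k)"
    then have "concat w = \<gamma>" "kappa w \<noteq> (0::'k)" by (auto simp: basis_kernel_def split: if_splits)
    then show "int (length w) = int (Suc (cdeg \<gamma>)) \<and> length (concat w) \<in> {length \<gamma>}"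
      using kappa_length(3)[of w, where 'k = 'k] by simp
  qed simp
  moreover have "func (bar_cycles Q R) (basis_kernel \<gamma>) (bar_diff R x) = 0" if x: "x \<in> bar_space Q R" for x :: "'a list list \<Rightarrow> 'k"
  proof -
    have "ev (basis_kernel \<gamma>) (bar_diff R x) = ev (\<lambda>w. ev (basis_kernel \<gamma>) (bar_diff_word R w)) x"
      by (rule ev_bar_diff[OF bar_spaceD(1)[OF x]])
    also have "\<dots> = ev (\<lambda>w. 0) x"
    proof (rule ev_cong)
      fix w assume "x w \<noteq> 0"
      then have w: "bar_word Q R w" by (rule bar_spaceD(2)[OF x])
      have k0: "basis_kernel \<gamma> v = (0::'k)" if "\<not> bar_word Q R v" for v
        by (simp add: basis_kernel_def kappa_not_bar[OF that])
      have "ev (basis_kernel \<gamma>) (bar_diff_word R w) = (\<Sum>i<length w - 1. (-1) ^ i * (basis_kernel \<gamma> (mrg i w) :: 'k))"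
        by (rule ev_bar_diff_word_bar[OF w k0])
      also have "\<dots> = (\<Sum>i<length w - 1. (if concat w = \<gamma> then 1 else 0) * ((-1) ^ i * kappa (mrg i w)))"
        by (rule sum.cong) (auto simp: basis_kernel_def mrg_props)
      also have "\<dots> = 0" unfolding sum_distrib_left[symmetric] kappa_boundary[OF w] by simp
      finally show "ev (basis_kernel \<gamma>) (bar_diff_word R w) = (0::'k)" .
    qed
    finally show ?thesis by (simp add: func_def ev_def)
  qed
  ultimately show ?thesis by simp
qed

lemma basis_single:
  assumes "chain_factorization Q R us"
  shows "func (bar_cycles Q R) (basis_kernel \<gamma>) (single us) = (if concat us = \<gamma> then 1 else 0 :: 'k::field)"
  using single_chain_cycle[OF assms, where 'k = 'k] kappa_chain[OF assms, where 'k = 'k]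
  by (simp add: func_def ev_single basis_kernel_def)

text \<open>
  Uniqueness holds because a class is determined by its values at the cycles of chains.
\<close>
lemma chain_dual_eq: "chain_dual Q R \<gamma> = func (bar_cycles Q R) (basis_kernel \<gamma> :: _ \<Rightarrow> 'k::field)"
  unfolding chain_dual_def
proof (rule the_equality)
  show "(\<exists>n. func (bar_cycles Q R) (basis_kernel \<gamma> :: _ \<Rightarrow> 'k) \<in> component (Ext Q R) n) \<and>
     (\<forall>us. chain_factorization Q R us \<longrightarrow> func (bar_cycles Q R) (basis_kernel \<gamma> :: _ \<Rightarrow> 'k) (single us) = (if concat us = \<gamma> then 1 else 0))"
    using basis_component basis_single by blast
next
  fix \<phi> :: "('a list list \<Rightarrow> 'k) \<Rightarrow> 'k"
  assume \<phi>: "(\<exists>n. \<phi> \<in> component (Ext Q R) n) \<and>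
     (\<forall>us. chain_factorization Q R us \<longrightarrow> \<phi> (single us) = (if concat us = \<gamma> then 1 else 0))"
  then obtain n where n: "\<phi> \<in> component (Ext Q R) n" by blast
  show "\<phi> = func (bar_cycles Q R) (basis_kernel \<gamma>)"
  proof (rule Ext_eqI[OF n basis_component])
    fix us assume us: "chain_factorization Q R us"
    then show "\<phi> (single us) = func (bar_cycles Q R) (basis_kernel \<gamma>) (single us)"
      unfolding basis_single[OF us] using \<phi> by blast
  qed
qed

lemma coord_chain_dual: "is_chain \<gamma> \<Longrightarrow> coord (chain_dual Q R \<gamma>) g = (if g = \<gamma> then 1 else 0 :: 'k::field)"
  using factors[of g] basis_single[of "factors g" \<gamma>, where 'k = 'k] by (auto simp: coord_def chain_dual_eq)

lemma tens_chain_dual: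
  "\<forall>\<gamma>\<in>set \<gamma>s. is_chain \<gamma> \<Longrightarrow> tens (map (chain_dual Q R) \<gamma>s) y = (if y = \<gamma>s then 1 else 0 :: 'k::field)"
proof (induction \<gamma>s arbitrary: y)
  case Nil
  then show ?case by (cases y) auto
next
  case (Cons \<gamma> \<gamma>s)
  then show ?case by (cases y) (auto simp: coord_chain_dual)
qed

lemma mu_chain_dual:
  assumes "\<forall>\<gamma>\<in>set \<gamma>s. is_chain \<gamma>"
  shows "mu n (map (chain_dual Q R) \<gamma>s) = (\<lambda>x. block_sign \<gamma>s * (chain_dual Q R (concat \<gamma>s) x :: 'k::field))"
proof -
  have "khat mu_kernel (map (chain_dual Q R) \<gamma>s) w = block_sign \<gamma>s * (basis_kernel (concat \<gamma>s) w :: 'k)" for w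
  proof -
    have "(\<Sum>b\<in>Words (concat w). block_sign b * tens (map (chain_dual Q R) \<gamma>s) b) =
        (\<Sum>b\<in>Words (concat w). if b = \<gamma>s then block_sign \<gamma>s else (0::'k))"
      by (rule sum.cong) (auto simp: tens_chain_dual[OF assms])
    also have "\<dots> = (if concat w = concat \<gamma>s then block_sign \<gamma>s else 0)"
      unfolding sum.delta[OF finite_Words] using assms by (auto simp: Words_def)
    finally show ?thesis by (simp add: khat_mu basis_kernel_def)
  qed
  then show ?thesis unfolding mu_def kern_def chain_dual_eq func_scale[symmetric] by presburger
qed

end

theorem theorem4p9:
  fixes Q :: "('v, 'a) pre_digraph" and R :: "'a list set"
  assumes "fin_digraph Q"
    and "monomial_relations Q R"
  shows "\<exists>\<mu> :: nat \<Rightarrow> (('a list list \<Rightarrow> 'k::field) \<Rightarrow> 'k) list \<Rightarrow> ('a list list \<Rightarrow> 'k) \<Rightarrow> 'k.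
    a_infinity_algebra (Ext Q R) \<mu> \<and>
    (\<forall>d. \<forall>\<phi> \<in> component (Ext Q R) d. \<mu> 1 [\<phi>] = 0) \<and>
    canonical Q R \<mu> \<and>
    (\<forall>n \<gamma>s rs r.
       n \<ge> 2 \<and> length \<gamma>s = n \<and> length rs = n \<and> (\<forall>i<n. chain Q R (rs ! i) (\<gamma>s ! i)) \<and>
       r = sum_list rs + 1 \<longrightarrow>
       \<mu> n (map (chain_dual Q R) \<gamma>s) =
         (if chain Q R r (concat \<gamma>s)
          then scl (Ext Q R) ((-1) ^ sign_exponent rs r) (chain_dual Q R (concat \<gamma>s))
          else 0))"
proof -
  interpret monomial_quiver Q R
    using assms fin_digraph.axioms(1) by (intro monomial_quiver.intro)
  show ?thesis
  proof (intro exI[of _ mu] conjI allI ballI impI)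
    fix n r :: nat and \<gamma>s rs
    assume a: "n \<ge> 2 \<and> length \<gamma>s = n \<and> length rs = n \<and> (\<forall>i<n. chain Q R (rs ! i) (\<gamma>s ! i)) \<and> r = sum_list rs + 1"
    then have chains: "\<forall>\<gamma>\<in>set \<gamma>s. is_chain \<gamma>" unfolding is_chain_def by (metis in_set_conv_nth)
    have rs: "map cdeg \<gamma>s = rs" using a by (intro nth_equalityI) (auto intro: cdeg_eq)
    have r: "r = Suc (wdeg \<gamma>s)" using a by (simp add: wdeg_def rs)
    have sign: "block_sign \<gamma>s = (if chain Q R r (concat \<gamma>s) then (-1) ^ sign_exponent rs r else (0::'k))"
      using chains by (simp add: block_sign_def good_def rs r)
    show "mu n (map (chain_dual Q R) \<gamma>s) =
        (if chain Q R r (concat \<gamma>s)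
         then scl (Ext Q R) ((-1) ^ sign_exponent rs r) (chain_dual Q R (concat \<gamma>s) :: _ \<Rightarrow> 'k) else 0)"
      unfolding mu_chain_dual[OF chains] sign by (auto simp: fun_eq_iff)
  qed (rule a_infinity_mu mu_one canonical_mu)+
qed

end
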